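(* Let $[x_1]^0_{\chi_1}$ and $[x_2]^0_{\chi_2}$ be two simple objects of $\mathcal T$ (so $x_1,x_2$ are objects of $\mathcal A$ and $\chi_i$ is an irreducible character of $A(x_i)$). Then $$[x_1]^0_{\chi_1}\otimes[x_2]^0_{\chi_2}\;\cong\;\bigoplus_{x,\chi}\ \big([x]^0_{\chi}\big)^{\oplus m(x,\chi)},\qquad m(x,\chi)=\langle\chi_{T(x_1,x_2,x)}\mid\chi_1\otimes\chi_2\otimes\chi^\vee\rangle ,$$ where $x$ runs through representatives of the isomorphism classes of subquotients of $x_1\times x_2$, $\chi$ runs through all irreducible characters of $A(x)$, $\chi^\vee$ is the dual character, and $\langle\cdot\mid\cdot\rangle$ is the usual pairing of characters of the finite group $A(x_1)\times A(x_2)\times A(x)$.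
   Context: Standing assumptions. $\mathbb K$ is an algebraically closed field of characteristic $0$. $\mathcal A$ is a finitely complete category with terminal object $\ast$. Monomorphisms are called injective ($\hookrightarrow$) and define subobjects of their target; the image of a morphism $y\to x$ is the smallest subobject of $x$ through which it factors; a morphism is surjective ($\twoheadrightarrow$) if its image is its whole target. $\mathcal A$ is assumed regular (every morphism has an image and surjectivity is preserved under pullback), subobject finite (each object has finitely many subobjects), exact (every equivalence relation $r\subseteq x\times x$ is effective, i.e. is the kernel pair of a surjective $x\twoheadrightarrow x/r$), Mal'cev (every reflexive relation $r\subseteq x\times x$ is an equivalence relation), and $\ast$ has no proper subobject. A degree function $\delta$ assigns to each surjective morphism $e$ an element $\delta(e)\in\mathbb K$ with $\delta(\mathrm{id}_x)=1$, $\delta(e')=\delta(e)$ whenever $e'$ is a pullback of $e$, and $\delta(ef)=\delta(e)\delta(f)$ for composable surjective $e,f$. For surjective $e:x\twoheadrightarrow z$ put $\omega_e:=\sum_{y\subseteq x,\ e(y)=z}\mu_{\mathrm s}(y,x)\,\delta(e|_y)$, where $\mu_{\mathrm s}$ is the Möbius function of the finite poset $\mathrm s(x)$ of subobjects of $x$ ordered by inclusion. $\delta$ is assumed non-degenerate: $\omega_e\neq0$ for all surjective $e$. The category $\mathcal T=\mathcal T(\mathcal A,\delta)$. Let $\mathcal T^0$ have objects $[x]$, $x\in\mathcal A$, where $\mathrm{Hom}([x],[y])$ is the $\mathbb K$-vector space with basis $\langle r\rangle$, $r\subseteq x\times y$ a subobject; $\langle r\rangle:[x]\to[y]$ followed by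 $\langle s\rangle:[y]\to[z]$ is $\delta(r\times_ys\twoheadrightarrow r\circ s)\langle r\circ s\rangle$ with $r\circ s=\mathrm{image}(r\times_ys\to x\times z)$. $\mathcal T$ is the pseudo-abelian (idempotent) completion of the additive completion of $\mathcal T^0$. It is a semisimple rigid symmetric monoidal category with $[x]\otimes[y]=[x\times y]$, unit $I=[\ast]$, $\mathrm{End}(I)=\mathbb K$, $[x]^\vee=[x]$ and $\langle r\rangle^\vee=\langle r^\vee\rangle$ (factors swapped). A morphism $f:x\to y$ gives $[f]=\langle\Gamma_f\rangle:[x]\to[y]$ with $\Gamma_f$ its graph. The finite group $A(x):=\mathrm{Aut}_{\mathcal A}(x)$ acts on $[x]$ by $g\mapsto[g]$. Simple objects. $z$ is a subquotient of $x$ if there are a subobject $y\subseteq x$ and a surjection $y\twoheadrightarrow z$; it is proper if $z\not\cong x$. $[x]^1$ denotes the unique direct summand of $[x]$ which is isomorphic to a direct summand of a finite direct sum $\bigoplus[z_i]$ with all $z_i$ proper subquotients of $x$, and such that every morphism $[z]\to[x]$ with $z$ a proper subquotient of $x$ factors through $[x]^1$. It has a unique complement $[x]^0$ in $[x]$, and $\mathbb K[A(x)]\to\mathrm{End}_{\mathcal T}([x]^0)$ is an isomorphism. Hence $[x]^0=\bigoplus_\chi V_\chi\otimes_{\mathbb K}[x]^0_\chi$ ($\chi$ over the irreducible characters of $A(x)$, $V_\chi$ the irreducible module with character $\chi$) with $[x]^0_\chi$ simple; every simple object of $\mathcal T$ is isomorphic to $[x]^0_\chi$ for a pair $(x,\chi)$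 unique up to isomorphism. The set $T$. For objects $x_1,x_2,x_3$ of $\mathcal A$, $T(x_1,x_2,x_3)$ is the set of subobjects $r\subseteq x_1\times x_2\times x_3$ such that the three projections $r\to x_i$ are surjective and the three projections $r\to x_1\times x_2$, $r\to x_1\times x_3$, $r\to x_2\times x_3$ are injective. The group $A(x_1)\times A(x_2)\times A(x_3)$ permutes this finite set; $\chi_{T(x_1,x_2,x_3)}$ is the corresponding permutation character. *)

theory Defs
  imports
    "HOL-Library.Function_Algebras"
    "HOL-Computational_Algebra.Polynomial"
    "Jordan_Normal_Form.VS_Connect"
begin

section \<open>Categories and finite limits\<close>

text \<open>Arrows compose as functions do: \<open>g \<cdot>\<^bsub>C\<^esub> f\<close> is \<open>f\<close> followed by \<open>g\<close>.\<close>

record ('o, 'm) category_data =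
  Obj :: "'o set"
  Arr :: "'m set"
  Dom :: "'m \<Rightarrow> 'o"
  Cod :: "'m \<Rightarrow> 'o"
  Ide :: "'o \<Rightarrow> 'm"
  cmp :: "'m \<Rightarrow> 'm \<Rightarrow> 'm"  (infixl \<open>\<cdot>\<index>\<close> 70)

definition homs :: "('o, 'm) category_data \<Rightarrow> 'o \<Rightarrow> 'o \<Rightarrow> 'm set" where
  "homs C x y = {f \<in> Arr C. Dom C f = x \<and> Cod C f = y}"

definition category :: "('o, 'm) category_data \<Rightarrow> bool" where
  "category C \<longleftrightarrow>
     (\<forall>f \<in> Arr C. Dom C f \<in> Obj C \<and> Cod C f \<in> Obj C) \<and>
     (\<forall>x \<in> Obj C. Ide C x \<in> homs C x x) \<and>
     (\<forall>f \<in> Arr C. \<forall>g \<in> Arr C. Cod C f = Dom C g \<longrightarrow> g \<cdot>\<^bsub>C\<^esub> f \<in> homs C (Dom C f) (Cod C g)) \<and>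
     (\<forall>f \<in> Arr C. f \<cdot>\<^bsub>C\<^esub> Ide C (Dom C f) = f \<and> Ide C (Cod C f) \<cdot>\<^bsub>C\<^esub> f = f) \<and>
     (\<forall>f \<in> Arr C. \<forall>g \<in> Arr C. \<forall>h \<in> Arr C. Cod C f = Dom C g \<longrightarrow> Cod C g = Dom C h \<longrightarrow>
        h \<cdot>\<^bsub>C\<^esub> (g \<cdot>\<^bsub>C\<^esub> f) = (h \<cdot>\<^bsub>C\<^esub> g) \<cdot>\<^bsub>C\<^esub> f)"

definition is_iso :: "('o, 'm) category_data \<Rightarrow> 'm \<Rightarrow> bool" where
  "is_iso C f \<longleftrightarrow> f \<in> Arr C \<and>
     (\<exists>g \<in> homs C (Cod C f) (Dom C f). g \<cdot>\<^bsub>C\<^esub> f = Ide C (Dom C f) \<and> f \<cdot>\<^bsub>C\<^esub> g = Ide C (Cod C f))"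

definition isomorphic :: "('o, 'm) category_data \<Rightarrow> 'o \<Rightarrow> 'o \<Rightarrow> bool" where
  "isomorphic C x y \<longleftrightarrow> (\<exists>f \<in> homs C x y. is_iso C f)"

definition is_mono :: "('o, 'm) category_data \<Rightarrow> 'm \<Rightarrow> bool" where
  "is_mono C m \<longleftrightarrow> m \<in> Arr C \<and>
     (\<forall>t. \<forall>f \<in> homs C t (Dom C m). \<forall>g \<in> homs C t (Dom C m). m \<cdot>\<^bsub>C\<^esub> f = m \<cdot>\<^bsub>C\<^esub> g \<longrightarrow> f = g)"

text \<open>A diagram is given on a graph with vertex set \<open>V\<close>: the vertex \<open>i\<close> carries the object \<open>D i\<close>,
  and a triple \<open>(i, j, f) \<in> E\<close> is an edge from \<open>i\<close> to \<open>j\<close> labelled by \<open>f : D i \<rightarrow> D j\<close>.\<close>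

definition is_diagram ::
  "('o, 'm) category_data \<Rightarrow> nat set \<Rightarrow> (nat \<Rightarrow> 'o) \<Rightarrow> (nat \<times> nat \<times> 'm) set \<Rightarrow> bool" where
  "is_diagram C V D E \<longleftrightarrow> (\<forall>i \<in> V. D i \<in> Obj C) \<and>
     (\<forall>(i, j, f) \<in> E. i \<in> V \<and> j \<in> V \<and> f \<in> homs C (D i) (D j))"

definition is_cone ::
  "('o, 'm) category_data \<Rightarrow> nat set \<Rightarrow> (nat \<Rightarrow> 'o) \<Rightarrow> (nat \<times> nat \<times> 'm) set \<Rightarrow> 'o \<Rightarrow> (nat \<Rightarrow> 'm) \<Rightarrow> bool"
  where
  "is_cone C V D E l p \<longleftrightarrow> l \<in> Obj C \<and> (\<forall>i \<in> V. p i \<in> homs C l (D i)) \<and>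
     (\<forall>(i, j, f) \<in> E. f \<cdot>\<^bsub>C\<^esub> p i = p j)"

definition is_limit ::
  "('o, 'm) category_data \<Rightarrow> nat set \<Rightarrow> (nat \<Rightarrow> 'o) \<Rightarrow> (nat \<times> nat \<times> 'm) set \<Rightarrow> 'o \<Rightarrow> (nat \<Rightarrow> 'm) \<Rightarrow> bool"
  where
  "is_limit C V D E l p \<longleftrightarrow> is_cone C V D E l p \<and>
     (\<forall>l' p'. is_cone C V D E l' p' \<longrightarrow> (\<exists>!h. h \<in> homs C l' l \<and> (\<forall>i \<in> V. p i \<cdot>\<^bsub>C\<^esub> h = p' i)))"

definition finitely_complete :: "('o, 'm) category_data \<Rightarrow> bool" where
  "finitely_complete C \<longleftrightarrow>
     (\<forall>V D E. finite V \<longrightarrow> finite E \<longrightarrow> is_diagram C V D E \<longrightarrow> (\<exists>l p. is_limit C V D E l p))"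

definition is_terminal :: "('o, 'm) category_data \<Rightarrow> 'o \<Rightarrow> bool" where
  "is_terminal C t \<longleftrightarrow> t \<in> Obj C \<and> (\<forall>x \<in> Obj C. \<exists>!f. f \<in> homs C x t)"

definition is_product :: "('o, 'm) category_data \<Rightarrow> 'o \<Rightarrow> 'o \<Rightarrow> 'o \<Rightarrow> 'm \<Rightarrow> 'm \<Rightarrow> bool" where
  "is_product C x y P p q \<longleftrightarrow> p \<in> homs C P x \<and> q \<in> homs C P y \<and>
     (\<forall>t. \<forall>f \<in> homs C t x. \<forall>g \<in> homs C t y. \<exists>!h. h \<in> homs C t P \<and> p \<cdot>\<^bsub>C\<^esub> h = f \<and> q \<cdot>\<^bsub>C\<^esub> h = g)"

text \<open>\<open>p\<close> and \<open>q\<close> are the projections of a pullback of \<open>f : x \<rightarrow> z\<close> and \<open>g : y \<rightarrow> z\<close>.\<close>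

definition is_pullback :: "('o, 'm) category_data \<Rightarrow> 'm \<Rightarrow> 'm \<Rightarrow> 'm \<Rightarrow> 'm \<Rightarrow> bool" where
  "is_pullback C f g p q \<longleftrightarrow> f \<in> Arr C \<and> g \<in> Arr C \<and> Cod C f = Cod C g \<and>
     p \<in> homs C (Dom C p) (Dom C f) \<and> q \<in> homs C (Dom C p) (Dom C g) \<and> f \<cdot>\<^bsub>C\<^esub> p = g \<cdot>\<^bsub>C\<^esub> q \<and>
     (\<forall>t. \<forall>u \<in> homs C t (Dom C f). \<forall>v \<in> homs C t (Dom C g). f \<cdot>\<^bsub>C\<^esub> u = g \<cdot>\<^bsub>C\<^esub> v \<longrightarrow>
        (\<exists>!h. h \<in> homs C t (Dom C p) \<and> p \<cdot>\<^bsub>C\<^esub> h = u \<and> q \<cdot>\<^bsub>C\<^esub> h = v))"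

text \<open>Products, pullbacks and (below) images are chosen once and for all; another choice changes
  the resulting tensor category only up to equivalence.\<close>

definition chosen_product :: "('o, 'm) category_data \<Rightarrow> 'o \<Rightarrow> 'o \<Rightarrow> 'o \<times> 'm \<times> 'm" where
  "chosen_product C x y = (SOME (P, p, q). is_product C x y P p q)"

definition prd :: "('o, 'm) category_data \<Rightarrow> 'o \<Rightarrow> 'o \<Rightarrow> 'o" where
  "prd C x y = fst (chosen_product C x y)"

definition proj1 :: "('o, 'm) category_data \<Rightarrow> 'o \<Rightarrow> 'o \<Rightarrow> 'm" where
  "proj1 C x y = fst (snd (chosen_product C x y))"

definition proj2 :: "('o, 'm) category_data \<Rightarrow> 'o \<Rightarrow> 'o \<Rightarrow> 'm" where
  "proj2 C x y = snd (snd (chosen_product C x y))"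

definition tuple :: "('o, 'm) category_data \<Rightarrow> 'm \<Rightarrow> 'm \<Rightarrow> 'm" where
  "tuple C f g = (THE h. h \<in> homs C (Dom C f) (prd C (Cod C f) (Cod C g)) \<and>
     proj1 C (Cod C f) (Cod C g) \<cdot>\<^bsub>C\<^esub> h = f \<and> proj2 C (Cod C f) (Cod C g) \<cdot>\<^bsub>C\<^esub> h = g)"

definition chosen_pullback :: "('o, 'm) category_data \<Rightarrow> 'm \<Rightarrow> 'm \<Rightarrow> 'm \<times> 'm" where
  "chosen_pullback C f g = (SOME (p, q). is_pullback C f g p q)"


section \<open>Subobjects, images, and the standing assumptions on the category\<close>

definition factors :: "('o, 'm) category_data \<Rightarrow> 'm \<Rightarrow> 'm \<Rightarrow> bool" where
  "factors C f m \<longleftrightarrow> (\<exists>h \<in> homs C (Dom C f) (Dom C m). f = m \<cdot>\<^bsub>C\<^esub> h)"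

text \<open>A subobject is an equivalence class of monomorphisms.\<close>

definition sub_of :: "('o, 'm) category_data \<Rightarrow> 'm \<Rightarrow> 'm set" where
  "sub_of C m = {n. is_mono C n \<and> Cod C n = Cod C m \<and> factors C m n \<and> factors C n m}"

definition Sub :: "('o, 'm) category_data \<Rightarrow> 'o \<Rightarrow> 'm set set" where
  "Sub C x = sub_of C ` {m. is_mono C m \<and> Cod C m = x}"

definition rep :: "'m set \<Rightarrow> 'm" where
  "rep s = (SOME m. m \<in> s)"

definition sub_le :: "('o, 'm) category_data \<Rightarrow> 'm set \<Rightarrow> 'm set \<Rightarrow> bool" where
  "sub_le C s t \<longleftrightarrow> (\<exists>m \<in> s. \<exists>n \<in> t. factors C m n)"

definition is_image :: "('o, 'm) category_data \<Rightarrow> 'm \<Rightarrow> 'm \<Rightarrow> bool" where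
  "is_image C f m \<longleftrightarrow> f \<in> Arr C \<and> is_mono C m \<and> Cod C m = Cod C f \<and> factors C f m \<and>
     (\<forall>n. is_mono C n \<longrightarrow> Cod C n = Cod C f \<longrightarrow> factors C f n \<longrightarrow> factors C m n)"

definition surj_arr :: "('o, 'm) category_data \<Rightarrow> 'm \<Rightarrow> bool" where
  "surj_arr C e \<longleftrightarrow> e \<in> Arr C \<and> is_image C e (Ide C (Cod C e))"

text \<open>A factorization \<open>f = m \<cdot> e\<close> through the image of \<open>f\<close>, returned as \<open>(m, e)\<close>.\<close>

definition image_fact :: "('o, 'm) category_data \<Rightarrow> 'm \<Rightarrow> 'm \<times> 'm" where
  "image_fact C f = (SOME (m, e). is_image C f m \<and> e \<in> homs C (Dom C f) (Dom C m) \<and> m \<cdot>\<^bsub>C\<^esub> e = f)"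

definition regular :: "('o, 'm) category_data \<Rightarrow> bool" where
  "regular C \<longleftrightarrow> (\<forall>f \<in> Arr C. \<exists>m. is_image C f m) \<and>
     (\<forall>f g p q. is_pullback C f g p q \<longrightarrow> surj_arr C f \<longrightarrow> surj_arr C q)"

definition subobject_finite :: "('o, 'm) category_data \<Rightarrow> bool" where
  "subobject_finite C \<longleftrightarrow> (\<forall>x \<in> Obj C. finite (Sub C x))"

text \<open>Relations \<open>r \<subseteq> x \<times> x\<close> are given by monomorphisms \<open>r\<close> into \<open>x \<times> x\<close>;
  \<open>leg1\<close> and \<open>leg2\<close> are their two projections to \<open>x\<close>.\<close>

definition is_relation :: "('o, 'm) category_data \<Rightarrow> 'o \<Rightarrow> 'm \<Rightarrow> bool" where
  "is_relation C x r \<longleftrightarrow> x \<in> Obj C \<and> is_mono C r \<and> Cod C r = prd C x x"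

definition leg1 :: "('o, 'm) category_data \<Rightarrow> 'o \<Rightarrow> 'o \<Rightarrow> 'm \<Rightarrow> 'm" where
  "leg1 C x y r = proj1 C x y \<cdot>\<^bsub>C\<^esub> r"

definition leg2 :: "('o, 'm) category_data \<Rightarrow> 'o \<Rightarrow> 'o \<Rightarrow> 'm \<Rightarrow> 'm" where
  "leg2 C x y r = proj2 C x y \<cdot>\<^bsub>C\<^esub> r"

definition reflexive_rel :: "('o, 'm) category_data \<Rightarrow> 'o \<Rightarrow> 'm \<Rightarrow> bool" where
  "reflexive_rel C x r \<longleftrightarrow> is_relation C x r \<and> factors C (tuple C (Ide C x) (Ide C x)) r"

definition symmetric_rel :: "('o, 'm) category_data \<Rightarrow> 'o \<Rightarrow> 'm \<Rightarrow> bool" where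
  "symmetric_rel C x r \<longleftrightarrow> is_relation C x r \<and> factors C (tuple C (leg2 C x x r) (leg1 C x x r)) r"

definition transitive_rel :: "('o, 'm) category_data \<Rightarrow> 'o \<Rightarrow> 'm \<Rightarrow> bool" where
  "transitive_rel C x r \<longleftrightarrow> is_relation C x r \<and>
     (\<forall>p q. is_pullback C (leg2 C x x r) (leg1 C x x r) p q \<longrightarrow>
        factors C (tuple C (leg1 C x x r \<cdot>\<^bsub>C\<^esub> p) (leg2 C x x r \<cdot>\<^bsub>C\<^esub> q)) r)"

definition equivalence_rel :: "('o, 'm) category_data \<Rightarrow> 'o \<Rightarrow> 'm \<Rightarrow> bool" where
  "equivalence_rel C x r \<longleftrightarrow> reflexive_rel C x r \<and> symmetric_rel C x r \<and> transitive_rel C x r"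

definition exact :: "('o, 'm) category_data \<Rightarrow> bool" where
  "exact C \<longleftrightarrow> (\<forall>x r. equivalence_rel C x r \<longrightarrow>
     (\<exists>e. surj_arr C e \<and> Dom C e = x \<and> is_pullback C e e (leg1 C x x r) (leg2 C x x r)))"

definition malcev :: "('o, 'm) category_data \<Rightarrow> bool" where
  "malcev C \<longleftrightarrow> (\<forall>x r. reflexive_rel C x r \<longrightarrow> equivalence_rel C x r)"

definition terminal_has_no_proper_subobject :: "('o, 'm) category_data \<Rightarrow> bool" where
  "terminal_has_no_proper_subobject C \<longleftrightarrow>
     (\<forall>t m. is_terminal C t \<longrightarrow> is_mono C m \<longrightarrow> Cod C m = t \<longrightarrow> is_iso C m)"

definition subquotient :: "('o, 'm) category_data \<Rightarrow> 'o \<Rightarrow> 'o \<Rightarrow> bool" where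
  "subquotient C z x \<longleftrightarrow> (\<exists>m e. is_mono C m \<and> Cod C m = x \<and> surj_arr C e \<and> Dom C e = Dom C m \<and> Cod C e = z)"

definition proper_subquotient :: "('o, 'm) category_data \<Rightarrow> 'o \<Rightarrow> 'o \<Rightarrow> bool" where
  "proper_subquotient C z x \<longleftrightarrow> subquotient C z x \<and> \<not> isomorphic C z x"

definition subquotient_representatives :: "('o, 'm) category_data \<Rightarrow> 'o \<Rightarrow> 'o set \<Rightarrow> bool" where
  "subquotient_representatives C x R \<longleftrightarrow> (\<forall>z \<in> R. subquotient C z x) \<and>
     (\<forall>z. subquotient C z x \<longrightarrow> (\<exists>!w. w \<in> R \<and> isomorphic C z w))"


section \<open>Degree functions\<close>

text \<open>The Moebius function of a finite poset \<open>(P, leq)\<close> is the inverse of the zeta function in the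
  incidence algebra; it is extended by 0 to non-comparable arguments.\<close>

definition moebius :: "'a set \<Rightarrow> ('a \<Rightarrow> 'a \<Rightarrow> bool) \<Rightarrow> 'a \<Rightarrow> 'a \<Rightarrow> int" where
  "moebius P leq = (THE \<mu>.
     (\<forall>a b. \<not> (a \<in> P \<and> b \<in> P \<and> leq a b) \<longrightarrow> \<mu> a b = 0) \<and>
     (\<forall>a \<in> P. \<forall>b \<in> P. leq a b \<longrightarrow>
        (\<Sum>c \<in> {c \<in> P. leq a c \<and> leq c b}. \<mu> a c) = (if a = b then 1 else 0)))"

definition degree_function :: "('o, 'm) category_data \<Rightarrow> ('m \<Rightarrow> 'k::field) \<Rightarrow> bool" where
  "degree_function C \<delta> \<longleftrightarrow> (\<forall>x \<in> Obj C. \<delta> (Ide C x) = 1) \<and>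
     (\<forall>e g p e'. surj_arr C e \<longrightarrow> is_pullback C e g p e' \<longrightarrow> \<delta> e' = \<delta> e) \<and>
     (\<forall>e f. surj_arr C e \<longrightarrow> surj_arr C f \<longrightarrow> Cod C f = Dom C e \<longrightarrow> \<delta> (e \<cdot>\<^bsub>C\<^esub> f) = \<delta> e * \<delta> f)"

definition omega :: "('o, 'm) category_data \<Rightarrow> ('m \<Rightarrow> 'k::field) \<Rightarrow> 'm \<Rightarrow> 'k" where
  "omega C \<delta> e = (\<Sum>y \<in> {y \<in> Sub C (Dom C e). surj_arr C (e \<cdot>\<^bsub>C\<^esub> rep y)}.
     of_int (moebius (Sub C (Dom C e)) (sub_le C) y (sub_of C (Ide C (Dom C e)))) *
     \<delta> (e \<cdot>\<^bsub>C\<^esub> rep y))"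

definition nondegenerate :: "('o, 'm) category_data \<Rightarrow> ('m \<Rightarrow> 'k::field) \<Rightarrow> bool" where
  "nondegenerate C \<delta> \<longleftrightarrow> (\<forall>e. surj_arr C e \<longrightarrow> omega C \<delta> e \<noteq> 0)"


section \<open>Linear categories, additive and idempotent completion\<close>

text \<open>Morphisms live in a type with pointwise addition and zero (for functions these come from
  \<^theory>\<open>HOL-Library.Function_Algebras\<close>); morphisms do not carry their endpoints, so composition
  takes the three objects: \<open>lcomp L x y z g f\<close> is \<open>f : x \<rightarrow> y\<close> followed by \<open>g : y \<rightarrow> z\<close>.\<close>

record ('o, 'h, 'k) lincat =
  lobj :: "'o set"
  lhom :: "'o \<Rightarrow> 'o \<Rightarrow> 'h set"
  lcomp :: "'o \<Rightarrow> 'o \<Rightarrow> 'o \<Rightarrow> 'h \<Rightarrow> 'h \<Rightarrow> 'h"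
  lid :: "'o \<Rightarrow> 'h"
  lscale :: "'k \<Rightarrow> 'h \<Rightarrow> 'h"

definition liso :: "('o, 'h, 'k) lincat \<Rightarrow> 'o \<Rightarrow> 'o \<Rightarrow> bool" where
  "liso L X Y \<longleftrightarrow> (\<exists>f \<in> lhom L X Y. \<exists>g \<in> lhom L Y X.
     lcomp L X Y X g f = lid L X \<and> lcomp L Y X Y f g = lid L Y)"

definition is_summand :: "('o, 'h, 'k) lincat \<Rightarrow> 'o \<Rightarrow> 'o \<Rightarrow> 'h \<Rightarrow> 'h \<Rightarrow> bool" where
  "is_summand L Y X i p \<longleftrightarrow> X \<in> lobj L \<and> Y \<in> lobj L \<and> i \<in> lhom L Y X \<and> p \<in> lhom L X Y \<and>
     lcomp L Y X Y p i = lid L Y"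

text \<open>\<open>X\<close> is the direct sum (biproduct) of the finite family \<open>F\<close> over \<open>I\<close>, with injections \<open>i\<close>
  and projections \<open>p\<close>.\<close>

definition is_direct_sum :: "('o, 'h::comm_monoid_add, 'k) lincat \<Rightarrow>
    'o \<Rightarrow> 'a set \<Rightarrow> ('a \<Rightarrow> 'o) \<Rightarrow> ('a \<Rightarrow> 'h) \<Rightarrow> ('a \<Rightarrow> 'h) \<Rightarrow> bool" where
  "is_direct_sum L X I F i p \<longleftrightarrow> finite I \<and> X \<in> lobj L \<and>
     (\<forall>a \<in> I. F a \<in> lobj L \<and> i a \<in> lhom L (F a) X \<and> p a \<in> lhom L X (F a)) \<and>
     (\<forall>a \<in> I. \<forall>b \<in> I. lcomp L (F a) X (F b) (p b) (i a) = (if a = b then lid L (F a) else 0)) \<and>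
     (\<Sum>a \<in> I. lcomp L X (F a) X (i a) (p a)) = lid L X"

definition iso_to_direct_sum :: "('o, 'h::comm_monoid_add, 'k) lincat \<Rightarrow>
    'o \<Rightarrow> 'a set \<Rightarrow> ('a \<Rightarrow> 'o) \<Rightarrow> bool" where
  "iso_to_direct_sum L X I F \<longleftrightarrow> (\<exists>D i p. is_direct_sum L D I F i p \<and> liso L X D)"

text \<open>Objects are finite lists, morphisms \<open>xs \<rightarrow> ys\<close> are matrices with entry
  \<open>M i j : xs ! j \<rightarrow> ys ! i\<close>, extended by 0 outside the index range.\<close>

definition additive_completion ::
  "('o, 'h::comm_monoid_add, 'k) lincat \<Rightarrow> ('o list, nat \<Rightarrow> nat \<Rightarrow> 'h, 'k) lincat" where
  "additive_completion L = \<lparr>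
     lobj = lists (lobj L),
     lhom = (\<lambda>xs ys. {M. \<forall>i j. if i < length ys \<and> j < length xs
                               then M i j \<in> lhom L (xs ! j) (ys ! i) else M i j = 0}),
     lcomp = (\<lambda>xs ys zs N M i j. if i < length zs \<and> j < length xs
                then (\<Sum>k < length ys. lcomp L (xs ! j) (ys ! k) (zs ! i) (N i k) (M k j)) else 0),
     lid = (\<lambda>xs i j. if i = j \<and> i < length xs then lid L (xs ! i) else 0),
     lscale = (\<lambda>c M i j. lscale L c (M i j)) \<rparr>"

text \<open>Objects are pairs of an object and an idempotent endomorphism \<open>e\<close> (standing for its image);
  the identity of \<open>(x, e)\<close> is \<open>e\<close>.\<close>

definition idempotent_completion ::
  "('o, 'h, 'k) lincat \<Rightarrow> ('o \<times> 'h, 'h, 'k) lincat" where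
  "idempotent_completion L = \<lparr>
     lobj = {(x, e). x \<in> lobj L \<and> e \<in> lhom L x x \<and> lcomp L x x x e e = e},
     lhom = (\<lambda>(x, e) (y, f). {h \<in> lhom L x y. lcomp L x y y f (lcomp L x x y h e) = h}),
     lcomp = (\<lambda>X Y Z. lcomp L (fst X) (fst Y) (fst Z)),
     lid = snd,
     lscale = lscale L \<rparr>"


section \<open>The tensor category\<close>

text \<open>The canonical map \<open>r \<times>\<^sub>y s \<rightarrow> x \<times> z\<close> for \<open>r \<subseteq> x \<times> y\<close> and \<open>s \<subseteq> y \<times> z\<close>.\<close>

definition rel_span :: "('o, 'm) category_data \<Rightarrow> 'o \<Rightarrow> 'o \<Rightarrow> 'o \<Rightarrow> 'm set \<Rightarrow> 'm set \<Rightarrow> 'm" where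
  "rel_span C x y z r s =
     (let (p, q) = chosen_pullback C (leg2 C x y (rep r)) (leg1 C y z (rep s))
      in tuple C (leg1 C x y (rep r) \<cdot>\<^bsub>C\<^esub> p) (leg2 C y z (rep s) \<cdot>\<^bsub>C\<^esub> q))"

definition rel_comp :: "('o, 'm) category_data \<Rightarrow> 'o \<Rightarrow> 'o \<Rightarrow> 'o \<Rightarrow> 'm set \<Rightarrow> 'm set \<Rightarrow> 'm set" where
  "rel_comp C x y z r s = sub_of C (fst (image_fact C (rel_span C x y z r s)))"

definition rel_degree ::
  "('o, 'm) category_data \<Rightarrow> ('m \<Rightarrow> 'k) \<Rightarrow> 'o \<Rightarrow> 'o \<Rightarrow> 'o \<Rightarrow> 'm set \<Rightarrow> 'm set \<Rightarrow> 'k" where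
  "rel_degree C \<delta> x y z r s = \<delta> (snd (image_fact C (rel_span C x y z r s)))"

definition basis_vec :: "'s \<Rightarrow> 's \<Rightarrow> 'k::field" where
  "basis_vec r = (\<lambda>s. if s = r then 1 else 0)"

definition graph :: "('o, 'm) category_data \<Rightarrow> 'm \<Rightarrow> 'm set" where
  "graph C f = sub_of C (tuple C (Ide C (Dom C f)) f)"

text \<open>The free vector space on the finite set of subobjects of \<open>x \<times> y\<close>, as coefficient functions.\<close>

definition TCat0 :: "('o, 'm) category_data \<Rightarrow> ('m \<Rightarrow> 'k) \<Rightarrow> ('o, 'm set \<Rightarrow> 'k::field, 'k) lincat" where
  "TCat0 C \<delta> = \<lparr>
     lobj = Obj C,
     lhom = (\<lambda>x y. {f. \<forall>r. r \<notin> Sub C (prd C x y) \<longrightarrow> f r = 0}),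
     lcomp = (\<lambda>x y z g f t. \<Sum>r \<in> Sub C (prd C x y). \<Sum>s \<in> Sub C (prd C y z).
                f r * g s * (rel_degree C \<delta> x y z r s * basis_vec (rel_comp C x y z r s) t)),
     lid = (\<lambda>x. basis_vec (graph C (Ide C x))),
     lscale = (\<lambda>c f r. c * f r) \<rparr>"

type_synonym ('o, 'm, 'k) T_object = "'o list \<times> (nat \<Rightarrow> nat \<Rightarrow> 'm set \<Rightarrow> 'k)"

definition TCat :: "('o, 'm) category_data \<Rightarrow> ('m \<Rightarrow> 'k) \<Rightarrow>
    (('o, 'm, 'k) T_object, nat \<Rightarrow> nat \<Rightarrow> 'm set \<Rightarrow> 'k::field, 'k) lincat" where
  "TCat C \<delta> = idempotent_completion (additive_completion (TCat0 C \<delta>))"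

text \<open>\<open>T_sum C \<delta> xs\<close> is the direct sum of the objects \<open>[x]\<close> for \<open>x\<close> in the list \<open>xs\<close>.\<close>

definition T_sum :: "('o, 'm) category_data \<Rightarrow> ('m \<Rightarrow> 'k::field) \<Rightarrow> 'o list \<Rightarrow> ('o, 'm, 'k) T_object" where
  "T_sum C \<delta> xs = (xs, lid (additive_completion (TCat0 C \<delta>)) xs)"

definition T_obj :: "('o, 'm) category_data \<Rightarrow> ('m \<Rightarrow> 'k::field) \<Rightarrow> 'o \<Rightarrow> ('o, 'm, 'k) T_object" where
  "T_obj C \<delta> x = T_sum C \<delta> [x]"

text \<open>\<open>[f] : [x] \<rightarrow> [y]\<close> as a 1-by-1 matrix.\<close>

definition T_graph :: "('o, 'm) category_data \<Rightarrow> 'm \<Rightarrow> nat \<Rightarrow> nat \<Rightarrow> 'm set \<Rightarrow> 'k::field" where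
  "T_graph C f = (\<lambda>i j. if i = 0 \<and> j = 0 then basis_vec (graph C f) else 0)"

text \<open>On morphisms the tensor product is bilinear with \<open>\<langle>r\<rangle> \<otimes> \<langle>s\<rangle> = \<langle>r \<times> s\<rangle>\<close>, where for
  \<open>r \<subseteq> x \<times> x'\<close> and \<open>s \<subseteq> y \<times> y'\<close> the product \<open>r \<times> s\<close> is viewed in \<open>(x \<times> y) \<times> (x' \<times> y')\<close>.\<close>

definition rel_tensor :: "('o, 'm) category_data \<Rightarrow>
    'o \<Rightarrow> 'o \<Rightarrow> 'o \<Rightarrow> 'o \<Rightarrow> 'm set \<Rightarrow> 'm set \<Rightarrow> 'm set" where
  "rel_tensor C x x' y y' r s =
     (let p = proj1 C (Dom C (rep r)) (Dom C (rep s)); q = proj2 C (Dom C (rep r)) (Dom C (rep s))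
      in sub_of C (tuple C
           (tuple C (leg1 C x x' (rep r) \<cdot>\<^bsub>C\<^esub> p) (leg1 C y y' (rep s) \<cdot>\<^bsub>C\<^esub> q))
           (tuple C (leg2 C x x' (rep r) \<cdot>\<^bsub>C\<^esub> p) (leg2 C y y' (rep s) \<cdot>\<^bsub>C\<^esub> q))))"

definition TCat0_tensor :: "('o, 'm) category_data \<Rightarrow> 'o \<Rightarrow> 'o \<Rightarrow> 'o \<Rightarrow> 'o \<Rightarrow>
    ('m set \<Rightarrow> 'k) \<Rightarrow> ('m set \<Rightarrow> 'k) \<Rightarrow> 'm set \<Rightarrow> 'k::field" where
  "TCat0_tensor C x x' y y' f g t = (\<Sum>r \<in> Sub C (prd C x x'). \<Sum>s \<in> Sub C (prd C y y').
     f r * g s * basis_vec (rel_tensor C x x' y y' r s) t)"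

text \<open>The summand \<open>xs ! a \<times> ys ! b\<close> of the tensor product sits at position \<open>a * length ys + b\<close>;
  the idempotent is the Kronecker product of the two idempotents.\<close>

definition T_tensor :: "('o, 'm) category_data \<Rightarrow>
    ('o, 'm, 'k::field) T_object \<Rightarrow> ('o, 'm, 'k) T_object \<Rightarrow> ('o, 'm, 'k) T_object" where
  "T_tensor C X Y =
     (let xs = fst X; ys = fst Y; n = length ys
      in (concat (map (\<lambda>x. map (prd C x) ys) xs),
          \<lambda>i j. if i < length xs * n \<and> j < length xs * n
                then TCat0_tensor C (xs ! (j div n)) (xs ! (i div n)) (ys ! (j mod n)) (ys ! (i mod n))
                       (snd X (i div n) (j div n)) (snd Y (i mod n) (j mod n))
                else 0))"


section \<open>Characters of finite groups\<close>

definition matrix_rep :: "('g, 'b) monoid_scheme \<Rightarrow> nat \<Rightarrow> ('g \<Rightarrow> 'k::field mat) \<Rightarrow> bool" where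
  "matrix_rep G d \<rho> \<longleftrightarrow> (\<forall>g \<in> carrier G. \<rho> g \<in> carrier_mat d d) \<and> \<rho> \<one>\<^bsub>G\<^esub> = 1\<^sub>m d \<and>
     (\<forall>g \<in> carrier G. \<forall>h \<in> carrier G. \<rho> (g \<otimes>\<^bsub>G\<^esub> h) = \<rho> g * \<rho> h)"

definition irreducible_rep :: "('g, 'b) monoid_scheme \<Rightarrow> nat \<Rightarrow> ('g \<Rightarrow> 'k::field mat) \<Rightarrow> bool" where
  "irreducible_rep G d \<rho> \<longleftrightarrow> matrix_rep G d \<rho> \<and> d > 0 \<and>
     (\<forall>W. VectorSpace.subspace class_ring W (module_vec TYPE('k) d) \<longrightarrow>
        (\<forall>g \<in> carrier G. \<forall>v \<in> W. \<rho> g *\<^sub>v v \<in> W) \<longrightarrow> W = {0\<^sub>v d} \<or> W = carrier_vec d)"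

text \<open>Characters are set to 0 off the carrier, so that they are determined by their values on \<open>G\<close>;
  \<open>sum_list (diag_mat A)\<close> is the trace.\<close>

definition rep_char :: "('g, 'b) monoid_scheme \<Rightarrow> ('g \<Rightarrow> 'k::field mat) \<Rightarrow> 'g \<Rightarrow> 'k" where
  "rep_char G \<rho> = (\<lambda>g. if g \<in> carrier G then sum_list (diag_mat (\<rho> g)) else 0)"

definition irr_chars :: "('g, 'b) monoid_scheme \<Rightarrow> ('g \<Rightarrow> 'k::field) set" where
  "irr_chars G = {\<chi>. \<exists>d \<rho>. irreducible_rep G d \<rho> \<and> \<chi> = rep_char G \<rho>}"

definition dual_char :: "('g, 'b) monoid_scheme \<Rightarrow> ('g \<Rightarrow> 'k::field) \<Rightarrow> 'g \<Rightarrow> 'k" where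
  "dual_char G \<chi> = (\<lambda>g. if g \<in> carrier G then \<chi> (inv\<^bsub>G\<^esub> g) else 0)"

text \<open>Over \<open>\<complex>\<close> the second factor is the complex conjugate of \<open>\<psi> g\<close>.\<close>

definition char_pairing :: "('g, 'b) monoid_scheme \<Rightarrow> ('g \<Rightarrow> 'k) \<Rightarrow> ('g \<Rightarrow> 'k) \<Rightarrow> 'k::field" where
  "char_pairing G \<phi> \<psi> = (\<Sum>g \<in> carrier G. \<phi> g * \<psi> (inv\<^bsub>G\<^esub> g)) / of_nat (Coset.order G)"

definition perm_char :: "('g \<Rightarrow> 's \<Rightarrow> 's) \<Rightarrow> 's set \<Rightarrow> 'g \<Rightarrow> 'k::field" where
  "perm_char act S g = of_nat (card {s \<in> S. act g s = s})"

definition aut_group :: "('o, 'm) category_data \<Rightarrow> 'o \<Rightarrow> 'm monoid" where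
  "aut_group C x = \<lparr> carrier = {g \<in> homs C x x. is_iso C g}, mult = cmp C, one = Ide C x \<rparr>"


section \<open>The simple objects\<close>

text \<open>The map \<open>i : Y \<rightarrow> [x]\<close> exhibits \<open>Y\<close> as the summand \<open>[x]\<^sup>1\<close>.\<close>

definition is_lower_part :: "('o, 'm) category_data \<Rightarrow> ('m \<Rightarrow> 'k::field) \<Rightarrow> 'o \<Rightarrow>
    ('o, 'm, 'k) T_object \<Rightarrow> (nat \<Rightarrow> nat \<Rightarrow> 'm set \<Rightarrow> 'k) \<Rightarrow> bool" where
  "is_lower_part C \<delta> x Y i \<longleftrightarrow>
     (\<exists>p. is_summand (TCat C \<delta>) Y (T_obj C \<delta> x) i p) \<and>
     (\<exists>zs i' p'. (\<forall>z \<in> set zs. proper_subquotient C z x) \<and> is_summand (TCat C \<delta>) Y (T_sum C \<delta> zs) i' p') \<and>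
     (\<forall>z. proper_subquotient C z x \<longrightarrow>
        (\<forall>f \<in> lhom (TCat C \<delta>) (T_obj C \<delta> z) (T_obj C \<delta> x).
           \<exists>g \<in> lhom (TCat C \<delta>) (T_obj C \<delta> z) Y. lcomp (TCat C \<delta>) (T_obj C \<delta> z) Y (T_obj C \<delta> x) i g = f))"

text \<open>The map \<open>j : Z \<rightarrow> [x]\<close> exhibits \<open>Z\<close> as \<open>[x]\<^sup>0\<close>, and \<open>q\<close> is the projection along \<open>[x]\<^sup>1\<close>.\<close>

definition is_upper_part :: "('o, 'm) category_data \<Rightarrow> ('m \<Rightarrow> 'k::field) \<Rightarrow> 'o \<Rightarrow>
    ('o, 'm, 'k) T_object \<Rightarrow> (nat \<Rightarrow> nat \<Rightarrow> 'm set \<Rightarrow> 'k) \<Rightarrow> (nat \<Rightarrow> nat \<Rightarrow> 'm set \<Rightarrow> 'k) \<Rightarrow> bool" where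
  "is_upper_part C \<delta> x Z j q \<longleftrightarrow>
     (\<exists>Y i p. is_lower_part C \<delta> x Y i \<and>
        is_direct_sum (TCat C \<delta>) (T_obj C \<delta> x) {0, 1::nat}
          (\<lambda>a. if a = 0 then Z else Y) (\<lambda>a. if a = 0 then j else i) (\<lambda>a. if a = 0 then q else p))"

definition upper_action :: "('o, 'm) category_data \<Rightarrow> ('m \<Rightarrow> 'k::field) \<Rightarrow> 'o \<Rightarrow> ('o, 'm, 'k) T_object \<Rightarrow>
    (nat \<Rightarrow> nat \<Rightarrow> 'm set \<Rightarrow> 'k) \<Rightarrow> (nat \<Rightarrow> nat \<Rightarrow> 'm set \<Rightarrow> 'k) \<Rightarrow> 'm \<Rightarrow> nat \<Rightarrow> nat \<Rightarrow> 'm set \<Rightarrow> 'k" where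
  "upper_action C \<delta> x Z j q g =
     lcomp (TCat C \<delta>) Z (T_obj C \<delta> x) Z q
       (lcomp (TCat C \<delta>) Z (T_obj C \<delta> x) (T_obj C \<delta> x) (T_graph C g) j)"

text \<open>\<open>F\<close> is the family of the objects \<open>[x]\<^sup>0\<^sub>\<chi>\<close>: there is a decomposition of \<open>[x]\<^sup>0\<close> as the direct
  sum over \<open>\<chi>\<close> of \<open>V\<^sub>\<chi> \<otimes> F \<chi>\<close>, equivariant under the automorphism group of \<open>x\<close>.  With a basis of
  \<open>V\<^sub>\<chi>\<close> fixed, \<open>V\<^sub>\<chi> \<otimes> F \<chi>\<close> is the direct sum of \<open>d \<chi> = dim V\<^sub>\<chi>\<close> copies of \<open>F \<chi>\<close>, and the group acts
  on it through the scalar matrices \<open>\<rho> \<chi> g\<close>.\<close>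

definition is_simple_family :: "('o, 'm) category_data \<Rightarrow> ('m \<Rightarrow> 'k::field) \<Rightarrow> 'o \<Rightarrow>
    (('m \<Rightarrow> 'k) \<Rightarrow> ('o, 'm, 'k) T_object) \<Rightarrow> bool" where
  "is_simple_family C \<delta> x F \<longleftrightarrow>
     (\<exists>Z j q d \<rho> i p. is_upper_part C \<delta> x Z j q \<and>
        (\<forall>\<chi> \<in> irr_chars (aut_group C x).
           irreducible_rep (aut_group C x) (d \<chi>) (\<rho> \<chi>) \<and> rep_char (aut_group C x) (\<rho> \<chi>) = \<chi>) \<and>
        is_direct_sum (TCat C \<delta>) Z (SIGMA \<chi>:irr_chars (aut_group C x). {..<d \<chi>})
          (\<lambda>(\<chi>, a). F \<chi>) (\<lambda>(\<chi>, a). i \<chi> a) (\<lambda>(\<chi>, a). p \<chi> a) \<and>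
        (\<forall>g \<in> carrier (aut_group C x). \<forall>\<chi> \<in> irr_chars (aut_group C x). \<forall>b < d \<chi>.
           lcomp (TCat C \<delta>) (F \<chi>) Z Z (upper_action C \<delta> x Z j q g) (i \<chi> b) =
           (\<Sum>a < d \<chi>. lscale (TCat C \<delta>) (\<rho> \<chi> g $$ (a, b)) (i \<chi> a))))"

text \<open>Such a family is unique up to isomorphism; one is chosen for each \<open>x\<close>.\<close>

definition simple_object :: "('o, 'm) category_data \<Rightarrow> ('m \<Rightarrow> 'k::field) \<Rightarrow> 'o \<Rightarrow>
    ('m \<Rightarrow> 'k) \<Rightarrow> ('o, 'm, 'k) T_object" where
  "simple_object C \<delta> x = (SOME F. is_simple_family C \<delta> x F)"


section \<open>The sets of ternary relations and the multiplicities\<close>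

text \<open>\<open>x\<^sub>1 \<times> x\<^sub>2 \<times> x\<^sub>3\<close> is bracketed to the left.\<close>

definition prd3 :: "('o, 'm) category_data \<Rightarrow> 'o \<Rightarrow> 'o \<Rightarrow> 'o \<Rightarrow> 'o" where
  "prd3 C x1 x2 x3 = prd C (prd C x1 x2) x3"

definition prj1 :: "('o, 'm) category_data \<Rightarrow> 'o \<Rightarrow> 'o \<Rightarrow> 'o \<Rightarrow> 'm" where
  "prj1 C x1 x2 x3 = proj1 C x1 x2 \<cdot>\<^bsub>C\<^esub> proj1 C (prd C x1 x2) x3"

definition prj2 :: "('o, 'm) category_data \<Rightarrow> 'o \<Rightarrow> 'o \<Rightarrow> 'o \<Rightarrow> 'm" where
  "prj2 C x1 x2 x3 = proj2 C x1 x2 \<cdot>\<^bsub>C\<^esub> proj1 C (prd C x1 x2) x3"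

definition prj3 :: "('o, 'm) category_data \<Rightarrow> 'o \<Rightarrow> 'o \<Rightarrow> 'o \<Rightarrow> 'm" where
  "prj3 C x1 x2 x3 = proj2 C (prd C x1 x2) x3"

definition ternary_set :: "('o, 'm) category_data \<Rightarrow> 'o \<Rightarrow> 'o \<Rightarrow> 'o \<Rightarrow> 'm set set" where
  "ternary_set C x1 x2 x3 = {r \<in> Sub C (prd3 C x1 x2 x3).
     let a1 = prj1 C x1 x2 x3 \<cdot>\<^bsub>C\<^esub> rep r; a2 = prj2 C x1 x2 x3 \<cdot>\<^bsub>C\<^esub> rep r; a3 = prj3 C x1 x2 x3 \<cdot>\<^bsub>C\<^esub> rep r
     in surj_arr C a1 \<and> surj_arr C a2 \<and> surj_arr C a3 \<and>
        is_mono C (tuple C a1 a2) \<and> is_mono C (tuple C a1 a3) \<and> is_mono C (tuple C a2 a3)}"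

definition ternary_action :: "('o, 'm) category_data \<Rightarrow> 'o \<Rightarrow> 'o \<Rightarrow> 'o \<Rightarrow>
    'm \<times> 'm \<times> 'm \<Rightarrow> 'm set \<Rightarrow> 'm set" where
  "ternary_action C x1 x2 x3 = (\<lambda>(g1, g2, g3) r. sub_of C (
     tuple C (tuple C (g1 \<cdot>\<^bsub>C\<^esub> prj1 C x1 x2 x3) (g2 \<cdot>\<^bsub>C\<^esub> prj2 C x1 x2 x3)) (g3 \<cdot>\<^bsub>C\<^esub> prj3 C x1 x2 x3)
     \<cdot>\<^bsub>C\<^esub> rep r))"

definition ternary_char :: "('o, 'm) category_data \<Rightarrow> 'o \<Rightarrow> 'o \<Rightarrow> 'o \<Rightarrow> 'm \<times> 'm \<times> 'm \<Rightarrow> 'k::field" where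
  "ternary_char C x1 x2 x3 = perm_char (ternary_action C x1 x2 x3) (ternary_set C x1 x2 x3)"

definition tensor_char :: "('m \<Rightarrow> 'k) \<Rightarrow> ('m \<Rightarrow> 'k) \<Rightarrow> ('m \<Rightarrow> 'k) \<Rightarrow> 'm \<times> 'm \<times> 'm \<Rightarrow> 'k::field" where
  "tensor_char \<chi>1 \<chi>2 \<chi>3 = (\<lambda>(g1, g2, g3). \<chi>1 g1 * \<chi>2 g2 * \<chi>3 g3)"

end

theory Submission
 imports Defs "Jordan_Normal_Form.Char_Poly" "HOL-Algebra.Coset"
begin

text \<open>Every relation between \<open>x\<close> and \<open>y\<close> factors through a common subquotient (Goursat), so modulo
 morphisms through proper subquotients only isomorphisms survive, and \<open>[x]\<^sup>0\<close> carries the group algebra of the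
 automorphism group of \<open>x\<close>.  The projector onto \<open>[x]\<^sup>1\<close> exists because the trace form
 is nondegenerate, which by Moebius inversion amounts to \<open>\<omega>\<^sub>e \<noteq> 0\<close>.  In the same way a relation
 \<open>r\<close> on \<open>x\<^sub>1 \<times> x\<^sub>2 \<times> x\<close>, seen as a morphism \<open>[x\<^sub>1] \<otimes> [x\<^sub>2] \<rightarrow> [x]\<close>, becomes zero between the upper parts
 unless it lies in \<open>T(x\<^sub>1, x\<^sub>2, x)\<close>, and these relations are permuted by the three automorphism groups.
 The multiplicity of \<open>[x]\<^sup>0\<^sub>\<chi>\<close> is the rank of the idempotent
 \<open>w \<mapsto> e\<^sub>\<chi> w (e\<^sub>1 \<otimes> e\<^sub>2)\<close> on the space of these morphisms; in characteristic 0 the rank is the trace, which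
 expands over the group elements into the pairing with the permutation character.\<close>

section \<open>Finite limits\<close>

text \<open>Up to the completion everything is computed with idempotents in spaces of relations: the
  projector onto \<open>[x]^1\<close> is the two-sided unit of the ideal of morphisms through proper
  subquotients, and \<open>[x]^0_chi\<close> is the image of one diagonal matrix unit of the group
  algebra, cut down by the complement of that projector. Every arrow f, monic or not, gets a vector
  \<open>vec f\<close>, the degree of its surjective part times its image, so that composites,
  tensor products and traces can be read off from arbitrary pullbacks. Inductions run over
  \<open>csz x\<close>, the number of subobjects of the square of x, which drops strictly on proper
  subquotients. Traces are degrees of maps to the terminal object, which are surjective because that
  object has no proper subobject. The last obstacle is that \<open>simple_object\<close> is an
  arbitrary choice among the families meeting a specification: any such family is shown to split
  matrix unit idempotents for its own choice of representations, and the multiplicity count is made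
  for arbitrary choices so that it applies.\<close>

locale fc_category =
 fixes C :: "('o, 'm) category_data" (structure)
 assumes cat: "category C" and fc: "finitely_complete C"
begin

abbreviation arr where "arr f == f : Arr C"
abbreviation obj where "obj x == x : Obj C"
abbreviation comp (infixl "**" 70) where "g**f == g \<cdot> f"
abbreviation dom where "dom == Dom C"
abbreviation cod where "cod == Cod C"
abbreviation ide where "ide == Ide C"
abbreviation tup where "tup == tuple C"
abbreviation mono where "mono == is_mono C"
abbreviation iso where "iso == is_iso C"
abbreviation epi where "epi == surj_arr C"
abbreviation pb where "pb == is_pullback C"
abbreviation fac where "fac == factors C"
abbreviation prd where "prd == Defs.prd C"
abbreviation sub where "sub == sub_of C"
abbreviation isom where "isom == isomorphic C"
abbreviation le where "le == sub_le C"
abbreviation pr1 where "pr1 == proj1 C"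
abbreviation pr2 where "pr2 == proj2 C"
abbreviation subq where "subq == subquotient C"
abbreviation Sub where "Sub == Defs.Sub C"

lemma in_homs [simp]: "f : homs C x y \<longleftrightarrow> f : Arr C & dom f = x & cod f = y" by (auto simp: homs_def)

lemma dom_obj [simp]: "arr f ==> dom f : Obj C"
 and cod_obj [simp]: "arr f ==> cod f : Obj C" using cat by (auto simp: category_def)

lemma ide_arr [simp]:
 assumes "obj x" shows "arr (ide x)" "dom (ide x) = x" "cod (ide x) = x"
proof -
 have "ide x : homs C x x" using assms cat unfolding category_def by blast
 then show "arr (ide x)" "dom (ide x) = x" "cod (ide x) = x" by auto
qed

lemma comp_arr [simp]:
 assumes "arr f" "arr g" "cod f = dom g"
 shows "arr (g**f)" "dom (g**f) = dom f" "cod (g**f) = cod g"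
proof -
 have "g**f : homs C (dom f) (cod g)" using assms cat unfolding category_def by blast
 then show "arr (g**f)" "dom (g**f) = dom f" "cod (g**f) = cod g" by auto
qed

lemma comp_ide [simp]: "arr f ==> dom f = x ==> f**ide x = f"
 and ide_comp [simp]: "arr f ==> cod f = y ==> ide y**f = f" using cat by (auto simp: category_def)

lemma comp_assoc [simp]:
 "arr f ==> arr g ==> arr h ==> cod f = dom g ==> cod g = dom h ==>
  (h**g)**f = h**(g**f)" using cat unfolding category_def by metis

text \<open>The simplifier brackets all composites to the right, so a commuting square no longer
  matches once a further arrow \<open>k\<close> is attached; this form applies the square in front
  of \<open>k\<close>.\<close>

lemma comp_reassoc:
 assumes "a**b = c**d" "arr a" "arr b" "arr c" "arr d" "arr k"
  "cod b = dom a" "cod d = dom c" "cod k = dom b" "cod k = dom d"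
 shows "a**(b**k) = c**(d**k)" using assms comp_assoc[of k b a] comp_assoc[of k d c] by simp

lemma comp_reassoc1:
 assumes "a**b = c" "arr a" "arr b" "arr k" "cod b = dom a" "cod k = dom b"
 shows "a**(b**k) = c**k" using assms comp_assoc[of k b a] by simp

section \<open>Terminal objects, products and pullbacks obtained from finite limits\<close>

lemma limit_exists:
 assumes "finite V" "finite E" "is_diagram C V D E" shows "EX l p. is_limit C V D E l p" using fc assms unfolding finitely_complete_def by blast

lemma terminal_exists: "EX t. is_terminal C t"
proof -
 obtain l p where l: "is_limit C {} (%_. undefined) {} l p" using limit_exists[of "{}" "{}" "%_. undefined"] by (auto simp: is_diagram_def)
 then have "is_terminal C l" by (auto simp: is_limit_def is_cone_def is_terminal_def)
 then show ?thesis ..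
qed

lemma product_exists:
 assumes "obj x" "obj y" shows "EX P p q. is_product C x y P p q"
proof -
 let ?D = "%i::nat. if i = 0 then x else y"
 obtain l p where l: "is_limit C {0,1} ?D {} l p" using limit_exists[of "{0,1}" "{}" ?D] assms by (auto simp: is_diagram_def)
 have "is_product C x y l (p 0) (p 1)" unfolding is_product_def
 proof (intro conjI allI ballI)
  show "p 0 : homs C l x" "p 1 : homs C l y" using l by (auto simp: is_limit_def is_cone_def)
 next
  fix t f g assume f: "f : homs C t x" and g: "g : homs C t y"
  then have "is_cone C {0,1} ?D {} t (%i. if i = 0 then f else g)" by (auto simp: is_cone_def)
  then have "EX! h. h : homs C t l & (ALL i : {0,1}. p i**h = (if i = 0 then f else g))" using l unfolding is_limit_def by blast
  then show "EX! h. h : homs C t l & p 0**h = f & p 1**h = g" by simp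
 qed
 then show ?thesis by blast
qed

lemma chosen_product:
 assumes "obj x" "obj y"
 shows "is_product C x y (prd x y) (pr1 x y) (pr2 x y)"
proof -
 have "EX a. (%(P, p, q). is_product C x y P p q) a" using product_exists[OF assms] by auto
 from someI_ex[OF this] show ?thesis unfolding prd_def proj1_def proj2_def chosen_product_def case_prod_beta .
qed

lemma proj_arr [simp]:
 assumes "obj x" "obj y"
 shows "arr (pr1 x y)" "dom (pr1 x y) = prd x y" "cod (pr1 x y) = x"
  "arr (pr2 x y)" "dom (pr2 x y) = prd x y" "cod (pr2 x y) = y" using chosen_product[OF assms] by (auto simp: is_product_def)

lemma prd_obj [simp]: "obj x ==> obj y ==> prd x y : Obj C" using proj_arr(1,2) dom_obj by metis

lemma tuple_ex1:
 assumes "arr f" "arr g" "dom f = dom g"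
 shows "EX! h. h : homs C (dom f) (prd (cod f) (cod g)) &
  pr1 (cod f) (cod g)**h = f & pr2 (cod f) (cod g)**h = g"
proof -
 have "f : homs C (dom f) (cod f)" "g : homs C (dom f) (cod g)" using assms by auto
 moreover have "is_product C (cod f) (cod g) (prd (cod f) (cod g))
   (pr1 (cod f) (cod g)) (pr2 (cod f) (cod g))" using assms by (intro chosen_product) auto
 ultimately show ?thesis unfolding is_product_def by blast
qed

lemma tuple_arr [simp]:
 assumes "arr f" "arr g" "dom f = dom g"
 shows "arr (tup f g)" "dom (tup f g) = dom f"
  "cod (tup f g) = prd (cod f) (cod g)" using theI'[OF tuple_ex1[OF assms]] unfolding tuple_def[symmetric] by auto

lemma proj_tuple [simp]:
 assumes "arr f" "arr g" "dom f = dom g" "cod f = x" "cod g = y"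
 shows "pr1 x y**tup f g = f" "pr2 x y**tup f g = g" using theI'[OF tuple_ex1[OF assms(1-3)]] assms(4,5) unfolding tuple_def[symmetric] by auto

lemma proj_tuple_comp [simp]:
 assumes "arr f" "arr g" "dom f = dom g" "cod f = x" "cod g = y"
  "arr k" "cod k = dom f"
 shows "pr1 x y**(tup f g**k) = f**k" "pr2 x y**(tup f g**k) = g**k"
proof -
 have o: "obj x" "obj y" using assms by auto
 show "pr1 x y**(tup f g**k) = f**k" by (rule comp_reassoc1) (use assms o in auto)
 show "pr2 x y**(tup f g**k) = g**k" by (rule comp_reassoc1) (use assms o in auto)
qed

lemma prod_eqI:
 assumes "arr h" "arr k" "dom h = dom k" "cod h = prd x y" "cod k = prd x y"
  "obj x" "obj y"
  "pr1 x y**h = pr1 x y**k" "pr2 x y**h = pr2 x y**k"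
 shows "h = k"
proof -
 let ?f = "pr1 x y**h" and ?g = "pr2 x y**h"
 have "EX! h. h : homs C (dom ?f) (prd (cod ?f) (cod ?g)) &
  pr1 (cod ?f) (cod ?g)**h = ?f & pr2 (cod ?f) (cod ?g)**h = ?g" by (rule tuple_ex1) (use assms in auto)
 then show ?thesis using assms by auto
qed

lemma tuple_eta:
 assumes "arr h" "cod h = prd x y" "obj x" "obj y"
 shows "tup (pr1 x y**h) (pr2 x y**h) = h" by (rule prod_eqI[of _ _ x y]) (use assms in auto)

lemma tuple_comp [simp]:
 assumes "arr f" "arr g" "dom f = dom g" "arr k" "cod k = dom f"
 shows "tup f g**k = tup (f**k) (g**k)" by (rule prod_eqI[of _ _ "cod f" "cod g"]) (use assms in auto)

lemma tuple_eq_iff [simp]: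
 assumes "arr f" "arr g" "dom f = dom g" "arr f'" "arr g'" "dom f' = dom g'"
  "cod f = cod f'" "cod g = cod g'"
 shows "tup f g = tup f' g' \<longleftrightarrow> f = f' & g = g'"
proof
 assume e: "tup f g = tup f' g'"
 have "pr1 (cod f) (cod g)**tup f g = f" "pr2 (cod f) (cod g)**tup f g = g"
  "pr1 (cod f) (cod g)**tup f' g' = f'" "pr2 (cod f) (cod g)**tup f' g' = g'" using assms by simp_all
 with e show "f = f' & g = g'" by simp
qed simp

lemma tuple_obtain:
 assumes "arr h" "cod h = prd x y" "obj x" "obj y"
 obtains a b where "tup a b = h" "arr a" "arr b" "dom a = dom h" "dom b = dom h"
  "cod a = x" "cod b = y"
proof
 show "tup (pr1 x y**h) (pr2 x y**h) = h" using tuple_eta[OF assms] .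
qed (use assms in auto)

lemma tuple_proj [simp]:
 "obj x ==> obj y ==> tup (pr1 x y) (pr2 x y) = ide (prd x y)" by (rule prod_eqI[of _ _ x y]) auto

lemma pullbackI:
 assumes "arr f" "arr g" "cod f = cod g" "arr p" "arr q" "dom p = dom q"
  "cod p = dom f" "cod q = dom g" "f**p = g**q"
  and ex: "!!u v. arr u ==> arr v ==> dom u = dom v ==> cod u = dom f ==>
   cod v = dom g ==> f**u = g**v ==>
   EX h. arr h & dom h = dom u & cod h = dom p & p**h = u & q**h = v"
  and un: "!!h k. arr h ==> arr k ==> dom h = dom k ==> cod h = dom p ==>
   cod k = dom p ==> p**h = p**k ==> q**h = q**k ==> h = k"
 shows "pb f g p q" unfolding is_pullback_def
proof (intro conjI allI ballI impI)
 fix t u v assume uv: "u : homs C t (dom f)" "v : homs C t (dom g)" "f**u = g**v"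
 then obtain h where "arr h & dom h = dom u & cod h = dom p & p**h = u & q**h = v" using ex[of u v] by auto
 then show "EX! h. h : homs C t (dom p) & p**h = u & q**h = v" using uv un by (intro ex1I[of _ h]) auto
qed (use assms in auto)

lemma pullbackD:
 assumes "pb f g p q"
 shows "arr f" "arr g" "cod f = cod g" "arr p" "arr q" "dom p = dom q"
  "cod p = dom f" "cod q = dom g" "f**p = g**q" using assms by (auto simp: is_pullback_def)

lemma pullback_lift:
 assumes "pb f g p q" "arr u" "arr v" "dom u = dom v" "cod u = dom f"
  "cod v = dom g" "f**u = g**v"
 obtains h where "arr h" "dom h = dom u" "cod h = dom p" "p**h = u" "q**h = v"
proof -
 have "u : homs C (dom u) (dom f)" "v : homs C (dom u) (dom g)" using assms by auto
 then have "EX! h. h : homs C (dom u) (dom p) & p**h = u & q**h = v" using assms(1,7) unfolding is_pullback_def by blast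
 then show ?thesis using that by auto
qed

lemma pullback_eqI:
 assumes "pb f g p q" "arr h" "arr k" "dom h = dom k" "cod h = dom p"
  "cod k = dom p" "p**h = p**k" "q**h = q**k"
 shows "h = k"
proof -
 note d = pullbackD[OF assms(1)]
 have "p**h : homs C (dom h) (dom f)" "q**h : homs C (dom h) (dom g)" using d assms by auto
 moreover have "f**(p**h) = g**(q**h)" by (rule comp_reassoc) (use d assms in auto)
 ultimately have "EX! l. l : homs C (dom h) (dom p) & p**l = p**h & q**l = q**h" using assms(1) unfolding is_pullback_def by blast
 then show ?thesis using assms by auto
qed

lemma pullback_exists:
 assumes "arr f" "arr g" "cod f = cod g"
 shows "EX p q. pb f g p q"
proof -
 \<comment> \<open>The cospan as a graph: vertex 2 carries the common codomain, and the leg of a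
   cone at 2 is forced by the other two.\<close>
 let ?D = "%i::nat. if i = 0 then dom f else if i = 1 then dom g else cod f"
 let ?E = "{(0, 2, f), (1, 2, g)}"
 obtain l p where l: "is_limit C {0,1,2} ?D ?E l p" using limit_exists[of "{0,1,2}" ?E ?D] assms by (auto simp: is_diagram_def)
 then have p: "arr (p 0)" "dom (p 0) = l" "cod (p 0) = dom f"
  "arr (p 1)" "dom (p 1) = l" "cod (p 1) = dom g" "f**p 0 = p 2" "g**p 1 = p 2" by (auto simp: is_limit_def is_cone_def)
 have "pb f g (p 0) (p 1)" unfolding is_pullback_def
 proof (intro conjI allI ballI impI)
  fix t u v assume uv: "u : homs C t (dom f)" "v : homs C t (dom g)" "f**u = g**v"
  let ?q = "%i::nat. if i = 0 then u else if i = 1 then v else f**u"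
  have "is_cone C {0,1,2} ?D ?E t ?q" using uv assms by (auto simp: is_cone_def)
  then have "EX! h. h : homs C t l & (ALL i : {0,1,2}. p i**h = ?q i)" using l unfolding is_limit_def by blast
  moreover have "(ALL i : {0,1,2}. p i**h = ?q i) \<longleftrightarrow> p 0**h = u & p 1**h = v" if "h : homs C t l" for h
  proof -
   have "p 2**h = f**(p 0**h)" using that p assms comp_reassoc1[OF p(7), of h] by auto
   then show ?thesis by auto
  qed
  ultimately show "EX! h. h : homs C t (dom (p 0)) & p 0**h = u & p 1**h = v" using p(2) by (smt (verit, best))
 qed (use assms p in auto)
 then show ?thesis by blast
qed

lemma chosen_pullback:
 assumes "arr f" "arr g" "cod f = cod g" "chosen_pullback C f g = (p, q)"
 shows "pb f g p q"
proof -
 have "EX a. (%(p, q). pb f g p q) a" using pullback_exists[OF assms(1-3)] by auto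
 from someI_ex[OF this] show ?thesis using assms(4) unfolding chosen_pullback_def by auto
qed

lemma pullback_sym: "pb f g p q ==> pb g f q p"
proof -
 assume a: "pb f g p q"
 note d = pullbackD[OF a]
 show ?thesis
 proof (rule pullbackI)
  fix u v assume "arr u" "arr v" "dom u = dom v" "cod u = dom g"
   "cod v = dom f" "g**u = f**v"
  then show "EX h. arr h & dom h = dom u & cod h = dom q & q**h = u & p**h = v" using pullback_lift[OF a, of v u] d(6) by metis
 next
  fix h k assume "arr h" "arr k" "dom h = dom k" "cod h = dom q" "cod k = dom q"
   "q**h = q**k" "p**h = p**k"
  then show "h = k" using pullback_eqI[OF a, of h k] d by simp
 qed (use d in auto)
qed

lemma pullback_paste:
 assumes A: "pb f g p q" and B: "pb h p v u"
 shows "pb (f**h) g v (q**u)"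
proof -
 note a = pullbackD[OF A] and b = pullbackD[OF B]
 show ?thesis
 proof (rule pullbackI)
  have 1: "f**(h**v) = f**(p**u)" using b by simp
  have 2: "f**(p**u) = g**(q**u)" by (rule comp_reassoc) (use a b in auto)
  show "(f**h)**v = g**(q**u)" using a b 1 2 by simp
 next
  fix s t assume st: "arr s" "arr t" "dom s = dom t" "cod s = dom (f**h)"
   "cod t = dom g" "(f**h)**s = g**t"
  then have cs: "cod s = dom h" using a b by simp
  have "f**(h**s) = g**t" using st a b cs by simp
  then obtain k where k: "arr k" "dom k = dom s" "cod k = dom p" "p**k = h**s" "q**k = t" using pullback_lift[OF A, of "h**s" t] st a b cs by auto
  then obtain l where l: "arr l" "dom l = dom s" "cod l = dom v" "v**l = s" "u**l = k" using pullback_lift[OF B, of s k] st a b cs by auto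
  then have "(q**u)**l = t" using k a b by simp
  then show "EX h. arr h & dom h = dom s & cod h = dom v & v**h = s & (q**u)**h = t" using l by blast
 next
  fix k l assume kl: "arr k" "arr l" "dom k = dom l" "cod k = dom v" "cod l = dom v"
   "v**k = v**l" "(q**u)**k = (q**u)**l"
  have "u**k = u**l"
  proof (rule pullback_eqI[OF A])
   have "p**(u**k) = h**(v**k)" by (rule comp_reassoc) (use b kl in auto)
   moreover have "p**(u**l) = h**(v**l)" by (rule comp_reassoc) (use b kl in auto)
   ultimately show "p**(u**k) = p**(u**l)" using kl by simp
  qed (use a b kl in auto)
  then show "k = l" using pullback_eqI[OF B] kl by blast
 qed (use a b in auto)
qed

lemma pullback_paste2:
 assumes A: "pb f g p q" and B: "pb q h u v"
 shows "pb f (g**h) (p**u) v" using pullback_sym[OF pullback_paste[OF pullback_sym[OF A] pullback_sym[OF B]]] .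

end

section \<open>Subobjects and images\<close>

context fc_category
begin

lemma monoD:
 assumes "mono m" shows "arr m"
  and "!!f g. arr f ==> arr g ==> dom f = dom g ==> cod f = dom m ==>
   cod g = dom m ==> m**f = m**g ==> f = g" using assms by (auto simp: is_mono_def)

lemma mono_arr [simp]: "mono m ==> arr m" by (auto simp: is_mono_def)

lemma monoI:
 assumes "arr m"
  and "!!f g. arr f ==> arr g ==> dom f = dom g ==> cod f = dom m ==>
   cod g = dom m ==> m**f = m**g ==> f = g"
 shows "mono m" unfolding is_mono_def by (intro conjI allI ballI impI, fact, rule assms(2)) auto

lemma isoD:
 assumes "iso f"
 obtains g where "arr f" "arr g" "dom g = cod f" "cod g = dom f"
  "g**f = ide (dom f)" "f**g = ide (cod f)" using assms by (auto simp: is_iso_def)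

lemma isoI:
 assumes "arr f" "arr g" "dom g = cod f" "cod g = dom f"
  "g**f = ide (dom f)" "f**g = ide (cod f)"
 shows "iso f" using assms by (auto simp: is_iso_def)

lemma iso_arr [simp]: "iso f ==> arr f" by (auto simp: is_iso_def)

lemma iso_mono: "iso f ==> mono f"
proof (erule isoD, rule monoI)
 fix g h k
 assume a: "arr f" "arr g" "dom g = cod f" "cod g = dom f" "g**f = ide (dom f)"
  "arr h" "arr k" "dom h = dom k" "cod h = dom f" "cod k = dom f" "f**h = f**k"
 then have "(g**f)**h = (g**f)**k" by (subst (1 2) comp_assoc) auto
 with a show "h = k" by simp
qed

lemma ide_iso [simp]: "obj x ==> iso (ide x)" by (rule isoI[of _ "ide x"]) auto

lemma ide_mono [simp]: "obj x ==> mono (ide x)" by (rule iso_mono) auto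

lemma iso_comp:
 assumes "iso f" "iso g" "cod f = dom g" shows "iso (g**f)"
proof -
 obtain f' where f: "arr f" "arr f'" "dom f' = cod f" "cod f' = dom f"
  "f'**f = ide (dom f)" "f**f' = ide (cod f)" using assms(1) by (rule isoD)
 obtain g' where g: "arr g" "arr g'" "dom g' = cod g" "cod g' = dom g"
  "g'**g = ide (dom g)" "g**g' = ide (cod g)" using assms(2) by (rule isoD)
 show ?thesis
 proof (rule isoI[of _ "f'**g'"])
  have "g'**(g**f) = f" using comp_reassoc1[OF g(5), of f] f g assms by simp
  then show "(f'**g')**(g**f) = ide (dom (g**f))" using f g assms by simp
  have "f**(f'**g') = g'" using comp_reassoc1[OF f(6), of g'] f g assms by simp
  then show "(g**f)**(f'**g') = ide (cod (g**f))" using f g assms by simp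
 qed (use f g assms in auto)
qed

lemma mono_comp:
 assumes "mono m" "mono n" "cod m = dom n" shows "mono (n**m)"
proof (rule monoI)
 fix f g
 assume a: "arr f" "arr g" "dom f = dom g" "cod f = dom (n**m)"
  "cod g = dom (n**m)" "(n**m)**f = (n**m)**g"
 then have "n**(m**f) = n**(m**g)" using assms by simp
 then have "m**f = m**g" by - (rule monoD(2)[OF assms(2)]; (use a assms in auto))
 then show "f = g" by - (rule monoD(2)[OF assms(1)]; (use a assms in auto))
qed (use assms in auto)

lemma mono_cancel:
 assumes "mono (n**m)" "arr m" "arr n" "cod m = dom n" shows "mono m"
proof (rule monoI)
 fix f g
 assume a: "arr f" "arr g" "dom f = dom g" "cod f = dom m"
  "cod g = dom m" "m**f = m**g"
 then show "f = g" by - (rule monoD(2)[OF assms(1)]; (use a assms in auto))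
qed (use assms in auto)

lemma mono_split_iso:
 assumes "mono m" "arr h" "dom h = cod m" "cod h = dom m" "m**h = ide (cod m)"
 shows "iso m"
proof (rule isoI[of _ h])
 have "m**(h**m) = m**ide (dom m)" using comp_reassoc1[OF assms(5), of m] assms by simp
 then show "h**m = ide (dom m)" by - (rule monoD(2)[OF assms(1)]; (use assms in auto))
qed (use assms in auto)

section \<open>Factorization through monomorphisms and the order on subobjects\<close>

lemma factorsI:
 assumes "arr h" "dom h = dom f" "cod h = dom m" "f = m**h" shows "fac f m" using assms by (auto simp: factors_def)

lemma factorsE:
 assumes "fac f m"
 obtains h where "arr h" "dom h = dom f" "cod h = dom m" "m**h = f" using assms by (auto simp: factors_def)

lemma factors_refl: "arr f ==> fac f f" by (rule factorsI[of "ide (dom f)"]) auto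

lemma factors_comp:
 assumes "fac f m" "arr m" "arr k" "cod k = dom f" shows "fac (f**k) m"
proof -
 obtain h where h: "arr h" "dom h = dom f" "cod h = dom m" "m**h = f" using assms(1) by (rule factorsE)
 have "arr f" using h assms comp_arr(1) by metis
 then show ?thesis using h(1-3) assms comp_reassoc1[OF h(4), of k] by (intro factorsI[of "h**k"]) auto
qed

lemma factors_trans:
 assumes "fac f m" "fac m n" "arr n" shows "fac f n"
proof -
 obtain h where h: "arr h" "dom h = dom f" "cod h = dom m" "m**h = f" using assms(1) by (rule factorsE)
 obtain k where k: "arr k" "dom k = dom m" "cod k = dom n" "n**k = m" using assms(2) by (rule factorsE)
 show ?thesis using comp_reassoc1[OF k(4), of h] by (intro factorsI[of "k**h"]) (use h k assms in auto)
qed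

lemma factors_cod: "fac f m ==> arr m ==> cod f = cod m" using comp_arr(3) by (elim factorsE) metis

lemma factors_ide: "arr m ==> cod m = x ==> fac m (ide x)" by (rule factorsI[of m]) auto

lemma mono_factors_iso:
 assumes "mono m" "mono n" "fac m n" "fac n m"
 obtains i where "iso i" "dom i = dom m" "cod i = dom n" "n**i = m"
proof -
 obtain h where h: "arr h" "dom h = dom m" "cod h = dom n" "n**h = m" using assms(3) by (rule factorsE)
 obtain k where k: "arr k" "dom k = dom n" "cod k = dom m" "m**k = n" using assms(4) by (rule factorsE)
 have mn: "arr m" "arr n" using assms by auto
 have 1: "m**(k**h) = n**h" using comp_reassoc1[OF k(4), of h] h(1-3) k(1-3) mn by simp
 have "k**h = ide (dom m)" by (rule monoD(2)[OF assms(1)]) (use h(1-3) k(1-3) mn 1 h(4) in auto)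
 moreover have 2: "n**(h**k) = m**k" using comp_reassoc1[OF h(4), of k] h(1-3) k(1-3) mn by simp
 have "h**k = ide (dom n)" by (rule monoD(2)[OF assms(2)]) (use h(1-3) k(1-3) mn 2 k(4) in auto)
 ultimately have "iso h" using h k by (intro isoI[of _ k]) auto
 then show ?thesis using that h by blast
qed

lemma sub_of_eq_iff:
 assumes "mono m" "mono n" "cod m = cod n"
 shows "sub m = sub n \<longleftrightarrow> fac m n & fac n m"
proof
 assume "sub m = sub n"
 moreover have "m : sub m" using assms factors_refl by (auto simp: sub_of_def)
 ultimately show "fac m n & fac n m" by (auto simp: sub_of_def)
next
 assume "fac m n & fac n m"
 then show "sub m = sub n" using assms factors_trans[of _ m n] factors_trans[of _ n m] factors_trans[of m n] factors_trans[of n m]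
  unfolding sub_of_def by (intro Collect_cong) (metis mono_arr)
qed

lemma sub_of_Sub [simp]: "mono m ==> cod m = x ==> sub m : Sub x" by (auto simp: Sub_def)

lemma rep_in: "mono m ==> rep (sub m) : sub m" unfolding rep_def by (rule someI[of _ m]) (auto simp: sub_of_def intro: factors_refl)

lemma rep_sub_of:
 assumes "mono m"
 shows "mono (rep (sub m))" "cod (rep (sub m)) = cod m"
  "fac m (rep (sub m))" "fac (rep (sub m)) m" using rep_in[OF assms] by (auto simp: sub_of_def)

lemma rep_Sub [simp]:
 assumes "s : Sub x"
 shows "mono (rep s)" "cod (rep s) = x" "sub (rep s) = s"
proof -
 obtain m where m: "mono m" "cod m = x" "s = sub m" using assms by (auto simp: Sub_def)
 then show "mono (rep s)" "cod (rep s) = x" using rep_sub_of by auto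
 show "sub (rep s) = s" using m rep_sub_of by (simp add: sub_of_eq_iff)
qed

lemma rep_sub_of_iso:
 assumes "mono m"
 obtains i where "iso i" "dom i = dom (rep (sub m))" "cod i = dom m"
  "m**i = rep (sub m)" using mono_factors_iso[OF rep_sub_of(1)[OF assms] assms rep_sub_of(4,3)[OF assms]] .

lemma sub_of_comp_iso:
 assumes "mono m" "iso i" "cod i = dom m"
 shows "sub (m**i) = sub m"
proof -
 obtain j where j: "arr i" "arr j" "dom j = cod i" "cod j = dom i"
  "j**i = ide (dom i)" "i**j = ide (cod i)" using assms(2) by (rule isoD)
 have "mono (m**i)" using assms iso_mono mono_comp by auto
 then show ?thesis using assms j by (subst sub_of_eq_iff) (auto intro: factorsI[of i] factorsI[of j])
qed

lemma sub_le_iff: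
 assumes "s : Sub x" "t : Sub x"
 shows "le s t \<longleftrightarrow> fac (rep s) (rep t)"
proof
 assume "le s t"
 then obtain m n where mn: "m : s" "n : t" "fac m n" by (auto simp: sub_le_def)
 have "m : sub (rep s)" "n : sub (rep t)" using mn assms by auto
 then have "fac (rep s) m" "mono m" "mono n" "fac n (rep t)" by (auto simp: sub_of_def)
 then show "fac (rep s) (rep t)" using mn assms by (meson factors_trans mono_arr rep_Sub(1))
next
 have "rep s : s" "rep t : t" using rep_in[OF rep_Sub(1)[OF assms(1)]] rep_in[OF rep_Sub(1)[OF assms(2)]] assms by auto
 then show "fac (rep s) (rep t) ==> le s t" by (auto simp: sub_le_def)
qed

lemma sub_le_antisym:
 "s : Sub x ==> t : Sub x ==> le s t ==> le t s ==> s = t" using sub_of_eq_iff[of "rep s" "rep t"] by (simp add: sub_le_iff)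

lemma sub_le_refl: "s : Sub x ==> le s s" by (simp add: sub_le_iff factors_refl)

lemma sub_le_trans:
 "s : Sub x ==> t : Sub x ==> u : Sub x ==> le s t ==> le t u ==> le s u" by (auto simp: sub_le_iff intro: factors_trans)

lemma pullback_mono:
 assumes "pb f m p q" "mono m" shows "mono p"
proof (rule monoI)
 note d = pullbackD[OF assms(1)]
 fix h k assume a: "arr h" "arr k" "dom h = dom k" "cod h = dom p" "cod k = dom p"
  "p**h = p**k"
 have "m**(q**h) = f**(p**h)" by (rule comp_reassoc) (use d a in auto)
 also have "... = m**(q**k)" unfolding a(6) by (rule comp_reassoc) (use d a in auto)
 finally have "q**h = q**k" by - (rule monoD(2)[OF assms(2)]; (use d a in auto))
 then show "h = k" using pullback_eqI[OF assms(1)] a by blast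
qed (use pullbackD[OF assms(1)] in auto)

lemma pullback_iso_unique:
 assumes "pb f g p q" "pb f g p' q'"
 obtains i where "iso i" "dom i = dom p'" "cod i = dom p" "p**i = p'" "q**i = q'"
proof -
 note d = pullbackD[OF assms(1)] and d' = pullbackD[OF assms(2)]
 obtain i where i: "arr i" "dom i = dom p'" "cod i = dom p" "p**i = p'" "q**i = q'" using pullback_lift[OF assms(1), of p' q'] d d' by auto
 obtain j where j: "arr j" "dom j = dom p" "cod j = dom p'" "p'**j = p" "q'**j = q" using pullback_lift[OF assms(2), of p q] d d' by auto
 have "i**j = ide (dom p)" by (rule pullback_eqI[OF assms(1)]) (use i(1-3) j d d' comp_reassoc1[OF i(4), of j] comp_reassoc1[OF i(5), of j] in auto)
 moreover have "j**i = ide (dom p')" by (rule pullback_eqI[OF assms(2)])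
   (use j(1-3) i d d' comp_reassoc1[OF j(4), of i] comp_reassoc1[OF j(5), of i] in auto)
 ultimately have "iso i" using i j by (intro isoI[of _ j]) auto
 then show ?thesis using that i by blast
qed

text \<open>The equalizer is the pullback of \<open>tup f g\<close> along the diagonal, which is
  monic because a projection splits it.\<close>

lemma equalizer_exists:
 assumes "arr f" "arr g" "dom f = dom g" "cod f = cod g"
 obtains m where "mono m" "cod m = dom f" "f**m = g**m"
  "!!k. arr k ==> cod k = dom f ==> f**k = g**k ==> fac k m"
proof -
 let ?y = "cod f" and ?d = "tup (ide (cod f)) (ide (cod f))"
 have y: "obj ?y" using assms by auto
 have dm: "mono ?d"
 proof (rule mono_cancel[of "pr1 ?y ?y"])
  show "mono (pr1 ?y ?y**?d)" using y by simp
 qed (use y in auto)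
 obtain p q where pb: "pb (tup f g) ?d p q" using pullback_exists[of "tup f g" ?d] assms y by auto
 note d = pullbackD[OF pb]
 have "tup (f**p) (g**p) = tup q q" using d assms y by simp
 then have e: "f**p = q & g**p = q" by (subst (asm) tuple_eq_iff) (use d assms y in auto)
 show ?thesis
 proof (rule that[of p])
  show "mono p" using pullback_mono[OF pb dm] .
  show "f**p = g**p" using e by simp
  fix k assume k: "arr k" "cod k = dom f" "f**k = g**k"
  then have "tup f g**k = ?d**(f**k)" using assms y by simp
  then obtain h where "arr h" "dom h = dom k" "cod h = dom p" "p**h = k" using pullback_lift[OF pb, of k "f**k"] k assms y by auto
  then show "fac k p" by (intro factorsI[of h]) auto
 qed (use d assms in auto)
qed

end

section \<open>Surjections and image factorizations in a regular category\<close>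

locale reg_category = fc_category +
 assumes reg: "regular C"
begin

lemma image_exists: "arr f ==> EX m. is_image C f m" using reg by (auto simp: regular_def)

lemma surj_pullback: "pb f g p q ==> epi f ==> epi q" using reg unfolding regular_def by blast

lemma surj_pullback': "pb f g p q ==> epi g ==> epi p" using surj_pullback pullback_sym by blast

lemma surj_arr [simp]: "epi e ==> arr e" by (auto simp: surj_arr_def)

lemma surj_mono_iso:
 assumes "epi e" "mono n" "fac e n" shows "iso n"
proof -
 have c: "cod e = cod n" using assms factors_cod by auto
 then have "fac (ide (cod n)) n" using assms unfolding surj_arr_def is_image_def by auto
 then obtain h where "arr h" "dom h = dom (ide (cod n))" "cod h = dom n"
  "n**h = ide (cod n)" by (rule factorsE)
 then show ?thesis using assms mono_split_iso[of n h] by auto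
qed

text \<open>That the image is the whole target amounts to every mono through which e factors being
  invertible; this is the form in which surjectivity is verified below.\<close>

lemma surjI:
 assumes "arr e"
  and "!!n k. mono n ==> cod n = cod e ==> arr k ==> dom k = dom e ==>
   cod k = dom n ==> n**k = e ==> iso n"
 shows "epi e" unfolding surj_arr_def is_image_def
proof (intro conjI allI impI)
 fix n assume n: "mono n" "cod n = cod e" "fac e n"
 obtain k where "arr k" "dom k = dom e" "cod k = dom n" "n**k = e" using n(3) by (rule factorsE)
 then have "iso n" using assms(2) n by blast
 then obtain g where "arr g" "dom g = cod n" "cod g = dom n" "n**g = ide (cod n)" by (rule isoD)
 then show "fac (ide (cod e)) n" using n assms(1) by (intro factorsI[of g]) auto
qed (use assms(1) in \<open>auto intro: factors_ide\<close>)

lemma iso_surj: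
 assumes i: "iso i" shows "epi i"
proof (rule surjI)
 fix n k assume a: "mono n" "cod n = cod i" "arr k" "dom k = dom i"
  "cod k = dom n" "n**k = i"
 obtain j where j: "arr i" "arr j" "dom j = cod i" "cod j = dom i"
  "i**j = ide (cod i)" using i by (meson isoD)
 then have "n**(k**j) = ide (cod n)" using a comp_reassoc1[OF a(6), of j] by simp
 then show "iso n" using a j by - (rule mono_split_iso[of n "k**j"]; auto)
qed (use i in auto)

lemma ide_surj [simp]: "obj x ==> epi (ide x)" by (rule iso_surj) auto

lemma surj_and_mono_iso: "epi e ==> mono e ==> iso e" using surj_mono_iso factors_refl by auto

lemma surj_cancel:
 assumes "epi (f**g)" "arr f" "arr g" "cod g = dom f" shows "epi f"
proof (rule surjI)
 fix n k assume a: "mono n" "cod n = cod f" "arr k" "dom k = dom f"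
   "cod k = dom n" "n**k = f"
 then have "fac (f**g) n" using assms(2-) comp_reassoc1[OF a(6), of g] by (intro factorsI[of "k**g"]) auto
 then show "iso n" using surj_mono_iso[OF assms(1)] a by auto
qed (use assms in auto)

text \<open>If the composite factors through a mono n, then f factors through the pullback of n
  along e, which is therefore invertible; so e itself factors through n.\<close>

lemma surj_comp:
 assumes e: "epi e" and f: "epi f" and c: "cod f = dom e" shows "epi (e**f)"
proof (rule surjI)
 show "arr (e**f)" using assms by auto
 fix n k assume a: "mono n" "cod n = cod (e**f)" "arr k" "dom k = dom (e**f)"
   "cod k = dom n" "n**k = e**f"
 have ar: "arr e" "arr f" using e f by auto
 obtain p q where pb: "pb e n p q" using pullback_exists[of e n] a ar c by auto
 note d = pullbackD[OF pb]
 have "mono p" using pullback_mono[OF pb a(1)] .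
 moreover obtain h where "arr h" "dom h = dom f" "cod h = dom p" "p**h = f"
 proof (rule pullback_lift[OF pb ar(2) a(3) _ c _ a(6)[symmetric]])
  show "dom f = dom k" "cod k = dom n" using a(4,5) ar c by simp_all
 qed
 then have "fac f p" by (metis factorsI)
 ultimately have "iso p" using surj_mono_iso[OF f] by blast
 then obtain j where j: "arr j" "dom j = cod p" "cod j = dom p" "p**j = ide (cod p)" by (meson isoD)
 have "e = e**(p**j)" using j d ar by simp
 also have "... = n**(q**j)" by (rule comp_reassoc) (use j d ar in auto)
 finally have "fac e n" using j d by (intro factorsI[of "q**j"]) auto
 then show "iso n" using surj_mono_iso[OF e] a by auto
qed

text \<open>The equalizer of f and g is a mono through which e factors, hence invertible.\<close>

lemma surj_epi:
 assumes "epi e" "arr f" "arr g" "dom f = cod e" "dom g = cod e"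
  "cod f = cod g" "f**e = g**e"
 shows "f = g"
proof -
 obtain m where m: "mono m" "cod m = dom f" "f**m = g**m"
  "!!k. arr k ==> cod k = dom f ==> f**k = g**k ==> fac k m" using equalizer_exists[of f g] assms by auto
 then have "iso m" using assms surj_mono_iso[of e m] by auto
 then obtain j where j: "arr j" "dom j = cod m" "cod j = dom m" "m**j = ide (cod m)" by (meson isoD)
 have "f = f**(m**j)" using j m(1,2) assms by simp
 also have "... = g**(m**j)" by (rule comp_reassoc) (use j m assms in auto)
 also have "... = g" using j m(1,2) assms by simp
 finally show ?thesis .
qed

lemma image_surj:
 assumes "is_image C f m" "arr e" "dom e = dom f" "cod e = dom m" "m**e = f"
 shows "epi e"
proof (rule surjI)
 have m: "mono m" "arr m" using assms by (auto simp: is_image_def)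
 fix n k assume a: "mono n" "cod n = cod e" "arr k" "dom k = dom e"
   "cod k = dom n" "n**k = e"
 have "mono (m**n)" using a m assms mono_comp by auto
 moreover have "fac f (m**n)" using a m assms by (intro factorsI[of k]) auto
 ultimately have "fac m (m**n)" using assms a m unfolding is_image_def by auto
 then obtain h where h: "arr h" "dom h = dom m" "cod h = dom (m**n)" "(m**n)**h = m" by (rule factorsE)
 have "n**h = ide (cod n)" by (rule monoD(2)[OF m(1)]) (use h(1-3) h(4) a(1-5) m assms in auto)
 then show "iso n" using h(1-3) a(1-5) m assms by - (rule mono_split_iso[of n h]; auto)
qed (use assms in auto)

lemma image_fact:
 assumes "arr f" "image_fact C f = (m, e)"
 shows "mono m" "epi e" "dom e = dom f" "cod e = dom m" "cod m = cod f" "m**e = f"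
proof -
 obtain m' where m': "is_image C f m'" using image_exists[OF assms(1)] by blast
 then obtain e' where "e' : homs C (dom f) (dom m')" "m'**e' = f" unfolding is_image_def factors_def by blast
 then have "EX a. (%(m, e). is_image C f m & e : homs C (dom f) (dom m) & m**e = f) a" using m' by auto
 from someI_ex[OF this] have
  *: "is_image C f m & e : homs C (dom f) (dom m) & m**e = f" using assms(2) unfolding image_fact_def by auto
 then show "mono m" "dom e = dom f" "cod e = dom m" "cod m = cod f" "m**e = f" by (auto simp: is_image_def)
 show "epi e" by (rule image_surj[of f m]) (use * in auto)
qed

lemma image_obtain:
 assumes "arr f"
 obtains m e where "mono m" "epi e" "dom e = dom f" "cod e = dom m"
  "cod m = cod f" "m**e = f" using image_fact[OF assms] by (metis surj_pair)

text \<open>The diagonal filler of a square with a surjection on one side and a mono on the other: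
  the mono pulled back along f receives e, hence is invertible.\<close>

lemma surj_lift_mono:
 assumes e: "epi e" and m: "mono m" and "arr f" "arr g"
  "dom f = cod e" "dom g = dom e" "cod g = dom m" "cod f = cod m" "f**e = m**g"
 shows "fac f m"
proof -
 have ar: "arr e" "arr m" using e m by auto
 obtain p q where pb: "pb f m p q" using pullback_exists[of f m] assms ar by auto
 note d = pullbackD[OF pb]
 obtain h where "arr h" "dom h = dom e" "cod h = dom p" "p**h = e" using pullback_lift[OF pb, of e g] assms ar by auto
 then have "fac e p" by (metis factorsI)
 then have "iso p" using surj_mono_iso[OF e pullback_mono[OF pb m]] by blast
 then obtain j where j: "arr j" "dom j = cod p" "cod j = dom p" "p**j = ide (cod p)" by (meson isoD)
 have "f = f**(p**j)" using j d assms by simp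
 also have "... = m**(q**j)" by (rule comp_reassoc) (use j d assms in auto)
 finally show ?thesis using j d by (intro factorsI[of "q**j"]) auto
qed

lemma surj_factor_cover:
 assumes "epi e" "mono m" "arr f" "dom f = cod e" "fac (f**e) m"
 shows "fac f m"
proof -
 obtain g where "arr g" "dom g = dom (f**e)" "cod g = dom m" "m**g = f**e" using assms(5) by (rule factorsE)
 then show ?thesis using surj_lift_mono[of e m f g] assms factors_cod[OF assms(5)] by auto
qed

lemma image_unique:
 assumes "mono m" "epi e" "cod e = dom m" "mono n" "epi f" "cod f = dom n"
  "m**e = n**f"
 obtains i where "iso i" "dom i = dom m" "cod i = dom n" "n**i = m" "i**e = f"
proof -
 have ar: "arr m" "arr n" "arr e" "arr f" using assms by auto
 have de: "dom e = dom f" "cod m = cod n" using comp_arr(2,3)[of e m] comp_arr(2,3)[of f n] assms ar by metis+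
 have "fac m n" by (rule surj_lift_mono[of e n m f]) (use assms ar de in auto)
 moreover have "fac n m" by (rule surj_lift_mono[of f m n e]) (use assms ar de in auto)
 ultimately obtain i where i: "iso i" "dom i = dom m" "cod i = dom n" "n**i = m" using mono_factors_iso[OF assms(1,4)] by blast
 have "n**(i**e) = n**f" using comp_reassoc1[OF i(4), of e] i assms ar de by simp
 then have "i**e = f" by - (rule monoD(2)[OF assms(4)]; (use i assms ar de in auto))
 then show ?thesis using that i by blast
qed

text \<open>A surjection is the coequalizer of its kernel pair. The image of \<open>tup e g\<close>
  is the graph of the wanted map: its first leg a is surjective because e is, and monic because g
  agrees on the two projections of the kernel pair; so h is b after the inverse of a.\<close>

lemma surj_coequalizer:
 assumes e: "epi e" and pb: "pb e e p q"
  and g: "arr g" "dom g = dom e" "g**p = g**q"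
 obtains h where "arr h" "dom h = cod e" "cod h = cod g" "h**e = g"
proof -
 have ea: "arr e" using e by simp
 note d = pullbackD[OF pb]
 let ?y = "cod e" and ?t = "cod g"
 have o: "obj ?y" "obj ?t" using ea g by auto
 obtain m k where mk: "mono m" "epi k" "dom k = dom e" "cod k = dom m"
  "cod m = prd ?y ?t" "m**k = tup e g" using image_obtain[of "tup e g"] ea g by auto
 have ma: "arr m" "arr k" using mk by auto
 obtain a b where mt: "tup a b = m" and m: "arr a" "arr b" "dom a = dom m" "dom b = dom m"
  "cod a = ?y" "cod b = ?t" using tuple_obtain[of m ?y ?t] ma mk o by metis
 have "tup a b**k = tup e g" using mk mt by simp
 then have "tup (a**k) (b**k) = tup e g" using mk(2-5) m ma by simp
 then have ak: "a**k = e & b**k = g" by (subst (asm) tuple_eq_iff) (use m ma mk ea g in auto)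
 have "epi a" using surj_cancel[of a k] ak e m ma mk by auto
 moreover have "mono a"
 proof (rule monoI)
  fix u v assume uv: "arr u" "arr v" "dom u = dom v" "cod u = dom a" "cod v = dom a"
   "a**u = a**v"
  txt \<open>Cover the common domain so that both \<open>u\<close> and \<open>v\<close> lift along \<open>k\<close>.\<close>
  obtain p1 q1 where pb1: "pb k u p1 q1" using pullback_exists[of k u] ma uv m mk by auto
  note d1 = pullbackD[OF pb1]
  obtain p2 q2 where pb2: "pb k (v**q1) p2 q2" using pullback_exists[of k "v**q1"] ma uv m mk d1 by auto
  note d2 = pullbackD[OF pb2]
  have s: "epi (q1**q2)" using surj_comp[of q1 q2] surj_pullback[OF pb1] surj_pullback[OF pb2] mk d1 d2 uv by auto
  have dq: "cod q2 = dom q1" "cod q1 = dom v" using d1 d2 uv m by auto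
  let ?l1 = "p1**q2"
  have l: "arr ?l1" "arr p2" "dom ?l1 = dom p2" "cod ?l1 = dom e" "cod p2 = dom e" using d1 d2 mk uv m by auto
  have kl1: "k**?l1 = u**(q1**q2)" by (rule comp_reassoc) (use d1 d2 dq uv m ma in auto)
  have kp2: "k**p2 = v**(q1**q2)" using d2 d1 dq uv m by simp
  have "e**?l1 = a**(k**?l1)" using comp_reassoc1[of a k e ?l1] ak l ma m mk by simp
  also have "... = a**(k**p2)" unfolding kl1 kp2 by (rule comp_reassoc) (use uv m d1 d2 dq in auto)
  also have "... = e**p2" using comp_reassoc1[of a k e p2] ak l ma m mk by simp
  finally obtain w where w: "arr w" "dom w = dom p2" "cod w = dom p" "p**w = ?l1" "q**w = p2" using pullback_lift[OF pb, of ?l1 p2] l ea by auto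
  have gl: "g**?l1 = g**p2" unfolding w(4,5)[symmetric] by (rule comp_reassoc) (use w d g in auto)
  have "b**(u**(q1**q2)) = b**(k**?l1)" using kl1 by simp
  also have "... = g**?l1" using comp_reassoc1[of b k g ?l1] ak l ma m mk by simp
  also have "... = b**(k**p2)" unfolding gl using comp_reassoc1[of b k g p2] ak l ma m mk by simp
  also have "... = b**(v**(q1**q2))" using kp2 by simp
  finally have "(b**u)**(q1**q2) = (b**v)**(q1**q2)" using uv m d1 d2 dq by simp
  then have "b**u = b**v" by - (rule surj_epi[OF s]; (use uv m d1 d2 dq in auto))
  then have "tup a b**u = tup a b**v" using uv m by simp
  then have "m**u = m**v" using mt by simp
  then show "u = v" by - (rule monoD(2)[OF mk(1)]; (use uv m in auto))
 qed (use m in auto)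
 ultimately have "iso a" by (rule surj_and_mono_iso)
 then obtain j where j: "arr j" "dom j = cod a" "cod j = dom a" "j**a = ide (dom a)" by (meson isoD)
 have "j**e = k" using comp_reassoc1[OF j(4), of k] ak j m ma mk by auto
 then have "(b**j)**e = g" using ak j m ma mk ea by simp
 then show ?thesis using that[of "b**j"] j m by auto
qed

end

section \<open>Images weighted by degrees\<close>

declare plus_fun_apply [simp del] zero_fun_apply [simp del]

lemmas fun_apply = plus_fun_apply zero_fun_apply minus_apply uminus_apply

definition fsc :: "'k => ('s => 'k::field) => 's => 'k" where
 "fsc c f = (%s. c * f s)"

lemma fsc_simps [simp]:
 "fsc 1 f = f" "fsc 0 f = 0" "fsc c (fsc d f) = fsc (c * d) f" "fsc c 0 = 0" by (auto simp: fsc_def fun_eq_iff fun_apply)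

lemma fsc_add: "fsc c (f + g) = fsc c f + fsc c g" by (auto simp: fsc_def fun_eq_iff algebra_simps fun_apply)

lemma fsc_apply: "fsc c f s = c * f s" by (simp add: fsc_def)

lemma sum_fun_eval: "sum h A t = (SUM a:A. h a t)" by (induction A rule: infinite_finite_induct) (auto simp: fun_apply)

lemma fsc_sum: "fsc c (SUM a:A. f a) = (SUM a:A. fsc c (f a))" by (rule ext) (simp add: sum_fun_eval fsc_apply sum_distrib_left)

locale deg_category = reg_category C for C :: "('o, 'm) category_data" (structure) +
 fixes \<delta> :: "'m => 'k::field_char_0"
 assumes deg: "degree_function C \<delta>" and subfin: "subobject_finite C"
  and term_sub: "terminal_has_no_proper_subobject C"
begin

abbreviation iv where "iv x == m_inv (aut_group C x)"
abbreviation TC where "TC == TCat C \<delta>"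
abbreviation Tob where "Tob == T_obj C \<delta>"

lemma deg_ide [simp]: "obj x ==> \<delta> (ide x) = 1" using deg by (auto simp: degree_function_def)

lemma deg_pullback: "pb e g p e' ==> epi e ==> \<delta> e' = \<delta> e" using deg unfolding degree_function_def by blast

lemma deg_pullback': "pb g e e' p ==> epi e ==> \<delta> e' = \<delta> e" using deg_pullback pullback_sym by blast

lemma deg_comp: "epi e ==> epi f ==> cod f = dom e ==> \<delta> (e**f) = \<delta> e * \<delta> f" using deg unfolding degree_function_def by blast

text \<open>An isomorphism is a pullback of an identity.\<close>

lemma deg_iso:
 assumes "iso i" shows "\<delta> i = 1"
proof -
 obtain j where j: "arr i" "arr j" "dom j = cod i" "cod j = dom i"
  "j**i = ide (dom i)" "i**j = ide (cod i)" using assms by (rule isoD)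
 have "pb (ide (cod i)) (ide (cod i)) i i"
 proof (rule pullbackI)
  fix u v assume uv: "arr u" "arr v" "dom u = dom v" "cod u = dom (ide (cod i))"
   "cod v = dom (ide (cod i))" "ide (cod i)**u = ide (cod i)**v"
  then have "u = v" using j by simp
  moreover have "i**(j**u) = u" using comp_reassoc1[OF j(6), of u] uv j by simp
  ultimately show "EX h. arr h & dom h = dom u & cod h = dom i & i**h = u & i**h = v" using uv j by (intro exI[of _ "j**u"]) simp
 next
  fix h k assume "arr h" "arr k" "dom h = dom k" "cod h = dom i"
   "cod k = dom i" "i**h = i**k"
  then show "h = k" by - (rule monoD(2)[OF iso_mono[OF assms]])
 qed (use j in auto)
 from deg_pullback[OF this] j show ?thesis by simp
qed

lemma finite_Sub [simp]: "obj x ==> finite (Sub x)" using subfin by (auto simp: subobject_finite_def)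

text \<open>The composite of two basis relations is this vector for the span out of their fibre
  product. Allowing arrows that are not monic means that no image has to be taken between two
  operations.\<close>

definition vec :: "'m => 'm set => 'k" where
 "vec f = fsc (\<delta> (snd (image_fact C f))) (basis_vec (sub (fst (image_fact C f))))"

text \<open>Image factorizations are unique up to an isomorphism, and isomorphisms have degree
  1.\<close>

lemma vec_eq:
 assumes "mono m" "epi e" "cod e = dom m" "f = m**e"
 shows "vec f = fsc (\<delta> e) (basis_vec (sub m))"
proof -
 obtain n k where nk: "image_fact C f = (n, k)" by (cases "image_fact C f")
 have fa: "arr f" using assms by auto
 note i = image_fact[OF fa nk]
 obtain j where j: "iso j" "dom j = dom m" "cod j = dom n" "n**j = m" "j**e = k" using image_unique[OF assms(1-3) i(1,2,4)] i(6) assms(4) by metis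
 have "sub m = sub n" using sub_of_comp_iso[OF i(1) j(1,3)] j by simp
 moreover have "\<delta> k = \<delta> e" using deg_comp[OF iso_surj[OF j(1)] assms(2)] deg_iso[OF j(1)] j assms by simp
 ultimately show ?thesis using nk by (simp add: vec_def)
qed

lemma vec_mono: "mono m ==> vec m = basis_vec (sub m)" using vec_eq[of m "ide (dom m)" m] by simp

lemma vec_rep: "s : Sub x ==> vec (rep s) = basis_vec s" using vec_mono[of "rep s"] by simp

lemma vec_comp_surj:
 assumes "arr f" "epi e" "cod e = dom f"
 shows "vec (f**e) = fsc (\<delta> e) (vec f)"
proof -
 obtain m k where mk: "mono m" "epi k" "dom k = dom f" "cod k = dom m"
  "cod m = cod f" "m**k = f" using image_obtain[OF assms(1)] by blast
 have "f**e = m**(k**e)" using comp_reassoc1[OF mk(6), of e] mk assms by simp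
 then have "vec (f**e) = fsc (\<delta> (k**e)) (basis_vec (sub m))" using mk assms surj_comp by (intro vec_eq) auto
 also have "... = fsc (\<delta> e) (fsc (\<delta> k) (basis_vec (sub m)))" using deg_comp[of k e] mk assms by (simp add: mult.commute)
 also have "fsc (\<delta> k) (basis_vec (sub m)) = vec f" using mk by (intro vec_eq[symmetric]) auto
 finally show ?thesis .
qed

lemma vec_comp_iso: "arr f ==> iso i ==> cod i = dom f ==> vec (f**i) = vec f" using vec_comp_surj[of f i] iso_surj[of i] deg_iso[of i] by simp

lemma vec_obtain:
 assumes "arr f"
 obtains s e where "s : Sub (cod f)" "epi e" "dom e = dom f" "cod e = dom (rep s)"
  "rep s**e = f" "vec f = fsc (\<delta> e) (basis_vec s)"
proof -
 obtain m k where mk: "mono m" "epi k" "dom k = dom f" "cod k = dom m"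
  "cod m = cod f" "m**k = f" using image_obtain[OF assms(1)] by blast
 let ?s = "sub m"
 have s: "?s : Sub (cod f)" using mk by simp
 obtain i where i: "iso i" "dom i = dom m" "cod i = dom (rep ?s)" "rep ?s**i = m"
  using mono_factors_iso[OF mk(1) rep_sub_of(1)[OF mk(1)] rep_sub_of(3,4)[OF mk(1)]] by blast
 have su: "epi (i**k)" using surj_comp iso_surj i mk by simp
 have f: "rep ?s**(i**k) = f" using comp_reassoc1[OF i(4), of k] i mk s by simp
 have "vec f = fsc (\<delta> (i**k)) (basis_vec (sub (rep ?s)))" using f su i mk rep_sub_of by (intro vec_eq) auto
 then show ?thesis using that[OF s su] f i mk s by simp
qed

lemma vec_support: "arr f ==> s ~: Sub (cod f) ==> vec f s = 0" by (erule vec_obtain) (auto simp: fsc_apply basis_vec_def)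

section \<open>The linear category of relations before any completion\<close>

abbreviation hom0 :: "'o => 'o => ('m set => 'k) set" where
 "hom0 x y == lhom (TCat0 C \<delta>) x y"

abbreviation cp :: "'o => 'o => 'o => ('m set => 'k) => ('m set => 'k) => 'm set => 'k" where
 "cp x y z == lcomp (TCat0 C \<delta>) x y z"

abbreviation cx where "cx x == cp x x x"

lemma hom0_iff: "f : hom0 x y \<longleftrightarrow> (ALL r. r ~: Sub (prd x y) --> f r = 0)" by (simp add: TCat0_def)

lemma cp_eq: "cp x y z g f = (SUM r : Sub (prd x y). SUM s : Sub (prd y z).
  fsc (f r * g s) (vec (rel_span C x y z r s)))"
proof (rule ext)
 fix t
 show "cp x y z g f t = (SUM r : Sub (prd x y). SUM s : Sub (prd y z).
  fsc (f r * g s) (vec (rel_span C x y z r s))) t" by (simp add: TCat0_def vec_def fsc_apply rel_degree_def rel_comp_def sum_fun_eval mult.assoc)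
qed

lemma sum_basis:
 assumes "finite A" "r : A"
 shows "(SUM s:A. fsc (c * basis_vec r s) (F s)) = fsc c (F r)"
proof -
 have "(SUM s:A. fsc (c * basis_vec r s) (F s)) = (SUM s:{r}. fsc (c * basis_vec r s) (F s))"
  using assms by (intro sum.mono_neutral_right) (auto simp: basis_vec_def)
 then show ?thesis by (simp add: basis_vec_def)
qed

lemma cp_add_left: "cp x y z (g + g') f = cp x y z g f + cp x y z g' f"
 by (rule ext) (simp add: cp_eq sum_fun_eval fsc_apply sum.distrib ring_distribs fun_apply)

lemma cp_add_right: "cp x y z g (f + f') = cp x y z g f + cp x y z g f'"
 by (rule ext) (simp add: cp_eq sum_fun_eval fsc_apply sum.distrib ring_distribs fun_apply)

lemma cp_fsc_left: "cp x y z (fsc c g) f = fsc c (cp x y z g f)" unfolding cp_eq fsc_sum by (simp add: fsc_apply mult_ac)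

lemma cp_fsc_right: "cp x y z g (fsc c f) = fsc c (cp x y z g f)" unfolding cp_eq fsc_sum by (simp add: fsc_apply mult_ac)

lemma cp_basis:
 assumes "r : Sub (prd x y)" "s : Sub (prd y z)" "obj x" "obj y" "obj z"
 shows "cp x y z (basis_vec s) (basis_vec r) = vec (rel_span C x y z r s)"
proof -
 have "cp x y z (basis_vec s) (basis_vec r) = (SUM r' : Sub (prd x y).
  fsc (1 * basis_vec r r') (vec (rel_span C x y z r' s)))" unfolding cp_eq
 proof (rule sum.cong[OF refl])
  fix r'
  show "(SUM s' : Sub (prd y z). fsc (basis_vec r r' * basis_vec s s') (vec (rel_span C x y z r' s')))
   = fsc (1 * basis_vec r r') (vec (rel_span C x y z r' s))" using sum_basis[of "Sub (prd y z)" s "basis_vec r r'"] assms by simp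
 qed
 also have "... = vec (rel_span C x y z r s)" using sum_basis[of "Sub (prd x y)" r 1] assms by simp
 finally show ?thesis .
qed

lemma legs:
 assumes "r : Sub (prd x y)" "obj x" "obj y"
 shows "arr (leg1 C x y (rep r))" "arr (leg2 C x y (rep r))"
  "dom (leg1 C x y (rep r)) = dom (rep r)" "dom (leg2 C x y (rep r)) = dom (rep r)"
  "cod (leg1 C x y (rep r)) = x" "cod (leg2 C x y (rep r)) = y"
  "tup (leg1 C x y (rep r)) (leg2 C x y (rep r)) = rep r" using assms tuple_eta[of "rep r" x y] by (auto simp: leg1_def leg2_def)

lemma rep_comp_legs:
 assumes "r : Sub (prd x y)" "obj x" "obj y"
  "arr a" "arr b" "dom a = dom b" "cod a = x" "cod b = y"
  "arr e" "cod e = dom (rep r)" "rep r**e = tup a b"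
 shows "leg1 C x y (rep r)**e = a" "leg2 C x y (rep r)**e = b"
proof -
 have "pr1 x y**(rep r**e) = a" "pr2 x y**(rep r**e) = b" unfolding assms(11) using assms by simp_all
 then show "leg1 C x y (rep r)**e = a" "leg2 C x y (rep r)**e = b" using assms(1-3,9,10) by (simp_all add: leg1_def leg2_def)
qed

text \<open>Composition may be computed from arbitrary spans and an arbitrary pullback, not only
  from the chosen ones. The surjections \<open>e\<close> and \<open>e'\<close> onto the images pull
  back to surjections \<open>u1\<close> and \<open>u2\<close> of the same degrees over the chosen
  fibre product, so the factor \<open>\<delta> e * \<delta> e'\<close> appears on both
  sides.\<close>

lemma cp_vec:
 assumes ab: "arr a" "arr b" "dom a = dom b" "cod a = x"
  and cd: "arr c" "arr d" "dom c = dom d" "cod d = z"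
  and pb: "pb b c p q" and y: "cod b = y"
 shows "cp x y z (vec (tup c d)) (vec (tup a b)) = vec (tup (a**p) (d**q))"
proof -
 note D = pullbackD[OF pb]
 have cy: "cod c = y" using D y by simp
 have o: "obj x" "obj y" "obj z" using ab cd y by auto
 obtain r e where r: "r : Sub (cod (tup a b))" "epi e" "dom e = dom (tup a b)"
   "cod e = dom (rep r)" "rep r**e = tup a b" "vec (tup a b) = fsc (\<delta> e) (basis_vec r)" using vec_obtain[of "tup a b"] ab by auto
 obtain s e' where s: "s : Sub (cod (tup c d))" "epi e'" "dom e' = dom (tup c d)"
   "cod e' = dom (rep s)" "rep s**e' = tup c d" "vec (tup c d) = fsc (\<delta> e') (basis_vec s)" using vec_obtain[of "tup c d"] cd by auto
 have rS: "r : Sub (prd x y)" and sS: "s : Sub (prd y z)" using r s ab cd y cy by auto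
 have de: "dom e = dom a" "dom e' = dom c" using r s ab cd by auto
 have ea: "arr e" "arr e'" using r s by auto
 let ?r1 = "leg1 C x y (rep r)" and ?r2 = "leg2 C x y (rep r)"
 let ?s1 = "leg1 C y z (rep s)" and ?s2 = "leg2 C y z (rep s)"
 note lr = legs[OF rS o(1,2)] and ls = legs[OF sS o(2,3)]
 have re: "?r1**e = a" "?r2**e = b" using rep_comp_legs[OF rS o(1,2) ab y ea(1) r(4,5)] by auto
 have se: "?s1**e' = c" "?s2**e' = d" using rep_comp_legs[OF sS o(2,3) cd(1-3) cy cd(4) ea(2) s(4,5)] by auto
 obtain u v where uv: "chosen_pullback C ?r2 ?s1 = (u, v)" by (cases "chosen_pullback C ?r2 ?s1")
 have pb0: "pb ?r2 ?s1 u v" using chosen_pullback[OF _ _ _ uv] lr ls by auto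
 note d0 = pullbackD[OF pb0]
 obtain v1 u1 where pb1: "pb e u v1 u1" using pullback_exists[of e u] d0 ea r(4) lr by auto
 note d1 = pullbackD[OF pb1]
 have u1: "epi u1" "\<delta> u1 = \<delta> e" using surj_pullback[OF pb1] deg_pullback[OF pb1] r by auto
 have pb2: "pb b ?s1 v1 (v**u1)" using pullback_paste[OF pb0 pb1] re by simp
 note d2 = pullbackD[OF pb2]
 obtain u2 v2 where pb3: "pb (v**u1) e' u2 v2" using pullback_exists[of "v**u1" e'] d2 d0 d1 ea s(4) ls by auto
 note d3 = pullbackD[OF pb3]
 have u2: "epi u2" "\<delta> u2 = \<delta> e'" using surj_pullback'[OF pb3] deg_pullback'[OF pb3] s by auto
 have pb4: "pb b c (v1**u2) v2" using pullback_paste2[OF pb2 pb3] se by simp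
 obtain i where i: "iso i" "dom i = dom (v1**u2)" "cod i = dom p" "p**i = v1**u2" "q**i = v2" using pullback_iso_unique[OF pb pb4] by blast
 have c: "cod u2 = dom u1" "cod u1 = dom u" using d0 d1 d3 by auto
 have "a**v1 = ?r1**(e**v1)" using comp_reassoc1[OF re(1), of v1] d1 ea lr r(4) by simp
 also have "... = ?r1**(u**u1)" using d1 by simp
 finally have av: "a**v1 = (?r1**u)**u1" using d1 d0 lr by simp
 have "a**(v1**u2) = ((?r1**u)**u1)**u2" using comp_reassoc1[OF av, of u2] d1 d0 d3 ab de lr c by simp
 also have "... = (?r1**u)**(u1**u2)" using d0 d1 d3 lr c by simp
 finally have 1: "a**(v1**u2) = (?r1**u)**(u1**u2)" .
 have "d**v2 = ?s2**(e'**v2)" using comp_reassoc1[OF se(2), of v2] d3 ea ls s(4) by simp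
 also have "... = ?s2**((v**u1)**u2)" using d3 by simp
 also have "... = (?s2**v)**(u1**u2)" using d0 d1 d3 ls c by simp
 finally have 2: "d**v2 = (?s2**v)**(u1**u2)" .
 have ii: "arr i" using i by auto
 have "a**(p**i) = (?r1**u)**(u1**u2)" "d**(q**i) = (?s2**v)**(u1**u2)" using 1 2 i by simp_all
 then have "tup (a**p) (d**q)**i = tup ((?r1**u)**(u1**u2)) ((?s2**v)**(u1**u2))" using ab cd D ii i(3) by simp
 also have "... = tup (?r1**u) (?s2**v)**(u1**u2)" using d0 d1 d3 lr ls c by simp
 also have "tup (?r1**u) (?s2**v) = rel_span C x y z r s" by (simp add: rel_span_def uv)
 finally have 3: "tup (a**p) (d**q)**i = rel_span C x y z r s**(u1**u2)" .
 have sp: "arr (rel_span C x y z r s)" "dom (rel_span C x y z r s) = dom u" unfolding rel_span_def uv using d0 lr ls by simp_all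
 have "vec (tup (a**p) (d**q)) = vec (tup (a**p) (d**q)**i)" using ab cd D i by (intro vec_comp_iso[symmetric]) auto
 also have "... = fsc (\<delta> (u1**u2)) (vec (rel_span C x y z r s))"
  unfolding 3 using sp u1 u2 c d0 d1 by (intro vec_comp_surj) (auto intro: surj_comp)
 also have "\<delta> (u1**u2) = \<delta> e * \<delta> e'" using deg_comp[OF u1(1) u2(1)] u1 u2 c by simp
 also have "vec (rel_span C x y z r s) = cp x y z (basis_vec s) (basis_vec r)" using cp_basis[OF rS sS o] by simp
 finally show ?thesis unfolding r(6) s(6) cp_fsc_left cp_fsc_right by (simp add: mult.commute)
qed

lemma vec_hom0: "arr a ==> arr b ==> dom a = dom b ==> cod a = x ==> cod b = y ==>
 vec (tup a b) : hom0 x y" unfolding hom0_iff using vec_support[of "tup a b"] by auto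

lemma hom0_expand:
 assumes "f : hom0 x y" "obj x" "obj y"
 shows "f = (SUM r:Sub (prd x y). fsc (f r) (basis_vec r))"
proof (rule ext)
 fix t
 note * = sum_fun_eval
 show "f t = (SUM r:Sub (prd x y). fsc (f r) (basis_vec r)) t"
 proof (cases "t : Sub (prd x y)")
  case True
  have "(SUM r:Sub (prd x y). f r * basis_vec r t) = (SUM r:{t}. f r * basis_vec r t)"
   using True assms by (intro sum.mono_neutral_right) (auto simp: basis_vec_def)
  then show ?thesis by (simp add: * fsc_apply basis_vec_def)
 next
  case False
  then have "f t = 0" using assms(1) by (simp add: hom0_iff)
  moreover have "(SUM r:Sub (prd x y). f r * basis_vec r t) = 0" using False by (intro sum.neutral) (auto simp: basis_vec_def)
  ultimately show ?thesis by (simp add: * fsc_apply)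
 qed
qed

text \<open>Linear identities reduce to spans. The spans may be taken monic, which is what the
  factorization of relations through subquotients asks for.\<close>

lemma hom0_induct [consumes 3, case_names vec add scale zero]:
 assumes "f : hom0 x y" "obj x" "obj y"
  and vec: "!!a b. arr a ==> arr b ==> dom a = dom b ==> cod a = x ==> cod b = y ==>
   mono (tup a b) ==> P (vec (tup a b))"
  and add: "!!f g. P f ==> P g ==> P (f + g)"
  and scale: "!!c f. P f ==> P (fsc c f)" and zero: "P 0"
 shows "P f"
proof -
 have b: "P (basis_vec r)" if "r : Sub (prd x y)" for r
  using vec[of "leg1 C x y (rep r)" "leg2 C x y (rep r)"] legs[OF that assms(2,3)] vec_rep[OF that] that by simp
 have "P (SUM r:A. fsc (f r) (basis_vec r))" if "A <= Sub (prd x y)" for A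
  using that by (induction A rule: infinite_finite_induct) (auto intro: add scale zero b)
 then have "P (SUM r:Sub (prd x y). fsc (f r) (basis_vec r))" by blast
 then show ?thesis by (rule ssubst[OF hom0_expand[OF assms(1-3)], of P])
qed

lemma cp_zero [simp]: "cp x y z g 0 = 0" "cp x y z 0 f = 0" by (simp_all add: cp_eq fun_apply)

lemma hom0_add: "f : hom0 x y ==> g : hom0 x y ==> f + g : hom0 x y"
 and hom0_fsc: "f : hom0 x y ==> fsc c f : hom0 x y"
 and hom0_zero: "0 : hom0 x y" by (auto simp: hom0_iff fsc_apply fun_apply)

lemma cp_hom0:
 assumes "f : hom0 x y" "g : hom0 y z" "obj x" "obj y" "obj z"
 shows "cp x y z g f : hom0 x z" using assms(1,3,4)
proof (induction rule: hom0_induct)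
 case (vec a b)
 note v1 = this
 show ?case using assms(2,4,5)
 proof (induction rule: hom0_induct)
  case (vec c d)
  obtain p q where pb: "pb b c p q" using pullback_exists[of b c] v1 vec by auto
  show ?case using cp_vec[OF v1(1-4) vec(1-3,5) pb v1(5)] vec_hom0 v1 vec pullbackD[OF pb] by auto
 qed (auto simp: cp_add_left cp_fsc_left intro: hom0_add hom0_fsc hom0_zero)
qed (auto simp: cp_add_right cp_fsc_right intro: hom0_add hom0_fsc hom0_zero)

text \<open>Both bracketings are the vector of the span out of the iterated fibre product.\<close>

lemma cp_assoc:
 assumes "f : hom0 x y" "g : hom0 y z" "h : hom0 z w" "obj x" "obj y" "obj z" "obj w"
 shows "cp x z w h (cp x y z g f) = cp x y w (cp y z w h g) f" using assms(1,4,5)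
proof (induction rule: hom0_induct)
 case (vec a b)
 note v1 = this
 show ?case using assms(2,5,6)
 proof (induction rule: hom0_induct)
  case (vec c d)
  note v2 = this
  show ?case using assms(3,6,7)
  proof (induction rule: hom0_induct)
   case (vec m n)
   obtain p q where pb: "pb b c p q" using pullback_exists[of b c] v1 v2 by auto
   obtain p' q' where pb': "pb d m p' q'" using pullback_exists[of d m] v2 vec by auto
   note D = pullbackD[OF pb] and D' = pullbackD[OF pb']
   obtain u v where pb2: "pb q p' u v" using pullback_exists[of q p'] D D' v2 by auto
   note D2 = pullbackD[OF pb2]
   have A: "pb (d**q) m u (q'**v)" using pullback_paste[OF pb' pb2] .
   have B: "pb b (c**p') (p**u) v" using pullback_paste2[OF pb pb2] .
   have "cp x z w (vec (tup m n)) (vec (tup (a**p) (d**q)))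
     = vec (tup ((a**p)**u) (n**(q'**v)))" by (rule cp_vec) (use A v1 v2 vec D D' D2 in auto)
   moreover have "cp x y w (vec (tup (c**p') (n**q'))) (vec (tup a b))
     = vec (tup (a**(p**u)) ((n**q')**v))" by (rule cp_vec) (use B v1 v2 vec D D' D2 in auto)
   moreover have "cp x y z (vec (tup c d)) (vec (tup a b)) = vec (tup (a**p) (d**q))" by (rule cp_vec) (use pb v1 v2 in auto)
   moreover have "cp y z w (vec (tup m n)) (vec (tup c d)) = vec (tup (c**p') (n**q'))" by (rule cp_vec) (use pb' v2 vec in auto)
   moreover have "(a**p)**u = a**(p**u)" "n**(q'**v) = (n**q')**v" using D D' D2 v1 v2 vec by auto
   ultimately show ?case by simp
  qed (auto simp: cp_add_left cp_fsc_left)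
 qed (auto simp: cp_add_left cp_fsc_left cp_add_right cp_fsc_right)
qed (auto simp: cp_add_right cp_fsc_right)

definition id0 :: "'o => 'm set => 'k" where "id0 x = vec (tup (ide x) (ide x))"

lemma graph_mono:
 assumes "arr f" shows "mono (tup (ide (dom f)) f)"
proof (rule mono_cancel[of "pr1 (dom f) (cod f)"])
 show "mono (pr1 (dom f) (cod f)**tup (ide (dom f)) f)" using assms by simp
qed (use assms in auto)

lemma vec_graph: "arr f ==> vec (tup (ide (dom f)) f) = basis_vec (graph C f)" using vec_mono[OF graph_mono] by (simp add: graph_def)

lemma lid0: "obj x ==> lid (TCat0 C \<delta>) x = id0 x" using vec_graph[of "ide x"] by (simp add: TCat0_def id0_def)

lemma pullback_ide: "arr f ==> pb f (ide (cod f)) (ide (dom f)) f"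
proof (rule pullbackI)
 fix u v assume "arr f" "arr u" "arr v" "dom u = dom v" "cod u = dom f"
  "cod v = dom (ide (cod f))" "f**u = ide (cod f)**v"
 then show "EX h. arr h & dom h = dom u & cod h = dom (ide (dom f)) &
   ide (dom f)**h = u & f**h = v" by (intro exI[of _ u]) auto
qed auto

lemma cp_id_right:
 assumes "f : hom0 x y" "obj x" "obj y" shows "cp x x y f (id0 x) = f" using assms
proof (induction rule: hom0_induct)
 case (vec a b)
 have "cp x x y (vec (tup a b)) (vec (tup (ide x) (ide x)))
   = vec (tup (ide x**a) (b**ide (dom a)))" by (rule cp_vec) (use vec pullback_sym[OF pullback_ide[of a]] assms in auto)
 then show ?case using vec by (simp add: id0_def)
qed (auto simp: cp_add_left cp_fsc_left)

lemma cp_id_left: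
 assumes "f : hom0 x y" "obj x" "obj y" shows "cp x y y (id0 y) f = f" using assms
proof (induction rule: hom0_induct)
 case (vec a b)
 have "cp x y y (vec (tup (ide y) (ide y))) (vec (tup a b))
   = vec (tup (a**ide (dom b)) (ide y**b))" by (rule cp_vec) (use vec pullback_ide[of b] assms in auto)
 then show ?case using vec by (simp add: id0_def)
qed (auto simp: cp_add_right cp_fsc_right)

lemma id0_hom0: "obj x ==> id0 x : hom0 x x" unfolding id0_def by (rule vec_hom0) auto

end

section \<open>Tensor products of relations\<close>

context fc_category
begin

definition prodm :: "'m => 'm => 'm" where
 "prodm f g = tup (f**pr1 (dom f) (dom g)) (g**pr2 (dom f) (dom g))"

lemma prodm_arr [simp]:
 assumes "arr f" "arr g"
 shows "arr (prodm f g)" "dom (prodm f g) = prd (dom f) (dom g)"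
  "cod (prodm f g) = prd (cod f) (cod g)" using assms by (simp_all add: prodm_def)

lemma prodm_tuple:
 assumes "arr f" "arr g" "arr u" "arr v" "dom u = dom v" "cod u = dom f" "cod v = dom g"
 shows "prodm f g**tup u v = tup (f**u) (g**v)" using assms by (simp add: prodm_def)

lemma prodm_comp:
 assumes "arr f" "arr g" "arr u" "arr v" "cod u = dom f" "cod v = dom g"
 shows "prodm f g**prodm u v = prodm (f**u) (g**v)" using assms prodm_tuple[of f g "u**pr1 (dom u) (dom v)" "v**pr2 (dom u) (dom v)"]
 by (simp add: prodm_def[of u v] prodm_def[of "f**u" "g**v"])

lemma prodm_ide: "obj x ==> obj y ==> prodm (ide x) (ide y) = ide (prd x y)" by (simp add: prodm_def)

lemma pullback_prod:
 assumes A: "pb b c p q" and B: "pb b' c' p' q'"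
 shows "pb (prodm b b') (prodm c c') (prodm p p') (prodm q q')"
proof -
 note a = pullbackD[OF A] and b = pullbackD[OF B]
 show ?thesis
 proof (rule pullbackI)
  show "prodm b b'**prodm p p' = prodm c c'**prodm q q'" using a b by (simp add: prodm_comp)
 next
  fix u v assume uv: "arr u" "arr v" "dom u = dom v" "cod u = dom (prodm b b')"
   "cod v = dom (prodm c c')" "prodm b b'**u = prodm c c'**v"
  have o: "obj (dom b)" "obj (dom b')" "obj (dom c)" "obj (dom c')" using a b by auto
  have cu: "cod u = prd (dom b) (dom b')" "cod v = prd (dom c) (dom c')" using uv a b by auto
  obtain u1 u2 where u: "tup u1 u2 = u" "arr u1" "arr u2" "dom u1 = dom u" "dom u2 = dom u"
   "cod u1 = dom b" "cod u2 = dom b'" using tuple_obtain[OF uv(1) cu(1) o(1,2)] by metis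
  obtain v1 v2 where v: "tup v1 v2 = v" "arr v1" "arr v2" "dom v1 = dom v" "dom v2 = dom v"
   "cod v1 = dom c" "cod v2 = dom c'" using tuple_obtain[OF uv(2) cu(2) o(3,4)] by metis
  have "prodm b b'**tup u1 u2 = prodm c c'**tup v1 v2" using uv(6) u(1) v(1) by simp
  then have "tup (b**u1) (b'**u2) = tup (c**v1) (c'**v2)" using u(2-) v(2-) a b by (simp add: prodm_tuple)
  then have e: "b**u1 = c**v1 & b'**u2 = c'**v2" by (subst (asm) tuple_eq_iff) (use a b u(2-) v(2-) uv in auto)
  obtain h where h: "arr h" "dom h = dom u1" "cod h = dom p" "p**h = u1" "q**h = v1" using pullback_lift[OF A u(2) v(2) _ u(6) v(6)] e u v uv by metis
  obtain k where k: "arr k" "dom k = dom u2" "cod k = dom p'" "p'**k = u2" "q'**k = v2"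
   using pullback_lift[OF B u(3) v(3) _ u(7) v(7)] e u v uv by metis
  have "prodm p p'**tup h k = tup u1 u2" "prodm q q'**tup h k = tup v1 v2" using h k a b u(2-) v(2-) by (simp_all add: prodm_tuple)
  then show "EX h. arr h & dom h = dom u & cod h = dom (prodm p p') &
   prodm p p'**h = u & prodm q q'**h = v" using h(1-3) k(1-3) u v a b by (intro exI[of _ "tup h k"]) simp
 next
  fix h k assume hk: "arr h" "arr k" "dom h = dom k" "cod h = dom (prodm p p')"
   "cod k = dom (prodm p p')" "prodm p p'**h = prodm p p'**k" "prodm q q'**h = prodm q q'**k"
  have o: "obj (dom p)" "obj (dom p')" using a b by auto
  have c: "cod h = prd (dom p) (dom p')" "cod k = prd (dom p) (dom p')" using hk a b by auto
  obtain h1 h2 where h: "tup h1 h2 = h" "arr h1" "arr h2" "dom h1 = dom h" "dom h2 = dom h"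
   "cod h1 = dom p" "cod h2 = dom p'" using tuple_obtain[OF hk(1) c(1) o] by metis
  obtain k1 k2 where k: "tup k1 k2 = k" "arr k1" "arr k2" "dom k1 = dom k" "dom k2 = dom k"
   "cod k1 = dom p" "cod k2 = dom p'" using tuple_obtain[OF hk(2) c(2) o] by metis
  have "prodm p p'**tup h1 h2 = prodm p p'**tup k1 k2"
   "prodm q q'**tup h1 h2 = prodm q q'**tup k1 k2" using hk h k by auto
  then have "tup (p**h1) (p'**h2) = tup (p**k1) (p'**k2)"
   "tup (q**h1) (q'**h2) = tup (q**k1) (q'**k2)" using h(2-) k(2-) a b by (simp_all add: prodm_tuple)
  then have "p**h1 = p**k1 & p'**h2 = p'**k2" "q**h1 = q**k1 & q'**h2 = q'**k2" by (subst (asm) tuple_eq_iff; use a b h(2-) k(2-) hk in auto)+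
  then have "h1 = k1" "h2 = k2" using pullback_eqI[OF A, of h1 k1] pullback_eqI[OF B, of h2 k2] h(2-) k(2-) hk(3) a b by auto
  then show "h = k" using h k by simp
 qed (use a b in auto)
qed

lemma prodm_mono:
 assumes "mono f" "mono g" shows "mono (prodm f g)"
proof (rule monoI)
 fix h k assume hk: "arr h" "arr k" "dom h = dom k" "cod h = dom (prodm f g)"
   "cod k = dom (prodm f g)" "prodm f g**h = prodm f g**k"
 have o: "obj (dom f)" "obj (dom g)" using assms by auto
 have c: "cod h = prd (dom f) (dom g)" "cod k = prd (dom f) (dom g)" using hk assms by auto
 obtain h1 h2 where h: "tup h1 h2 = h" "arr h1" "arr h2" "dom h1 = dom h" "dom h2 = dom h"
  "cod h1 = dom f" "cod h2 = dom g" using tuple_obtain[OF hk(1) c(1) o] by metis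
 obtain k1 k2 where k: "tup k1 k2 = k" "arr k1" "arr k2" "dom k1 = dom k" "dom k2 = dom k"
  "cod k1 = dom f" "cod k2 = dom g" using tuple_obtain[OF hk(2) c(2) o] by metis
 have "prodm f g**tup h1 h2 = prodm f g**tup k1 k2" using hk h k by auto
 then have "tup (f**h1) (g**h2) = tup (f**k1) (g**k2)" using h(2-) k(2-) assms by (simp add: prodm_tuple)
 then have "f**h1 = f**k1 & g**h2 = g**k2" by (subst (asm) tuple_eq_iff; use assms h(2-) k(2-) hk in auto)
 then have "h1 = k1" "h2 = k2" using monoD(2)[OF assms(1), of h1 k1] monoD(2)[OF assms(2), of h2 k2] h(2-) k(2-) hk(3) by auto
 then show "h = k" using h k by simp
qed (use assms in auto)

text \<open>Exhibits \<open>prodm e (ide w)\<close> as a pullback of e, so that surjectivity and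
  degree carry over; a product of two surjections is a composite of two maps of this kind.\<close>

lemma pullback_prodm_left:
 assumes "arr e" "obj w"
 shows "pb e (pr1 (cod e) w) (pr1 (dom e) w) (prodm e (ide w))"
proof (rule pullbackI)
 fix u v assume uv: "arr u" "arr v" "dom u = dom v" "cod u = dom e"
  "cod v = dom (pr1 (cod e) w)" "e**u = pr1 (cod e) w**v"
 then have cv: "cod v = prd (cod e) w" using assms by simp
 have "prodm e (ide w)**tup u (pr2 (cod e) w**v) = v"
  by (rule prod_eqI[of _ _ "cod e" w]) (use uv cv assms in \<open>auto simp: prodm_tuple\<close>)
 then show "EX h. arr h & dom h = dom u & cod h = dom (pr1 (dom e) w) &
   pr1 (dom e) w**h = u & prodm e (ide w)**h = v" using uv(1-5) assms by (intro exI[of _ "tup u (pr2 (cod e) w**v)"]) simp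
next
 fix h k assume hk: "arr h" "arr k" "dom h = dom k" "cod h = dom (pr1 (dom e) w)"
  "cod k = dom (pr1 (dom e) w)" "pr1 (dom e) w**h = pr1 (dom e) w**k"
  "prodm e (ide w)**h = prodm e (ide w)**k"
 then have "pr2 (cod e) w**(prodm e (ide w)**h) = pr2 (cod e) w**(prodm e (ide w)**k)" by simp
 then have "pr2 (dom e) w**h = pr2 (dom e) w**k" using hk(1-5) assms by (simp add: prodm_def)
 then show "h = k" using hk assms by - (rule prod_eqI[of _ _ "dom e" w]; simp)
qed (use assms in \<open>auto simp: prodm_def\<close>)

lemma pullback_prodm_right:
 assumes "arr e" "obj w"
 shows "pb e (pr2 w (cod e)) (pr2 w (dom e)) (prodm (ide w) e)"
proof (rule pullbackI)
 fix u v assume uv: "arr u" "arr v" "dom u = dom v" "cod u = dom e"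
  "cod v = dom (pr2 w (cod e))" "e**u = pr2 w (cod e)**v"
 then have cv: "cod v = prd w (cod e)" using assms by simp
 have "prodm (ide w) e**tup (pr1 w (cod e)**v) u = v"
  by (rule prod_eqI[of _ _ w "cod e"]) (use uv cv assms in \<open>auto simp: prodm_tuple\<close>)
 then show "EX h. arr h & dom h = dom u & cod h = dom (pr2 w (dom e)) &
   pr2 w (dom e)**h = u & prodm (ide w) e**h = v" using uv(1-5) assms by (intro exI[of _ "tup (pr1 w (cod e)**v) u"]) simp
next
 fix h k assume hk: "arr h" "arr k" "dom h = dom k" "cod h = dom (pr2 w (dom e))"
  "cod k = dom (pr2 w (dom e))" "pr2 w (dom e)**h = pr2 w (dom e)**k"
  "prodm (ide w) e**h = prodm (ide w) e**k"
 then have "pr1 w (cod e)**(prodm (ide w) e**h) = pr1 w (cod e)**(prodm (ide w) e**k)" by simp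
 then have "pr1 w (dom e)**h = pr1 w (dom e)**k" using hk(1-5) assms by (simp add: prodm_def)
 then show "h = k" using hk assms by - (rule prod_eqI[of _ _ w "dom e"]; simp)
qed (use assms in \<open>auto simp: prodm_def\<close>)

end

context reg_category
begin

lemma prodm_surj:
 assumes "epi e" "epi f" shows "epi (prodm e f)"
proof -
 have "prodm e f = prodm e (ide (cod f))**prodm (ide (dom e)) f" using assms by (simp add: prodm_comp)
 then show ?thesis using surj_comp[of "prodm e (ide (cod f))" "prodm (ide (dom e)) f"] assms
   surj_pullback[OF pullback_prodm_left[of e "cod f"]] surj_pullback[OF pullback_prodm_right[of f "dom e"]] by simp
qed

end

context deg_category
begin

lemma prodm_deg:
 assumes "epi e" "epi f" shows "\<delta> (prodm e f) = \<delta> e * \<delta> f"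
proof -
 have "prodm e f = prodm e (ide (cod f))**prodm (ide (dom e)) f" using assms by (simp add: prodm_comp)
 moreover have "epi (prodm e (ide (cod f)))" "epi (prodm (ide (dom e)) f)" using assms prodm_surj by auto
 ultimately show ?thesis using deg_comp[of "prodm e (ide (cod f))" "prodm (ide (dom e)) f"] assms
   deg_pullback[OF pullback_prodm_left[of e "cod f"]] deg_pullback[OF pullback_prodm_right[of f "dom e"]] by simp
qed

abbreviation ten0 :: "'o => 'o => 'o => 'o => ('m set => 'k) => ('m set => 'k) => 'm set => 'k" where
 "ten0 == TCat0_tensor C"

lemma ten0_eq: "ten0 x x' y y' f g = (SUM r : Sub (prd x x'). SUM s : Sub (prd y y').
  fsc (f r * g s) (basis_vec (rel_tensor C x x' y y' r s)))" by (rule ext) (simp add: TCat0_tensor_def sum_fun_eval fsc_apply mult.assoc)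

lemma ten0_add_left: "ten0 x x' y y' (f + f') g = ten0 x x' y y' f g + ten0 x x' y y' f' g"
 by (rule ext) (simp add: ten0_eq sum_fun_eval fsc_apply sum.distrib ring_distribs fun_apply)

lemma ten0_add_right: "ten0 x x' y y' f (g + g') = ten0 x x' y y' f g + ten0 x x' y y' f g'"
 by (rule ext) (simp add: ten0_eq sum_fun_eval fsc_apply sum.distrib ring_distribs fun_apply)

lemma ten0_fsc_left: "ten0 x x' y y' (fsc c f) g = fsc c (ten0 x x' y y' f g)" unfolding ten0_eq fsc_sum by (simp add: fsc_apply mult_ac)

lemma ten0_fsc_right: "ten0 x x' y y' f (fsc c g) = fsc c (ten0 x x' y y' f g)" unfolding ten0_eq fsc_sum by (simp add: fsc_apply mult_ac)

lemma ten0_zero [simp]: "ten0 x x' y y' 0 g = 0" "ten0 x x' y y' f 0 = 0" by (simp_all add: ten0_eq fun_apply)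

lemma ten0_basis:
 assumes "r : Sub (prd x x')" "s : Sub (prd y y')"
  "obj x" "obj x'" "obj y" "obj y'"
 shows "ten0 x x' y y' (basis_vec r) (basis_vec s) = basis_vec (rel_tensor C x x' y y' r s)"
proof -
 have "ten0 x x' y y' (basis_vec r) (basis_vec s) = (SUM r' : Sub (prd x x').
  fsc (1 * basis_vec r r') (basis_vec (rel_tensor C x x' y y' r' s)))" unfolding ten0_eq
 proof (rule sum.cong[OF refl])
  fix r'
  show "(SUM s' : Sub (prd y y'). fsc (basis_vec r r' * basis_vec s s') (basis_vec (rel_tensor C x x' y y' r' s')))
   = fsc (1 * basis_vec r r') (basis_vec (rel_tensor C x x' y y' r' s))" using sum_basis[of "Sub (prd y y')" s "basis_vec r r'"] assms by simp
 qed
 also have "... = basis_vec (rel_tensor C x x' y y' r s)" using sum_basis[of "Sub (prd x x')" r 1] assms by simp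
 finally show ?thesis .
qed

lemma tensor_span_mono:
 assumes "mono (tup a b)" "mono (tup c d)"
  "arr a" "arr b" "dom a = dom b" "arr c" "arr d" "dom c = dom d"
 shows "mono (tup (prodm a c) (prodm b d))"
proof (rule monoI)
 fix h k assume hk: "arr h" "arr k" "dom h = dom k" "cod h = dom (tup (prodm a c) (prodm b d))"
   "cod k = dom (tup (prodm a c) (prodm b d))"
   "tup (prodm a c) (prodm b d)**h = tup (prodm a c) (prodm b d)**k"
 then have co: "cod h = prd (dom a) (dom c)" "cod k = prd (dom a) (dom c)" using assms by auto
 have o: "obj (dom a)" "obj (dom c)" using assms by auto
 obtain h1 h2 where h: "tup h1 h2 = h" "arr h1" "arr h2" "dom h1 = dom h" "dom h2 = dom h"
  "cod h1 = dom a" "cod h2 = dom c" using tuple_obtain[OF hk(1) co(1) o] by metis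
 obtain k1 k2 where k: "tup k1 k2 = k" "arr k1" "arr k2" "dom k1 = dom k" "dom k2 = dom k"
  "cod k1 = dom a" "cod k2 = dom c" using tuple_obtain[OF hk(2) co(2) o] by metis
 have "tup (prodm a c**h) (prodm b d**h) = tup (prodm a c**k) (prodm b d**k)" using hk(6) hk(1-3) co assms by simp
 then have "prodm a c**h = prodm a c**k & prodm b d**h = prodm b d**k" by (subst (asm) tuple_eq_iff; use assms hk(1-3) co in auto)
 then have "prodm a c**tup h1 h2 = prodm a c**tup k1 k2 & prodm b d**tup h1 h2 = prodm b d**tup k1 k2" using h(1) k(1) by simp
 then have "tup (a**h1) (c**h2) = tup (a**k1) (c**k2)" "tup (b**h1) (d**h2) = tup (b**k1) (d**k2)"
  using h(2-) k(2-) assms by (simp_all add: prodm_tuple)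
 then have "a**h1 = a**k1 & c**h2 = c**k2" "b**h1 = b**k1 & d**h2 = d**k2" by (subst (asm) tuple_eq_iff; use assms h(2-) k(2-) hk in auto)+
 then have "tup a b**h1 = tup a b**k1" "tup c d**h2 = tup c d**k2" using assms h(2-) k(2-) by simp_all
 then have "h1 = k1" "h2 = k2" using monoD(2)[OF assms(1), of h1 k1] monoD(2)[OF assms(2), of h2 k2] h(2-) k(2-) hk(3) assms by auto
 then show "h = k" using h k by simp
qed (use assms in auto)

text \<open>A product of images is the image of the product, and the degree of a product of
  surjections is the product of the degrees.\<close>

lemma ten0_vec:
 assumes ab: "arr a" "arr b" "dom a = dom b" "cod a = x" "cod b = x'"
  and cd: "arr c" "arr d" "dom c = dom d" "cod c = y" "cod d = y'"
 shows "ten0 x x' y y' (vec (tup a b)) (vec (tup c d)) = vec (tup (prodm a c) (prodm b d))"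
proof -
 have o: "obj x" "obj x'" "obj y" "obj y'" using ab cd by auto
 obtain r e where r: "r : Sub (cod (tup a b))" "epi e" "dom e = dom (tup a b)"
   "cod e = dom (rep r)" "rep r**e = tup a b" "vec (tup a b) = fsc (\<delta> e) (basis_vec r)" using vec_obtain[of "tup a b"] ab by auto
 obtain s e' where s: "s : Sub (cod (tup c d))" "epi e'" "dom e' = dom (tup c d)"
   "cod e' = dom (rep s)" "rep s**e' = tup c d" "vec (tup c d) = fsc (\<delta> e') (basis_vec s)" using vec_obtain[of "tup c d"] cd by auto
 have rS: "r : Sub (prd x x')" and sS: "s : Sub (prd y y')" using r s ab cd by auto
 have ea: "arr e" "arr e'" using r s by auto
 let ?r1 = "leg1 C x x' (rep r)" and ?r2 = "leg2 C x x' (rep r)"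
 let ?s1 = "leg1 C y y' (rep s)" and ?s2 = "leg2 C y y' (rep s)"
 note lr = legs[OF rS o(1,2)] and ls = legs[OF sS o(3,4)]
 have re: "?r1**e = a" "?r2**e = b" using rep_comp_legs[OF rS o(1,2) ab ea(1) r(4,5)] by auto
 have se: "?s1**e' = c" "?s2**e' = d" using rep_comp_legs[OF sS o(3,4) cd ea(2) s(4,5)] by auto
 let ?t = "tup (prodm ?r1 ?s1) (prodm ?r2 ?s2)"
 have m: "mono ?t" using tensor_span_mono[of ?r1 ?r2 ?s1 ?s2] lr ls rS sS by simp
 have rt: "rel_tensor C x x' y y' r s = sub ?t" using lr ls by (simp add: rel_tensor_def prodm_def Let_def)
 have "?t**prodm e e' = tup (prodm a c) (prodm b d)" using lr ls ea r(4) s(4) by (simp add: prodm_comp re se)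
 then have "vec (tup (prodm a c) (prodm b d)) = fsc (\<delta> (prodm e e')) (vec ?t)"
  using vec_comp_surj[of ?t "prodm e e'"] prodm_surj r s lr ls by simp
 also have "... = fsc (\<delta> e * \<delta> e') (basis_vec (rel_tensor C x x' y y' r s))" using vec_mono[OF m] rt prodm_deg r s by simp
 finally show ?thesis unfolding r(6) s(6) ten0_fsc_left ten0_fsc_right ten0_basis[OF rS sS o] by (simp add: mult.commute)
qed

lemma ten0_hom0:
 assumes "f : hom0 x x'" "g : hom0 y y'" "obj x" "obj x'" "obj y" "obj y'"
 shows "ten0 x x' y y' f g : hom0 (prd x y) (prd x' y')" using assms(1,3,4)
proof (induction rule: hom0_induct)
 case (vec a b)
 note v1 = this
 show ?case using assms(2,5,6)
 proof (induction rule: hom0_induct)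
  case (vec c d)
  show ?case using ten0_vec[OF v1(1-5) vec(1-5)] v1 vec by (simp only:) (rule vec_hom0; simp)
 qed (auto simp: ten0_add_right ten0_fsc_right intro: hom0_add hom0_fsc hom0_zero)
qed (auto simp: ten0_add_left ten0_fsc_left intro: hom0_add hom0_fsc hom0_zero)

text \<open>The interchange law. On spans it comes from the fact that a product of two pullback
  squares is a pullback square.\<close>

lemma ten0_cp:
 assumes "f : hom0 x x'" "f' : hom0 x' x''" "g : hom0 y y'" "g' : hom0 y' y''"
  "obj x" "obj x'" "obj x''" "obj y" "obj y'" "obj y''"
 shows "ten0 x x'' y y'' (cp x x' x'' f' f) (cp y y' y'' g' g) =
  cp (prd x y) (prd x' y') (prd x'' y'') (ten0 x' x'' y' y'' f' g') (ten0 x x' y y' f g)" using assms(1,5,6)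
proof (induction rule: hom0_induct)
 case (vec a b)
 note v1 = this
 show ?case using assms(2,6,7)
 proof (induction rule: hom0_induct)
  case (vec c d)
  note v2 = this
  show ?case using assms(3,8,9)
  proof (induction rule: hom0_induct)
   case (vec a' b')
   note v3 = this
   show ?case using assms(4,9,10)
   proof (induction rule: hom0_induct)
    case (vec c' d')
    obtain p q where pb: "pb b c p q" using pullback_exists[of b c] v1 v2 by auto
    obtain p' q' where pb': "pb b' c' p' q'" using pullback_exists[of b' c'] v3 vec by auto
    note D = pullbackD[OF pb] and D' = pullbackD[OF pb']
    have "cp x x' x'' (vec (tup c d)) (vec (tup a b)) = vec (tup (a**p) (d**q))" by (rule cp_vec) (use pb v1 v2 in auto)
    moreover have "cp y y' y'' (vec (tup c' d')) (vec (tup a' b')) = vec (tup (a'**p') (d'**q'))" by (rule cp_vec) (use pb' v3 vec in auto)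
    moreover have "ten0 x x'' y y'' (vec (tup (a**p) (d**q))) (vec (tup (a'**p') (d'**q'))) =
     vec (tup (prodm (a**p) (a'**p')) (prodm (d**q) (d'**q')))" by (rule ten0_vec) (use v1 v2 v3 vec D D' in auto)
    moreover have "ten0 x x' y y' (vec (tup a b)) (vec (tup a' b')) = vec (tup (prodm a a') (prodm b b'))" by (rule ten0_vec) (use v1 v3 in auto)
    moreover have "ten0 x' x'' y' y'' (vec (tup c d)) (vec (tup c' d')) = vec (tup (prodm c c') (prodm d d'))" by (rule ten0_vec) (use v2 vec in auto)
    moreover have "cp (prd x y) (prd x' y') (prd x'' y'')
     (vec (tup (prodm c c') (prodm d d'))) (vec (tup (prodm a a') (prodm b b'))) =
     vec (tup (prodm a a'**prodm p p') (prodm d d'**prodm q q'))" by (rule cp_vec) (use pullback_prod[OF pb pb'] v1 v2 v3 vec in auto)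
    moreover have "prodm a a'**prodm p p' = prodm (a**p) (a'**p')" "prodm d d'**prodm q q' = prodm (d**q) (d'**q')"
     by (rule prodm_comp; use v1 v2 v3 vec D D' in auto)+
    ultimately show ?case by simp
   qed (auto simp: ten0_add_right ten0_fsc_right cp_add_left cp_fsc_left)
  qed (auto simp: ten0_add_right ten0_fsc_right cp_add_right cp_fsc_right)
 qed (auto simp: ten0_add_left ten0_fsc_left cp_add_left cp_fsc_left)
qed (auto simp: ten0_add_left ten0_fsc_left cp_add_right cp_fsc_right)

lemma ten0_id0: "obj x ==> obj y ==> ten0 x x y y (id0 x) (id0 y) = id0 (prd x y)" unfolding id0_def by (subst ten0_vec) (auto simp: prodm_ide)

section \<open>The trace\<close>

definition one :: 'o where "one = (SOME t. is_terminal C t)"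

definition bang :: "'o => 'm" where "bang w = (THE f. f : homs C w one)"

text \<open>This is the dimension of \<open>[w]\<close>: the diagonal of w meets itself in w, so
  \<open>num w\<close> is the trace of \<open>id0 w\<close>.\<close>

definition num :: "'o => 'k" where "num w = \<delta> (bang w)"

lemma terminal_one: "is_terminal C one" unfolding one_def using terminal_exists by (rule someI_ex)

lemma bang_ex1: "obj w ==> EX! f. f : homs C w one" using terminal_one unfolding is_terminal_def by blast

lemma bang:
 assumes "obj w"
 shows "arr (bang w)" "dom (bang w) = w" "cod (bang w) = one" using theI'[OF bang_ex1[OF assms]] unfolding bang_def[symmetric] by auto

lemma bang_unique: "arr f ==> cod f = one ==> f = bang (dom f)" using bang_ex1[of "dom f"] bang[of "dom f"] by auto

lemma bang_surj:
 assumes "obj w" shows "epi (bang w)"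
proof (rule surjI)
 fix n k assume "mono n" "cod n = cod (bang w)"
 then show "iso n" using term_sub terminal_one bang[OF assms] unfolding terminal_has_no_proper_subobject_def by metis
qed (use bang[OF assms] in auto)

lemma num_surj:
 assumes "epi e" shows "num (dom e) = \<delta> e * num (cod e)"
proof -
 have "bang (dom e) = bang (cod e)**e" using bang_unique[of "bang (cod e)**e"] bang[of "cod e"] assms by simp
 then show ?thesis using deg_comp[OF bang_surj[of "cod e"] assms] bang[of "cod e"] assms by (simp add: num_def mult.commute)
qed

lemma num_iso: "iso i ==> num (dom i) = num (cod i)" using num_surj[of i] iso_surj deg_iso by simp

text \<open>An intersection number: on \<open>vec f\<close> it is the dimension of the fibre product
  of f and h, by \<open>cnt_vec\<close>.\<close>

definition cnt :: "'m => ('m set => 'k) => 'k" where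
 "cnt h v = (SUM r : Sub (cod h). v r * num (dom (fst (chosen_pullback C (rep r) h))))"

lemma cnt_add: "cnt h (f + g) = cnt h f + cnt h g" by (simp add: cnt_def fun_apply ring_distribs sum.distrib)

lemma cnt_fsc: "cnt h (fsc c f) = c * cnt h f" by (simp add: cnt_def fsc_apply sum_distrib_left mult.assoc)

lemma cnt_zero [simp]: "cnt h 0 = 0" by (simp add: cnt_def fun_apply)

lemma cnt_vec:
 assumes pb: "pb f h p q" shows "cnt h (vec f) = num (dom p)"
proof -
 note D = pullbackD[OF pb]
 obtain r e where r: "r : Sub (cod f)" "epi e" "dom e = dom f"
   "cod e = dom (rep r)" "rep r**e = f" "vec f = fsc (\<delta> e) (basis_vec r)" using vec_obtain[OF D(1)] by metis
 have o: "obj (cod f)" using D by simp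
 obtain u v where uv: "chosen_pullback C (rep r) h = (u, v)" by (cases "chosen_pullback C (rep r) h")
 have pb0: "pb (rep r) h u v" using chosen_pullback[OF _ _ _ uv] r(1) D by simp
 note d0 = pullbackD[OF pb0]
 obtain v1 u1 where pb1: "pb e u v1 u1" using pullback_exists[of e u] d0 r by auto
 note d1 = pullbackD[OF pb1]
 have u1: "epi u1" "\<delta> u1 = \<delta> e" using surj_pullback[OF pb1] deg_pullback[OF pb1] r by auto
 have "pb f h v1 (v**u1)" using pullback_paste[OF pb0 pb1] r(5) by simp
 then obtain i where i: "iso i" "dom i = dom v1" "cod i = dom p" using pullback_iso_unique[OF pb] by blast
 have "num (dom p) = num (dom u1)" using num_iso[OF i(1)] i d1 by simp
 also have "... = \<delta> e * num (dom u)" using num_surj[OF u1(1)] u1 d1 by simp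
 finally have 1: "num (dom p) = \<delta> e * num (dom u)" .
 have "cnt h (basis_vec r) = (SUM s : {r}. basis_vec r s * num (dom (fst (chosen_pullback C (rep s) h))))"
  unfolding cnt_def using r(1) D o by (intro sum.mono_neutral_right) (auto simp: basis_vec_def)
 then show ?thesis using 1 uv by (simp add: r(6) cnt_fsc basis_vec_def)
qed

definition tr :: "'o => ('m set => 'k) => 'k" where
 "tr x f = cnt (tup (ide x) (ide x)) f"

text \<open>The composite meets the diagonal in the same object in which the first relation meets
  the transpose of the second: a point of either is a pair of points that agree in x and in y. This
  symmetric description gives the cyclicity of the trace and the entries of its Gram matrix.\<close>

lemma tr_comp:
 assumes ab: "arr a" "arr b" "dom a = dom b" "cod a = x" "cod b = y"
  and cd: "arr c" "arr d" "dom c = dom d" "cod c = y" "cod d = x"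
  and pb: "pb (tup a b) (tup d c) u v"
 shows "tr x (cp x y x (vec (tup c d)) (vec (tup a b))) = num (dom u)"
proof -
 note D = pullbackD[OF pb]
 have o: "obj x" "obj y" using ab by auto
 obtain p q where P: "pb b c p q" using pullback_exists[of b c] ab cd by auto
 note d = pullbackD[OF P]
 have du: "cod u = dom a" "cod v = dom c" using D ab cd by auto
 have "tup (a**u) (b**u) = tup (d**v) (c**v)" using D(9) D(1-8) ab cd du by simp
 then have e: "a**u = d**v & b**u = c**v" by (subst (asm) tuple_eq_iff; use ab cd D du in auto)
 obtain k where k: "arr k" "dom k = dom u" "cod k = dom p" "p**k = u" "q**k = v" using pullback_lift[OF P D(4,5,6)] du ab cd e by metis
 let ?g = "tup (ide x) (ide x)"
 have ap: "(a**p)**k = a**u" "(d**q)**k = d**v" using k d ab cd by simp_all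
 have "pb (tup (a**p) (d**q)) ?g k (a**u)"
 proof (rule pullbackI)
  show "tup (a**p) (d**q)**k = ?g**(a**u)" using ap e k d ab cd D du o by simp
 next
  fix s m assume sm: "arr s" "arr m" "dom s = dom m" "cod s = dom (tup (a**p) (d**q))"
   "cod m = dom ?g" "tup (a**p) (d**q)**s = ?g**m"
  then have cs: "cod s = dom p" "cod m = x" using d ab cd o by auto
  have "tup ((a**p)**s) ((d**q)**s) = tup m m" using sm(6) sm(1-3) cs d ab cd o by simp
  then have "(a**p)**s = m & (d**q)**s = m" by (subst (asm) tuple_eq_iff; use sm(1-3) cs d ab cd o in auto)
  then have e2: "a**(p**s) = m" "d**(q**s) = m" using sm(1-3) cs d ab cd by auto
  have e3: "b**(p**s) = c**(q**s)" by (rule comp_reassoc) (use sm(1-3) cs d ab cd in auto)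
  have "tup a b**(p**s) = tup d c**(q**s)" using e2 e3 sm(1-3) cs d ab cd by simp
  then obtain h where h: "arr h" "dom h = dom (p**s)" "cod h = dom u" "u**h = p**s" "v**h = q**s"
   using pullback_lift[OF pb, of "p**s" "q**s"] sm(1-3) cs d ab cd by auto
  have "k**h = s" by (rule pullback_eqI[OF P]) (use h k sm(1-3) cs d comp_reassoc1[OF k(4), of h] comp_reassoc1[OF k(5), of h] in auto)
  moreover have "(a**u)**h = m" using h D du ab e2 by simp
  ultimately show "EX h. arr h & dom h = dom s & cod h = dom k & k**h = s & (a**u)**h = m" using h(1-3) k(1-3) cs sm d by (intro exI[of _ h]) simp
 next
  fix h l assume hl: "arr h" "arr l" "dom h = dom l" "cod h = dom k" "cod l = dom k"
   "k**h = k**l"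
  have "u**h = u**l" using comp_reassoc1[OF k(4), of h] comp_reassoc1[OF k(4), of l] hl k(1-3) d by simp
  moreover have "v**h = v**l" using comp_reassoc1[OF k(5), of h] comp_reassoc1[OF k(5), of l] hl k(1-3) d by simp
  ultimately show "h = l" using hl k(1-3) by - (rule pullback_eqI[OF pb]; simp)
 qed (use k ab cd d D du o in auto)
 from cnt_vec[OF this] have "tr x (vec (tup (a**p) (d**q))) = num (dom u)" using k by (simp add: tr_def)
 moreover have "cp x y x (vec (tup c d)) (vec (tup a b)) = vec (tup (a**p) (d**q))" by (rule cp_vec) (use P ab cd in auto)
 ultimately show ?thesis by simp
qed

lemma tr_add: "tr x (f + g) = tr x f + tr x g"
 and tr_fsc: "tr x (fsc c f) = c * tr x f"
 and tr_zero [simp]: "tr x 0 = 0" by (simp_all add: tr_def cnt_add cnt_fsc)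

lemma pullback_swap:
 assumes ab: "arr a" "arr b" "dom a = dom b" "cod a = x" "cod b = y"
  and cd: "arr c" "arr d" "dom c = dom d" "cod c = y" "cod d = x"
  and pb: "pb (tup a b) (tup d c) u v"
 shows "pb (tup b a) (tup c d) u v"
proof -
 have sw: "tup a b**s = tup d c**t \<longleftrightarrow> tup b a**s = tup c d**t"
  if "arr s" "arr t" "cod s = dom a" "cod t = dom c" "dom s = dom t" for s t using that ab cd by (simp add: conj_commute)
 note D = pullbackD[OF pb]
 have du: "cod u = dom a" "cod v = dom c" using D ab cd by auto
 show ?thesis
 proof (rule pullbackI)
  show "tup b a**u = tup c d**v" using sw[of u v] D du by simp
 next
  fix s t assume st: "arr s" "arr t" "dom s = dom t" "cod s = dom (tup b a)"
   "cod t = dom (tup c d)" "tup b a**s = tup c d**t"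
  then have cs: "cod s = dom a" "cod t = dom c" using ab cd by auto
  have "tup a b**s = tup d c**t" using sw st cs by blast
  then show "EX h. arr h & dom h = dom s & cod h = dom u & u**h = s & v**h = t" using pullback_lift[OF pb st(1-3)] cs ab cd by (metis tuple_arr(2))
 qed (use D du ab cd pullback_eqI[OF pb] in auto)
qed

lemma tr_cyc:
 assumes "f : hom0 x y" "g : hom0 y x" "obj x" "obj y"
 shows "tr x (cp x y x g f) = tr y (cp y x y f g)" using assms(1,3,4)
proof (induction rule: hom0_induct)
 case (vec a b)
 note v1 = this
 show ?case using assms(2,4,3)
 proof (induction rule: hom0_induct)
  case (vec c d)
  obtain u v where pb: "pb (tup a b) (tup d c) u v" using pullback_exists[of "tup a b" "tup d c"] v1 vec by auto
  have "pb (tup c d) (tup b a) v u" by (rule pullback_sym, rule pullback_swap) (use v1 vec pb in auto)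
  then have "tr y (cp y x y (vec (tup a b)) (vec (tup c d))) = num (dom v)" by (intro tr_comp) (use v1 vec in auto)
  moreover have "tr x (cp x y x (vec (tup c d)) (vec (tup a b))) = num (dom u)" by (rule tr_comp) (use v1 vec pb in auto)
  ultimately show ?case using pullbackD[OF pb] by simp
 qed (auto simp: cp_add_left cp_fsc_left cp_add_right cp_fsc_right tr_add tr_fsc)
qed (auto simp: cp_add_left cp_fsc_left cp_add_right cp_fsc_right tr_add tr_fsc)

end

section \<open>Moebius inversion\<close>

locale finite_poset =
 fixes P :: "'a set" and leq :: "'a => 'a => bool"
 assumes fin: "finite P"
  and refl: "a : P ==> leq a a"
  and antisym: "a : P ==> b : P ==> leq a b ==> leq b a ==> a = b"
  and trans: "a : P ==> b : P ==> c : P ==> leq a b ==> leq b c ==> leq a c"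
begin

definition is_mu :: "('a => 'a => int) => bool" where
 "is_mu \<mu> \<longleftrightarrow> (ALL a b. ~ (a : P & b : P & leq a b) --> \<mu> a b = 0) &
  (ALL a : P. ALL b : P. leq a b -->
    (SUM c : {c : P. leq a c & leq c b}. \<mu> a c) = (if a = b then 1 else 0))"

lemma card_down:
 assumes "b : P" "c : P" "leq c b" "c ~= b"
 shows "card {d : P. leq d c} < card {d : P. leq d b}"
proof (rule psubset_card_mono)
 show "{d : P. leq d c} \<subset> {d : P. leq d b}" using assms refl antisym trans by blast
qed (use fin in auto)

lemma interval_split:
 assumes "a : P" "b : P" "leq a b"
 shows "(SUM c : {c : P. leq a c & leq c b}. \<mu> a c) =
  \<mu> a b + (SUM c : {c : P. leq a c & leq c b & c ~= b}. (\<mu> a c :: int))"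
proof -
 have "{c : P. leq a c & leq c b} = insert b {c : P. leq a c & leq c b & c ~= b}" using assms refl by auto
 then show ?thesis using fin by simp
qed

lemma is_mu_unique:
 assumes "is_mu \<mu>" "is_mu \<nu>" shows "\<mu> = \<nu>"
proof -
 have "\<mu> a b = \<nu> a b" if "a : P" "b : P" "leq a b" for a b using that
 proof (induction "card {d : P. leq d b}" arbitrary: b rule: less_induct)
  case less
  have "(SUM c : {c : P. leq a c & leq c b & c ~= b}. \<mu> a c) = (SUM c : {c : P. leq a c & leq c b & c ~= b}. \<nu> a c)"
   using less card_down by (intro sum.cong) auto
  moreover have "(SUM c : {c : P. leq a c & leq c b}. \<mu> a c) = (SUM c : {c : P. leq a c & leq c b}. \<nu> a c)"
   using assms less by (simp add: is_mu_def)
  ultimately show ?case using interval_split[of a b \<mu>] interval_split[of a b \<nu>] less by simp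
 qed
 then have "\<mu> a b = \<nu> a b" for a b using assms unfolding is_mu_def by (cases "a : P & b : P & leq a b") auto
 then show ?thesis by (intro ext)
qed

text \<open>The recursion for the Moebius function is iterated as an operator \<open>F\<close>. The
  value at b involves only elements strictly below b, so \<open>card P\<close> iterations reach a
  fixed point.\<close>

lemma is_mu_exists: "EX \<mu>. is_mu \<mu>"
proof -
 define F where "F \<mu> a b = (if a : P & b : P & leq a b then
   (if a = b then 1 else 0) - (SUM c : {c : P. leq a c & leq c b & c ~= b}. \<mu> a c) else 0)" for \<mu> :: "'a => 'a => int" and a b
 define M where "M n = (F ^^ n) (%a b. 0)" for n
 have MS: "M (Suc n) = F (M n)" for n by (simp add: M_def)
 have st: "M (Suc n) a b = M n a b" if "b : P" "card {d : P. leq d b} <= n" for n a b using that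
 proof (induction n arbitrary: b)
  case 0
  then have "{d : P. leq d b} = {}" using fin by auto
  then show ?case using 0 refl by auto
 next
  case (Suc n)
  have "(SUM c : {c : P. leq a c & leq c b & c ~= b}. M (Suc n) a c) = (SUM c : {c : P. leq a c & leq c b & c ~= b}. M n a c)"
  proof (rule sum.cong[OF HOL.refl])
   fix c assume "c : {c : P. leq a c & leq c b & c ~= b}"
   then show "M (Suc n) a c = M n a c" using Suc card_down[of b c] by (intro Suc.IH) auto
  qed
  then have "F (M (Suc n)) a b = F (M n) a b" by (simp only: F_def)
  then show ?case by (simp only: MS)
 qed
 have fx: "F (M (card P)) = M (card P)"
 proof (intro ext)
  fix a b
  show "F (M (card P)) a b = M (card P) a b"
  proof (cases "b : P")
   case True
   have "card {d : P. leq d b} <= card P" using fin by (intro card_mono) auto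
   then show ?thesis using st[OF True] MS by metis
  next
   case False
   then have "M n a b = 0" for n by (induction n) (simp_all add: MS F_def M_def)
   then show ?thesis by (simp add: MS[symmetric])
  qed
 qed
 have "is_mu (M (card P))" unfolding is_mu_def
 proof (intro conjI allI ballI impI)
  fix a b assume "~ (a : P & b : P & leq a b)"
  then show "M (card P) a b = 0" by (subst fx[symmetric]) (auto simp: F_def)
 next
  fix a b assume ab: "a : P" "b : P" "leq a b"
  have "M (card P) a b = (if a = b then 1 else 0) -
    (SUM c : {c : P. leq a c & leq c b & c ~= b}. M (card P) a c)"
   by (subst fx[symmetric]) (use ab in \<open>simp add: F_def\<close>)
  then show "(SUM c : {c : P. leq a c & leq c b}. M (card P) a c) = (if a = b then 1 else 0)" using interval_split[OF ab] by simp
 qed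
 then show ?thesis by (rule exI[of is_mu])
qed

lemma moebius_is_mu: "is_mu (moebius P leq)"
proof -
 have "EX! \<mu>. is_mu \<mu>" using is_mu_exists is_mu_unique by blast
 from theI'[OF this] show ?thesis unfolding moebius_def is_mu_def .
qed

lemma moebius_eqI: "is_mu \<mu> ==> moebius P leq = \<mu>" using moebius_is_mu is_mu_unique by blast

lemma moebius_zero: "~ (a : P & b : P & leq a b) ==> moebius P leq a b = 0" using moebius_is_mu by (auto simp: is_mu_def)

lemma moebius_sum_right:
 assumes "a : P" "b : P"
 shows "(SUM c : {c : P. leq c b}. moebius P leq a c) = (if a = b then 1 else 0)"
proof -
 have "(SUM c : {c : P. leq c b}. moebius P leq a c) = (SUM c : {c : P. leq a c & leq c b}. moebius P leq a c)"
  using moebius_zero fin by (intro sum.mono_neutral_right) auto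
 also have "... = (if a = b then 1 else 0)"
 proof (cases "leq a b")
  case True
  then show ?thesis using moebius_is_mu assms by (simp add: is_mu_def)
 next
  case False
  then have e: "{c : P. leq a c & leq c b} = {}" using assms trans by blast
  have "a ~= b" using False refl assms by blast
  then show ?thesis unfolding e by simp
 qed
 finally show ?thesis .
qed

end

lemma (in finite_poset) dual: "finite_poset P (%a b. leq b a)" by unfold_locales (use fin refl antisym trans in blast)+

context finite_poset
begin

text \<open>A left and a right inverse of the zeta function coincide: the product of
  \<open>?\<mu>\<close>, zeta and the transpose of \<open>?\<nu>\<close> is evaluated with both
  bracketings.\<close>

lemma moebius_dual:
 assumes "a : P" "b : P"
 shows "moebius P leq a b = moebius P (%a b. leq b a) b a"
proof -
 interpret D: finite_poset P "%a b. leq b a" by (rule dual)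
 let ?\<mu> = "moebius P leq" and ?\<nu> = "moebius P (%a b. leq b a)"
 have "?\<mu> a b = (SUM c:P. if b = c then ?\<mu> a c else 0)" using assms fin by (subst sum.delta') auto
 also have "... = (SUM c:P. ?\<mu> a c * (if b = c then 1 else 0))" by (intro sum.cong) auto
 also have "... = (SUM c:P. ?\<mu> a c * (SUM d:{d : P. leq c d}. ?\<nu> b d))" using D.moebius_sum_right[OF assms(2)] by (intro sum.cong) auto
 also have "... = (SUM c:P. SUM d:P. if leq c d then ?\<mu> a c * ?\<nu> b d else 0)"
  using fin by (simp add: sum.inter_filter sum_distrib_left if_distrib cong: if_cong)
 also have "... = (SUM d:P. SUM c:P. if leq c d then ?\<mu> a c * ?\<nu> b d else 0)" by (rule sum.swap)
 also have "... = (SUM d:P. (SUM c:{c : P. leq c d}. ?\<mu> a c) * ?\<nu> b d)"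
  using fin by (simp add: sum.inter_filter sum_distrib_right if_distrib if_distribR cong: if_cong)
 also have "... = (SUM d:P. (if a = d then 1 else 0) * ?\<nu> b d)" using moebius_sum_right[OF assms(1)] by (intro sum.cong) auto
 also have "... = (SUM d:P. if a = d then ?\<nu> b d else 0)" by (intro sum.cong) auto
 also have "... = ?\<nu> b a" using assms fin by (subst sum.delta') auto
 finally show ?thesis .
qed

lemma moebius_sum_left:
 assumes "a : P" "b : P"
 shows "(SUM c : {c : P. leq a c}. moebius P leq c b) = (if a = b then 1 else 0)"
proof -
 interpret D: finite_poset P "%a b. leq b a" by (rule dual)
 have "(SUM c : {c : P. leq a c}. moebius P leq c b) = (SUM c : {c : P. leq a c}. moebius P (%a b. leq b a) b c)"
  using assms by (intro sum.cong) (auto simp: moebius_dual)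
 also have "... = (if a = b then 1 else 0)" using D.moebius_sum_right[OF assms(2,1)] by auto
 finally show ?thesis .
qed

text \<open>The image of phi is closed downwards, so intervals in Q are intervals of P, and the
  Moebius function depends on the interval only. It is applied to the subobjects of a
  subobject.\<close>

lemma moebius_embedding:
 assumes Q: "finite_poset Q leq'" and f: "phi ` Q <= P" "inj_on phi Q"
  "!!a b. a : Q ==> b : Q ==> leq' a b \<longleftrightarrow> leq (phi a) (phi b)"
  "!!a c. a : Q ==> c : P ==> leq c (phi a) ==> c : phi ` Q" "a : Q" "b : Q"
 shows "moebius Q leq' a b = moebius P leq (phi a) (phi b)"
proof -
 interpret Q: finite_poset Q leq' by fact
 define \<mu> where "\<mu> a b = (if a : Q & b : Q then moebius P leq (phi a) (phi b) else 0)" for a b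
 have "Q.is_mu \<mu>" unfolding Q.is_mu_def
 proof (intro conjI allI ballI impI)
  fix a b assume "~ (a : Q & b : Q & leq' a b)"
  then show "\<mu> a b = 0" using moebius_zero f(3) unfolding \<mu>_def by auto
 next
  fix a b assume ab: "a : Q" "b : Q" "leq' a b"
  have "(SUM c : {c : Q. leq' a c & leq' c b}. \<mu> a c) = (SUM c : {c : Q. leq' a c & leq' c b}. moebius P leq (phi a) (phi c))"
   unfolding \<mu>_def using ab by (intro sum.cong) auto
  also have "... = (SUM c : phi ` {c : Q. leq' a c & leq' c b}. moebius P leq (phi a) c)"
   using f(2) by (subst sum.reindex) (auto intro: inj_on_subset)
  also have "phi ` {c : Q. leq' a c & leq' c b} = {c : P. leq (phi a) c & leq c (phi b)}" using f(1,3,4) ab by (auto simp: image_iff) (metis imageE)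
  also have "(SUM c : {c : P. leq (phi a) c & leq c (phi b)}. moebius P leq (phi a) c) = (if phi a = phi b then 1 else 0)"
  proof -
   have "phi a : P" "phi b : P" "leq (phi a) (phi b)" using f ab by auto
   then show ?thesis using moebius_is_mu unfolding is_mu_def by blast
  qed
  finally show "(SUM c : {c : Q. leq' a c & leq' c b}. \<mu> a c) = (if a = b then 1 else 0)" using inj_on_eq_iff[OF f(2) ab(1,2)] by simp
 qed
 from Q.moebius_eqI[OF this] show ?thesis using f by (simp add: \<mu>_def)
qed

end

section \<open>Dual bases for the trace form\<close>

locale nondeg_category = deg_category C \<delta> for C :: "('o, 'm) category_data" (structure) and \<delta> :: "'m => 'k::field_char_0" +
 assumes nondeg: "nondegenerate C \<delta>"
begin

lemma Sub_poset: "obj x ==> finite_poset (Sub x) (le)" by (rule finite_poset.intro) (erule finite_Sub, erule sub_le_refl, erule (3) sub_le_antisym,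
  erule (4) sub_le_trans)

abbreviation mu :: "'o => 'm set => 'm set => int" where
 "mu x == moebius (Sub x) (le)"

lemma sub_le_sub_of:
 assumes m: "mono m" "cod m = x" and n: "mono n" "cod n = x"
 shows "le (sub m) (sub n) \<longleftrightarrow> fac m n"
proof -
 note rm = rep_sub_of[OF m(1)] and rn = rep_sub_of[OF n(1)]
 have "le (sub m) (sub n) \<longleftrightarrow> fac (rep (sub m)) (rep (sub n))" using sub_le_iff[of "sub m" x "sub n"] m n by simp
 also have "... \<longleftrightarrow> fac m n"
 proof
  assume a: "fac (rep (sub m)) (rep (sub n))"
  show "fac m n" using factors_trans[OF factors_trans[OF rm(3) a] rn(4)] rn(1) n by simp
 next
  assume a: "fac m n"
  show "fac (rep (sub m)) (rep (sub n))" using factors_trans[OF factors_trans[OF rm(4) a] rn(3)] rn(1) n by simp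
 qed
 finally show ?thesis .
qed

lemma sub_le_top:
 assumes "a : Sub w" "obj w" shows "le a (sub (ide w))" using sub_le_sub_of[of "rep a" w "ide w"] factors_ide[of "rep a" w] assms by simp

text \<open>The Moebius transform of \<open>num\<close>: the share of the dimension of u that its
  proper subobjects do not account for. It equals \<open>omega\<close> of the map from the domain of
  \<open>rep u\<close> to the terminal object.\<close>

definition weight :: "'o => 'm set => 'k" where
 "weight x u = (SUM y : {y : Sub x. le y u}. of_int (mu x y u) * num (dom (rep y)))"

lemma num_sub_of:
 assumes "mono m" shows "num (dom (rep (sub m))) = num (dom m)"
proof -
 obtain i where "iso i" "dom i = dom (rep (sub m))" "cod i = dom m" using rep_sub_of_iso[OF assms] by blast
 then show ?thesis using num_iso[of i] by simp
qed

text \<open>Composing with \<open>rep u\<close> identifies the subobjects of its domain with the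
  subobjects of x below u. So the weight is \<open>omega\<close> of a map to the terminal object,
  and non-degeneracy applies.\<close>

lemma weight_nonzero:
 assumes x: "obj x" and u: "u : Sub x" shows "weight x u ~= 0"
proof -
 interpret P: finite_poset "Sub x" "le" using x by (rule Sub_poset)
 let ?m = "rep u" let ?w = "dom ?m"
 have m: "mono ?m" "cod ?m = x" "sub ?m = u" "arr ?m" using u by auto
 have w: "obj ?w" using m by simp
 define phi where "phi y = sub (?m**rep y)" for y
 have phim: "mono (?m**rep y)" "cod (?m**rep y) = x" if "y : Sub ?w" for y using that m mono_comp[of "rep y" ?m] by auto
 have le: "le a b \<longleftrightarrow> le (phi a) (phi b)" if ab: "a : Sub ?w" "b : Sub ?w" for a b
 proof -
  have "le (phi a) (phi b) \<longleftrightarrow> fac (?m**rep a) (?m**rep b)" unfolding phi_def by (rule sub_le_sub_of) (use phim ab in auto)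
  also have "... \<longleftrightarrow> fac (rep a) (rep b)"
  proof
   assume "fac (?m**rep a) (?m**rep b)"
   then obtain h where h: "arr h" "dom h = dom (?m**rep a)" "cod h = dom (?m**rep b)"
    "(?m**rep b)**h = ?m**rep a" by (rule factorsE)
   have ar: "arr (rep a)" "arr (rep b)" "cod (rep a) = ?w" "cod (rep b) = ?w" using ab by auto
   have "rep b**h = rep a" by (rule monoD(2)[OF m(1)]) (use h m(4) ar in auto)
   then show "fac (rep a) (rep b)" using h ar m(4) by (intro factorsI[of h]) auto
  next
   assume "fac (rep a) (rep b)"
   then obtain h where h: "arr h" "dom h = dom (rep a)" "cod h = dom (rep b)"
    "rep b**h = rep a" by (rule factorsE)
   have ar: "arr (rep a)" "arr (rep b)" "cod (rep a) = ?w" "cod (rep b) = ?w" using ab by auto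
   show "fac (?m**rep a) (?m**rep b)" by (rule factorsI[of h]) (use h ar m(4) in auto)
  qed
  also have "... \<longleftrightarrow> le a b" using sub_le_iff[of a ?w b] ab by simp
  finally show ?thesis by simp
 qed
 have inj: "inj_on phi (Sub ?w)"
 proof (rule inj_onI)
  fix a b assume ab: "a : Sub ?w" "b : Sub ?w" "phi a = phi b"
  have "phi b : Sub x" using phim[OF ab(2)] by (simp add: phi_def)
  then have "le (phi b) (phi b)" by (rule sub_le_refl)
  then have "le a b" "le b a" using le[of a b] le[of b a] ab by simp_all
  then show "a = b" using sub_le_antisym[OF ab(1,2)] by blast
 qed
 have im: "phi ` Sub ?w <= Sub x" using phim by (auto simp: phi_def)
 let ?t = "sub (ide ?w)"
 have t: "?t : Sub ?w" using w by simp
 have phit: "phi ?t = u"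
 proof -
  obtain i where i: "iso i" "dom i = dom (rep ?t)" "cod i = dom (ide ?w)" "ide ?w**i = rep ?t" using rep_sub_of_iso[OF ide_mono[OF w]] by blast
  have "phi ?t = sub (?m**i)" using i w by (simp add: phi_def)
  also have "... = u" using sub_of_comp_iso[OF m(1) i(1)] i w m by simp
  finally show ?thesis .
 qed
 have down: "c : phi ` Sub ?w" if "c : Sub x" "le c u" for c
 proof -
  have "fac (rep c) ?m" using sub_le_iff[of c x u] that u by simp
  then obtain h where h: "arr h" "dom h = dom (rep c)" "cod h = ?w" "?m**h = rep c" by (rule factorsE)
  have hm: "mono h" using mono_cancel[of ?m h] h m that by simp
  obtain i where i: "iso i" "dom i = dom (rep (sub h))" "cod i = dom h" "h**i = rep (sub h)" using rep_sub_of_iso[OF hm] by blast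
  have "phi (sub h) = sub (?m**(h**i))" using i by (simp add: phi_def)
  also have "?m**(h**i) = rep c**i" using comp_reassoc1[OF h(4), of i] h i m by simp
  also have "sub (rep c**i) = c" using sub_of_comp_iso[of "rep c" i] i h that by simp
  finally show ?thesis using hm h by (intro image_eqI[of _ _ "sub h"]) auto
 qed
 have down': "c : phi ` Sub ?w" if "a : Sub ?w" "c : Sub x" "le c (phi a)" for a c
 proof -
  have "le (phi a) u" using le[OF that(1) t] phit sub_le_top[OF that(1) w] by simp
  moreover have "phi a : Sub x" using im that(1) by blast
  ultimately have "le c u" using sub_le_trans[OF that(2) _ u that(3)] by blast
  then show ?thesis using down[OF that(2)] by blast
 qed
 have mu_eq: "mu ?w y ?t = mu x (phi y) u" if "y : Sub ?w" for y using P.moebius_embedding[OF Sub_poset[OF w] im inj le down' that t] phit by simp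
 have numeq: "num (dom (rep (phi y))) = num (dom (rep y))" if "y : Sub ?w" for y
  unfolding phi_def using num_sub_of[OF phim(1)[OF that]] that m by simp
 have img: "phi ` Sub ?w = {y : Sub x. le y u}"
 proof (intro equalityI subsetI)
  fix y assume "y : phi ` Sub ?w"
  then obtain a where a: "a : Sub ?w" "y = phi a" by auto
  have "le y u" using le[OF a(1) t] phit sub_le_top[OF a(1) w] a(2) by simp
  moreover have "y : Sub x" using im a by blast
  ultimately show "y : {y : Sub x. le y u}" by simp
 qed (use down in auto)
 have "omega C \<delta> (bang ?w) = (SUM y : Sub ?w. of_int (mu ?w y ?t) * num (dom (rep y)))"
 proof -
  have b: "bang ?w**rep y = bang (dom (rep y))" if "y : Sub ?w" for y using bang_unique[of "bang ?w**rep y"] bang[OF w] that by simp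
  then have "{y : Sub (dom (bang ?w)). epi (bang ?w**rep y)} = Sub ?w" using bang[OF w] bang_surj by auto
  then show ?thesis unfolding omega_def using b bang[OF w] by (simp add: num_def)
 qed
 also have "... = (SUM y : Sub ?w. of_int (mu x (phi y) u) * num (dom (rep (phi y))))" using mu_eq numeq by (intro sum.cong) auto
 also have "... = (SUM y : phi ` Sub ?w. of_int (mu x y u) * num (dom (rep y)))" using inj by (simp add: sum.reindex)
 also have "... = weight x u" unfolding img weight_def ..
 finally have "weight x u = omega C \<delta> (bang ?w)" by simp
 then show ?thesis using nondeg bang_surj[OF w] unfolding nondegenerate_def by simp
qed

lemma num_eq_weight:
 assumes x: "obj x" and t: "t : Sub x"
 shows "num (dom (rep t)) = (SUM u : {u : Sub x. le u t}. weight x u)"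
proof -
 interpret P: finite_poset "Sub x" "le" using x by (rule Sub_poset)
 have "(SUM u : {u : Sub x. le u t}. weight x u) =
  (SUM u : {u : Sub x. le u t}. SUM y : Sub x. of_int (mu x y u) * num (dom (rep y)))" unfolding weight_def
  by (intro sum.cong sum.mono_neutral_left) (auto simp: x P.moebius_zero)
 also have "... = (SUM y : Sub x. (SUM u : {u : Sub x. le u t}. of_int (mu x y u)) * num (dom (rep y)))"
  by (subst sum.swap) (simp add: sum_distrib_right)
 also have "... = (SUM y : Sub x. (if y = t then 1 else 0) * num (dom (rep y)))"
 proof (rule sum.cong[OF refl])
  fix y assume y: "y : Sub x"
  have "(SUM u : {u : Sub x. le u t}. (of_int (mu x y u) :: 'k)) =
    of_int (SUM u : {u : Sub x. le u t}. mu x y u)" by simp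
  then show "(SUM u : {u : Sub x. le u t}. of_int (mu x y u)) * num (dom (rep y)) =
    (if y = t then 1 else 0) * num (dom (rep y))" using P.moebius_sum_right[OF y t] by simp
 qed
 also have "... = (SUM y : Sub x. if y = t then num (dom (rep y)) else 0)" by (intro sum.cong) auto
 also have "... = num (dom (rep t))" using t x by (subst sum.delta) auto
 finally show ?thesis by simp
qed

text \<open>The subobjects of an intersection are the common subobjects. For a product of two
  objects this writes the Gram matrix of the trace form as zeta^T D zeta with D the diagonal matrix
  of the weights, so that it is invertible.\<close>

lemma num_pullback_weight:
 assumes x: "obj x" and r: "r : Sub x" and s: "s : Sub x" and pb: "pb (rep r) (rep s) p q"
 shows "num (dom p) = (SUM u : {u : Sub x. le u r & le u s}. weight x u)"
proof -
 note d = pullbackD[OF pb]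
 have p: "mono p" using pullback_mono[OF pb] s by simp
 let ?m = "rep r**p"
 have m: "mono ?m" "cod ?m = x" using mono_comp[OF p, of "rep r"] r d(4-8) by auto
 let ?t = "sub ?m"
 have t: "?t : Sub x" using m by simp
 have ms: "?m = rep s**q" using d by simp
 have "le u ?t \<longleftrightarrow> le u r & le u s" if u: "u : Sub x" for u
 proof -
  have ua: "arr (rep u)" "cod (rep u) = x" using u by auto
  have "le u ?t \<longleftrightarrow> fac (rep u) ?m" using sub_le_sub_of[of "rep u" x ?m] u m by simp
  also have "... \<longleftrightarrow> fac (rep u) (rep r) & fac (rep u) (rep s)"
  proof
   assume a: "fac (rep u) ?m"
   have "fac ?m (rep r)" by (rule factorsI[of p]) (use d r in auto)
   moreover have "fac ?m (rep s)" by (rule factorsI[of q]) (use d s in auto)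
   ultimately show "fac (rep u) (rep r) & fac (rep u) (rep s)" using factors_trans[OF a] r s by auto
  next
   assume "fac (rep u) (rep r) & fac (rep u) (rep s)"
   then obtain h k where h: "arr h" "dom h = dom (rep u)" "cod h = dom (rep r)" "rep r**h = rep u"
    and k: "arr k" "dom k = dom (rep u)" "cod k = dom (rep s)" "rep s**k = rep u" by (metis factorsE)
   obtain l where l: "arr l" "dom l = dom h" "cod l = dom p" "p**l = h" "q**l = k" using pullback_lift[OF pb h(1) k(1)] h k by metis
   show "fac (rep u) ?m" by (rule factorsI[of l]) (use l h d(1-8) r in auto)
  qed
  also have "... \<longleftrightarrow> le u r & le u s" using sub_le_iff[OF u r] sub_le_iff[OF u s] by simp
  finally show ?thesis .
 qed
 then have "{u : Sub x. le u ?t} = {u : Sub x. le u r & le u s}" by auto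
 moreover have "num (dom p) = num (dom (rep ?t))" using num_sub_of[OF m(1)] d r by simp
 ultimately show ?thesis using num_eq_weight[OF x t] by simp
qed

lemma fsc_add_scalar: "fsc (a + b) f = fsc a f + fsc b f" by (simp add: fsc_def fun_eq_iff fun_apply ring_distribs)

lemma tr_cp_sum_left: "tr x (cp x z x (SUM y:A. g y) h) = (SUM y:A. tr x (cp x z x (g y) h))"
 by (induction A rule: infinite_finite_induct) (auto simp: cp_add_left tr_add)

lemma hom0_sum: "(!!a. a : A ==> f a : hom0 x y) ==> (SUM a:A. f a) : hom0 x y"
 by (induction A rule: infinite_finite_induct) (auto intro: hom0_add hom0_zero)

lemma basis_hom0: "r : Sub (prd x y) ==> basis_vec r : hom0 x y" by (auto simp: hom0_iff basis_vec_def)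

text \<open>With the Gram matrix in the form zeta^T D zeta, Moebius inversion of the standard basis
  gives \<open>E\<close>, and Moebius inversion of the transposed relations, divided by the weights,
  gives the dual basis \<open>E'\<close>.\<close>

lemma dual_bases:
 assumes o: "obj x" "obj z"
 obtains E E' :: "'m set => 'm set => 'k" where
  "!!u. u : Sub (prd x z) ==> E u : hom0 x z" "!!u. u : Sub (prd x z) ==> E' u : hom0 z x"
  "!!h. h : hom0 x z ==> h = (SUM u:Sub (prd x z). fsc (tr x (cp x z x (E' u) h)) (E u))"
proof -
 let ?W = "prd x z" let ?S = "Sub ?W"
 have W: "obj ?W" using o by simp
 interpret P: finite_poset ?S "le" using W by (rule Sub_poset)
 define E where "E u = (SUM y:?S. fsc (of_int (mu ?W y u)) (basis_vec y) :: 'm set => 'k)" for u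
 define T where "T y = vec (tup (leg2 C x z (rep y)) (leg1 C x z (rep y)))" for y
 define E' where "E' u = fsc (1 / weight ?W u) (SUM y:?S. fsc (of_int (mu ?W y u)) (T y))" for u
 have T: "T y : hom0 z x" if "y : ?S" for y unfolding T_def using legs[OF that o] by (intro vec_hom0) auto
 have G: "tr x (cp x z x (T y) (basis_vec r)) = (SUM u : {u : ?S. le u r & le u y}. weight ?W u)" if y: "y : ?S" and r: "r : ?S" for y r
 proof -
  obtain p q where pb: "pb (rep r) (rep y) p q" using pullback_exists[of "rep r" "rep y"] y r by auto
  have b: "basis_vec r = vec (tup (leg1 C x z (rep r)) (leg2 C x z (rep r)))" using vec_rep[OF r] legs[OF r o] by simp
  have "tr x (cp x z x (T y) (basis_vec r)) = num (dom p)" unfolding b T_def by (rule tr_comp) (use legs[OF r o] legs[OF y o] pb in auto)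
  then show ?thesis using num_pullback_weight[OF W r y pb] by simp
 qed
 have tE': "tr x (cp x z x (E' u) (basis_vec r)) = (if le u r then 1 else 0)" if u: "u : ?S" and r: "r : ?S" for u r
 proof -
  have "tr x (cp x z x (E' u) (basis_vec r)) = 1 / weight ?W u *
    (SUM y:?S. of_int (mu ?W y u) * tr x (cp x z x (T y) (basis_vec r)))" unfolding E'_def cp_fsc_left tr_fsc tr_cp_sum_left ..
  also have "(SUM y:?S. of_int (mu ?W y u) * tr x (cp x z x (T y) (basis_vec r)))
   = (SUM y:?S. SUM v:?S. if le v r & le v y then of_int (mu ?W y u) * weight ?W v else 0)"
   using G[OF _ r] W by (intro sum.cong) (auto simp: sum.inter_filter sum_distrib_left if_distrib cong: if_cong)
  also have "... = (SUM v:?S. SUM y:?S. if le v r & le v y then of_int (mu ?W y u) * weight ?W v else 0)" by (rule sum.swap)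
  also have "... = (SUM v:?S. if v = u then (if le v r then weight ?W v else 0) else 0)"
  proof (rule sum.cong[OF refl])
   fix v assume v: "v : ?S"
   have "(SUM y:?S. if le v r & le v y then of_int (mu ?W y u) * weight ?W v else 0)
    = (if le v r then (SUM y:{y : ?S. le v y}. of_int (mu ?W y u) * weight ?W v) else 0)" using W by (auto simp: sum.inter_filter)
   also have "(SUM y:{y : ?S. le v y}. of_int (mu ?W y u) * weight ?W v) =
     of_int (SUM y:{y : ?S. le v y}. mu ?W y u) * weight ?W v" by (simp add: sum_distrib_right)
   also have "(SUM y:{y : ?S. le v y}. mu ?W y u) = (if v = u then 1 else 0)" using P.moebius_sum_left[OF v u] .
   finally show "(SUM y:?S. if le v r & le v y then of_int (mu ?W y u) * weight ?W v else 0)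
    = (if v = u then (if le v r then weight ?W v else 0) else 0)" by auto
  qed
  also have "... = (if le u r then weight ?W u else 0)" using u W by simp
  finally show ?thesis using weight_nonzero[OF W u] by simp
 qed
 have bE: "basis_vec r = (SUM u:?S. fsc (if le u r then 1 else 0) (E u))" if r: "r : ?S" for r
 proof (rule ext)
  fix t
  have "(SUM u:?S. fsc (if le u r then 1 else 0) (E u)) t =
   (SUM u:?S. (if le u r then 1 else 0) * (SUM y:?S. of_int (mu ?W y u) * basis_vec y t))" by (simp only: sum_fun_eval fsc_apply E_def)
  also have "... = (SUM u:?S. SUM y:?S. (if le u r then of_int (mu ?W y u) else 0) * basis_vec y t)"
   unfolding sum_distrib_left by (rule sum.cong[OF refl], rule sum.cong[OF refl]) simp
  also have "... = (SUM y:?S. (SUM u:?S. (if le u r then of_int (mu ?W y u) else 0)) * basis_vec y t)"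
   by (subst sum.swap) (simp add: sum_distrib_right)
  also have "... = (SUM y:?S. (if y = r then 1 else 0) * basis_vec y t)"
  proof (rule sum.cong[OF refl])
   fix y assume y: "y : ?S"
   have "(SUM u:?S. (if le u r then of_int (mu ?W y u) else 0)) = (SUM u:{u : ?S. le u r}. of_int (mu ?W y u) :: 'k)"
    using W by (simp add: sum.inter_filter)
   also have "... = of_int (SUM u:{u : ?S. le u r}. mu ?W y u)" by simp
   also have "... = (if y = r then 1 else 0)" unfolding P.moebius_sum_right[OF y r] by simp
   finally show "(SUM u:?S. (if le u r then of_int (mu ?W y u) else 0)) * basis_vec y t = (if y = r then 1 else 0) * (basis_vec y t :: 'k)" by simp
  qed
  also have "... = (SUM y:?S. if y = r then basis_vec y t else 0)" by (intro sum.cong) auto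
  also have "... = basis_vec r t" using r W by (subst sum.delta) auto
  finally show "basis_vec r t = (SUM u:?S. fsc (if le u r then 1 else 0) (E u)) t" by simp
 qed
 show ?thesis
 proof (rule that[of E E'])
  show "E u : hom0 x z" for u unfolding E_def by (intro hom0_sum hom0_fsc basis_hom0)
  show "E' u : hom0 z x" for u unfolding E'_def by (intro hom0_sum hom0_fsc T)
  fix h assume "h : hom0 x z"
  then show "h = (SUM u:?S. fsc (tr x (cp x z x (E' u) h)) (E u))" using o
  proof (induction rule: hom0_induct)
   case (vec a b)
   then have "vec (tup a b) = basis_vec (sub (tup a b))" "sub (tup a b) : ?S" using vec_mono by auto
   then show ?case using bE tE' by (simp cong: sum.cong)
  next
   case (add f g)
   have "(SUM u:?S. fsc (tr x (cp x z x (E' u) (f + g))) (E u)) =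
    (SUM u:?S. fsc (tr x (cp x z x (E' u) f)) (E u)) + (SUM u:?S. fsc (tr x (cp x z x (E' u) g)) (E u))"
    by (simp add: cp_add_right tr_add fsc_add_scalar sum.distrib)
   then show ?case using add by metis
  next
   case (scale c f)
   have "(SUM u:?S. fsc (tr x (cp x z x (E' u) (fsc c f))) (E u)) =
    fsc c (SUM u:?S. fsc (tr x (cp x z x (E' u) f)) (E u))" by (simp add: cp_fsc_right tr_fsc fsc_sum)
   then show ?case using scale by metis
  qed simp
 qed
qed

end

section \<open>Subquotients\<close>

context fc_category
begin

lemma isomorphicI: "iso i ==> dom i = x ==> cod i = y ==> isom x y" by (auto simp: isomorphic_def)

lemma isomorphicE:
 assumes "isom x y" obtains i where "iso i" "dom i = x" "cod i = y" using assms by (auto simp: isomorphic_def)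

lemma iso_inverse:
 assumes "iso i"
 obtains j where "iso j" "dom j = cod i" "cod j = dom i"
  "j**i = ide (dom i)" "i**j = ide (cod i)"
proof -
 obtain j where j: "arr i" "arr j" "dom j = cod i" "cod j = dom i"
  "j**i = ide (dom i)" "i**j = ide (cod i)" using assms by (rule isoD)
 then have "iso j" by (intro isoI[of j i]) auto
 then show ?thesis using that j by blast
qed

lemma isomorphic_refl: "obj x ==> isom x x" by (rule isomorphicI[of "ide x"]) auto

lemma isomorphic_sym: "isom x y ==> isom y x" by (metis isomorphicE isomorphicI iso_inverse)

lemma isomorphic_trans: "isom x y ==> isom y z ==> isom x z"
proof (elim isomorphicE)
 fix i j assume "iso i" "dom i = x" "cod i = y" "iso j" "dom j = y" "cod j = z"
 then show ?thesis using iso_comp[of i j] by (intro isomorphicI[of "j**i"]) auto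
qed

end

section \<open>A size that drops on proper subobjects and proper quotients\<close>

context deg_category
begin

lemma sub_of_inject:
 assumes "mono m" "mono n" "sub m = sub n" "cod m = cod n"
 shows "fac m n" "fac n m" using sub_of_eq_iff[OF assms(1,2,4)] assms(3) by auto

text \<open>The measure for all inductions over subquotients. The square is taken because the
  diagonal, which decides whether a quotient map is monic, is a subobject of it.\<close>

definition csz :: "'o => nat" where
 "csz x = card (Sub (prd x x))"

lemma push_inj:
 assumes n: "mono n" shows "inj_on (%s. sub (n**rep s)) (Sub (dom n))"
proof (rule inj_onI)
 fix a b assume ab: "a : Sub (dom n)" "b : Sub (dom n)" "sub (n**rep a) = sub (n**rep b)"
 have F: "fac (rep a) (rep b)" if "fac (n**rep a) (n**rep b)"
  and a: "a : Sub (dom n)" and b: "b : Sub (dom n)" for a b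
 proof -
  obtain h where h: "arr h" "dom h = dom (n**rep a)" "cod h = dom (n**rep b)"
   "(n**rep b)**h = n**rep a" using \<open>fac (n**rep a) (n**rep b)\<close> by (rule factorsE)
  have ar: "arr (rep a)" "arr (rep b)" "cod (rep a) = dom n" "cod (rep b) = dom n" "arr n" using a b n by auto
  have "rep b**h = rep a" by (rule monoD(2)[OF n]) (use h ar in auto)
  then show ?thesis using h ar by (intro factorsI[of h]) auto
 qed
 have m: "mono (n**rep a)" "mono (n**rep b)" using mono_comp[of "rep a" n] mono_comp[of "rep b" n] n ab by auto
 have "fac (n**rep a) (n**rep b)" "fac (n**rep b) (n**rep a)" using sub_of_inject[OF m ab(3)] ab n by auto
 then have "fac (rep a) (rep b)" "fac (rep b) (rep a)" using F ab by auto
 then show "a = b" using sub_of_eq_iff[of "rep a" "rep b"] ab by simp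
qed

lemma push_Sub: "mono n ==> (%s. sub (n**rep s)) ` Sub (dom n) <= Sub (cod n)"
proof (rule image_subsetI)
 fix s assume "mono n" "s : Sub (dom n)"
 then show "sub (n**rep s) : Sub (cod n)" using mono_comp[of "rep s" n] by (intro sub_of_Sub) auto
qed

lemma csz_mono:
 assumes m: "mono m"
 shows "csz (dom m) <= csz (cod m)" and "csz (dom m) = csz (cod m) ==> iso m"
proof -
 let ?n = "prodm m m" let ?phi = "%s. sub (?n**rep s)"
 let ?x = "cod m"
 have ma: "arr m" using m by simp
 have n: "mono ?n" "dom ?n = prd (dom m) (dom m)" "cod ?n = prd ?x ?x" using prodm_mono[OF m m] ma by auto
 have x: "obj ?x" "obj (prd ?x ?x)" using ma by auto
 note inj = push_inj[OF n(1), unfolded n(2)] and im = push_Sub[OF n(1), unfolded n(2,3)]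
 show "csz (dom m) <= csz ?x" unfolding csz_def using card_inj_on_le[OF inj im] x by simp
 \<comment> \<open>Equality makes the largest subobject of the square of x come from the square of
   the domain of m. The resulting section of \<open>prodm m m\<close>, restricted to the diagonal,
   splits m.\<close>
 assume "csz (dom m) = csz ?x"
 then have "?phi ` Sub (prd (dom m) (dom m)) = Sub (prd ?x ?x)" using card_image[OF inj] im x by (intro card_subset_eq) (auto simp: csz_def)
 moreover have "sub (ide (prd ?x ?x)) : Sub (prd ?x ?x)" using x by simp
 ultimately have "sub (ide (prd ?x ?x)) : ?phi ` Sub (prd (dom m) (dom m))" by simp
 then obtain s where s: "s : Sub (prd (dom m) (dom m))" "sub (ide (prd ?x ?x)) = ?phi s" by blast
 have ns: "mono (?n**rep s)" using mono_comp[of "rep s" ?n] n s by auto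
 have sa: "arr (rep s)" "cod (rep s) = prd (dom m) (dom m)" using s by auto
 have "fac (ide (prd ?x ?x)) (?n**rep s)" using sub_of_inject(1)[OF ide_mono[OF x(2)] ns s(2)] n sa x ma by auto
 then obtain h where h: "arr h" "dom h = dom (ide (prd ?x ?x))" "cod h = dom (?n**rep s)"
  "(?n**rep s)**h = ide (prd ?x ?x)" by (rule factorsE)
 have hh: "dom h = prd ?x ?x" "cod h = dom (rep s)" using h x n sa ma by auto
 let ?k = "rep s**h" let ?d = "tup (ide ?x) (ide ?x)"
 have k: "arr ?k" "dom ?k = prd ?x ?x" "cod ?k = prd (dom m) (dom m)" "?n**?k = ide (prd ?x ?x)" using h(1,4) hh sa n ma by auto
 have "m**(pr1 (dom m) (dom m)**?k) = pr1 ?x ?x**(?n**?k)" using k(1-3) ma by (simp add: prodm_def)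
 also have "... = pr1 ?x ?x" using k x by simp
 finally have e: "m**(pr1 (dom m) (dom m)**?k) = pr1 ?x ?x" .
 have "m**((pr1 (dom m) (dom m)**?k)**?d) = pr1 ?x ?x**?d" by (rule comp_reassoc1[OF e]) (use k ma x in auto)
 also have "... = ide ?x" using x by simp
 finally have e2: "m**((pr1 (dom m) (dom m)**?k)**?d) = ide ?x" .
 show "iso m" by (rule mono_split_iso[OF m _ _ _ e2]) (use k(1-3) ma x hh h sa in auto)
qed

text \<open>A subobject is recovered from its pullback along a surjection, because the pulled back
  surjection covers it.\<close>

lemma pull_inj:
 assumes e: "epi e" and p: "pb e (rep s) p q" and p': "pb e (rep s') p' q'"
  and s: "s : Sub (cod e)" "s' : Sub (cod e)" and eq: "sub p = sub p'"
 shows "s = s'"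
proof -
 have F: "fac (rep s) (rep s')" if p: "pb e (rep s) p q" and p': "pb e (rep s') p' q'"
  and s: "s : Sub (cod e)" "s' : Sub (cod e)" and f: "fac p p'" for s s' p q p' q'
 proof -
  note d = pullbackD[OF p] and d' = pullbackD[OF p']
  obtain h where h: "arr h" "dom h = dom p" "cod h = dom p'" "p'**h = p" using f by (rule factorsE)
  have "rep s**q = e**(p'**h)" using d h by simp
  also have "... = rep s'**(q'**h)" by (rule comp_reassoc) (use d' h d in auto)
  finally have "fac (rep s**q) (rep s')" using d d' h by (intro factorsI[of "q'**h"]) auto
  then show ?thesis by (rule surj_factor_cover[OF surj_pullback[OF p e] rep_Sub(1)[OF s(2)], rotated 2]) (use d(2,8) in auto)
 qed
 have m: "mono p" "mono p'" using pullback_mono[OF p] pullback_mono[OF p'] s by auto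
 have "fac p p'" "fac p' p" using sub_of_inject[OF m eq] pullbackD[OF p] pullbackD[OF p'] by auto
 then have "fac (rep s) (rep s')" "fac (rep s') (rep s)" using F[OF p p' s] F[OF p' p s(2,1)] by auto
 then show ?thesis using sub_of_eq_iff[of "rep s" "rep s'"] s by simp
qed

lemma csz_surj:
 assumes e: "epi e"
 shows "csz (cod e) <= csz (dom e)" and "csz (cod e) = csz (dom e) ==> iso e"
proof -
 let ?E = "prodm e e" let ?x = "dom e" let ?z = "cod e"
 have ea: "arr e" using e by simp
 have E: "epi ?E" "dom ?E = prd ?x ?x" "cod ?E = prd ?z ?z" "arr ?E" using prodm_surj[OF e e] ea by auto
 have x: "obj ?x" "obj (prd ?x ?x)" "obj (prd ?z ?z)" using ea by auto
 have "EX p q. pb ?E (rep s) p q" if "s : Sub (prd ?z ?z)" for s using that E by (intro pullback_exists) auto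
 then obtain P Q where PQ: "!!s. s : Sub (prd ?z ?z) ==> pb ?E (rep s) (P s) (Q s)" by metis
 let ?phi = "%s. sub (P s)"
 have inj: "inj_on ?phi (Sub (prd ?z ?z))" using pull_inj[OF E(1) PQ PQ] E by (intro inj_onI) auto
 have Pm: "mono (P s)" "cod (P s) = prd ?x ?x" if "s : Sub (prd ?z ?z)" for s
  using pullback_mono[OF PQ[OF that]] that pullbackD[OF PQ[OF that]] E by auto
 have im: "?phi ` Sub (prd ?z ?z) <= Sub (prd ?x ?x)" using Pm by auto
 show "csz ?z <= csz ?x" unfolding csz_def using card_inj_on_le[OF inj im] x by simp
 \<comment> \<open>Equality makes the diagonal of x a pullback along \<open>prodm e e\<close>. Such
   a pullback is saturated for e in both coordinates, so the diagonal contains the kernel pair of e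
   and e is monic.\<close>
 assume "csz ?z = csz ?x"
 then have sur: "?phi ` Sub (prd ?z ?z) = Sub (prd ?x ?x)" using card_image[OF inj] im x by (intro card_subset_eq) (auto simp: csz_def)
 let ?d = "tup (ide ?x) (ide ?x)"
 have dm: "mono ?d" "cod ?d = prd ?x ?x" using graph_mono[of "ide ?x"] x by auto
 then have "sub ?d : ?phi ` Sub (prd ?z ?z)" using sur by simp
 then obtain s where s: "s : Sub (prd ?z ?z)" "sub ?d = ?phi s" by blast
 note pb = PQ[OF s(1)] and pm = Pm[OF s(1)]
 note D = pullbackD[OF pb]
 have fac: "fac ?d (P s)" "fac (P s) ?d" using sub_of_inject[OF dm(1) pm(1) s(2)] pm dm by auto
 have "mono e"
 proof (rule monoI)
  fix f g assume fg: "arr f" "arr g" "dom f = dom g" "cod f = ?x" "cod g = ?x" "e**f = e**g"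
  have "fac (?d**f) (P s)" using factors_comp[OF fac(1), of f] fg x pm by simp
  then obtain h where h: "arr h" "dom h = dom (?d**f)" "cod h = dom (P s)" "P s**h = ?d**f" by (rule factorsE)
  have df: "dom (?d**f) = dom f" using fg x by simp
  have "?E**tup f g = ?E**(?d**f)" using fg ea x by (simp add: prodm_tuple)
  also have "... = ?E**(P s**h)" using h by simp
  also have "... = rep s**(Q s**h)" by (rule comp_reassoc) (use D h in auto)
  finally obtain k where k: "arr k" "dom k = dom (tup f g)" "cod k = dom (P s)" "P s**k = tup f g"
   using pullback_lift[OF pb, of "tup f g" "Q s**h"] fg h(1-3) df D E by auto
  have "fac (P s**k) ?d" using factors_comp[OF fac(2), of k] k(1-3) pm dm by simp
  then obtain l where l: "arr l" "dom l = dom (P s**k)" "cod l = dom ?d" "?d**l = P s**k" by (rule factorsE)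
  have l': "cod l = ?x" "dom l = dom f" using l(2,3) k x fg by auto
  have "tup l l = tup f g" using l(1,4) l' k(4) x by simp
  then have "l = f & l = g" by (subst (asm) tuple_eq_iff; use l(1) l' fg in auto)
  then show "f = g" by metis
 qed (rule ea)
 then show "iso e" using surj_and_mono_iso e by blast
qed

section \<open>Subquotients: size, transitivity, and finiteness up to isomorphism\<close>

lemma subquotientI:
 "mono m ==> epi e ==> dom e = dom m ==> cod m = x ==> cod e = z ==> subq z x" by (auto simp: subquotient_def)

lemma subquotientE:
 assumes "subq z x"
 obtains m e where "mono m" "epi e" "dom e = dom m" "cod m = x" "cod e = z" using assms by (auto simp: subquotient_def)

lemma subquotient_obj:
 assumes "subq z x" shows "obj z" "obj x" using assms by (auto elim!: subquotientE)

lemma subquotient_csz: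
 assumes "mono m" "epi e" "dom e = dom m"
 shows "csz (cod e) <= csz (cod m)" "csz (cod e) = csz (cod m) ==> iso m"
  "csz (cod e) = csz (cod m) ==> iso e" using csz_mono[OF assms(1)] csz_surj[OF assms(2)] assms(3) by auto

lemma isomorphic_csz:
 assumes "isom x y" shows "csz x = csz y"
proof -
 obtain i where i: "iso i" "dom i = x" "cod i = y" using assms by (rule isomorphicE)
 then show ?thesis using csz_mono(1)[OF iso_mono[OF i(1)]] csz_surj(1)[OF iso_surj[OF i(1)]] by simp
qed

lemma proper_subquotient_csz:
 assumes "proper_subquotient C z x" shows "csz z < csz x"
proof -
 have s: "subq z x" and n: "~ isom z x" using assms by (auto simp: proper_subquotient_def)
 obtain m e where me: "mono m" "epi e" "dom e = dom m" "cod m = x" "cod e = z" using s by (rule subquotientE)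
 note c = subquotient_csz[OF me(1-3)]
 have "csz z ~= csz x"
 proof
  assume "csz z = csz x"
  then have i: "iso m" "iso e" using c me by auto
  have "isom z x" using isomorphic_trans[OF isomorphic_sym[OF isomorphicI[OF i(2)]] isomorphicI[OF i(1)]] me by simp
  with n show False by simp
 qed
 then show ?thesis using c(1) me by simp
qed

lemma csz_proper: "subq z x ==> csz z ~= csz x ==> proper_subquotient C z x" using isomorphic_csz by (auto simp: proper_subquotient_def)

lemma isomorphic_subquotient: "isom z x ==> subq z x"
proof -
 assume "isom z x"
 then obtain i where i: "iso i" "dom i = x" "cod i = z" using isomorphicE isomorphic_sym by metis
 then have "obj x" by auto
 then show ?thesis using i iso_surj by (intro subquotientI[of "ide x" i]) auto
qed

lemma subquotient_refl: "obj x ==> subq x x" using isomorphic_subquotient isomorphic_refl by blast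

text \<open>The subobject of z is pulled back along the quotient map onto z.\<close>

lemma subquotient_trans:
 assumes "subq v z" "subq z x" shows "subq v x"
proof -
 obtain n f where nf: "mono n" "epi f" "dom f = dom n" "cod n = z" "cod f = v" using assms(1) by (rule subquotientE)
 obtain m e where me: "mono m" "epi e" "dom e = dom m" "cod m = x" "cod e = z" using assms(2) by (rule subquotientE)
 obtain p q where pb: "pb e n p q" using pullback_exists[of e n] nf me by auto
 note d = pullbackD[OF pb]
 have "mono p" "epi q" using pullback_mono[OF pb nf(1)] surj_pullback[OF pb me(2)] by auto
 then show ?thesis using nf me d mono_comp[of p m] surj_comp[of f q] by (intro subquotientI[of "m**p" "f**q"]) auto
qed

text \<open>The kernel pair, seen inside the square of x, knows the subobject through its diagonal
  and the quotient as a coequalizer. An inclusion of kernel pairs therefore induces a map j of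
  subobjects and a map h of quotients.\<close>

lemma kernel_pair_determines:
 assumes me: "mono m" "epi e" "dom e = dom m" "cod m = x" and pb: "pb e e p q"
  and me': "mono m'" "epi e'" "dom e' = dom m'" "cod m' = x" and pb': "pb e' e' p' q'"
  and fac: "fac (tup (m**p) (m**q)) (tup (m'**p') (m'**q'))"
 obtains j h where "arr j" "dom j = dom m" "cod j = dom m'" "m'**j = m"
  "arr h" "dom h = cod e" "cod h = cod e'" "h**e = e'**j"
proof -
 note d = pullbackD[OF pb] and d' = pullbackD[OF pb']
 have ma: "arr m" "arr m'" using me me' by auto
 obtain i where i: "arr i" "dom i = dom (tup (m**p) (m**q))"
  "cod i = dom (tup (m'**p') (m'**q'))" "tup (m'**p') (m'**q')**i = tup (m**p) (m**q)" using fac by (rule factorsE)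
 have di: "dom i = dom p" "cod i = dom p'" using i(2,3) d d' ma me me' by auto
 have "tup (m'**(p'**i)) (m'**(q'**i)) = tup (m**p) (m**q)" using i(1,4) di d d' ma me me' by simp
 then have e: "m'**(p'**i) = m**p & m'**(q'**i) = m**q" by (subst (asm) tuple_eq_iff; use i(1) di d d' ma me me' in auto)
 obtain k where k: "arr k" "dom k = dom e" "cod k = dom p" "p**k = ide (dom e)" using pullback_lift[OF pb, of "ide (dom e)" "ide (dom e)"] d by auto
 have "m = m**(p**k)" using k me ma by simp
 also have "... = m'**((p'**i)**k)" using comp_reassoc1[OF conjunct1[OF e, symmetric], of k] k(1-3) i(1) di d(4-8) d'(4-8) ma me me' by simp
 finally have mj: "m = m'**((p'**i)**k)" .
 let ?j = "(p'**i)**k"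
 have j: "arr ?j" "dom ?j = dom m" "cod ?j = dom m'" using k i(1) di d d' ma me me' by auto
 have jp: "?j**p = p'**i"
 proof (rule monoD(2)[OF me'(1)])
  have "m'**(?j**p) = m**p" using comp_reassoc1[OF mj[symmetric], of p] j d me ma by simp
  then show "m'**(?j**p) = m'**(p'**i)" using e by simp
 qed (use j d d' me me' i(1) di k in auto)
 have jq: "?j**q = q'**i"
 proof (rule monoD(2)[OF me'(1)])
  have "m'**(?j**q) = m**q" using comp_reassoc1[OF mj[symmetric], of q] j d me ma by simp
  then show "m'**(?j**q) = m'**(q'**i)" using e by simp
 qed (use j d d' me me' i(1) di k in auto)
 have ea: "arr e" "arr e'" using d d' by auto
 have "(e'**?j)**p = e'**(?j**p)" by (rule comp_assoc) (use j d d' me me' in auto)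
 also have "... = e'**(p'**i)" using jp by simp
 also have "... = e'**(q'**i)" by (rule comp_reassoc) (use i(1) di d d' in auto)
 also have "... = e'**(?j**q)" using jq by simp
 also have "... = (e'**?j)**q" by (rule comp_assoc[symmetric]) (use j d d' me me' in auto)
 finally have eq: "(e'**?j)**p = (e'**?j)**q" .
 have J: "arr (e'**?j)" "dom (e'**?j) = dom e" "cod (e'**?j) = cod e'" using j ea me me' by (simp_all only: comp_arr)
 obtain h where h: "arr h" "dom h = cod e" "cod h = cod (e'**?j)" "h**e = e'**?j" by (rule surj_coequalizer[OF me(2) pb J(1,2) eq])
 show ?thesis by (rule that[OF j mj[symmetric] h(1,2) _ h(4)]) (use h(3) J(3) in simp)
qed

lemma kernel_pair_mono:
 assumes "mono m" "dom e = dom m" "pb e e p q"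
 shows "mono (tup (m**p) (m**q))"
proof (rule monoI)
 note d = pullbackD[OF assms(3)]
 have ma: "arr m" using assms by simp
 fix f g assume fg: "arr f" "arr g" "dom f = dom g" "cod f = dom (tup (m**p) (m**q))"
  "cod g = dom (tup (m**p) (m**q))" "tup (m**p) (m**q)**f = tup (m**p) (m**q)**g"
 have c: "cod f = dom p" "cod g = dom p" using fg d assms by auto
 have "tup (m**(p**f)) (m**(q**f)) = tup (m**(p**g)) (m**(q**g))" using fg(6) fg(1-3) c d assms ma by simp
 then have "m**(p**f) = m**(p**g) & m**(q**f) = m**(q**g)" by (subst (asm) tuple_eq_iff; use fg(1-3) c d assms ma in auto)
 then have "p**f = p**g" "q**f = q**g" using monoD(2)[OF assms(1), of "p**f" "p**g"] monoD(2)[OF assms(1), of "q**f" "q**g"]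
   fg(1-3) c d assms by auto
 then show "f = g" using pullback_eqI[OF assms(3)] fg c by blast
qed (use pullbackD[OF assms(3)] assms in auto)

text \<open>The code is the kernel pair inside the square of x. As that square has finitely many
  subobjects, there are finitely many subquotients up to isomorphism, which makes the direct sum in
  the theorem finite.\<close>

lemma subquotient_code:
 assumes x: "obj x"
 obtains \<kappa> where "!!z. subq z x ==> \<kappa> z : Sub (prd x x)"
  "!!z z'. subq z x ==> subq z' x ==> \<kappa> z = \<kappa> z' ==> isom z z'"
proof -
 have "EX m e p q. mono m & epi e & dom e = dom m & cod m = x & cod e = z & pb e e p q" if z: "subq z x" for z
  using z pullback_exists by (elim subquotientE) (metis surj_arr)
 then obtain M E P Q where A: "!!z. subq z x ==> mono (M z) & epi (E z) &
   dom (E z) = dom (M z) & cod (M z) = x & cod (E z) = z & pb (E z) (E z) (P z) (Q z)" by metis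
 define t where "t z = tup (M z**P z) (M z**Q z)" for z
 have t: "mono (t z)" "cod (t z) = prd x x" if "subq z x" for z
 proof -
  have a: "mono (M z)" "dom (E z) = dom (M z)" "cod (M z) = x" "pb (E z) (E z) (P z) (Q z)" using A[OF that] by auto
  show "mono (t z)" unfolding t_def by (rule kernel_pair_mono) (use a in auto)
  show "cod (t z) = prd x x" unfolding t_def using pullbackD[OF a(4)] a by simp
 qed
 show ?thesis
 proof (rule that[of "%z. sub (t z)"])
  show "sub (t z) : Sub (prd x x)" if "subq z x" for z using t[OF that] by simp
  fix z z' assume z: "subq z x" and z': "subq z' x" and eq: "sub (t z) = sub (t z')"
  have f: "fac (t z) (t z')" "fac (t z') (t z)" using sub_of_inject[OF t(1)[OF z] t(1)[OF z'] eq] t(2)[OF z] t(2)[OF z'] by auto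
  note a = A[OF z] and a' = A[OF z']
  obtain j h where j: "arr j" "dom j = dom (M z)" "cod j = dom (M z')" "M z'**j = M z"
    "arr h" "dom h = cod (E z)" "cod h = cod (E z')" "h**E z = E z'**j"
   using kernel_pair_determines[of "M z" "E z" x "P z" "Q z" "M z'" "E z'" "P z'" "Q z'"] a a' f(1)[unfolded t_def] by metis
  obtain j' h' where j': "arr j'" "dom j' = dom (M z')" "cod j' = dom (M z)" "M z**j' = M z'"
    "arr h'" "dom h' = cod (E z')" "cod h' = cod (E z)" "h'**E z' = E z**j'"
   using kernel_pair_determines[of "M z'" "E z'" x "P z'" "Q z'" "M z" "E z" "P z" "Q z"] a a' f(2)[unfolded t_def] by metis
  have zo: "obj z" "obj z'" using z z' subquotient_obj by auto
  have ar: "arr (M z)" "arr (M z')" "arr (E z)" "arr (E z')" using a a' by auto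
  have MM: "M z**(j'**j) = M z**ide (dom (M z))" "M z'**(j**j') = M z'**ide (dom (M z'))"
   using comp_reassoc1[OF j'(4), of j] comp_reassoc1[OF j(4), of j'] j j' ar by simp_all
  have jj: "j'**j = ide (dom (M z))" "j**j' = ide (dom (M z'))"
   using monoD(2)[of "M z", OF _ _ _ _ _ _ MM(1)] monoD(2)[of "M z'", OF _ _ _ _ _ _ MM(2)] a a' j j' ar by auto
  have "(h'**h)**E z = h'**(E z'**j)" using j j' ar by simp
  also have "... = (E z**j')**j" by (rule comp_reassoc1[OF j'(8)]) (use j j' ar a a' in auto)
  also have "... = ide z**E z" using jj j j' ar a a' by simp
  finally have hh1: "h'**h = ide z" using a j j' ar zo by - (rule surj_epi[of "E z"]; simp)
  have "(h**h')**E z' = h**(E z**j')" using j j' ar by simp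
  also have "... = (E z'**j)**j'" by (rule comp_reassoc1[OF j(8)]) (use j j' ar a a' in auto)
  also have "... = ide z'**E z'" using jj j j' ar a a' by simp
  finally have hh2: "h**h' = ide z'" using a' j j' ar zo by - (rule surj_epi[of "E z'"]; simp)
  have "iso h" using j(5-7) j'(5-7) a a' hh1 hh2 by (intro isoI[of h h']) auto
  then show "isom z z'" using j a a' by (intro isomorphicI[of h]) auto
 qed
qed

lemma subquotient_representatives_finite:
 assumes "obj x" "subquotient_representatives C x R" shows "finite R"
proof -
 obtain \<kappa> where k: "!!z. subq z x ==> \<kappa> z : Sub (prd x x)"
  "!!z z'. subq z x ==> subq z' x ==> \<kappa> z = \<kappa> z' ==> isom z z'" using subquotient_code[OF assms(1)] by blast
 have R: "!!z. z : R ==> subq z x" "!!z. subq z x ==> EX! w. w : R & isom z w" using assms(2) by (auto simp: subquotient_representatives_def)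
 have "inj_on \<kappa> R"
 proof (rule inj_onI)
  fix z z' assume z: "z : R" "z' : R" "\<kappa> z = \<kappa> z'"
  then have "isom z z'" "isom z z" using k R isomorphic_refl subquotient_obj by auto
  then show "z = z'" using R z by blast
 qed
 moreover have "\<kappa> ` R <= Sub (prd x x)" using k R by auto
 ultimately show ?thesis using assms(1) inj_on_finite finite_Sub prd_obj by metis
qed

lemma subquotient_representatives_exists: "EX R. subquotient_representatives C x R"
proof -
 define cl where "cl z = (SOME w. subq w x & isom z w)" for z
 have cl: "subq (cl z) x" "isom z (cl z)" if "subq z x" for z
 proof -
  have "subq z x & isom z z" using that isomorphic_refl subquotient_obj by auto
  from someI[of "%w. subq w x & isom z w", OF this]
  show "subq (cl z) x" "isom z (cl z)" by (auto simp: cl_def)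
 qed
 have eq: "cl z = cl z'" if "isom z z'" for z z'
 proof -
  have "isom z w \<longleftrightarrow> isom z' w" for w using that isomorphic_trans isomorphic_sym by blast
  then show ?thesis by (simp add: cl_def)
 qed
 have "subquotient_representatives C x (cl ` {z. subq z x})" unfolding subquotient_representatives_def
 proof (intro conjI ballI allI impI)
  fix z assume z: "subq z x"
  show "EX! w. w : cl ` {z. subq z x} & isom z w"
  proof (rule ex1I[of _ "cl z"])
   fix w assume "w : cl ` {z. subq z x} & isom z w"
   then obtain v where v: "subq v x" "w = cl v" "isom z w" by auto
   then have "isom z v" using cl isomorphic_trans isomorphic_sym by blast
   then show "w = cl z" using eq v by simp
  qed (use cl z in auto)
 qed (use cl in auto)
 then show ?thesis ..
qed

end

section \<open>Goursat's lemma\<close>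

lemma (in fc_category) pullback_ex:
 assumes "pb f g p q" "arr u" "arr v" "dom u = dom v" "cod u = dom f"
  "cod v = dom g" "f**u = g**v"
 shows "EX h. arr h & dom h = dom u & cod h = dom p & p**h = u & q**h = v" using pullback_lift[OF assms] by metis

locale mal_category = nondeg_category C \<delta> for C :: "('o, 'm) category_data" (structure) and \<delta> :: "'m => 'k::field_char_0" +
 assumes exact: "exact C" and malcev: "malcev C"
begin

text \<open>Malcev categories have difunctional relations: apply symmetry to the reflexive relation
 \<open>(g, h) \<mapsto> (a g, b h) \<in> r\<close> on the relation \<open>r = (a, b)\<close> itself.\<close>

lemma difunctional:
 assumes m: "mono (tup a b)" and ab: "arr a" "arr b" "dom a = dom b"
  and ijk: "arr i" "arr j" "arr k" "dom i = dom k" "dom j = dom k"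
   "cod i = dom a" "cod j = dom a" "cod k = dom a"
  and eq: "b**i = b**j" "a**j = a**k"
 shows "fac (tup (a**i) (b**k)) (tup a b)"
proof -
 let ?w = "dom a"
 have w: "obj ?w" using ab by simp
 let ?E = "prodm a b" let ?t = "tup a b" let ?d = "tup (ide ?w) (ide ?w)"
 obtain s t where pb: "pb ?E ?t s t" using pullback_exists[of ?E ?t] ab by auto
 note D = pullbackD[OF pb]
 have s: "mono s" "cod s = prd ?w ?w" using pullback_mono[OF pb m] D ab by auto
 have "?E**?d = ?t**ide ?w" using ab w by (simp add: prodm_tuple)
 then obtain h where h: "arr h" "dom h = ?w" "cod h = dom s" "s**h = ?d" using pullback_ex[OF pb, of ?d "ide ?w"] ab w by auto
 have rel: "is_relation C ?w s" using s w by (simp add: is_relation_def)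
 have "fac ?d s" by (rule factorsI[of h]) (use h w in auto)
 then have "reflexive_rel C ?w s" using rel by (simp add: reflexive_rel_def)
 then have "symmetric_rel C ?w s" using malcev by (simp add: malcev_def equivalence_rel_def)
 then have sym: "fac (tup (leg2 C ?w ?w s) (leg1 C ?w ?w s)) s" by (simp add: symmetric_rel_def)
 have dj: "cod i = dom b" "cod j = dom b" "cod k = dom b" using ijk ab by auto
 \<comment> \<open>The pair (k, i) is related, with j as witness; symmetry relates (i, k), and this
   is the claim.\<close>
 have "?E**tup k i = ?t**j" using ab ijk dj eq by (simp add: prodm_tuple)
 then obtain l where l: "arr l" "dom l = dom k" "cod l = dom s" "s**l = tup k i" using pullback_ex[OF pb, of "tup k i" j] ab ijk dj by auto
 have "pr1 ?w ?w**(s**l) = k" "pr2 ?w ?w**(s**l) = i" using l ijk by auto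
 then have "leg1 C ?w ?w s**l = k" "leg2 C ?w ?w s**l = i" using l(1-3) s w by (auto simp: leg1_def leg2_def)
 then have "tup (leg2 C ?w ?w s) (leg1 C ?w ?w s)**l = tup i k" using l s w by (auto simp: leg1_def leg2_def)
 then have "fac (tup i k) s" using factors_comp[OF sym, of l] l s w by (auto simp: leg1_def leg2_def)
 then obtain n where n: "arr n" "dom n = dom (tup i k)" "cod n = dom s" "s**n = tup i k" by (rule factorsE)
 have "tup (a**i) (b**k) = ?E**(s**n)" using n ab ijk dj by (simp add: prodm_tuple)
 also have "... = ?t**(t**n)" by (rule comp_reassoc) (use D n ab in auto)
 finally show ?thesis by (intro factorsI[of "t**n"]) (use D n ab ijk in auto)
qed

text \<open>Goursat's lemma for surjective legs. Let \<open>rho\<close> be the image in the square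
  of \<open>cod a\<close> of the kernel pair of b. It is reflexive because a is surjective, hence an
  equivalence relation by the Mal'cev property, hence the kernel pair of some e by exactness; f
  exists because e after a takes equal values on the two projections of the kernel pair of
  b.\<close>

lemma goursat_surj:
 assumes m: "mono (tup a b)" and ab: "epi a" "epi b" "dom a = dom b"
 obtains e f where "epi e" "epi f" "dom e = cod a" "dom f = cod b" "pb e f a b"
proof -
 let ?x = "cod a" let ?y = "cod b" let ?w = "dom a"
 have ar: "arr a" "arr b" using ab by auto
 have x: "obj ?x" "obj ?w" using ar by auto
 obtain k1 k2 where K: "pb b b k1 k2" using pullback_exists[of b b] ar by auto
 note k = pullbackD[OF K]
 obtain rho \<kappa> where R: "mono rho" "epi \<kappa>" "dom \<kappa> = dom (tup (a**k1) (a**k2))" "cod \<kappa> = dom rho"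
   "cod rho = cod (tup (a**k1) (a**k2))" "rho**\<kappa> = tup (a**k1) (a**k2)" using image_obtain[of "tup (a**k1) (a**k2)"] k ar ab by auto
 have dk: "dom \<kappa> = dom k1" "cod rho = prd ?x ?x" using R k ar ab by auto
 have ra: "rho : Arr C" "\<kappa> : Arr C" using R by auto
 let ?d = "tup (ide ?x) (ide ?x)"
 let ?l1 = "leg1 C ?x ?x rho" and ?l2 = "leg2 C ?x ?x rho"
 have la: "arr ?l1" "arr ?l2" "dom ?l1 = dom rho" "dom ?l2 = dom rho" "cod ?l1 = ?x" "cod ?l2 = ?x"
  "tup ?l1 ?l2 = rho" using ra dk x tuple_eta[of rho ?x ?x] by (auto simp: leg1_def leg2_def)
 have lk: "?l1**\<kappa> = a**k1" "?l2**\<kappa> = a**k2"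
 proof -
  have "pr1 ?x ?x**(rho**\<kappa>) = a**k1" "pr2 ?x ?x**(rho**\<kappa>) = a**k2" unfolding R(6) using k ar ab by simp_all
  then show "?l1**\<kappa> = a**k1" "?l2**\<kappa> = a**k2" using ra R(4) dk x by (simp_all add: leg1_def leg2_def)
 qed
 have "fac ?d rho"
 proof (rule surj_factor_cover[OF ab(1) R(1)])
  obtain d where d: "arr d" "dom d = ?w" "cod d = dom k1" "k1**d = ide ?w" "k2**d = ide ?w"
   using pullback_ex[OF K, of "ide ?w" "ide ?w"] ar ab by auto
  have "?d**a = tup (a**(k1**d)) (a**(k2**d))" using d ar x by simp
  also have "... = tup (a**k1) (a**k2)**d" using d(1-3) k ar ab by simp
  also have "... = rho**(\<kappa>**d)" using comp_reassoc1[OF R(6), of d] d(1-3) ra R(4) dk by simp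
  finally show "fac (?d**a) rho" using d(1-3) ra R(4) dk x ar by (intro factorsI[of "\<kappa>**d"]) auto
 qed (use x in auto)
 then have "reflexive_rel C ?x rho" using R(1) dk x by (simp add: reflexive_rel_def is_relation_def)
 then have "equivalence_rel C ?x rho" using malcev by (simp add: malcev_def)
 then obtain e where e: "epi e" "dom e = ?x" "pb e e ?l1 ?l2" using exact unfolding exact_def by blast
 note E = pullbackD[OF e(3)]
 have ea: "arr e" using e by simp
 have "(e**a)**k1 = e**(?l1**\<kappa>)" using lk ea e k ar ab by simp
 also have "... = e**(?l2**\<kappa>)" by (rule comp_reassoc) (use E la ra R(4) in auto)
 also have "... = (e**a)**k2" using lk ea e k ar ab by simp
 finally obtain f where f: "arr f" "dom f = ?y" "cod f = cod (e**a)" "f**b = e**a" using surj_coequalizer[OF ab(2) K, of "e**a"] ea e ar ab by auto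
 have cf: "cod f = cod e" using f ea e ar by simp
 have "epi (f**b)" using surj_comp[OF e(1) ab(1)] e f by simp
 then have fs: "epi f" using surj_cancel[of f b] f ar by auto
 have "pb e f a b"
 proof (rule pullbackI)
  \<comment> \<open>Two covers are needed. First v is lifted along b to l, so that u and
    \<open>a**l\<close> become related by \<open>rho\<close>; then this relation is lifted to the
    kernel pair of b. Difunctionality gives the factorization on the cover, and it descends because
    \<open>tup a b\<close> is monic.\<close>
  fix u v assume uv: "arr u" "arr v" "dom u = dom v" "cod u = dom e" "cod v = dom f"
   "e**u = f**v"
  obtain l s where pb1: "pb b v l s" using pullback_exists[of b v] ar uv f by auto
  note d1 = pullbackD[OF pb1]
  have s: "epi s" using surj_pullback[OF pb1 ab(2)] .
  have cl: "cod l = ?w" "cod s = dom u" using d1 uv ab by auto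
  have "e**(a**l) = f**(b**l)" by (rule comp_reassoc[OF f(4)[symmetric]]) (use ea f ar d1 e ab cf cl in auto)
  also have "... = f**(v**s)" using d1 by simp
  also have "... = e**(u**s)" by (rule comp_reassoc[OF uv(6)[symmetric]]) (use uv d1 f ea in auto)
  finally have "e**(u**s) = e**(a**l)" by simp
  then obtain g where g: "arr g" "dom g = dom (u**s)" "cod g = dom ?l1" "?l1**g = u**s" "?l2**g = a**l"
   using pullback_ex[OF e(3), of "u**s" "a**l"] uv d1 cl ar e by auto
  have dg: "dom g = dom s" "cod g = dom rho" using g uv d1 cl la by auto
  obtain l' s' where pb2: "pb \<kappa> g l' s'" using pullback_exists[of \<kappa> g] ra g dg R(4) by auto
  note d2 = pullbackD[OF pb2]
  have s': "epi s'" using surj_pullback[OF pb2 R(2)] .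
  have c2: "cod l' = dom k1" "cod s' = dom s" "cod l' = dom k2" using d2 dk dg k by auto
  have A1: "a**(k1**l') = u**(s**s')"
  proof -
   have "a**(k1**l') = ?l1**(\<kappa>**l')" by (rule comp_reassoc[OF lk(1)[symmetric]]) (use k ar ab la ra c2 d2 R(4) dk in auto)
   also have "... = ?l1**(g**s')" using d2 by simp
   also have "... = (u**s)**s'" by (rule comp_reassoc1[OF g(4)]) (use g la d2 in auto)
   finally show ?thesis using uv d1 d2 c2 cl by simp
  qed
  have A2: "a**(k2**l') = a**(l**s')"
  proof -
   have "a**(k2**l') = ?l2**(\<kappa>**l')" by (rule comp_reassoc[OF lk(2)[symmetric]]) (use k ar ab la ra c2 d2 R(4) dk in auto)
   also have "... = ?l2**(g**s')" using d2 by simp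
   also have "... = (a**l)**s'" by (rule comp_reassoc1[OF g(5)]) (use g la d2 in auto)
   finally show ?thesis using ar d1 d2 c2 cl by simp
  qed
  have B: "b**(k1**l') = b**(k2**l')" by (rule comp_reassoc) (use k c2 d2 in auto)
  have "fac (tup (a**(k1**l')) (b**(l**s'))) (tup a b)" by (rule difunctional[OF m ar ab(3), of _ "k2**l'"]) (use k c2 d1 d2 cl ab A2 B in auto)
  moreover have "b**(l**s') = v**(s**s')" by (rule comp_reassoc) (use d1 c2 d2 in auto)
  ultimately have fac: "fac (tup u v**(s**s')) (tup a b)" using A1 uv d1 d2 c2 cl by simp
  have "fac (tup u v) (tup a b)" by (rule surj_factor_cover[OF surj_comp[OF s s'] m _ _ fac]) (use uv d1 d2 c2 cl in auto)
  then obtain h where h: "arr h" "dom h = dom (tup u v)" "cod h = dom (tup a b)" "tup a b**h = tup u v" by (rule factorsE)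
  have ch: "cod h = ?w" "dom h = dom u" using h ar ab uv by auto
  have "tup (a**h) (b**h) = tup u v" using h(1,4) ch ar ab by simp
  then have "a**h = u & b**h = v" by (subst (asm) tuple_eq_iff; use h(1) ch ar ab uv e f in auto)
  then show "EX h. arr h & dom h = dom u & cod h = dom a & a**h = u & b**h = v" using h(1) ch by blast
 next
  fix h k assume hk: "arr h" "arr k" "dom h = dom k" "cod h = dom a" "cod k = dom a"
   "a**h = a**k" "b**h = b**k"
  then show "h = k" using ar ab by - (rule monoD(2)[OF m]; simp)
 qed (use ar ab e f ea cf in auto)
 then show ?thesis using that e fs f by auto
qed

lemma goursat:
 assumes m: "mono (tup a b)" and ab: "arr a" "arr b" "dom a = dom b"
 obtains i e j f a' b' where
  "mono i" "cod i = cod a" "epi e" "dom e = dom i"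
  "mono j" "cod j = cod b" "epi f" "dom f = dom j"
  "pb e f a' b'" "i**a' = a" "j**b' = b" "epi a'" "epi b'"
proof -
 obtain i a' where i: "mono i" "epi a'" "dom a' = dom a" "cod a' = dom i" "cod i = cod a" "i**a' = a" using image_obtain[OF ab(1)] by blast
 obtain j b' where j: "mono j" "epi b'" "dom b' = dom b" "cod b' = dom j" "cod j = cod b" "j**b' = b" using image_obtain[OF ab(2)] by blast
 have ar: "arr i" "arr j" "arr a'" "arr b'" using i j by auto
 have "prodm i j**tup a' b' = tup a b" using ar i j ab by (simp add: prodm_tuple)
 then have "mono (tup a' b')" using mono_cancel[of "prodm i j" "tup a' b'"] m ar i j ab by simp
 from goursat_surj[OF this i(2) j(2)] i j ab obtain e f where
  "epi e" "epi f" "dom e = cod a'" "dom f = cod b'" "pb e f a' b'" by auto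
 then show ?thesis using that i j by metis
qed

lemma pullback_iso:
 assumes pb: "pb e f p q" and f: "iso f" shows "iso p"
 using surj_and_mono_iso surj_pullback'[OF pb iso_surj[OF f]] pullback_mono[OF pb iso_mono[OF f]] by blast

text \<open>By Goursat the relation is a fibre product over a common subquotient z, which reads as a
  composite through z. If z is as large as x, then the subobject i and its quotient map e are
  invertible, so \<open>b'\<close> is invertible as a pullback of e and b is monic; likewise with
  the sides exchanged. These implications detect the relations that survive modulo proper
  subquotients.\<close>

lemma vec_factor:
 assumes m: "mono (tup a b)" and ab: "arr a" "arr b" "dom a = dom b" "cod a = x" "cod b = y"
 obtains z h h' where "subq z x" "subq z y" "h : hom0 x z" "h' : hom0 z y"
  "vec (tup a b) = cp x z y h' h"
  "csz x <= csz z ==> epi a & mono b"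
  "csz y <= csz z ==> mono a & epi b"
proof -
 obtain i e j f a' b' where g:
  "mono i" "cod i = cod a" "epi e" "dom e = dom i"
  "mono j" "cod j = cod b" "epi f" "dom f = dom j"
  "pb e f a' b'" "i**a' = a" "j**b' = b" "epi a'" "epi b'" using goursat[OF m ab(1-3)] by metis
 note d = pullbackD[OF g(9)]
 let ?z = "cod e"
 have ar: "arr i" "arr j" using g by auto
 have "cp x ?z y (vec (tup f j)) (vec (tup i e)) = vec (tup (i**a') (j**b'))" by (rule cp_vec) (use g(1-9) d ar ab in auto)
 moreover have "subq ?z x" by (rule subquotientI[OF g(1,3,4)]) (use g ab in auto)
 moreover have "subq ?z y" by (rule subquotientI[OF g(5,7,8)]) (use g ab d in auto)
 moreover have "vec (tup i e) : hom0 x ?z" by (rule vec_hom0) (use g ar ab in auto)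
 moreover have "vec (tup f j) : hom0 ?z y" by (rule vec_hom0) (use g(1-9) d ar ab in auto)
 moreover have "epi a & mono b" if "csz x <= csz ?z"
 proof -
  have "csz ?z = csz x" using subquotient_csz(1)[OF g(1,3,4)] that g(2) ab by simp
  then have ie: "iso i" "iso e" using subquotient_csz(2,3)[OF g(1,3,4)] g(2) ab by auto
  have "iso b'" using pullback_iso[OF pullback_sym[OF g(9)] ie(2)] .
  then have "mono (j**b')" using mono_comp[OF iso_mono g(5)] d g(8) by simp
  moreover have "epi (i**a')" using surj_comp[OF iso_surj[OF ie(1)] g(12)] d g(4) by simp
  ultimately show ?thesis using g by simp
 qed
 moreover have "mono a & epi b" if "csz y <= csz ?z"
 proof -
  have "csz ?z = csz y" using subquotient_csz(1)[OF g(5,7,8)] that g(6) ab d by simp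
  then have ie: "iso j" "iso f" using subquotient_csz(2,3)[OF g(5,7,8)] g(6) ab d by auto
  have "iso a'" using pullback_iso[OF g(9) ie(2)] .
  then have "mono (i**a')" using mono_comp[OF iso_mono g(1)] d g(4) by simp
  moreover have "epi (j**b')" using surj_comp[OF iso_surj[OF ie(1)] g(13)] d g(8) by simp
  ultimately show ?thesis using g by simp
 qed
 ultimately show ?thesis using that[of ?z "vec (tup i e)" "vec (tup f j)"] g by simp
qed

text \<open>Suppose a relation with monic leg \<open>m1\<close> and surjective leg \<open>m2\<close>
  is the image of a composite through z. On the image n of q inside the second relation, d remains
  surjective and c becomes monic, so y is a quotient of a subobject of z. This excludes such
  relations from composites through proper subquotients of y.\<close>

lemma composite_subquotient:
 assumes ab: "arr a" "arr b" "dom a = dom b" "cod b = z"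
  and cd: "mono (tup c d)" "arr c" "arr d" "dom c = dom d" "cod d = y"
  and pb: "pb b c p q"
  and m: "arr m1" "arr m2" "arr e" "cod e = dom m1" "cod e = dom m2" "epi e"
   "m1**e = a**p" "m2**e = d**q" "mono m1" "epi m2"
 shows "subq y z"
proof -
 note D = pullbackD[OF pb]
 obtain n \<epsilon> where n: "mono n" "epi \<epsilon>" "dom \<epsilon> = dom q" "cod \<epsilon> = dom n" "cod n = cod q" "n**\<epsilon> = q"
  using image_obtain[OF D(5)] by blast
 have na: "arr n" "\<epsilon> : Arr C" using n by auto
 have cn: "cod n = dom c" "cod n = dom d" using n D cd by auto
 have de: "dom e = dom p"
 proof -
  have "dom (m1**e) = dom (a**p)" using m(7) by simp
  then show ?thesis using m(1-5) ab D by simp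
 qed
 have "(d**n)**\<epsilon> = m2**e" using m(8) n na cn cd by simp
 moreover have "epi (m2**e)" using surj_comp[OF m(10,6)] m by simp
 ultimately have "epi ((d**n)**\<epsilon>)" by simp
 then have sd: "epi (d**n)" by (rule surj_cancel) (use na cn cd n in auto)
 have "mono (c**n)"
 proof (rule monoI)
  fix u1 u2 assume u: "arr u1" "arr u2" "dom u1 = dom u2" "cod u1 = dom (c**n)" "cod u2 = dom (c**n)"
   "(c**n)**u1 = (c**n)**u2"
  have cu: "cod u1 = dom n" "cod u2 = dom n" using u na cn cd by auto
  obtain l s where pb2: "pb \<epsilon> u1 l s" using pullback_exists[of \<epsilon> u1] na u cu n by auto
  note d2 = pullbackD[OF pb2]
  have s: "epi s" using surj_pullback[OF pb2 n(2)] .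
  have cl: "cod l = dom q" "cod l = dom p" "cod s = dom u2" using d2 n D u by auto
  have ql: "q**l = n**(u1**s)"
  proof -
   have "q**l = n**(\<epsilon>**l)" using comp_reassoc1[OF n(6), of l] na d2 n by simp
   then show ?thesis using d2 by simp
  qed
  have cnu: "c**(n**(u1**s)) = c**(n**(u2**s))"
  proof -
   have "((c**n)**u1)**s = ((c**n)**u2)**s" using u(6) by simp
   then show ?thesis using u(1-3) cu d2 cl na cn cd by simp
  qed
  have "b**(p**l) = c**(q**l)" by (rule comp_reassoc) (use D d2 cl in auto)
  then have "b**(p**l) = c**(n**(u2**s))" using ql cnu by simp
  then obtain l2 where l2: "arr l2" "dom l2 = dom (p**l)" "cod l2 = dom p" "p**l2 = p**l" "q**l2 = n**(u2**s)"
   using pullback_ex[OF pb, of "p**l" "n**(u2**s)"] D d2 cl u(1-3) cu na cn by auto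
  have dl: "dom l2 = dom l" "dom l = dom s" using l2 D d2 cl by auto
  have da: "cod p = dom a" "cod q = dom d" using D ab cd by auto
  have "m1**(e**l) = a**(p**l)" by (rule comp_reassoc[OF m(7)]) (use m(1-5) ab D d2 cl de da in auto)
  also have "... = a**(p**l2)" using l2 by simp
  also have "... = m1**(e**l2)" by (rule comp_reassoc[OF m(7)[symmetric]]) (use m(1-5) ab D l2 de da in auto)
  finally have el: "e**l = e**l2" by - (rule monoD(2)[OF m(9)]; use m(1-5) d2 cl l2(1-3) dl de in auto)
  have "d**(q**l) = m2**(e**l)" by (rule comp_reassoc[OF m(8)[symmetric]]) (use m(1-5) cd D d2 cl de da in auto)
  also have "... = d**(q**l2)" unfolding el by (rule comp_reassoc[OF m(8)]) (use m(1-5) cd D l2 de da in auto)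
  finally have dn: "d**(n**(u1**s)) = d**(n**(u2**s))" using ql l2 by simp
  have "tup c d**(n**(u1**s)) = tup c d**(n**(u2**s))" using dn cnu u(1-3) cu d2 cl na cn cd by simp
  then have "n**(u1**s) = n**(u2**s)" by - (rule monoD(2)[OF cd(1)]; use u(1-3) cu d2 cl na cn cd in auto)
  then have "u1**s = u2**s" by - (rule monoD(2)[OF n(1)]; use u(1-3) cu d2 cl na in auto)
  then show "u1 = u2" by - (rule surj_epi[OF s]; use u(1-3) cu d2 cl in auto)
 qed (use na cn cd in auto)
 then show ?thesis by (rule subquotientI[OF _ sd]) (use na cn cd D ab in auto)
qed

lemma graph_of_iso:
 assumes ab: "iso a" "iso b" "dom a = dom b"
 obtains g where "iso g" "dom g = cod a" "cod g = cod b"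
  "vec (tup a b) = vec (tup (ide (cod a)) g)"
proof -
 obtain j where j: "iso j" "dom j = cod a" "cod j = dom a" "j**a = ide (dom a)" "a**j = ide (cod a)" using iso_inverse[OF ab(1)] by blast
 have ar: "arr a" "arr b" "arr j" using ab j by auto
 have "tup (ide (cod a)) (b**j)**a = tup a b" using ar ab j by simp
 moreover have "iso (b**j)" using iso_comp[OF j(1) ab(2)] j ab by simp
 ultimately show ?thesis using that[of "b**j"] vec_comp_iso[of "tup (ide (cod a)) (b**j)" a] ar ab j by simp
qed

end

declare minus_apply [simp del] uminus_apply [simp del]

section \<open>Splitting off the proper subquotients\<close>

context deg_category
begin

section \<open>Graphs of morphisms and automorphism groups\<close>

definition gr :: "'m => 'm set => 'k" where
 "gr g = vec (tup (ide (dom g)) g)"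

lemma gr_hom0: "arr g ==> dom g = x ==> cod g = y ==> gr g : hom0 x y" unfolding gr_def by (rule vec_hom0) auto

lemma gr_ide: "obj x ==> gr (ide x) = id0 x" by (simp add: gr_def id0_def)

lemma gr_basis: "arr g ==> gr g = basis_vec (graph C g)" by (simp add: gr_def vec_graph)

lemma gr_post:
 assumes "arr a" "arr b" "dom a = dom b" "cod a = x" "cod b = y" "arr g" "dom g = y" "cod g = z"
 shows "cp x y z (gr g) (vec (tup a b)) = vec (tup a (g**b))"
proof -
 have "cp x y z (vec (tup (ide y) g)) (vec (tup a b)) = vec (tup (a**ide (dom b)) (g**b))" by (rule cp_vec) (use assms pullback_ide[of b] in auto)
 then show ?thesis using assms by (simp add: gr_def)
qed

lemma gr_comp:
 assumes "arr f" "arr g" "dom f = x" "cod f = y" "dom g = y" "cod g = z"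
 shows "cp x y z (gr g) (gr f) = gr (g**f)" using gr_post[of "ide x" f x y g z] assms by (auto simp: gr_def)

lemma pullback_iso_left:
 assumes "iso g" "arr a" "cod g = cod a" "arr j" "dom j = cod g" "cod j = dom g"
  "j**g = ide (dom g)" "g**j = ide (cod g)"
 shows "pb g a (j**a) (ide (dom a))"
proof (rule pullbackI)
 have ga: "arr g" using assms by simp
 show "g**(j**a) = a**ide (dom a)" using comp_reassoc1[OF assms(8), of a] assms ga by simp
 fix u v assume uv: "arr u" "arr v" "dom u = dom v" "cod u = dom g" "cod v = dom a" "g**u = a**v"
 have "(j**a)**v = j**(g**u)" using uv(1-5) assms uv(6) by simp
 also have "... = u" using comp_reassoc1[OF assms(7), of u] uv ga assms by simp
 finally have "(j**a)**v = u" .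
 then show "EX h. arr h & dom h = dom u & cod h = dom (j**a) & (j**a)**h = u & ide (dom a)**h = v" using uv assms by (intro exI[of _ v]) auto
qed (use assms in auto)

text \<open>Precomposing with a graph is a pullback, and for an isomorphism that pullback is given
  by the inverse j. This is where inverses enter the action on the source side.\<close>

lemma gr_pre:
 assumes "iso g" "dom g = x'" "cod g = x" "arr j" "dom j = x" "cod j = x'"
  "j**g = ide x'" "g**j = ide x"
  "arr a" "arr b" "dom a = dom b" "cod a = x" "cod b = y"
 shows "cp x' x y (vec (tup a b)) (gr g) = vec (tup (j**a) b)"
proof -
 have pb: "pb g a (j**a) (ide (dom a))" by (rule pullback_iso_left) (use assms in auto)
 have "cp x' x y (vec (tup a b)) (vec (tup (ide x') g)) = vec (tup (ide x'**(j**a)) (b**ide (dom a)))"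
  by (rule cp_vec[OF _ _ _ _ _ _ _ _ pb]) (use assms in auto)
 then show ?thesis using assms by (simp add: gr_def)
qed

lemma graph_inj:
 assumes "arr f" "arr g" "dom f = dom g" "cod f = cod g" "graph C f = graph C g"
 shows "f = g"
proof -
 let ?x = "dom g"
 have x: "obj ?x" using assms by simp
 have "fac (tup (ide ?x) f) (tup (ide ?x) g)" using sub_of_inject(1)[OF graph_mono[of f] graph_mono[of g]] assms by (simp add: graph_def)
 then obtain h where h: "arr h" "dom h = dom (tup (ide ?x) f)" "cod h = dom (tup (ide ?x) g)"
  "tup (ide ?x) g**h = tup (ide ?x) f" by (rule factorsE)
 have dh: "dom h = ?x" "cod h = ?x" using h assms x by auto
 have "tup h (g**h) = tup (ide ?x) g**h" using h(1) dh assms(1-4) x by simp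
 also note h(4)
 finally have "tup h (g**h) = tup (ide ?x) f" .
 moreover have "tup h (g**h) = tup (ide ?x) f \<longleftrightarrow> h = ide ?x & g**h = f" by (rule tuple_eq_iff) (use h(1) dh assms x in auto)
 ultimately have "h = ide ?x" "g**h = f" by blast+
 then show ?thesis using assms(2) by simp
qed

abbreviation A :: "'o => 'm monoid" where "A x == aut_group C x"
abbreviation AA where "AA x == carrier (A x)"
abbreviation irr where "irr x == irr_chars (A x)"

lemma A_iff: "g : AA x \<longleftrightarrow> iso g & dom g = x & cod g = x" by (auto simp: aut_group_def)

lemma A_simps [simp]: "g \<otimes>\<^bsub>A x\<^esub> h = g**h" "\<one>\<^bsub>A x\<^esub> = ide x" by (simp_all add: aut_group_def)

lemma group_A:
 assumes "obj x" shows "group (A x)"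
proof (rule groupI)
 fix g h k assume "g : AA x" "h : AA x" "k : AA x"
 then show "g \<otimes>\<^bsub>A x\<^esub> h \<otimes>\<^bsub>A x\<^esub> k = g \<otimes>\<^bsub>A x\<^esub> (h \<otimes>\<^bsub>A x\<^esub> k)"
  by (auto simp: A_iff)
next
 fix g h assume "g : AA x" "h : AA x"
 then show "g \<otimes>\<^bsub>A x\<^esub> h : AA x" using iso_comp[of h g] by (auto simp: A_iff)
next
 fix g assume "g : AA x"
 show "EX h:AA x. h \<otimes>\<^bsub>A x\<^esub> g = \<one>\<^bsub>A x\<^esub>"
 proof (rule iso_inverse[of g])
  show "iso g" using \<open>g : AA x\<close> by (simp add: A_iff)
  fix j assume "iso j" "dom j = cod g" "cod j = dom g" "j**g = ide (dom g)"
  with \<open>g : AA x\<close> show ?thesis by (intro bexI[of _ j]) (auto simp: A_iff)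
 qed
qed (use assms in \<open>auto simp: A_iff\<close>)

lemma finite_A:
 assumes "obj x" shows "finite (AA x)"
proof (rule inj_on_finite)
 show "inj_on (graph C) (AA x)" using graph_inj by (intro inj_onI) (auto simp: A_iff)
 show "graph C ` AA x <= Sub (prd x x)" using graph_mono assms by (auto simp: A_iff graph_def intro!: sub_of_Sub)
qed (use assms in auto)

lemma A_inv:
 assumes "obj x" "g : AA x"
 shows "iv x g : AA x" "iv x g**g = ide x" "g**iv x g = ide x"
proof -
 interpret group "A x" using assms by (intro group_A)
 show "iv x g : AA x" "iv x g**g = ide x" "g**iv x g = ide x" using assms l_inv[of g] r_inv[of g] by auto
qed

lemma gr_A: "g : AA x ==> gr g : hom0 x x" by (intro gr_hom0) (auto simp: A_iff)

lemma gr_mult: "g : AA x ==> h : AA x ==> cx x (gr g) (gr h) = gr (g \<otimes>\<^bsub>A x\<^esub> h)" by (subst gr_comp) (auto simp: A_iff)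

section \<open>Ideals of morphisms that factor through given objects\<close>

lemma cp_minus_left: "cp x y z (g - g') f = cp x y z g f - cp x y z g' f" using cp_add_left[of x y z "g - g'" g' f] by (simp add: algebra_simps)

lemma cp_minus_right: "cp x y z g (f - f') = cp x y z g f - cp x y z g f'" using cp_add_right[of x y z g "f - f'" f'] by (simp add: algebra_simps)

lemma cp_sum_left: "cp x y z (SUM a:I. g a) f = (SUM a:I. cp x y z (g a) f)" by (induction I rule: infinite_finite_induct) (auto simp: cp_add_left)

lemma cp_sum_right: "cp x y z g (SUM a:I. f a) = (SUM a:I. cp x y z g (f a))" by (induction I rule: infinite_finite_induct) (auto simp: cp_add_right)

lemma tr_sum: "tr x (SUM a:I. f a) = (SUM a:I. tr x (f a))" by (induction I rule: infinite_finite_induct) (auto simp: tr_add)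

lemma hom0_minus: "f : hom0 x y ==> g : hom0 x y ==> f - g : hom0 x y" by (auto simp: hom0_iff fun_apply)

text \<open>Finite sums of composites through objects of Q, given by a step rule so that ideal
  properties follow by induction. With the proper subquotients of x as Q, the endomorphisms of x in
  this ideal are those through \<open>[x]^1\<close>.\<close>

inductive_set thru :: "'o set => 'o => 'o => ('m set => 'k) set" for Q x y where
 thru_zero: "0 : thru Q x y"
| thru_step: "f : thru Q x y ==> z : Q ==> obj z ==> h : hom0 x z ==> h' : hom0 z y ==>
  cp x z y h' h + f : thru Q x y"

lemma thru_comp: "z : Q ==> obj z ==> h : hom0 x z ==> h' : hom0 z y ==> cp x z y h' h : thru Q x y" using thru_step[OF thru_zero] by fastforce

lemma thru_add: "f : thru Q x y ==> g : thru Q x y ==> f + g : thru Q x y" by (induction rule: thru.induct) (auto simp: add.assoc intro: thru_step)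

lemma thru_fsc: "f : thru Q x y ==> fsc c f : thru Q x y"
proof (induction rule: thru.induct)
 case (thru_step f z h h')
 then show ?case using thru.thru_step[of "fsc c f" Q x y z "fsc c h" h'] by (simp add: fsc_add cp_fsc_right hom0_fsc)
qed (simp add: thru_zero)

lemma thru_sum: "(!!a. a : I ==> f a : thru Q x y) ==> (SUM a:I. f a) : thru Q x y"
 by (induction I rule: infinite_finite_induct) (auto intro: thru_add thru_zero)

lemma thru_hom0: "f : thru Q x y ==> obj x ==> obj y ==> f : hom0 x y" by (induction rule: thru.induct) (auto intro: hom0_zero hom0_add cp_hom0)

lemma thru_left:
 assumes "f : thru Q x y" "g : hom0 y w" "obj x" "obj y" "obj w"
 shows "cp x y w g f : thru Q x w" using assms(1)
proof induction
 case (thru_step f z h h')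
 then show ?case using thru.thru_step[of "cp x y w g f" Q x w z h "cp z y w g h'"] assms cp_hom0 by (simp add: cp_add_right cp_assoc)
qed (simp add: thru_zero)

lemma thru_right:
 assumes "f : thru Q x y" "g : hom0 w x" "obj x" "obj y" "obj w"
 shows "cp w x y f g : thru Q w y" using assms(1)
proof induction
 case (thru_step f z h h')
 then show ?case using thru.thru_step[of "cp w x y f g" Q w y z "cp w x z h g" h'] assms cp_hom0 by (simp add: cp_add_left cp_assoc[symmetric])
qed (simp add: thru_zero)

lemma thru_trans:
 assumes "f : thru Q x y" "!!z. z : Q ==> obj z ==> id0 z : thru Q' z z" "obj x" "obj y"
 shows "f : thru Q' x y" using assms(1)
proof induction
 case (thru_step f z h h')
 have "cp x z y h' (cp x z z (id0 z) h) : thru Q' x y" using thru_step assms by (intro thru_left thru_right) auto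
 then show ?case using thru_step assms by (auto simp: cp_id_left intro: thru_add)
qed (simp add: thru_zero)

lemma thru_unit_left:
 assumes "f : thru Q y x" "!!z f. z : Q ==> obj z ==> f : hom0 z x ==> cp z x x e f = f"
  "e : hom0 x x" "obj x" "obj y"
 shows "cp y x x e f = f" using assms(1)
proof induction
 case (thru_step f z h h')
 then show ?case using assms by (simp add: cp_add_right cp_assoc)
qed simp

lemma thru_unit_right:
 assumes "f : thru Q x y" "!!z f. z : Q ==> obj z ==> f : hom0 x z ==> cp x x z f e = f"
  "e : hom0 x x" "obj x" "obj y"
 shows "cp x x y f e = f" using assms(1)
proof induction
 case (thru_step f z h h')
 then show ?case using assms by (simp add: cp_add_left cp_assoc[symmetric])
qed simp

end

section \<open>The projector onto \<open>[x]^1\<close>, and relations modulo proper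
  subquotients\<close>

context mal_category
begin

definition PS :: "'o => 'o set" where "PS x = {z. proper_subquotient C z x}"

lemma PS_obj: "z : PS x ==> obj z" using subquotient_obj by (auto simp: PS_def proper_subquotient_def)

lemma PS_csz: "z : PS x ==> csz z < csz x" using proper_subquotient_csz by (auto simp: PS_def)

lemma PS_trans: "w : PS z ==> subq z x ==> w : PS x"
proof -
 assume a: "w : PS z" "subq z x"
 obtain m e where me: "mono m" "epi e" "dom e = dom m" "cod m = x" "cod e = z" using a(2) by (rule subquotientE)
 have "csz z <= csz x" using subquotient_csz(1)[OF me(1-3)] me by simp
 then show ?thesis using PS_csz[OF a(1)] a csz_proper[of w x] subquotient_trans[of w z x] by (auto simp: PS_def proper_subquotient_def[of C w z])
qed

lemma PSI: "subq z x ==> csz z ~= csz x ==> z : PS x" using csz_proper by (auto simp: PS_def)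

text \<open>The projector onto \<open>[x]^1\<close>, described without a splitting. Two such
  elements coincide, because each is a unit for the ideal that contains the other.\<close>

definition lowid :: "'o => ('m set => 'k) => bool" where
 "lowid x e \<longleftrightarrow> e : thru (PS x) x x &
  (ALL z : PS x. (ALL f : hom0 z x. cp z x x e f = f) & (ALL f : hom0 x z. cp x x z f e = f))"

lemma lowid_facts:
 assumes l: "lowid x e" and x: "obj x"
 defines "p == id0 x - e"
 shows "e : hom0 x x" "p : hom0 x x" "cx x e e = e" "cx x p p = p"
  "!!z f. z : PS x ==> f : hom0 z x ==> cp z x x p f = 0"
  "!!z f. z : PS x ==> f : hom0 x z ==> cp x x z f p = 0"
  "!!y f. obj y ==> f : thru (PS x) y x ==> cp y x x p f = 0"
  "!!y f. obj y ==> f : thru (PS x) x y ==> cp x x y f p = 0"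
  "!!g. g : AA x ==> cx x p (gr g) = cx x (gr g) p"
proof -
 have et: "e : thru (PS x) x x" and e1: "!!z f. z : PS x ==> f : hom0 z x ==> cp z x x e f = f"
  and e2: "!!z f. z : PS x ==> f : hom0 x z ==> cp x x z f e = f" using l by (auto simp: lowid_def)
 show eh: "e : hom0 x x" using thru_hom0[OF et x x] .
 show ph: "p : hom0 x x" unfolding p_def using eh x by (intro hom0_minus id0_hom0)
 have L: "cp y x x e f = f" if "obj y" "f : thru (PS x) y x" for y f using thru_unit_left[OF that(2) e1 eh x that(1)] .
 have R: "cp x x y f e = f" if "obj y" "f : thru (PS x) x y" for y f using thru_unit_right[OF that(2) e2 eh x that(1)] .
 show ee: "cx x e e = e" using L[OF x et] .
 show "cx x p p = p" unfolding p_def cp_minus_left cp_minus_right using ee eh x by (simp add: cp_id_left cp_id_right id0_hom0)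
 show "cp z x x p f = 0" if "z : PS x" "f : hom0 z x" for z f unfolding p_def cp_minus_left using that e1 x PS_obj by (simp add: cp_id_left)
 show "cp x x z f p = 0" if "z : PS x" "f : hom0 x z" for z f unfolding p_def cp_minus_right using that e2 x PS_obj by (simp add: cp_id_right)
 show "cp y x x p f = 0" if "obj y" "f : thru (PS x) y x" for y f unfolding p_def cp_minus_left using that L thru_hom0 x by (simp add: cp_id_left)
 show "cp x x y f p = 0" if "obj y" "f : thru (PS x) x y" for y f unfolding p_def cp_minus_right using that R thru_hom0 x by (simp add: cp_id_right)
 show "cx x p (gr g) = cx x (gr g) p" if g: "g : AA x" for g
 proof -
  have gh: "gr g : hom0 x x" using gr_A[OF g] .
  \<comment> \<open>Both products of e with \<open>gr g\<close> lie in the ideal, on which e is a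
    unit from either side; so both equal the threefold product.\<close>
  have "cx x (gr g) e = cx x e (cx x (gr g) e)" using L[OF x thru_left[OF et gh x x x]] by simp
  also have "... = cx x (cx x e (gr g)) e" using gh eh x by (simp add: cp_assoc)
  also have "... = cx x e (gr g)" using R[OF x thru_right[OF et gh x x x]] .
  finally show ?thesis unfolding p_def cp_minus_left cp_minus_right using gh x by (simp add: cp_id_left cp_id_right)
 qed
qed

text \<open>If the common subquotient is as large as x, both legs are invertible and the relation is
  the graph of an automorphism.\<close>

lemma basis_thru:
 assumes r: "r : Sub (prd x x)" and x: "obj x" and n: "r ~: graph C ` AA x"
 shows "basis_vec r : thru (PS x) x x"
proof -
 let ?a = "leg1 C x x (rep r)" and ?b = "leg2 C x x (rep r)"
 note l = legs[OF r x x]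
 have b: "basis_vec r = vec (tup ?a ?b)" using vec_rep[OF r] l by simp
 have m: "mono (tup ?a ?b)" using l r by simp
 obtain z h h' where z: "subq z x" "h : hom0 x z" "h' : hom0 z x" "vec (tup ?a ?b) = cp x z x h' h"
  "csz x <= csz z ==> epi ?a & mono ?b" "csz x <= csz z ==> mono ?a & epi ?b" using vec_factor[of ?a ?b x x, OF m] l by metis
 have "csz z ~= csz x"
 proof
  assume "csz z = csz x"
  then have "iso ?a" "iso ?b" using z surj_and_mono_iso by auto
  then obtain g where g: "iso g" "dom g = x" "cod g = x" "vec (tup ?a ?b) = vec (tup (ide x) g)" using graph_of_iso[of ?a ?b] l by metis
  have "basis_vec r = (basis_vec (graph C g) :: 'm set => 'k)" using g b vec_graph[of g] by simp
  then have "basis_vec r r = (basis_vec (graph C g) r :: 'k)" by simp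
  then have "r = graph C g" by (simp add: basis_vec_def split: if_splits)
  then show False using n g by (auto simp: A_iff)
 qed
 then have "z : PS x" using PSI z by blast
 then show ?thesis using thru_comp[of z "PS x" h x h' x] PS_obj z b by simp
qed

text \<open>Of the basis relations only graphs of automorphisms survive modulo the ideal; this is
  how the group algebra of \<open>A x\<close> appears in the endomorphisms of
  \<open>[x]^0\<close>.\<close>

lemma hom0_mod_thru:
 assumes f: "f : hom0 x x" and x: "obj x"
 shows "f - (SUM g : AA x. fsc (f (graph C g)) (gr g)) : thru (PS x) x x"
proof -
 let ?S = "Sub (prd x x)" let ?G = "graph C ` AA x"
 have G: "?G <= ?S" using graph_mono x by (auto simp: A_iff graph_def intro!: sub_of_Sub)
 have "f = (SUM r:?S. fsc (f r) (basis_vec r))" by (rule hom0_expand[OF f x x])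
 also have "... = (SUM r:?S - ?G. fsc (f r) (basis_vec r)) + (SUM r:?G. fsc (f r) (basis_vec r))" using G x by (intro sum.subset_diff) auto
 also have "(SUM r:?G. fsc (f r) (basis_vec r)) = (SUM g : AA x. fsc (f (graph C g)) (basis_vec (graph C g)))"
  using graph_inj by (subst sum.reindex) (auto simp: A_iff inj_on_def)
 also have "... = (SUM g : AA x. fsc (f (graph C g)) (gr g))" by (intro sum.cong) (auto simp: gr_basis A_iff)
 finally have "f - (SUM g : AA x. fsc (f (graph C g)) (gr g)) = (SUM r:?S - ?G. fsc (f r) (basis_vec r))" by (rule iffD2[OF diff_eq_eq])
 also have "... : thru (PS x) x x" using x by (intro thru_sum thru_fsc basis_thru) auto
 finally show ?thesis .
qed

text \<open>A common subquotient isomorphic to both x and y would make them isomorphic to each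
  other.\<close>

lemma thru_not_iso:
 assumes f: "f : hom0 x y" and o: "obj x" "obj y" and n: "~ isom x y"
 shows "f : thru (PS x \<union> PS y) x y" using f o
proof (induction rule: hom0_induct)
 case (vec a b)
 obtain z h h' where z: "subq z x" "subq z y" "h : hom0 x z" "h' : hom0 z y"
  "vec (tup a b) = cp x z y h' h" using vec_factor[OF vec(6,1-5)] by metis
 have "z : PS x \<union> PS y"
 proof (rule ccontr)
  assume "z ~: PS x \<union> PS y"
  then have "isom z x" "isom z y" using z by (auto simp: PS_def proper_subquotient_def)
  then show False using n isomorphic_trans isomorphic_sym by blast
 qed
 then show ?case using z thru_comp[of z "PS x \<union> PS y" h x h' y] subquotient_obj by simp
qed (auto intro: thru_add thru_fsc thru_zero)

lemma lowid_orthogonal: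
 assumes f: "f : hom0 x y" and o: "obj x" "obj y" and n: "~ isom x y"
  and ex: "lowid x ex" and ey: "lowid y ey"
 shows "cp x y y (id0 y - ey) (cp x x y f (id0 x - ex)) = 0"
proof -
 note X = lowid_facts[OF ex o(1)] and Y = lowid_facts[OF ey o(2)]
 have "f : thru (PS x \<union> PS y) x y" by (rule thru_not_iso[OF f o n])
 then show ?thesis
 proof induction
  case (thru_step f z h h')
  have "cp x y y (id0 y - ey) (cp x x y (cp x z y h' h) (id0 x - ex)) =
    cp x z y (cp z y y (id0 y - ey) h') (cp x x z h (id0 x - ex))" using thru_step o X(2) Y(2) by (simp add: cp_assoc cp_hom0)
  also have "... = 0" using thru_step X(6)[of z h] Y(5)[of z h'] by auto
  finally show ?case using thru_step by (simp add: cp_add_left cp_add_right)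
 qed simp
qed

end

section \<open>Existence of the projector onto \<open>[x]^1\<close>\<close>

context mal_category
begin

lemma dual_bases_ex:
 assumes o: "obj x" "obj z"
 shows "EX E E' :: 'm set => 'm set => 'k. (ALL u:Sub (prd x z). E u : hom0 x z & E' u : hom0 z x) &
  (ALL h:hom0 x z. h = (SUM u:Sub (prd x z). fsc (tr x (cp x z x (E' u) h)) (E u)))"
proof (rule dual_bases[OF o])
 fix E E' :: "'m set => 'm set => 'k"
 assume a: "!!u. u : Sub (prd x z) ==> E u : hom0 x z" "!!u. u : Sub (prd x z) ==> E' u : hom0 z x"
  "!!h. h : hom0 x z ==> h = (SUM u:Sub (prd x z). fsc (tr x (cp x z x (E' u) h)) (E u))"
 show ?thesis by (rule exI[of _ E], rule exI[of _ E'], intro conjI ballI) (rule a; assumption)+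
qed

lemma tr_nondegenerate:
 assumes k: "k : hom0 x z" and o: "obj x" "obj z"
  and t: "!!h. h : hom0 z x ==> tr x (cp x z x h k) = 0"
 shows "k = 0"
proof -
 obtain E E' :: "'m set => 'm set => 'k" where E:
  "ALL u:Sub (prd x z). E u : hom0 x z & E' u : hom0 z x"
  "ALL h:hom0 x z. h = (SUM u:Sub (prd x z). fsc (tr x (cp x z x (E' u) h)) (E u))" using dual_bases_ex[OF o] by blast
 have "k = (SUM u:Sub (prd x z). fsc (tr x (cp x z x (E' u) k)) (E u))" using E(2) k by blast
 also have "... = 0" using t E(1) by (intro sum.neutral) simp
 finally show ?thesis .
qed

text \<open>The central idempotent of the \<open>[z]\<^sup>0\<close>-isotypic part of \<open>[x]\<close>.  It is the Casimir element
 of the trace form, which on the group algebra of \<open>A z\<close> need not be the standard one;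
 hence the coefficients \<open>tr (p g\<^sup>-\<^sup>1)\<close>.\<close>

lemma isotypic_unit:
 assumes l: "lowid z e" and o: "obj x" "obj z"
 defines "p == id0 z - e"
 obtains U where "U : thru {z} x x"
  "!!h. h : hom0 x z ==> cp x x z (cp x z z p h) U = cp x z z p h"
  "!!y q f. obj y ==> f : hom0 x y ==> (!!h. h : hom0 z y ==> cp z y y q (cp z z y h p) = 0) ==>
   q : hom0 y y ==> cp x x y (cp x y y q f) U = 0"
proof -
 note F = lowid_facts[OF l o(2), folded p_def]
 have ph: "p : hom0 z z" and pp: "cp z z z p p = p" using F by auto
 interpret G: group "A z" by (rule group_A[OF o(2)])
 let ?G = "AA z" and ?S = "Sub (prd x z)" let ?N = "of_nat (card ?G) :: 'k"
 have fG: "finite ?G" using finite_A o by simp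
 have N: "?N ~= 0" using fG G.one_closed by (auto simp: card_eq_0_iff)
 obtain E E' :: "'m set => 'm set => 'k" where
  E0: "ALL u:?S. E u : hom0 x z & E' u : hom0 z x"
   "ALL h:hom0 x z. h = (SUM u:?S. fsc (tr x (cp x z x (E' u) h)) (E u))" using dual_bases_ex[OF o] by blast
 have E: "!!u. u : ?S ==> E u : hom0 x z" "!!u. u : ?S ==> E' u : hom0 z x" using E0(1) by auto
 have Etr: "h = (SUM u:?S. fsc (tr z (cp z x z h (E' u))) (E u))" if h: "h : hom0 x z" for h
 proof -
  have "tr x (cp x z x (E' u) h) = tr z (cp z x z h (E' u))" if "u : ?S" for u using tr_cyc[OF h E(2)[OF that] o] .
  then have "(SUM u:?S. fsc (tr x (cp x z x (E' u) h)) (E u)) = (SUM u:?S. fsc (tr z (cp z x z h (E' u))) (E u))" by (intro sum.cong) auto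
  moreover have "h = (SUM u:?S. fsc (tr x (cp x z x (E' u) h)) (E u))" using E0(2) h by blast
  ultimately show ?thesis by (rule trans[rotated])
 qed
 define t where "t g = tr z (cp z z z p (gr g))" for g
 define M where "M a u = cp x z x (E' u) (cp x z z p (cp x z z (gr a) (E u)))" for a u
 define U where "U = fsc (1 / ?N) (SUM u:?S. SUM a:?G. fsc (t (iv z a)) (M a u))"
 have Mt: "M a u : thru {z} x x" if "a : ?G" "u : ?S" for a u unfolding M_def using that ph E gr_A o by (intro thru_comp cp_hom0) auto
 have Ut: "U : thru {z} x x" unfolding U_def by (intro thru_fsc thru_sum Mt)
 \<comment> \<open>On the upper part, h after \<open>E' u\<close> is a combination of automorphisms
   b with coefficients \<open>f u (graph C b)\<close>. In terms of g, the product of b and a, the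
   coefficients sum over b to a trace involving the inverse of g; the dual bases then return h once
   for every g, and the factor \<open>1 / ?N\<close> averages.\<close>
 have R: "cp x x z h U = h" if h: "h : hom0 x z" and p: "cp x z z p h = h" for h
 proof -
  define f where "f u = cp z x z h (E' u)" for u
  have fh: "f u : hom0 z z" if "u : ?S" for u unfolding f_def using h E that o by (intro cp_hom0) auto
  have pf: "cp z z z p (f u) = f u" if "u : ?S" for u unfolding f_def using h E that o ph p by (simp add: cp_assoc)
  have fp: "cp z z z (f u) p = (SUM b:?G. fsc (f u (graph C b)) (cp z z z (gr b) p))" if u: "u : ?S" for u
  proof -
   let ?g = "SUM b:?G. fsc (f u (graph C b)) (gr b)"
   have gh: "?g : hom0 z z" by (intro hom0_sum hom0_fsc gr_A)
   have "cp z z z (f u - ?g) p = 0" using F(8)[OF o(2) hom0_mod_thru[OF fh[OF u] o(2)]] .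
   then show ?thesis by (simp add: cp_minus_left cp_sum_left cp_fsc_left)
  qed
  have hM: "cp x x z h (M a u) = (SUM b:?G. fsc (f u (graph C b)) (cp x z z p (cp x z z (gr (b \<otimes>\<^bsub>A z\<^esub> a)) (E u))))"
   if a: "a : ?G" and u: "u : ?S" for a u
  proof -
   have "cp x x z h (M a u) = cp x z z (cp z z z (f u) p) (cp x z z (gr a) (E u))"
    unfolding M_def f_def using h E u a ph gr_A o by (simp add: cp_assoc cp_hom0)
   also have "... = (SUM b:?G. fsc (f u (graph C b)) (cp x z z (cp z z z (gr b) p) (cp x z z (gr a) (E u))))"
    unfolding fp[OF u] by (simp add: cp_sum_left cp_fsc_left)
   also have "... = (SUM b:?G. fsc (f u (graph C b)) (cp x z z p (cp x z z (gr (b \<otimes>\<^bsub>A z\<^esub> a)) (E u))))"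
   proof (rule sum.cong[OF refl])
    fix b assume b: "b : ?G"
    have "cp x z z (cp z z z (gr b) p) (cp x z z (gr a) (E u)) =
      cp x z z (cp z z z p (gr b)) (cp x z z (gr a) (E u))" using F(9)[OF b] by simp
    also have "... = cp x z z p (cp x z z (cp z z z (gr b) (gr a)) (E u))" using E u a b ph gr_A o by (simp add: cp_assoc[symmetric] cp_hom0)
    finally show "fsc (f u (graph C b)) (cp x z z (cp z z z (gr b) p) (cp x z z (gr a) (E u))) =
     fsc (f u (graph C b)) (cp x z z p (cp x z z (gr (b \<otimes>\<^bsub>A z\<^esub> a)) (E u)))" using gr_mult[OF b a] by simp
   qed
   finally show ?thesis .
  qed
  have T: "(SUM b:?G. f u (graph C b) * t (iv z g \<otimes>\<^bsub>A z\<^esub> b)) = tr z (cp z x z (cp x z z (gr (iv z g)) h) (E' u))"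
   if g: "g : ?G" and u: "u : ?S" for g u
  proof -
   let ?i = "iv z g"
   have i: "?i : ?G" using g by simp
   have "(SUM b:?G. f u (graph C b) * t (?i \<otimes>\<^bsub>A z\<^esub> b)) = tr z (SUM b:?G. fsc (f u (graph C b)) (cp z z z p (gr (?i \<otimes>\<^bsub>A z\<^esub> b))))"
    by (simp add: tr_sum tr_fsc t_def)
   also have "(SUM b:?G. fsc (f u (graph C b)) (cp z z z p (gr (?i \<otimes>\<^bsub>A z\<^esub> b)))) =
    (SUM b:?G. fsc (f u (graph C b)) (cp z z z (gr ?i) (cp z z z (gr b) p)))"
   proof (rule sum.cong[OF refl])
    fix b assume b: "b : ?G"
    have "cp z z z p (gr (?i \<otimes>\<^bsub>A z\<^esub> b)) = cp z z z (gr (?i \<otimes>\<^bsub>A z\<^esub> b)) p"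
     by (rule F(9)[OF G.m_closed[OF i b]])
    also have "... = cp z z z (gr ?i) (cp z z z (gr b) p)" using gr_mult[OF i b] i b ph gr_A o by (simp add: cp_assoc)
    finally show "fsc (f u (graph C b)) (cp z z z p (gr (?i \<otimes>\<^bsub>A z\<^esub> b))) =
     fsc (f u (graph C b)) (cp z z z (gr ?i) (cp z z z (gr b) p))" by simp
   qed
   also have "... = cp z z z (gr ?i) (cp z z z (f u) p)" unfolding fp[OF u] by (simp add: cp_sum_right cp_fsc_right)
   also have "... = cp z z z (cp z z z (gr ?i) (f u)) p" using fh[OF u] i ph gr_A o by (simp add: cp_assoc)
   also have "tr z ... = tr z (cp z z z p (cp z z z (gr ?i) (f u)))" using fh[OF u] i ph gr_A o by (intro tr_cyc cp_hom0) auto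
   also have "cp z z z p (cp z z z (gr ?i) (f u)) = cp z z z (cp z z z p (gr ?i)) (f u)" using fh[OF u] i ph gr_A o by (simp add: cp_assoc)
   also have "... = cp z z z (gr ?i) (cp z z z p (f u))" unfolding F(9)[OF i] using fh[OF u] i ph gr_A o by (simp add: cp_assoc)
   also have "... = cp z x z (cp x z z (gr ?i) h) (E' u)" unfolding pf[OF u] unfolding f_def using h E u i gr_A o by (simp add: cp_assoc)
   finally show ?thesis .
  qed
  have "cp x x z h U = fsc (1 / ?N) (SUM u:?S. SUM a:?G. fsc (t (iv z a)) (cp x x z h (M a u)))"
   unfolding U_def by (simp add: cp_fsc_right cp_sum_right)
  also have "(SUM u:?S. SUM a:?G. fsc (t (iv z a)) (cp x x z h (M a u))) =
   (SUM u:?S. SUM g:?G. fsc (tr z (cp z x z (cp x z z (gr (iv z g)) h) (E' u))) (cp x z z p (cp x z z (gr g) (E u))))"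
  proof (rule sum.cong[OF refl])
   fix u assume u: "u : ?S"
   let ?Q = "%g. cp x z z p (cp x z z (gr g) (E u))"
   have "(SUM a:?G. fsc (t (iv z a)) (cp x x z h (M a u))) =
    (SUM a:?G. SUM b:?G. fsc (f u (graph C b) * t (iv z a)) (?Q (b \<otimes>\<^bsub>A z\<^esub> a)))"
    using hM[OF _ u] by (intro sum.cong) (auto simp: fsc_sum mult.commute)
   also have "... = (SUM b:?G. SUM a:?G. fsc (f u (graph C b) * t (iv z a)) (?Q (b \<otimes>\<^bsub>A z\<^esub> a)))" by (rule sum.swap)
   also have "... = (SUM b:?G. SUM g:?G. fsc (f u (graph C b) * t (iv z g \<otimes>\<^bsub>A z\<^esub> b)) (?Q g))"
   proof (rule sum.cong[OF refl])
    fix b assume b: "b : ?G"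
    show "(SUM a:?G. fsc (f u (graph C b) * t (iv z a)) (?Q (b \<otimes>\<^bsub>A z\<^esub> a))) =
     (SUM g:?G. fsc (f u (graph C b) * t (iv z g \<otimes>\<^bsub>A z\<^esub> b)) (?Q g))"
    proof (rule sum.reindex_bij_witness[of _ "%g. iv z b \<otimes>\<^bsub>A z\<^esub> g" "%a. b \<otimes>\<^bsub>A z\<^esub> a"])
     fix a assume a: "a : ?G"
     show "iv z b \<otimes>\<^bsub>A z\<^esub> (b \<otimes>\<^bsub>A z\<^esub> a) = a" using a b by (simp only: G.m_assoc[symmetric] G.inv_closed G.l_inv G.l_one)
     show "b \<otimes>\<^bsub>A z\<^esub> a : ?G" using a b by (intro G.m_closed)
     have "iv z (b \<otimes>\<^bsub>A z\<^esub> a) \<otimes>\<^bsub>A z\<^esub> b = iv z a"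
      using a b by (simp only: G.inv_mult_group G.m_assoc G.inv_closed G.l_inv G.r_one)
     then show "fsc (f u (graph C b) * t (iv z (b \<otimes>\<^bsub>A z\<^esub> a) \<otimes>\<^bsub>A z\<^esub> b)) (?Q (b \<otimes>\<^bsub>A z\<^esub> a)) =
      fsc (f u (graph C b) * t (iv z a)) (?Q (b \<otimes>\<^bsub>A z\<^esub> a))" by (simp only:)
    next
     fix g assume g: "g : ?G"
     show "b \<otimes>\<^bsub>A z\<^esub> (iv z b \<otimes>\<^bsub>A z\<^esub> g) = g" using g b by (simp only: G.m_assoc[symmetric] G.inv_closed G.r_inv G.l_one)
     show "iv z b \<otimes>\<^bsub>A z\<^esub> g : ?G" using g b by (intro G.m_closed G.inv_closed)
    qed
   qed
   also have "... = (SUM g:?G. SUM b:?G. fsc (f u (graph C b) * t (iv z g \<otimes>\<^bsub>A z\<^esub> b)) (?Q g))" by (rule sum.swap)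
   also have "... = (SUM g:?G. fsc (SUM b:?G. f u (graph C b) * t (iv z g \<otimes>\<^bsub>A z\<^esub> b)) (?Q g))"
    by (intro sum.cong refl ext) (simp add: sum_fun_eval fsc_apply sum_distrib_right)
   also have "... = (SUM g:?G. fsc (tr z (cp z x z (cp x z z (gr (iv z g)) h) (E' u))) (?Q g))" using T[OF _ u] by (intro sum.cong) auto
   finally show "(SUM a:?G. fsc (t (iv z a)) (cp x x z h (M a u))) =
    (SUM g:?G. fsc (tr z (cp z x z (cp x z z (gr (iv z g)) h) (E' u))) (?Q g))" .
  qed
  also have "... = (SUM g:?G. SUM u:?S. fsc (tr z (cp z x z (cp x z z (gr (iv z g)) h) (E' u))) (cp x z z p (cp x z z (gr g) (E u))))"
   by (rule sum.swap)
  also have "... = (SUM g:?G. h)"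
  proof (rule sum.cong[OF refl])
   fix g assume g: "g : ?G"
   let ?k = "cp x z z (gr (iv z g)) h"
   have i: "iv z g : ?G" using g by simp
   have kh: "?k : hom0 x z" using h i gr_A o by (intro cp_hom0) auto
   have "(SUM u:?S. fsc (tr z (cp z x z ?k (E' u))) (cp x z z p (cp x z z (gr g) (E u)))) =
    cp x z z p (cp x z z (gr g) (SUM u:?S. fsc (tr z (cp z x z ?k (E' u))) (E u)))" by (simp add: cp_sum_right cp_fsc_right)
   also have "... = cp x z z p (cp x z z (gr g) ?k)" by (rule arg_cong[where f = "%k. cp x z z p (cp x z z (gr g) k)", OF Etr[OF kh, symmetric]])
   also have "cp x z z (gr g) ?k = cp x z z (gr (g \<otimes>\<^bsub>A z\<^esub> iv z g)) h" using gr_mult[OF g i] h g i gr_A o by (simp add: cp_assoc)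
   also have "... = h" using G.r_inv[OF g] h o by (simp add: gr_ide cp_id_left)
   finally show "(SUM u:?S. fsc (tr z (cp z x z ?k (E' u))) (cp x z z p (cp x z z (gr g) (E u)))) = h" using p by simp
  qed
  also have "... = fsc ?N h" by (rule ext) (simp add: sum_fun_eval fsc_apply)
  finally show ?thesis using N by simp
 qed
 have ZR: "cp x x y (cp x y y q f) U = 0" if y: "obj y" and f: "f : hom0 x y"
  and z: "!!h. h : hom0 z y ==> cp z y y q (cp z z y h p) = 0" and q: "q : hom0 y y" for y f q
 proof -
  have "cp x x y (cp x y y q f) (M a u) = 0" if "a : ?G" "u : ?S" for a u
  proof -
   have "cp x x y (cp x y y q f) (M a u) =
    cp x z y (cp z y y q (cp z z y (cp z x y f (E' u)) p)) (cp x z z (gr a) (E u))"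
    unfolding M_def using that f y q E ph gr_A o by (simp add: cp_assoc cp_hom0)
   also have "... = 0" using z[of "cp z x y f (E' u)"] that f E o y by (simp add: cp_hom0)
   finally show ?thesis .
  qed
  then show ?thesis unfolding U_def by (simp add: cp_fsc_right cp_sum_right cong: sum.cong)
 qed
 show ?thesis
 proof (rule that[OF Ut])
  show "cp x x z (cp x z z p h) U = cp x z z p h" if "h : hom0 x z" for h using R[of "cp x z z p h"] that ph o pp by (simp add: cp_hom0 cp_assoc)
 qed (use ZR in blast)
qed

lemma id0_thru: "z : Q ==> obj z ==> id0 z : thru Q z z" using thru_comp[of z Q "id0 z" z "id0 z" z] by (simp add: cp_id_left id0_hom0)

text \<open>Induction on the size of x. The candidate is the sum of the isotypic units
  \<open>U z\<close> over representatives z of the proper subquotients. That it fixes morphisms from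
  x to z is shown by a second induction, on the size of z: the part landing in \<open>[z]^0\<close>
  is fixed by the unit of its representative and killed by the other units, and the rest factors
  through smaller objects.\<close>

lemma lowid_exists:
 assumes "obj x" shows "EX e. lowid x e" using assms
proof (induction "csz x" arbitrary: x rule: less_induct)
 case less
 note x = less.prems
 have "EX e. lowid z e" if "z : PS x" for z using less.hyps[OF PS_csz[OF that] PS_obj[OF that]] .
 then obtain lo where lo: "!!z. z : PS x ==> lowid z (lo z)" by metis
 define p where "p z = id0 z - lo z" for z
 define B where "B z U \<longleftrightarrow> U : thru {z} x x &
  (ALL h. h : hom0 x z --> cp x x z (cp x z z (p z) h) U = cp x z z (p z) h) &
  (ALL y:PS x. ~ isom z y --> (ALL f : hom0 x y. cp x x y (cp x y y (p y) f) U = 0))" for z U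
 have ex: "EX U. B z U" if z: "z : PS x" for z
 proof -
  have zo: "obj z" using PS_obj z by simp
  show ?thesis
  proof (rule isotypic_unit[OF lo[OF z] x zo])
   fix U assume U: "U : thru {z} x x"
    "!!h. h : hom0 x z ==> cp x x z (cp x z z (id0 z - lo z) h) U = cp x z z (id0 z - lo z) h"
    "!!y q f. obj y ==> f : hom0 x y ==> (!!h. h : hom0 z y ==> cp z y y q (cp z z y h (id0 z - lo z)) = 0) ==>
     q : hom0 y y ==> cp x x y (cp x y y q f) U = 0"
   have "cp x x y (cp x y y (p y) f) U = 0" if "y : PS x" "~ isom z y" "f : hom0 x y" for y f
   proof (rule U(3))
    show "p y : hom0 y y" using lowid_facts(2)[OF lo[OF that(1)] PS_obj[OF that(1)]] by (simp add: p_def)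
    show "cp z y y (p y) (cp z z y h (id0 z - lo z)) = 0" if "h : hom0 z y" for h
     using lowid_orthogonal[OF that zo PS_obj] \<open>y : PS x\<close> \<open>~ isom z y\<close> lo z by (simp add: p_def)
   qed (use that PS_obj in auto)
   then have "B z U" using U(1,2) unfolding B_def p_def by blast
   then show "EX U. B z U" by (rule exI[of "B z"])
  qed
 qed
 have "EX U. ALL z:PS x. B z (U z)" using ex by (intro bchoice) blast
 then obtain U where U: "ALL z:PS x. B z (U z)" by blast
 have Ut: "!!z. z : PS x ==> U z : thru {z} x x"
  and UR: "!!z h. z : PS x ==> h : hom0 x z ==> cp x x z (cp x z z (p z) h) (U z) = cp x z z (p z) h"
  and ZR: "!!z y f. z : PS x ==> y : PS x ==> ~ isom z y ==> f : hom0 x y ==> cp x x y (cp x y y (p y) f) (U z) = 0" using U unfolding B_def by blast+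
 obtain R where R: "subquotient_representatives C x R" using subquotient_representatives_exists by blast
 have Rsub: "subq w x" if "w : R" for w using R that unfolding subquotient_representatives_def by blast
 define R' where "R' = R \<inter> PS x"
 have fR: "finite R'" using subquotient_representatives_finite[OF x R] by (simp add: R'_def)
 define e where "e = (SUM z:R'. U z)"
 have Ut': "U z : thru (PS x) x x" if "z : PS x" for z using Ut[OF that] by (rule thru_trans) (use that x id0_thru in auto)
 have et: "e : thru (PS x) x x" unfolding e_def R'_def by (intro thru_sum Ut') auto
 have eh: "e : hom0 x x" using thru_hom0[OF et x x] .
 have rep: "EX z0:R'. isom z z0" if z: "z : PS x" for z
 proof -
  have "subq z x" using z by (simp add: PS_def proper_subquotient_def)
  then obtain z0 where z0: "z0 : R" "isom z z0" using R unfolding subquotient_representatives_def by blast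
  have "subq z0 x" using Rsub z0 by blast
  moreover have "csz z0 ~= csz x" using isomorphic_csz[OF z0(2)] PS_csz[OF z] by simp
  ultimately show ?thesis using z0 PSI by (auto simp: R'_def)
 qed
 have niso: "~ isom z y" if "z : R'" "y : R'" "z ~= y" for z y
 proof
  assume "isom z y"
  moreover have "isom z z" "subq z x" using that isomorphic_refl PS_obj by (auto simp: R'_def PS_def proper_subquotient_def)
  ultimately show False using that R unfolding subquotient_representatives_def R'_def by blast
 qed
 have sumR: "cp x x z (cp x z z (p z) f) e = cp x z z (p z) f" if z: "z : R'" and f: "f : hom0 x z" for z f
 proof -
  have "cp x x z (cp x z z (p z) f) e = (SUM y:R'. cp x x z (cp x z z (p z) f) (U y))" unfolding e_def by (rule cp_sum_right)
  also have "... = (SUM y:R'. if y = z then cp x z z (p z) f else 0)" using z f niso UR[of z f] ZR by (intro sum.cong) (auto simp: R'_def)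
  also have "... = cp x z z (p z) f" using z fR by simp
  finally show ?thesis .
 qed
 have unit: "ALL f : hom0 x z. cp x x z f e = f" if "z : PS x" for z using that
 proof (induction "csz z" arbitrary: z rule: less_induct)
  case (less z)
  obtain z0 where z0: "z0 : R'" "isom z z0" using rep less.prems by blast
  have zP: "z0 : PS x" using z0 by (simp add: R'_def)
  have o: "obj z" "obj z0" using PS_obj less.prems zP by auto
  note Lf = lowid_facts[OF lo[OF zP] o(2)]
  have lt: "lo z0 : thru (PS z0) z0 z0" using lo[OF zP] by (simp add: lowid_def)
  have IH: "ALL f : hom0 x w. cp x x w f e = f" if w: "w : PS z0" for w
  proof (rule less.hyps)
   show "csz w < csz z" using PS_csz[OF w] isomorphic_csz[OF z0(2)] by simp
   show "w : PS x" using PS_trans[OF w] zP by (simp add: PS_def proper_subquotient_def)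
  qed
  have r0: "cp x x z0 f e = f" if f: "f : hom0 x z0" for f
  proof -
   have "f = cp x z0 z0 (p z0) f + cp x z0 z0 (lo z0) f" unfolding p_def cp_minus_left using f o x by (simp add: cp_id_left)
   moreover have "cp x x z0 (cp x z0 z0 (lo z0) f) e = cp x z0 z0 (lo z0) f"
    by (rule thru_unit_right[OF thru_right[OF lt f]]) (use IH eh x o f in auto)
   ultimately show ?thesis using sumR[OF z0(1) f] by (metis cp_add_left)
  qed
  obtain i where i: "iso i" "dom i = z" "cod i = z0" using z0(2) by (rule isomorphicE)
  obtain j where j: "iso j" "dom j = cod i" "cod j = dom i" "j**i = ide (dom i)" "i**j = ide (cod i)" using iso_inverse[OF i(1)] by blast
  have gij: "gr i : hom0 z z0" "gr j : hom0 z0 z" using i j gr_hom0 by auto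
  have ji: "cp z z0 z (gr j) (gr i) = id0 z" using i j o gr_comp[of i j z z0 z] by (simp add: gr_ide)
  show ?case
  proof
   fix f assume f: "f : hom0 x z"
   have "f = cp x z0 z (gr j) (cp x z z0 (gr i) f)" using f gij o x ji by (simp add: cp_assoc cp_id_left)
   moreover have "cp x x z (cp x z0 z (gr j) (cp x z z0 (gr i) f)) e = cp x z0 z (gr j) (cp x x z0 (cp x z z0 (gr i) f) e)"
    using f gij o x eh by (simp add: cp_assoc cp_hom0)
   ultimately show "cp x x z f e = f" using r0[of "cp x z z0 (gr i) f"] f gij o x cp_hom0 by metis
  qed
 qed
 \<comment> \<open>The trace pairs morphisms from z to x nondegenerately with morphisms from x to z,
   so the right unit is also a left unit.\<close>
 have left: "cp z x x e f = f" if z: "z : PS x" and f: "f : hom0 z x" for z f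
 proof -
  note zo = PS_obj[OF z]
  let ?k = "cp z x x e f - f"
  have "?k = 0"
  proof (rule tr_nondegenerate[OF _ zo x])
   show "?k : hom0 z x" using f eh x zo by (intro hom0_minus cp_hom0)
   fix h assume h: "h : hom0 x z"
   have "cp z x z h ?k = cp z x z (cp x x z h e) f - cp z x z h f" using h f eh zo x by (simp add: cp_minus_right cp_assoc)
   also have "... = 0" using unit[OF z] h by simp
   finally show "tr z (cp z x z h ?k) = 0" by simp
  qed
  then show ?thesis by simp
 qed
 have "lowid x e" unfolding lowid_def using et unit left by blast
 then show ?case by (rule exI[of "lowid x"])
qed

end

section \<open>Ternary relations\<close>

context mal_category
begin

text \<open>Transport of relations along k. It regroups the factors of a triple product, turning a
  relation from x to y times z into a morphism from \<open>[x]\<close> tensor \<open>[y]\<close> to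
  \<open>[z]\<close>.\<close>

definition push :: "'m => ('m set => 'k) => 'm set => 'k" where
 "push k v = (SUM r : Sub (dom k). fsc (v r) (vec (k**rep r)))"

lemma push_add: "push k (f + g) = push k f + push k g" by (rule ext) (simp add: push_def sum_fun_eval fsc_apply fun_apply ring_distribs sum.distrib)

lemma push_fsc: "push k (fsc c f) = fsc c (push k f)" by (simp add: push_def fsc_apply fsc_sum)

lemma push_zero [simp]: "push k 0 = 0" by (simp add: push_def fun_apply)

lemma push_vec:
 assumes f: "arr f" "arr k" "cod f = dom k"
 shows "push k (vec f) = vec (k**f)"
proof -
 obtain r e where r: "r : Sub (cod f)" "epi e" "dom e = dom f"
   "cod e = dom (rep r)" "rep r**e = f" "vec f = fsc (\<delta> e) (basis_vec r)" using vec_obtain[OF f(1)] by metis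
 have rs: "arr (rep r)" "cod (rep r) = cod f" using r(1) by auto
 have "push k (basis_vec r) = vec (k**rep r)" unfolding push_def using sum_basis[of "Sub (dom k)" r 1 "%r. vec (k**rep r)"] r(1) f by simp
 then have "push k (vec f) = fsc (\<delta> e) (vec (k**rep r))" unfolding r(6) push_fsc by simp
 also have "... = vec ((k**rep r)**e)" using r(2,4) rs f by (intro vec_comp_surj[symmetric]) auto
 also have "(k**rep r)**e = k**f" using r(2,4,5) rs f by simp
 finally show ?thesis .
qed

lemma push_hom0: "arr k ==> cod k = prd x y ==> push k v : hom0 x y" unfolding push_def using vec_support[of "k**rep r" for r]
 by (intro hom0_sum hom0_fsc) (auto simp: hom0_iff)

definition t3 :: "'m => 'm => 'm => 'm" where "t3 a b c = tup (tup a b) c"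

text \<open>The permutations \<open>x \<times> (y \<times> z) \<cong> (x \<times> y) \<times> z\<close> and \<open>y \<times> (x \<times> z) \<cong> (x \<times> y) \<times> z\<close>.\<close>

definition al :: "'o => 'o => 'o => 'm" where
 "al x y z = (let p = pr2 x (prd y z) in t3 (pr1 x (prd y z)) (pr1 y z**p) (pr2 y z**p))"

definition be :: "'o => 'o => 'o => 'm" where
 "be x y z = (let p = pr2 y (prd x z) in t3 (pr1 x z**p) (pr1 y (prd x z)) (pr2 x z**p))"

lemma t3_arr [simp]:
 assumes "arr a" "arr b" "arr c" "dom a = dom b" "dom c = dom b"
 shows "arr (t3 a b c)" "dom (t3 a b c) = dom b" "cod (t3 a b c) = prd (prd (cod a) (cod b)) (cod c)" using assms by (simp_all add: t3_def)

lemma al_arr [simp]: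
 assumes "obj x" "obj y" "obj z"
 shows "arr (al x y z)" "dom (al x y z) = prd x (prd y z)" "cod (al x y z) = prd (prd x y) z" using assms by (simp_all add: al_def Let_def)

lemma be_arr [simp]:
 assumes "obj x" "obj y" "obj z"
 shows "arr (be x y z)" "dom (be x y z) = prd y (prd x z)" "cod (be x y z) = prd (prd x y) z" using assms by (simp_all add: be_def Let_def)

lemma al_tuple:
 assumes "arr a" "arr b" "arr c" "dom a = dom b" "dom c = dom b" "cod a = x" "cod b = y" "cod c = z"
 shows "al x y z**tup a (tup b c) = t3 a b c"
proof -
 have "obj x" "obj y" "obj z" using assms by auto
 then show ?thesis using assms by (simp add: al_def Let_def t3_def)
qed

lemma be_tuple:
 assumes "arr a" "arr b" "arr c" "dom a = dom b" "dom c = dom b" "cod a = x" "cod b = y" "cod c = z"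
 shows "be x y z**tup b (tup a c) = t3 a b c"
proof -
 have "obj x" "obj y" "obj z" using assms by auto
 then show ?thesis using assms by (simp add: be_def Let_def t3_def)
qed

lemma t3_comp:
 assumes "arr a" "arr b" "arr c" "dom a = dom b" "dom c = dom b" "arr k" "cod k = dom b"
 shows "t3 a b c**k = t3 (a**k) (b**k) (c**k)" using assms by (simp add: t3_def)

lemma t3_eq_iff:
 assumes "arr a" "arr b" "arr c" "dom a = dom b" "dom c = dom b"
  "arr a'" "arr b'" "arr c'" "dom a' = dom b'" "dom c' = dom b'"
  "cod a = cod a'" "cod b = cod b'" "cod c = cod c'"
 shows "t3 a b c = t3 a' b' c' \<longleftrightarrow> a = a' & b = b' & c = c'"
proof
 assume e: "t3 a b c = t3 a' b' c'"
 have "dom (t3 a b c) = dom (t3 a' b' c')" using e by simp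
 then have d: "dom b = dom b'" using assms by simp
 have "tup a b = tup a' b' & c = c'" using e unfolding t3_def by (rule iffD1[OF tuple_eq_iff, rotated -1]) (use assms in auto)
 moreover have "tup a b = tup a' b' \<longleftrightarrow> a = a' & b = b'" by (rule tuple_eq_iff) (use assms in auto)
 ultimately show "a = a' & b = b' & c = c'" by blast
qed simp

lemma t3_mono_perm:
 assumes "arr a" "arr b" "arr c" "dom a = dom b" "dom c = dom b" "mono (t3 a b c)"
 shows "mono (tup a (tup b c))" "mono (tup b (tup a c))" "mono (tup (tup a b) c)"
proof -
 have o: "obj (cod a)" "obj (cod b)" "obj (cod c)" using assms by auto
 show "mono (tup a (tup b c))" by (rule mono_cancel[of "al (cod a) (cod b) (cod c)"]) (use assms o in \<open>auto simp: al_tuple\<close>)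
 show "mono (tup b (tup a c))" by (rule mono_cancel[of "be (cod a) (cod b) (cod c)"]) (use assms o in \<open>auto simp: be_tuple\<close>)
 show "mono (tup (tup a b) c)" using assms by (simp add: t3_def)
qed

lemma t3_mono_iff:
 assumes "arr a" "arr b" "arr c" "dom a = dom b" "dom c = dom b"
 shows "mono (tup a (tup b c)) \<longleftrightarrow> mono (t3 a b c)"
  "mono (tup b (tup a c)) \<longleftrightarrow> mono (t3 a b c)"
proof -
 have M: "mono (t3 a b c)" if m: "mono f" and f: "arr f" "dom f = dom b"
  and F: "!!h k. arr h ==> arr k ==> dom h = dom k ==> cod h = dom b ==> cod k = dom b ==>
   a**h = a**k ==> b**h = b**k ==> c**h = c**k ==> f**h = f**k" for f
 proof (rule monoI)
  fix h k assume hk: "arr h" "arr k" "dom h = dom k" "cod h = dom (t3 a b c)" "cod k = dom (t3 a b c)"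
   "t3 a b c**h = t3 a b c**k"
  have cd: "cod h = dom b" "cod k = dom b" using hk assms by auto
  have "t3 (a**h) (b**h) (c**h) = t3 (a**k) (b**k) (c**k)" using hk(6) hk(1-3) cd assms by (simp add: t3_comp)
  moreover have "t3 (a**h) (b**h) (c**h) = t3 (a**k) (b**k) (c**k) \<longleftrightarrow> a**h = a**k & b**h = b**k & c**h = c**k"
   by (rule t3_eq_iff) (use hk(1-3) cd assms in auto)
  ultimately have "f**h = f**k" using F hk(1-3) cd by blast
  then show "h = k" by - (rule monoD(2)[OF m]; use hk(1-3) cd f in auto)
 qed (use assms in auto)
 show "mono (tup a (tup b c)) \<longleftrightarrow> mono (t3 a b c)" using M[of "tup a (tup b c)"] t3_mono_perm(1)[OF assms] assms by auto
 show "mono (tup b (tup a c)) \<longleftrightarrow> mono (t3 a b c)" using M[of "tup b (tup a c)"] t3_mono_perm(2)[OF assms] assms by auto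
qed

lemma t3_obtain:
 assumes "arr h" "cod h = prd (prd x y) z" "obj x" "obj y" "obj z"
 obtains a b c where "t3 a b c = h" "arr a" "arr b" "arr c" "dom a = dom h" "dom b = dom h" "dom c = dom h"
  "cod a = x" "cod b = y" "cod c = z"
proof -
 obtain u c where u: "tup u c = h" "arr u" "arr c" "dom u = dom h" "dom c = dom h"
  "cod u = prd x y" "cod c = z" using tuple_obtain[of h "prd x y" z] assms by auto
 obtain a b where "tup a b = u" "arr a" "arr b" "dom a = dom u" "dom b = dom u"
  "cod a = x" "cod b = y" using tuple_obtain[of u x y] u assms by auto
 then show ?thesis using that[of a b c] u by (simp add: t3_def)
qed

text \<open>The pullback of b and c carries along a spectator leg d. It computes the precomposition
  of a ternary relation with a morphism tensored with an identity.\<close>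

lemma pullback_tensor_left:
 assumes pb: "pb b c p q" and d: "arr d" "dom d = dom c" "cod d = y"
 shows "pb (prodm b (ide y)) (tup c d) (tup p (d**q)) q"
proof (rule pullbackI)
 note D = pullbackD[OF pb]
 have y: "obj y" using d by auto
 show "prodm b (ide y)**tup p (d**q) = tup c d**q" using D d y by (simp add: prodm_tuple)
 fix u v assume uv: "arr u" "arr v" "dom u = dom v" "cod u = dom (prodm b (ide y))"
   "cod v = dom (tup c d)" "prodm b (ide y)**u = tup c d**v"
 have cu: "cod u = prd (dom b) y" "cod v = dom c" using uv D d y by auto
 obtain u1 u2 where u: "tup u1 u2 = u" "arr u1" "arr u2" "dom u1 = dom u" "dom u2 = dom u"
   "cod u1 = dom b" "cod u2 = y" using tuple_obtain[OF uv(1) cu(1)] D y by auto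
 have "prodm b (ide y)**tup u1 u2 = tup c d**v" using uv(6) u(1) by simp
 then have "tup (b**u1) u2 = tup (c**v) (d**v)" using u(2-) D d y uv(1-3) cu by (simp add: prodm_tuple)
 moreover have "tup (b**u1) u2 = tup (c**v) (d**v) \<longleftrightarrow> b**u1 = c**v & u2 = d**v"
  by (rule tuple_eq_iff) (use u(2-) D d y uv(1-3) cu in auto)
 ultimately have e: "b**u1 = c**v" "u2 = d**v" by auto
 obtain h where h: "arr h" "dom h = dom u1" "cod h = dom p" "p**h = u1" "q**h = v" using pullback_ex[OF pb u(2) uv(2)] u uv(3) cu e by auto
 have "tup p (d**q)**h = u" using h D d e u(1) by simp
 then show "EX h. arr h & dom h = dom u & cod h = dom (tup p (d**q)) & tup p (d**q)**h = u & q**h = v"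
  using h(1-3) h(5) u(4) D d by (intro exI[of _ h]) simp
next
 note D = pullbackD[OF pb]
 fix h k assume hk: "arr h" "arr k" "dom h = dom k" "cod h = dom (tup p (d**q))"
   "cod k = dom (tup p (d**q))" "tup p (d**q)**h = tup p (d**q)**k" "q**h = q**k"
 have cd: "cod h = dom p" "cod k = dom p" using hk D d by auto
 have "tup (p**h) (d**(q**h)) = tup (p**k) (d**(q**k))" using hk(6) hk(1-3) cd D d by simp
 moreover have "tup (p**h) (d**(q**h)) = tup (p**k) (d**(q**k)) \<longleftrightarrow> p**h = p**k & d**(q**h) = d**(q**k)"
  by (rule tuple_eq_iff) (use hk(1-3) cd D d in auto)
 ultimately have "p**h = p**k" by blast
 then show "h = k" using pullback_eqI[OF pb hk(1-3) cd] hk(7) by blast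
qed (use pullbackD[OF pb] d in auto)

lemma pullback_tensor_right:
 assumes pb: "pb b c p q" and d: "arr d" "dom d = dom c" "cod d = y"
 shows "pb (prodm (ide y) b) (tup d c) (tup (d**q) p) q"
proof (rule pullbackI)
 note D = pullbackD[OF pb]
 have y: "obj y" using d by auto
 show "prodm (ide y) b**tup (d**q) p = tup d c**q" using D d y by (simp add: prodm_tuple)
 fix u v assume uv: "arr u" "arr v" "dom u = dom v" "cod u = dom (prodm (ide y) b)"
   "cod v = dom (tup d c)" "prodm (ide y) b**u = tup d c**v"
 have cu: "cod u = prd y (dom b)" "cod v = dom c" using uv D d y by auto
 obtain u2 u1 where u: "tup u2 u1 = u" "arr u2" "arr u1" "dom u2 = dom u" "dom u1 = dom u"
   "cod u2 = y" "cod u1 = dom b" using tuple_obtain[OF uv(1) cu(1)] D y by auto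
 have "prodm (ide y) b**tup u2 u1 = tup d c**v" using uv(6) u(1) by simp
 then have "tup u2 (b**u1) = tup (d**v) (c**v)" using u(2-) D d y uv(1-3) cu by (simp add: prodm_tuple)
 moreover have "tup u2 (b**u1) = tup (d**v) (c**v) \<longleftrightarrow> u2 = d**v & b**u1 = c**v"
  by (rule tuple_eq_iff) (use u(2-) D d y uv(1-3) cu in auto)
 ultimately have e: "b**u1 = c**v" "u2 = d**v" by auto
 obtain h where h: "arr h" "dom h = dom u1" "cod h = dom p" "p**h = u1" "q**h = v" using pullback_ex[OF pb u(3) uv(2)] u uv(3) cu e by auto
 have "tup (d**q) p**h = u" using h D d e u(1) by simp
 then show "EX h. arr h & dom h = dom u & cod h = dom (tup (d**q) p) & tup (d**q) p**h = u & q**h = v"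
  using h(1-3) h(5) u(5) D d by (intro exI[of _ h]) simp
next
 note D = pullbackD[OF pb]
 fix h k assume hk: "arr h" "arr k" "dom h = dom k" "cod h = dom (tup (d**q) p)"
   "cod k = dom (tup (d**q) p)" "tup (d**q) p**h = tup (d**q) p**k" "q**h = q**k"
 have cd: "cod h = dom p" "cod k = dom p" using hk D d by auto
 have "tup (d**(q**h)) (p**h) = tup (d**(q**k)) (p**k)" using hk(6) hk(1-3) cd D d by simp
 moreover have "tup (d**(q**h)) (p**h) = tup (d**(q**k)) (p**k) \<longleftrightarrow> d**(q**h) = d**(q**k) & p**h = p**k"
  by (rule tuple_eq_iff) (use hk(1-3) cd D d in auto)
 ultimately have "p**h = p**k" by blast
 then show "h = k" using pullback_eqI[OF pb hk(1-3) cd] hk(7) by blast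
qed (use pullbackD[OF pb] d in auto)

text \<open>Naturality of the duality between relations from x to y times z and relations from x
  times y to z: passing through h in the first reading is precomposing with h tensor identity in the
  second. So a factorization seen from the factor x becomes visible to a projector acting on that
  factor.\<close>

lemma push_al_comp:
 assumes "h : hom0 x w" "h' : hom0 w (prd y z)" "obj x" "obj y" "obj z" "obj w"
 shows "push (al x y z) (cp x w (prd y z) h' h) =
  cp (prd x y) (prd w y) z (push (al w y z) h') (ten0 x w y y h (id0 y))" using assms(1,3,6)
proof (induction rule: hom0_induct)
 case (vec a b)
 note v1 = this
 have yz: "obj (prd y z)" using assms by simp
 show ?case using assms(2,6) yz
 proof (induction rule: hom0_induct)
  case (vec c d)
  obtain d1 d2 where d: "tup d1 d2 = d" "arr d1" "arr d2" "dom d1 = dom d" "dom d2 = dom d"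
   "cod d1 = y" "cod d2 = z" using tuple_obtain[OF vec(2,5)] assms by metis
  obtain p q where pb: "pb b c p q" using pullback_exists[of b c] v1 vec by auto
  note D = pullbackD[OF pb]
  have cq: "cod q = dom d1" "cod q = dom d2" "cod q = dom d" using D d vec by auto
  have "cp x w (prd y z) (vec (tup c d)) (vec (tup a b)) = vec (tup (a**p) (d**q))" by (rule cp_vec) (use pb v1 vec in auto)
  also have "d**q = tup d1 d2**q" using d by simp
  also have "... = tup (d1**q) (d2**q)" using d(2-) D cq by simp
  finally have "push (al x y z) (cp x w (prd y z) (vec (tup c d)) (vec (tup a b)))
   = vec (al x y z**tup (a**p) (tup (d1**q) (d2**q)))" using v1 D d(2-) cq assms by (simp add: push_vec)
  also have "... = vec (t3 (a**p) (d1**q) (d2**q))" by (subst al_tuple) (use v1 D d(2-) cq in auto)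
  finally have L: "push (al x y z) (cp x w (prd y z) (vec (tup c d)) (vec (tup a b))) = vec (t3 (a**p) (d1**q) (d2**q))" .
  have "push (al w y z) (vec (tup c d)) = vec (al w y z**tup c (tup d1 d2))" using d(1) vec assms by (subst push_vec) auto
  also have "... = vec (tup (tup c d1) d2)" by (subst al_tuple) (use vec d(2-) in \<open>auto simp: t3_def\<close>)
  finally have R1: "push (al w y z) (vec (tup c d)) = vec (tup (tup c d1) d2)" .
  have R2: "ten0 x w y y (vec (tup a b)) (id0 y) = vec (tup (prodm a (ide y)) (prodm b (ide y)))"
   unfolding id0_def by (rule ten0_vec) (use v1 assms in auto)
  have "cp (prd x y) (prd w y) z (vec (tup (tup c d1) d2)) (vec (tup (prodm a (ide y)) (prodm b (ide y))))
   = vec (tup (prodm a (ide y)**tup p (d1**q)) (d2**q))"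
   by (rule cp_vec[OF _ _ _ _ _ _ _ _ pullback_tensor_left[OF pb]]) (use v1 vec d(2-) D assms in auto)
  also have "prodm a (ide y)**tup p (d1**q) = tup (a**p) (d1**q)" using v1 vec d(2-) D cq assms by (simp add: prodm_tuple)
  finally show ?case unfolding L R1 R2 by (simp add: t3_def)
 qed (auto simp: cp_add_left cp_fsc_left push_add push_fsc)
qed (auto simp: cp_add_right cp_fsc_right push_add push_fsc ten0_add_left ten0_fsc_left)

lemma push_be_comp:
 assumes "h : hom0 y w" "h' : hom0 w (prd x z)" "obj x" "obj y" "obj z" "obj w"
 shows "push (be x y z) (cp y w (prd x z) h' h) =
  cp (prd x y) (prd x w) z (push (be x w z) h') (ten0 x x y w (id0 x) h)" using assms(1,4,6)
proof (induction rule: hom0_induct)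
 case (vec a b)
 note v1 = this
 have xz: "obj (prd x z)" using assms by simp
 show ?case using assms(2,6) xz
 proof (induction rule: hom0_induct)
  case (vec c d)
  obtain d1 d2 where d: "tup d1 d2 = d" "arr d1" "arr d2" "dom d1 = dom d" "dom d2 = dom d"
   "cod d1 = x" "cod d2 = z" using tuple_obtain[OF vec(2,5)] assms by metis
  obtain p q where pb: "pb b c p q" using pullback_exists[of b c] v1 vec by auto
  note D = pullbackD[OF pb]
  have cq: "cod q = dom d1" "cod q = dom d2" "cod q = dom d" using D d vec by auto
  have "cp y w (prd x z) (vec (tup c d)) (vec (tup a b)) = vec (tup (a**p) (d**q))" by (rule cp_vec) (use pb v1 vec in auto)
  also have "d**q = tup d1 d2**q" using d by simp
  also have "... = tup (d1**q) (d2**q)" using d(2-) D cq by simp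
  finally have "push (be x y z) (cp y w (prd x z) (vec (tup c d)) (vec (tup a b)))
   = vec (be x y z**tup (a**p) (tup (d1**q) (d2**q)))" using v1 D d(2-) cq assms by (simp add: push_vec)
  also have "... = vec (t3 (d1**q) (a**p) (d2**q))" by (subst be_tuple) (use v1 D d(2-) cq in auto)
  finally have L: "push (be x y z) (cp y w (prd x z) (vec (tup c d)) (vec (tup a b))) = vec (t3 (d1**q) (a**p) (d2**q))" .
  have "push (be x w z) (vec (tup c d)) = vec (be x w z**tup c (tup d1 d2))" using d(1) vec assms by (subst push_vec) auto
  also have "... = vec (tup (tup d1 c) d2)" by (subst be_tuple) (use vec d(2-) in \<open>auto simp: t3_def\<close>)
  finally have R1: "push (be x w z) (vec (tup c d)) = vec (tup (tup d1 c) d2)" .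
  have R2: "ten0 x x y w (id0 x) (vec (tup a b)) = vec (tup (prodm (ide x) a) (prodm (ide x) b))"
   unfolding id0_def by (rule ten0_vec) (use v1 assms in auto)
  have "cp (prd x y) (prd x w) z (vec (tup (tup d1 c) d2)) (vec (tup (prodm (ide x) a) (prodm (ide x) b)))
   = vec (tup (prodm (ide x) a**tup (d1**q) p) (d2**q))"
   by (rule cp_vec[OF _ _ _ _ _ _ _ _ pullback_tensor_right[OF pb]]) (use v1 vec d(2-) D assms in auto)
  also have "prodm (ide x) a**tup (d1**q) p = tup (d1**q) (a**p)" using v1 vec d(2-) D cq assms by (simp add: prodm_tuple)
  finally show ?case unfolding L R1 R2 by (simp add: t3_def)
 qed (auto simp: cp_add_left cp_fsc_left push_add push_fsc)
qed (auto simp: cp_add_right cp_fsc_right push_add push_fsc ten0_add_right ten0_fsc_right)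

lemma push_al_surj:
 assumes "m : hom0 (prd x y) z" "obj x" "obj y" "obj z"
 obtains m' where "m' : hom0 x (prd y z)" "m = push (al x y z) m'"
proof -
 have xy: "obj (prd x y)" using assms by simp
 have "EX m' : hom0 x (prd y z). m = push (al x y z) m'" using assms(1) xy assms(4)
 proof (induction rule: hom0_induct)
  case (vec u c)
  obtain a b where u: "tup a b = u" "arr a" "arr b" "dom a = dom u" "dom b = dom u"
   "cod a = x" "cod b = y" using tuple_obtain[OF vec(1,4)] assms by metis
  have "push (al x y z) (vec (tup a (tup b c))) = vec (t3 a b c)" by (subst push_vec) (use u(2-) vec assms in \<open>auto simp: al_tuple\<close>)
  moreover have "vec (tup a (tup b c)) : hom0 x (prd y z)" by (rule vec_hom0) (use u(2-) vec in auto)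
  ultimately show ?case using u(1) by (auto simp: t3_def intro!: bexI[of _ "vec (tup a (tup b c))"])
 next
  case (add f g)
  then show ?case using push_add hom0_add by metis
 next
  case (scale c f)
  then show ?case using push_fsc hom0_fsc by metis
 next
  case zero
  then show ?case using push_zero hom0_zero by metis
 qed
 then show ?thesis using that by blast
qed

lemma push_be_surj:
 assumes "m : hom0 (prd x y) z" "obj x" "obj y" "obj z"
 obtains m' where "m' : hom0 y (prd x z)" "m = push (be x y z) m'"
proof -
 have xy: "obj (prd x y)" using assms by simp
 have "EX m' : hom0 y (prd x z). m = push (be x y z) m'" using assms(1) xy assms(4)
 proof (induction rule: hom0_induct)
  case (vec u c)
  obtain a b where u: "tup a b = u" "arr a" "arr b" "dom a = dom u" "dom b = dom u"
   "cod a = x" "cod b = y" using tuple_obtain[OF vec(1,4)] assms by metis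
  have "push (be x y z) (vec (tup b (tup a c))) = vec (t3 a b c)" by (subst push_vec) (use u(2-) vec assms in \<open>auto simp: be_tuple\<close>)
  moreover have "vec (tup b (tup a c)) : hom0 y (prd x z)" by (rule vec_hom0) (use u(2-) vec in auto)
  ultimately show ?case using u(1) by (auto simp: t3_def intro!: bexI[of _ "vec (tup b (tup a c))"])
 next
  case (add f g)
  then show ?case using push_add hom0_add by metis
 next
  case (scale c f)
  then show ?case using push_fsc hom0_fsc by metis
 next
  case zero
  then show ?case using push_zero hom0_zero by metis
 qed
 then show ?thesis using that by blast
qed

end

section \<open>The operator on ternary relations and its trace\<close>

context mal_category
begin

text \<open>The condition defining T on arbitrary legs, whereas \<open>ternary_set\<close> tests it
  on the chosen representative of a subobject.\<close>

definition Tc :: "'m => 'm => 'm => bool" where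
 "Tc a b c \<longleftrightarrow> epi a & epi b & epi c &
  mono (tup a b) & mono (tup a c) & mono (tup b c)"

lemma ternary_set_Tc:
 assumes r: "r : Sub (prd (prd x y) z)" "t3 a b c = rep r"
  and a: "arr a" "arr b" "arr c" "dom a = dom b" "dom c = dom b" "cod a = x" "cod b = y" "cod c = z"
 shows "r : ternary_set C x y z \<longleftrightarrow> Tc a b c"
proof -
 have o: "obj x" "obj y" "obj z" using a by auto
 have "prj1 C x y z**rep r = a" "prj2 C x y z**rep r = b" "prj3 C x y z**rep r = c"
  using a o by (auto simp: r(2)[symmetric] prj1_def prj2_def prj3_def t3_def)
 then show ?thesis using r(1) by (auto simp: ternary_set_def Tc_def prd3_def Let_def)
qed

lemma Tc_iso:
 assumes T: "Tc a b c" and i: "iso i" "cod i = dom b" and d: "dom a = dom b" "dom c = dom b"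
 shows "Tc (a**i) (b**i) (c**i)"
proof -
 have ar: "arr a" "arr b" "arr c" "arr i" using T i by (auto simp: Tc_def)
 have "mono (tup u v**i)" if "mono (tup u v)" "dom (tup u v) = cod i" for u v using mono_comp[OF iso_mono[OF i(1)] that(1)] that(2) by simp
 moreover have "epi (u**i)" if "epi u" "dom u = cod i" for u using surj_comp[OF that(1) iso_surj[OF i(1)]] that(2) by simp
 ultimately show ?thesis using T ar d i by (auto simp: Tc_def simp flip: tuple_comp)
qed

lemma ternary_set_sub_of:
 assumes m: "mono (t3 a b c)"
  and a: "arr a" "arr b" "arr c" "dom a = dom b" "dom c = dom b" "cod a = x" "cod b = y" "cod c = z"
 shows "sub (t3 a b c) : ternary_set C x y z \<longleftrightarrow> Tc a b c"
proof -
 obtain i where i: "iso i" "dom i = dom (rep (sub (t3 a b c)))" "cod i = dom (t3 a b c)"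
  "t3 a b c**i = rep (sub (t3 a b c))" using rep_sub_of_iso[OF m] .
 obtain j where j: "iso j" "dom j = cod i" "cod j = dom i"
  "j**i = ide (dom i)" "i**j = ide (cod i)" using iso_inverse[OF i(1)] .
 have ij: "arr i" "arr j" "cod i = dom b" using i j a by auto
 have "sub (t3 a b c) : ternary_set C x y z \<longleftrightarrow> Tc (a**i) (b**i) (c**i)"
  by (rule ternary_set_Tc) (use m i(4)[symmetric] ij a in \<open>auto simp: t3_comp\<close>)
 also have "... \<longleftrightarrow> Tc a b c"
 proof
  assume "Tc (a**i) (b**i) (c**i)"
  then have "Tc ((a**i)**j) ((b**i)**j) ((c**i)**j)" by (rule Tc_iso) (use a ij j in auto)
  then show "Tc a b c" using a ij j by simp
 qed (intro Tc_iso; use i ij a in auto)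
 finally show ?thesis .
qed

lemma ternary_action_sub_of:
 assumes m: "mono (t3 a b c)"
  and a: "arr a" "arr b" "arr c" "dom a = dom b" "dom c = dom b" "cod a = x" "cod b = y" "cod c = z"
  and g: "g1 : AA x" "g2 : AA y" "g3 : AA z"
 shows "mono (t3 (g1**a) (g2**b) (g3**c))"
  "ternary_action C x y z (g1, g2, g3) (sub (t3 a b c)) = sub (t3 (g1**a) (g2**b) (g3**c))"
  "Tc a b c ==> Tc (g1**a) (g2**b) (g3**c)"
proof -
 note g' = g[unfolded A_iff]
 have gs: "mono g1" "mono g2" "mono g3" "epi g1" "epi g2" "epi g3"
  "arr g1" "arr g2" "arr g3" "dom g1 = x" "dom g2 = y" "dom g3 = z" using g' iso_mono iso_surj by auto
 have o: "obj x" "obj y" "obj z" using a by auto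
 let ?P = "prodm (prodm g1 g2) g3"
 have P: "mono ?P" using gs by (intro prodm_mono)
 have e: "?P**t3 a b c = t3 (g1**a) (g2**b) (g3**c)" using gs a o by (simp add: t3_def prodm_tuple)
 show "mono (t3 (g1**a) (g2**b) (g3**c))" unfolding e[symmetric] by (rule mono_comp[OF m P]) (use a gs in auto)
 obtain i where i: "iso i" "dom i = dom (rep (sub (t3 a b c)))" "cod i = dom (t3 a b c)"
  "t3 a b c**i = rep (sub (t3 a b c))" using rep_sub_of_iso[OF m] .
 have ia: "arr i" using i by auto
 have "tup (tup (g1**prj1 C x y z) (g2**prj2 C x y z)) (g3**prj3 C x y z) = ?P" using gs o by (simp add: prodm_def prj1_def prj2_def prj3_def)
 then have "ternary_action C x y z (g1, g2, g3) (sub (t3 a b c)) = sub (?P**(t3 a b c**i))" by (simp add: ternary_action_def i(4))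
 also have "?P**(t3 a b c**i) = (?P**t3 a b c)**i" by (rule sym, rule comp_assoc) (use a i(3) ia gs in auto)
 also have "sub ((?P**t3 a b c)**i) = sub (?P**t3 a b c)" by (rule sub_of_comp_iso) (use mono_comp[OF m P] a i gs in auto)
 finally show "ternary_action C x y z (g1, g2, g3) (sub (t3 a b c)) = sub (t3 (g1**a) (g2**b) (g3**c))" unfolding e .
 have M: "mono (tup (g**u) (h**v))" if "mono (tup u v)" "mono g" "mono h" "arr u" "arr v" "dom u = dom v" "cod u = dom g" "cod v = dom h" for u v g h
  using mono_comp[OF that(1) prodm_mono[OF that(2,3)]] that by (simp add: prodm_tuple mono_arr)
 show "Tc (g1**a) (g2**b) (g3**c)" if "Tc a b c" using that gs a by (auto simp: Tc_def intro!: M surj_comp)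
qed

text \<open>The vector of a span is a multiple of a single basis relation, its image; a nonzero
  coefficient therefore identifies the image.\<close>

lemma vec_tuple_eval:
 assumes u: "arr u" "arr v" "dom u = dom v" "cod u = x" "cod v = y"
  and r: "mono (tup m1 m2)" "arr m1" "arr m2" "dom m1 = dom m2" "cod m1 = x" "cod m2 = y"
  and n: "vec (tup u v) (sub (tup m1 m2)) ~= 0"
 shows "EX e. epi e & cod e = dom m2 & m1**e = u & m2**e = v"
proof -
 obtain s e where s: "s : Sub (cod (tup u v))" "epi e" "dom e = dom (tup u v)"
  "cod e = dom (rep s)" "rep s**e = tup u v" "vec (tup u v) = fsc (\<delta> e) (basis_vec s)" by (rule vec_obtain[of "tup u v"]) (use u in auto)
 have ss: "s = sub (tup m1 m2)" using n by (auto simp: s(6) fsc_apply basis_vec_def split: if_splits)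
 obtain i where i: "iso i" "dom i = dom (rep s)" "cod i = dom (tup m1 m2)"
  "tup m1 m2**i = rep s" using rep_sub_of_iso[OF r(1)] ss by metis
 have ia: "arr i" "arr e" "cod i = dom m2" using i s(2) r by auto
 have "tup (m1**(i**e)) (m2**(i**e)) = tup m1 m2**(i**e)" by (rule sym, rule tuple_comp) (use ia i(2) s(4) r in auto)
 also have "... = (tup m1 m2**i)**e" by (rule sym, rule comp_assoc) (use ia i(2) s(4) r in auto)
 also have "... = tup u v" unfolding i(4) s(5) ..
 finally have "tup (m1**(i**e)) (m2**(i**e)) = tup u v" .
 moreover have "tup (m1**(i**e)) (m2**(i**e)) = tup u v \<longleftrightarrow> m1**(i**e) = u & m2**(i**e) = v"
  by (rule tuple_eq_iff) (use ia i(2) s(4) r u in auto)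
 moreover have "epi (i**e)" by (rule surj_comp[OF iso_surj[OF i(1)] s(2)]) (use i(2) s(4) in auto)
 moreover have "cod (i**e) = dom m2" using ia i(2) s(4) by simp
 ultimately show ?thesis by (intro exI[of _ "i**e"]) blast
qed

lemma subquotient_not_PS: "subq y z ==> z : PS y ==> False" by (elim subquotientE) (use subquotient_csz(1) PS_csz in fastforce)

lemma mono_tuple_swap:
 assumes "mono (tup a b)" "arr a" "arr b" "dom a = dom b" shows "mono (tup b a)"
proof -
 have o: "obj (cod a)" "obj (cod b)" using assms by auto
 let ?s = "tup (pr2 (cod b) (cod a)) (pr1 (cod b) (cod a))"
 have "?s**tup b a = tup a b" using assms(2-) o by simp
 then have "mono (?s**tup b a)" using assms(1) by simp
 then show ?thesis by (rule mono_cancel) (use assms(2-) o in auto)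
qed

text \<open>A nonzero coefficient would make the relation (m1, m2) the image of the composite span,
  and then y, or X in the second case, would be a subquotient of its own proper subquotient z.
  Coefficients at such relations thus do not see the ideal of morphisms through proper
  subquotients.\<close>

lemma cp_low_eval:
 assumes f: "f : hom0 X z" and k: "k : hom0 z y" and o: "obj X" "obj y" "obj z"
  and r: "mono (tup m1 m2)" "arr m1" "arr m2" "dom m1 = dom m2" "cod m1 = X" "cod m2 = y"
  and c: "z : PS y & mono m1 & epi m2 | z : PS X & epi m1 & mono m2"
 shows "cp X z y k f (sub (tup m1 m2)) = 0" using f o(1,3)
proof (induction rule: hom0_induct)
 case (vec a b)
 note v1 = this
 show ?case using k o(3,2)
 proof (induction rule: hom0_induct)
  case (vec c d)
  obtain p q where pb: "pb b c p q" using pullback_exists[of b c] v1 vec by auto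
  note D = pullbackD[OF pb]
  have e: "cp X z y (vec (tup c d)) (vec (tup a b)) = vec (tup (a**p) (d**q))" by (rule cp_vec) (use pb v1 vec in auto)
  show ?case unfolding e
  proof (rule ccontr)
   assume n: "vec (tup (a**p) (d**q)) (sub (tup m1 m2)) ~= 0"
   have "EX e. epi e & cod e = dom m2 & m1**e = a**p & m2**e = d**q" by (rule vec_tuple_eval[OF _ _ _ _ _ r(1-6) n]) (use v1 vec D in auto)
   then obtain e where e: "epi e" "cod e = dom m2" "m1**e = a**p" "m2**e = d**q" by blast
   show False using c
   proof (elim disjE conjE)
    assume z: "z : PS y" "mono m1" "epi m2"
    have "subq y z" by (rule composite_subquotient[of a b z c d y p q m1 m2 e]) (use z v1 vec pb e r in auto)
    then show False using subquotient_not_PS z(1) by blast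
   next
    assume z: "z : PS X" "epi m1" "mono m2"
    have "subq X z" by (rule composite_subquotient[of d c z b a X q p m2 m1 e]) (use z v1 vec pb e r mono_tuple_swap pullback_sym in auto)
    then show False using subquotient_not_PS z(1) by blast
   qed
  qed
 qed (simp_all only: cp_add_left cp_fsc_left cp_zero, simp_all add: fun_apply fsc_apply)
qed (simp_all only: cp_add_right cp_fsc_right cp_zero, simp_all add: fun_apply fsc_apply)

lemma thru_eval_left:
 assumes f: "f : thru (PS y) X y" and o: "obj X" "obj y"
  and r: "mono (tup m1 m2)" "arr m1" "arr m2" "dom m1 = dom m2" "cod m1 = X" "cod m2 = y"
   "mono m1" "epi m2"
 shows "f (sub (tup m1 m2)) = 0" using f
proof (induction rule: thru.induct)
 case (thru_step f z h h')
 then show ?case using cp_low_eval[OF _ _ o _ r(1-6)] PS_obj r(7,8) by (simp only: fun_apply) simp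
qed (simp only: fun_apply)

lemma thru_eval_right:
 assumes f: "f : thru (PS x) x Y" and o: "obj x" "obj Y"
  and r: "mono (tup m1 m2)" "arr m1" "arr m2" "dom m1 = dom m2" "cod m1 = x" "cod m2 = Y"
   "epi m1" "mono m2"
 shows "f (sub (tup m1 m2)) = 0" using f
proof (induction rule: thru.induct)
 case (thru_step f z h h')
 then show ?case using cp_low_eval[OF _ _ o _ r(1-6)] PS_obj r(7,8) by (simp only: fun_apply) simp
qed (simp only: fun_apply)

text \<open>Composing with a mono is injective on subobjects, so no two coefficients are
  merged.\<close>

lemma push_eval:
 assumes k: "mono k" and s: "s : Sub (dom k)"
 shows "push k v (sub (k**rep s)) = v s"
proof -
 have "vec (k**rep s') (sub (k**rep s)) = (if s' = s then 1 else 0)" if s': "s' : Sub (dom k)" for s'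
 proof -
  have km: "mono (k**rep s')" using s' k by (auto intro: mono_comp)
  have "sub (k**rep s) = sub (k**rep s') \<longleftrightarrow> s' = s" using inj_onD[OF push_inj[OF k] _ s s'] by auto
  then show ?thesis by (simp add: vec_mono[OF km] basis_vec_def)
 qed
 then have "push k v (sub (k**rep s)) = (SUM s':Sub (dom k). if s' = s then v s' else 0)"
  unfolding push_def by (auto simp: sum_fun_eval fsc_apply intro!: sum.cong)
 then show ?thesis using s k by simp
qed

lemma push_eval':
 assumes k: "mono k" and m: "mono m" "cod m = dom k"
 shows "push k v (sub (k**m)) = v (sub m)"
proof -
 obtain i where i: "iso i" "dom i = dom (rep (sub m))" "cod i = dom m" "m**i = rep (sub m)" using rep_sub_of_iso[OF m(1)] .
 have "sub ((k**m)**i) = sub (k**m)" by (rule sub_of_comp_iso) (use mono_comp[OF m(1) k] m k i in auto)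
 also have "(k**m)**i = k**rep (sub m)" unfolding i(4)[symmetric] by (rule comp_assoc) (use m k i in auto)
 finally show ?thesis using push_eval[OF k, of "sub m" v] m by simp
qed

lemma al_mono:
 assumes "obj x" "obj y" "obj z" shows "mono (al x y z)" "mono (be x y z)"
proof -
 let ?p1 = "pr1 x (prd y z)" and ?p = "pr2 x (prd y z)"
 have "mono (t3 ?p1 (pr1 y z**?p) (pr2 y z**?p))" using assms by (subst t3_mono_iff(1)[symmetric]) (auto simp flip: tuple_comp)
 then show "mono (al x y z)" by (simp add: al_def Let_def)
 let ?p1 = "pr1 y (prd x z)" and ?p = "pr2 y (prd x z)"
 have "mono (t3 (pr1 x z**?p) ?p1 (pr2 x z**?p))" using assms by (subst t3_mono_iff(2)[symmetric]) (auto simp flip: tuple_comp)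
 then show "mono (be x y z)" by (simp add: be_def Let_def)
qed

lemma ternary_obtain:
 assumes r: "r : Sub (prd (prd x y) z)" and o: "obj x" "obj y" "obj z"
 obtains a b c where "arr a" "arr b" "arr c" "dom a = dom b" "dom c = dom b"
  "cod a = x" "cod b = y" "cod c = z" "mono (t3 a b c)" "sub (t3 a b c) = r"
  "r : ternary_set C x y z \<longleftrightarrow> Tc a b c"
proof -
 note s = rep_Sub[OF r]
 obtain a b c where a: "t3 a b c = rep r" "arr a" "arr b" "arr c" "dom a = dom (rep r)" "dom b = dom (rep r)" "dom c = dom (rep r)"
  "cod a = x" "cod b = y" "cod c = z" by (rule t3_obtain[of "rep r" x y z]) (use s o in auto)
 then show ?thesis using that[of a b c] ternary_set_Tc[OF r] s by simp
qed

text \<open>With the idempotents of simple objects as p, q and w, this operator on morphisms from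
  \<open>[x]\<close> tensor \<open>[y]\<close> to \<open>[z]\<close> is the projector whose rank is
  the multiplicity.\<close>

definition Th :: "'o => 'o => 'o => ('m set => 'k) => ('m set => 'k) => ('m set => 'k) => ('m set => 'k) => 'm set => 'k" where
 "Th x y z p q w m = cp (prd x y) z z w (cp (prd x y) (prd x y) z m (ten0 x x y y p q))"

text \<open>The six conditions for T form three pairs: one leg is surjective and the other two are
  jointly monic. Each pair is what \<open>vec_factor\<close> yields when the triple product is split
  into that factor and the product of the other two. If a pair fails, the relation factors through a
  proper subquotient of the factor, and the upper projector on that factor kills it.\<close>

lemma Th_zero:
 assumes r: "r : Sub (prd (prd x y) z)" "r ~: ternary_set C x y z"
  and l: "lowid x ex" "lowid y ey" "lowid z ez" and o: "obj x" "obj y" "obj z"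
 shows "Th x y z (id0 x - ex) (id0 y - ey) (id0 z - ez) (basis_vec r) = 0"
proof -
 obtain a b c where a: "arr a" "arr b" "arr c" "dom a = dom b" "dom c = dom b"
  "cod a = x" "cod b = y" "cod c = z" "mono (t3 a b c)" "sub (t3 a b c) = r"
  "r : ternary_set C x y z \<longleftrightarrow> Tc a b c" using ternary_obtain[OF r(1) o] .
 note X = lowid_facts[OF l(1) o(1)] and Y = lowid_facts[OF l(2) o(2)] and Z = lowid_facts[OF l(3) o(3)]
 let ?X = "prd x y" let ?P = "ten0 x x y y (id0 x - ex) (id0 y - ey)"
 have XO: "obj ?X" "obj (prd y z)" "obj (prd x z)" using o by auto
 have P: "?P : hom0 ?X ?X" using X(2) Y(2) o by (intro ten0_hom0)
 have rv: "basis_vec r = vec (t3 a b c)" using vec_mono[OF a(9)] a(10) by simp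
 have ip: "cx x (id0 x) (id0 x - ex) = id0 x - ex" "cp y y y (id0 y) (id0 y - ey) = id0 y - ey" using cp_id_left X(2) Y(2) o by auto
 consider "~ (epi c & mono (tup a b))" | "~ (epi a & mono (tup b c))"
  | "~ (epi b & mono (tup a c))" using r(2) a(11) by (auto simp: Tc_def)
 then show ?thesis
 proof cases
  case 1
  obtain w h h' where w: "subq w ?X" "subq w z" "h : hom0 ?X w" "h' : hom0 w z"
   "vec (tup (tup a b) c) = cp ?X w z h' h" "csz z <= csz w ==> mono (tup a b) & epi c"
   by (rule vec_factor[of "tup a b" c ?X z]) (use a in \<open>auto simp: t3_def\<close>)
  have wz: "w : PS z" using w(6) 1 by (intro PSI[OF w(2)]) auto
  note wo = PS_obj[OF wz]
  have "cp ?X z z (id0 z - ez) (cp ?X ?X z (cp ?X w z h' h) ?P) = cp ?X z z (id0 z - ez) (cp ?X w z h' (cp ?X ?X w h ?P))"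
   using cp_assoc[OF P w(3,4) XO(1) XO(1) wo o(3)] by simp
  also have "... = cp ?X w z (cp w z z (id0 z - ez) h') (cp ?X ?X w h ?P)" by (rule cp_assoc[OF cp_hom0[OF P w(3)] w(4) Z(2)]) (use XO wo o in auto)
  also have "... = 0" using Z(5)[OF wz w(4)] by simp
  finally show ?thesis unfolding Th_def rv t3_def w(5) .
 next
  case 2
  obtain w h h' where w: "subq w x" "subq w (prd y z)" "h : hom0 x w" "h' : hom0 w (prd y z)"
   "vec (tup a (tup b c)) = cp x w (prd y z) h' h" "csz x <= csz w ==> epi a & mono (tup b c)"
   by (rule vec_factor[of a "tup b c" x "prd y z"]) (use a t3_mono_perm in auto)
  have wz: "w : PS x" using w(6) 2 by (intro PSI[OF w(1)]) auto
  note wo = PS_obj[OF wz]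
  have "vec (t3 a b c) = push (al x y z) (vec (tup a (tup b c)))" using a o by (subst push_vec) (auto simp: al_tuple)
  also have "... = cp ?X (prd w y) z (push (al w y z) h') (ten0 x w y y h (id0 y))" unfolding w(5) by (rule push_al_comp[OF w(3,4) o wo])
  finally have v: "vec (t3 a b c) = cp ?X (prd w y) z (push (al w y z) h') (ten0 x w y y h (id0 y))" .
  have "cp ?X ?X (prd w y) (ten0 x w y y h (id0 y)) ?P = ten0 x w y y (cp x x w h (id0 x - ex)) (cp y y y (id0 y) (id0 y - ey))"
   by (rule ten0_cp[symmetric]) (use X(2) Y(2) w(3) o wo id0_hom0 in auto)
  also have "... = 0" using X(6)[OF wz w(3)] by simp
  finally have z: "cp ?X ?X (prd w y) (ten0 x w y y h (id0 y)) ?P = 0" .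
  have "cp ?X ?X z (vec (t3 a b c)) ?P = cp ?X (prd w y) z (push (al w y z) h') (cp ?X ?X (prd w y) (ten0 x w y y h (id0 y)) ?P)"
   unfolding v by (rule cp_assoc[symmetric]) (use P w(3) ten0_hom0 id0_hom0 push_hom0 o wo XO in auto)
  then show ?thesis unfolding Th_def rv by (simp add: z)
 next
  case 3
  obtain w h h' where w: "subq w y" "subq w (prd x z)" "h : hom0 y w" "h' : hom0 w (prd x z)"
   "vec (tup b (tup a c)) = cp y w (prd x z) h' h" "csz y <= csz w ==> epi b & mono (tup a c)"
   by (rule vec_factor[of b "tup a c" y "prd x z"]) (use a t3_mono_perm in auto)
  have wz: "w : PS y" using w(6) 3 by (intro PSI[OF w(1)]) auto
  note wo = PS_obj[OF wz]
  have "vec (t3 a b c) = push (be x y z) (vec (tup b (tup a c)))" using a o by (subst push_vec) (auto simp: be_tuple)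
  also have "... = cp ?X (prd x w) z (push (be x w z) h') (ten0 x x y w (id0 x) h)" unfolding w(5) by (rule push_be_comp[OF w(3,4) o wo])
  finally have v: "vec (t3 a b c) = cp ?X (prd x w) z (push (be x w z) h') (ten0 x x y w (id0 x) h)" .
  have "cp ?X ?X (prd x w) (ten0 x x y w (id0 x) h) ?P = ten0 x x y w (cx x (id0 x) (id0 x - ex)) (cp y y w h (id0 y - ey))"
   by (rule ten0_cp[symmetric]) (use X(2) Y(2) w(3) o wo id0_hom0 in auto)
  also have "... = 0" using Y(6)[OF wz w(3)] by simp
  finally have z: "cp ?X ?X (prd x w) (ten0 x x y w (id0 x) h) ?P = 0" .
  have "cp ?X ?X z (vec (t3 a b c)) ?P = cp ?X (prd x w) z (push (be x w z) h') (cp ?X ?X (prd x w) (ten0 x x y w (id0 x) h) ?P)"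
   unfolding v by (rule cp_assoc[symmetric]) (use P w(3) ten0_hom0 id0_hom0 push_hom0 o wo XO in auto)
  then show ?thesis unfolding Th_def rv by (simp add: z)
 qed
qed

end

section \<open>The operator on T and its trace\<close>

context mal_category
begin

text \<open>Replacing an upper projector by the identity changes the morphism by one through proper
  subquotients of one factor. Such a morphism has coefficient zero at a relation in T, which seen
  from that factor has a surjective leg and a monic opposite leg.\<close>

lemma Th_diag:
 assumes r: "r : ternary_set C x y z" and m: "m : hom0 (prd x y) z"
  and l: "lowid x ex" "lowid y ey" "lowid z ez" and o: "obj x" "obj y" "obj z"
 shows "Th x y z (id0 x - ex) (id0 y - ey) (id0 z - ez) m r = m r"
proof -
 have rS: "r : Sub (prd (prd x y) z)" using r by (simp add: ternary_set_def prd3_def)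
 obtain a b c where a: "arr a" "arr b" "arr c" "dom a = dom b" "dom c = dom b"
  "cod a = x" "cod b = y" "cod c = z" "mono (t3 a b c)" "sub (t3 a b c) = r"
  "r : ternary_set C x y z \<longleftrightarrow> Tc a b c" using ternary_obtain[OF rS o] .
 have T: "epi a" "epi b" "epi c" "mono (tup a b)" "mono (tup a c)" "mono (tup b c)" using a(11) r by (auto simp: Tc_def)
 note X = lowid_facts[OF l(1) o(1)] and Y = lowid_facts[OF l(2) o(2)] and Z = lowid_facts[OF l(3) o(3)]
 let ?X = "prd x y" let ?px = "id0 x - ex" and ?py = "id0 y - ey"
 let ?P = "ten0 x x y y ?px ?py"
 have XO: "obj ?X" "obj (prd y z)" "obj (prd x z)" using o by auto
 have P: "?P : hom0 ?X ?X" using X(2) Y(2) o by (intro ten0_hom0)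
 have th: "ex : thru (PS x) x x" "ey : thru (PS y) y y" "ez : thru (PS z) z z" using l by (auto simp: lowid_def)
 have Z0: "cp ?X z z ez k r = 0" if "k : hom0 ?X z" for k
  using thru_eval_left[OF thru_right[OF th(3) that o(3,3) XO(1)] XO(1) o(3), of "tup a b" c] a T by (auto simp: t3_def)
 have A0: "cp ?X ?X z k (ten0 x x y y ex (id0 y)) r = 0" if k: "k : hom0 ?X z" for k
 proof -
  obtain k' where k': "k' : hom0 x (prd y z)" "k = push (al x y z) k'" using push_al_surj[OF k o] .
  have "cp x x (prd y z) k' ex (sub (tup a (tup b c))) = 0" by (rule thru_eval_right[OF thru_left[OF th(1) k'(1) o(1,1) XO(2)] o(1) XO(2)])
    (use a T t3_mono_perm in auto)
  moreover have "cp ?X ?X z k (ten0 x x y y ex (id0 y)) = push (al x y z) (cp x x (prd y z) k' ex)"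
   unfolding k'(2) by (rule push_al_comp[OF X(1) k'(1) o o(1), symmetric])
  moreover have "push (al x y z) (cp x x (prd y z) k' ex) (sub (al x y z**tup a (tup b c)))
   = cp x x (prd y z) k' ex (sub (tup a (tup b c)))" by (rule push_eval') (use a al_mono o t3_mono_perm in auto)
  moreover have "al x y z**tup a (tup b c) = t3 a b c" using a by (intro al_tuple) auto
  ultimately show ?thesis using a(10) by simp
 qed
 have B0: "cp ?X ?X z k (ten0 x x y y (id0 x) ey) r = 0" if k: "k : hom0 ?X z" for k
 proof -
  obtain k' where k': "k' : hom0 y (prd x z)" "k = push (be x y z) k'" using push_be_surj[OF k o] .
  have "cp y y (prd x z) k' ey (sub (tup b (tup a c))) = 0" by (rule thru_eval_right[OF thru_left[OF th(2) k'(1) o(2,2) XO(3)] o(2) XO(3)])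
    (use a T t3_mono_perm in auto)
  moreover have "cp ?X ?X z k (ten0 x x y y (id0 x) ey) = push (be x y z) (cp y y (prd x z) k' ey)"
   unfolding k'(2) by (rule push_be_comp[OF Y(1) k'(1) o o(2), symmetric])
  moreover have "push (be x y z) (cp y y (prd x z) k' ey) (sub (be x y z**tup b (tup a c)))
   = cp y y (prd x z) k' ey (sub (tup b (tup a c)))" by (rule push_eval') (use a al_mono o t3_mono_perm in auto)
  moreover have "be x y z**tup b (tup a c) = t3 a b c" using a by (intro be_tuple) auto
  ultimately show ?thesis using a(10) by simp
 qed
 have p: "id0 x = ?px + ex" "id0 y = ?py + ey" by simp_all
 have mi: "ten0 x x y y (id0 x) (id0 y) = id0 ?X" by (rule ten0_id0[OF o(1,2)])
 \<comment> \<open>Telescoping: the identity is a term with \<open>ex\<close> in the first factor, a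
   term with \<open>ey\<close> in the second, and the product of the upper projectors. The middle
   term is rewritten as a composite so that \<open>B0\<close> applies to it.\<close>
 have "ten0 x x y y (id0 x) (id0 y) = ten0 x x y y ex (id0 y) + ten0 x x y y ?px (id0 y)" unfolding ten0_add_left[symmetric] by simp
 also have "ten0 x x y y ?px (id0 y) = ten0 x x y y ?px ey + ?P" unfolding ten0_add_right[symmetric] by simp
 also have "ten0 x x y y ?px ey = cp ?X ?X ?X (ten0 x x y y ?px (id0 y)) (ten0 x x y y (id0 x) ey)"
  using ten0_cp[of "id0 x" x x ?px x ey y y "id0 y" y] X(1,2) Y(1,2) o id0_hom0 cp_id_left cp_id_right by simp
 finally have idX: "id0 ?X = ten0 x x y y ex (id0 y) + (cp ?X ?X ?X (ten0 x x y y ?px (id0 y)) (ten0 x x y y (id0 x) ey) + ?P)" unfolding mi .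
 have h: "ten0 x x y y ?px (id0 y) : hom0 ?X ?X" "ten0 x x y y (id0 x) ey : hom0 ?X ?X" using X(2) Y(1) o id0_hom0 by (auto intro!: ten0_hom0)
 have mP: "cp ?X ?X z m ?P : hom0 ?X z" using cp_hom0[OF P m] XO o by simp
 have "m = cp ?X ?X z m (id0 ?X)" using cp_id_right m XO o by simp
 also have "... = cp ?X ?X z m (ten0 x x y y ex (id0 y)) +
  (cp ?X ?X z (cp ?X ?X z m (ten0 x x y y ?px (id0 y))) (ten0 x x y y (id0 x) ey) + cp ?X ?X z m ?P)"
  unfolding idX cp_add_right using cp_assoc[OF h(2,1) m] XO o by simp
 finally have M: "m = cp ?X ?X z m (ten0 x x y y ex (id0 y)) +
  (cp ?X ?X z (cp ?X ?X z m (ten0 x x y y ?px (id0 y))) (ten0 x x y y (id0 x) ey) + cp ?X ?X z m ?P)" .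
 have aux: "f = g + (h + k) ==> f r = g r + (h r + k r)" for f g h k :: "'m set => 'k" by (simp add: plus_fun_apply)
 have "m r = 0 + (0 + cp ?X ?X z m ?P r)" using aux[OF M] unfolding A0[OF m] B0[OF cp_hom0[OF h(1) m XO(1,1) o(3)]] .
 moreover have "Th x y z ?px ?py (id0 z - ez) m r = cp ?X ?X z m ?P r - cp ?X z z ez (cp ?X ?X z m ?P) r"
  unfolding Th_def cp_minus_left using cp_id_left[OF mP XO(1) o(3)] by (simp add: minus_apply)
 ultimately show ?thesis using Z0[OF mP] by simp
qed

text \<open>Precomposition moves legs by the inverse automorphism, postcomposition by the
  automorphism itself; hence the mixed triple in \<open>r'\<close>.\<close>

lemma action_operator:
 assumes g: "g1 : AA x" "g2 : AA y" "g3 : AA z" and o: "obj x" "obj y" "obj z"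
  and r: "r : Sub (prd (prd x y) z)"
 defines "r' == ternary_action C x y z (iv x g1, iv y g2, g3) r"
 shows "Th x y z (gr g1) (gr g2) (gr g3) (basis_vec r) = basis_vec r'"
  "r' : Sub (prd (prd x y) z)" "r' : ternary_set C x y z \<longleftrightarrow> r : ternary_set C x y z"
proof -
 obtain a b c where a: "arr a" "arr b" "arr c" "dom a = dom b" "dom c = dom b"
  "cod a = x" "cod b = y" "cod c = z" "mono (t3 a b c)" "sub (t3 a b c) = r"
  "r : ternary_set C x y z \<longleftrightarrow> Tc a b c" using ternary_obtain[OF r o] .
 note i1 = A_inv[OF o(1) g(1)] and i2 = A_inv[OF o(2) g(2)] and i3 = A_inv[OF o(3) g(3)]
 let ?h1 = "iv x g1" and ?h2 = "iv y g2" and ?h3 = "iv z g3"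
 have d: "iso g1" "iso g2" "iso g3" "arr g1" "arr g2" "arr g3" "dom g1 = x" "cod g1 = x"
  "dom g2 = y" "cod g2 = y" "dom g3 = z" "cod g3 = z"
  "arr ?h1" "arr ?h2" "arr ?h3" "dom ?h1 = x" "cod ?h1 = x" "dom ?h2 = y" "cod ?h2 = y" "dom ?h3 = z" "cod ?h3 = z"
  using g i1(1) i2(1) i3(1) by (auto simp: A_iff)
 have inv2: "u**(v**k) = k" if "u**v = ide (cod k)" "arr u" "arr v" "arr k" "cod v = dom u" "cod k = dom v" for u v k
 proof -
  have "u**(v**k) = (u**v)**k" by (rule sym, rule comp_assoc) (use that in auto)
  then show ?thesis using that by simp
 qed
 have inv': "g1**(?h1**a) = a" "g2**(?h2**b) = b" "?h3**(g3**c) = c" by (rule inv2; use i1(2,3) i2(2,3) i3(2,3) d a in simp)+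
 have s: "mono (t3 (?h1**a) (?h2**b) (g3**c))" "r' = sub (t3 (?h1**a) (?h2**b) (g3**c))"
  "Tc a b c ==> Tc (?h1**a) (?h2**b) (g3**c)" using ternary_action_sub_of[OF a(9,1-8) i1(1) i2(1) g(3)] a(10) by (auto simp: r'_def)
 have ar: "arr (?h1**a)" "arr (?h2**b)" "arr (g3**c)" "dom (?h1**a) = dom (?h2**b)" "dom (g3**c) = dom (?h2**b)"
  "cod (?h1**a) = x" "cod (?h2**b) = y" "cod (g3**c) = z" using a d by auto
 have "Tc (?h1**a) (?h2**b) (g3**c) ==> Tc a b c" using ternary_action_sub_of(3)[OF s(1) ar g(1,2) i3(1)] unfolding inv' .
 then show "r' : ternary_set C x y z \<longleftrightarrow> r : ternary_set C x y z" using s(3) a(11) ternary_set_sub_of[OF s(1) ar] s(2) by blast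
 show "r' : Sub (prd (prd x y) z)" unfolding s(2) using s(1) ar by (intro sub_of_Sub) auto
 let ?X = "prd x y"
 have G: "ten0 x x y y (gr g1) (gr g2) = gr (prodm g1 g2)" unfolding gr_def using d o by (subst ten0_vec) (auto simp: prodm_ide)
 have jj: "prodm ?h1 ?h2**prodm g1 g2 = ide ?X" "prodm g1 g2**prodm ?h1 ?h2 = ide ?X" using d i1 i2 o by (simp_all add: prodm_comp prodm_ide)
 have iso: "iso (prodm g1 g2)" by (rule isoI[of _ "prodm ?h1 ?h2"]) (use d jj in auto)
 have "cp ?X ?X z (vec (tup (tup a b) c)) (gr (prodm g1 g2)) = vec (tup (prodm ?h1 ?h2**tup a b) c)" by (rule gr_pre[OF iso]) (use d a jj in auto)
 also have "prodm ?h1 ?h2**tup a b = tup (?h1**a) (?h2**b)" using d a by (simp add: prodm_tuple)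
 finally have "cp ?X ?X z (basis_vec r) (ten0 x x y y (gr g1) (gr g2)) = vec (tup (tup (?h1**a) (?h2**b)) c)"
  using vec_mono[OF a(9)] a(10) by (simp add: t3_def G)
 then have "Th x y z (gr g1) (gr g2) (gr g3) (basis_vec r) = cp ?X z z (gr g3) (vec (tup (tup (?h1**a) (?h2**b)) c))" by (simp add: Th_def)
 also have "... = vec (tup (tup (?h1**a) (?h2**b)) (g3**c))" by (rule gr_post) (use d a in auto)
 finally show "Th x y z (gr g1) (gr g2) (gr g3) (basis_vec r) = basis_vec r'" using vec_mono[OF s(1)] s(2) by (simp add: t3_def)
qed

lemma Th_comp:
 assumes "m : hom0 (prd x y) z" "p : hom0 x x" "p' : hom0 x x" "q : hom0 y y" "q' : hom0 y y" "w : hom0 z z" "w' : hom0 z z"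
  and o: "obj x" "obj y" "obj z"
 shows "Th x y z (cx x p' p) (cp y y y q' q) (cp z z z w w') m = Th x y z p q w (Th x y z p' q' w' m)"
proof -
 let ?X = "prd x y"
 have X: "obj ?X" using o by simp
 have t: "ten0 x x y y p q : hom0 ?X ?X" "ten0 x x y y p' q' : hom0 ?X ?X" using assms by (auto intro!: ten0_hom0)
 have e: "ten0 x x y y (cx x p' p) (cp y y y q' q) = cp ?X ?X ?X (ten0 x x y y p' q') (ten0 x x y y p q)" using assms by (intro ten0_cp)
 have m1: "cp ?X ?X z m (ten0 x x y y p' q') : hom0 ?X z" (is "?m1 : _") using cp_hom0[OF t(2) assms(1) X X o(3)] .
 have "Th x y z p q w (Th x y z p' q' w' m) = cp ?X z z w (cp ?X z z w' (cp ?X ?X z ?m1 (ten0 x x y y p q)))"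
  unfolding Th_def using cp_assoc[OF t(1) m1 assms(7) X X o(3,3)] by simp
 also have "... = cp ?X z z (cp z z z w w') (cp ?X ?X z ?m1 (ten0 x x y y p q))"
  by (rule cp_assoc[OF cp_hom0[OF t(1) m1 X X o(3)] assms(7,6) X o(3,3,3)])
 finally show ?thesis unfolding Th_def e cp_assoc[OF t(1,2) assms(1) X X X o(3)] ..
qed

lemma Th_hom0: "m : hom0 (prd x y) z ==> p : hom0 x x ==> q : hom0 y y ==> w : hom0 z z ==> obj x ==> obj y ==> obj z ==>
 Th x y z p q w m : hom0 (prd x y) z" unfolding Th_def by (auto intro!: cp_hom0 ten0_hom0)

text \<open>In the basis of relations the operator is the permutation action followed by a projector
  that kills relations outside T (\<open>Th_zero\<close>) and preserves coefficients inside T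
  (\<open>Th_diag\<close>). A diagonal entry is therefore 1 at the fixed points in T and 0
  elsewhere.\<close>

lemma Th_trace:
 assumes g: "g1 : AA x" "g2 : AA y" "g3 : AA z" and o: "obj x" "obj y" "obj z"
  and l: "lowid x ex" "lowid y ey" "lowid z ez"
 shows "(SUM r:Sub (prd (prd x y) z). Th x y z (cx x (id0 x - ex) (gr g1)) (cp y y y (id0 y - ey) (gr g2))
   (cp z z z (id0 z - ez) (gr g3)) (basis_vec r) r) = ternary_char C x y z (iv x g1, iv y g2, g3)"
proof -
 let ?S = "Sub (prd (prd x y) z)" and ?T = "ternary_set C x y z"
 let ?p = "id0 x - ex" and ?q = "id0 y - ey" and ?w = "id0 z - ez"
 let ?act = "ternary_action C x y z (iv x g1, iv y g2, g3)"
 note X = lowid_facts[OF l(1) o(1)] and Y = lowid_facts[OF l(2) o(2)] and Z = lowid_facts[OF l(3) o(3)]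
 have "Th x y z (cx x ?p (gr g1)) (cp y y y ?q (gr g2)) (cp z z z ?w (gr g3)) (basis_vec r) r
  = (if r : ?T & ?act r = r then 1 else 0)" if r: "r : ?S" for r
 proof -
  note act = action_operator[OF g o r]
  have "Th x y z (cx x ?p (gr g1)) (cp y y y ?q (gr g2)) (cp z z z ?w (gr g3)) (basis_vec r)
   = Th x y z ?p ?q ?w (basis_vec (?act r))" unfolding X(9)[OF g(1)] Y(9)[OF g(2)] act(1)[symmetric]
   by (rule Th_comp) (use basis_hom0 r X(2) Y(2) Z(2) g gr_A o in auto)
  moreover have "Th x y z ?p ?q ?w (basis_vec (?act r)) r = (if r : ?T & ?act r = r then 1 else 0)"
  proof (cases "r : ?T")
   case True
   then show ?thesis using Th_diag[OF True basis_hom0[OF act(2)] l o] by (simp add: basis_vec_def)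
  next
   case False
   then show ?thesis using Th_zero[OF act(2) _ l o] act(3) by (simp only: fun_apply) (simp add: fun_apply)
  qed
  ultimately show ?thesis by simp
 qed
 then have "(SUM r:?S. Th x y z (cx x ?p (gr g1)) (cp y y y ?q (gr g2)) (cp z z z ?w (gr g3)) (basis_vec r) r)
  = (SUM r:?S. if r : ?T & ?act r = r then 1 else 0)" by (rule sum.cong[OF refl])
 also have "... = of_nat (card {r : ?T. ?act r = r})"
 proof -
  have "?S \<inter> {r. r : ?T & ?act r = r} = {r : ?T. ?act r = r}" by (auto simp: ternary_set_def prd3_def)
  then show ?thesis using o by (simp add: sum.If_cases)
 qed
 finally show ?thesis by (simp add: ternary_char_def perm_char_def)
qed

end

section \<open>Representations of finite groups\<close>

lemma irreducible_repD:
 fixes rho :: "'g => 'k::field mat"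
 assumes "irreducible_rep G d rho"
 shows "matrix_rep G d rho" "d > 0"
  "!!W. W <= carrier_vec d ==> 0\<^sub>v d : W ==> (!!u v. u : W ==> v : W ==> u + v : W) ==>
   (!!c v. v : W ==> c \<cdot>\<^sub>v v : W) ==> (!!g v. g : carrier G ==> v : W ==> rho g *\<^sub>v v : W) ==>
   W = {0\<^sub>v d} | W = carrier_vec d"
proof -
 show "matrix_rep G d rho" "d > 0" using assms by (auto simp: irreducible_rep_def)
 fix W :: "'k vec set"
 assume W: "W <= carrier_vec d" "0\<^sub>v d : W" "!!u v. u : W ==> v : W ==> u + v : W"
  "!!c v. v : W ==> c \<cdot>\<^sub>v v : W" "!!g v. g : carrier G ==> v : W ==> rho g *\<^sub>v v : W"
 have "VectorSpace.subspace class_ring W (module_vec TYPE('k) d)"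
  using W vec_vs[of d, where 'a = 'k] vec_module[of d, where 'a = 'k] by (auto simp: VectorSpace.subspace_def submodule_def module_vec_simps)
 then show "W = {0\<^sub>v d} | W = carrier_vec d" using assms W(5) by (auto simp: irreducible_rep_def)
qed

locale fin_group = group G for G :: "('g, 'b) monoid_scheme" (structure) +
 assumes fin: "finite (carrier G)"
begin

lemma sum_left: "h : carrier G ==> (SUM g:carrier G. phi (h \<otimes> g)) = (SUM g:carrier G. phi g)"
 by (rule sum.reindex_bij_witness[of _ "%g. inv h \<otimes> g" "%g. h \<otimes> g"]) (auto simp: m_assoc[symmetric])

lemma sum_conj: "h : carrier G ==> (SUM g:carrier G. phi (h \<otimes> g \<otimes> inv h)) = (SUM g:carrier G. phi g)"
 by (rule sum.reindex_bij_witness[of _ "%g. inv h \<otimes> g \<otimes> h" "%g. h \<otimes> g \<otimes> inv h"])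
  (auto simp: m_assoc inv_solve_left, simp_all add: m_assoc[symmetric])

lemma sum_inv: "(SUM g:carrier G. phi (inv g)) = (SUM g:carrier G. phi g)" by (rule sum.reindex_bij_witness[of _ "%g. inv g" "%g. inv g"]) auto

lemma order_pos: "Coset.order G > 0" using fin by (simp add: order_gt_0_iff_finite)

lemma rep_mult:
 assumes "matrix_rep G d rho" "g : carrier G" "h : carrier G" "i < d" "j < d"
 shows "rho (g \<otimes> h) $$ (i, j) = (SUM k<d. rho g $$ (i, k) * rho h $$ (k, j))"
proof -
 have "rho g : carrier_mat d d" "rho h : carrier_mat d d" "rho (g \<otimes> h) = rho g * rho h" using assms by (auto simp: matrix_rep_def)
 then show ?thesis using assms(4,5) by (simp add: scalar_prod_def lessThan_atLeast0)
qed

lemma rep_one: "matrix_rep G d rho ==> i < d ==> j < d ==> rho \<one> $$ (i, j) = (if i = j then 1 else 0)" by (simp add: matrix_rep_def)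

lemma rep_char_eq: "matrix_rep G d rho ==> g : carrier G ==> rep_char G rho g = (SUM i<d. rho g $$ (i, i))"
 by (auto simp: rep_char_def diag_mat_def matrix_rep_def interv_sum_list_conv_sum_set_nat lessThan_atLeast0)

lemma rep_char_one: "matrix_rep G d rho ==> rep_char G rho \<one> = of_nat d" by (simp add: rep_char_eq rep_one)

text \<open>Intertwiners are bare coefficient functions with two explicit sizes, so that all
  identities are finite sums over indices without carrier conditions.\<close>

definition intertw :: "nat => ('g => 'k::field mat) => nat => ('g => 'k mat) => (nat => nat => 'k) => bool" where
 "intertw d rho d' rho' t \<longleftrightarrow> (ALL g : carrier G. ALL i<d'. ALL j<d.
  (SUM k<d'. rho' g $$ (i, k) * t k j) = (SUM k<d. t i k * rho g $$ (k, j)))"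

lemma rep_vec: "matrix_rep G d rho ==> g : carrier G ==> v : carrier_vec d ==> k < d ==>
  (rho g *\<^sub>v v) $ k = (SUM j<d. rho g $$ (k, j) * v $ j)" by (auto simp: matrix_rep_def scalar_prod_def lessThan_atLeast0)

lemma rep_vec_carrier: "matrix_rep G d rho ==> g : carrier G ==> v : carrier_vec d ==> rho g *\<^sub>v v : carrier_vec d"
 by (auto simp: matrix_rep_def)

text \<open>The kernel of an intertwiner is an invariant subspace of the irreducible source.\<close>

lemma kernel_cases:
 assumes i: "irreducible_rep G d rho" and r: "matrix_rep G d' rho'" and t: "intertw d rho d' rho' t"
 shows "(ALL i<d'. ALL j<d. t i j = 0) | (ALL v. (ALL i<d'. (SUM k<d. t i k * v k) = 0) --> (ALL k<d. v k = 0))"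
proof -
 note i' = irreducible_repD[OF i]
 let ?W = "{v : carrier_vec d. ALL i<d'. (SUM k<d. t i k * v $ k) = 0}"
 have "?W = {0\<^sub>v d} | ?W = carrier_vec d"
 proof (rule i'(3))
  show "u + v : ?W" if "u : ?W" "v : ?W" for u v using that by (auto simp: ring_distribs sum.distrib)
  show "c \<cdot>\<^sub>v v : ?W" if "v : ?W" for c v using that by (auto simp: mult.left_commute[of _ c] sum_distrib_left[symmetric])
  fix g v assume g: "g : carrier G" and v: "v : ?W"
  have "(SUM k<d. t i k * (rho g *\<^sub>v v) $ k) = 0" if "i < d'" for i
  proof -
   have "(SUM k<d. t i k * (rho g *\<^sub>v v) $ k) = (SUM j<d. (SUM k<d. t i k * rho g $$ (k, j)) * v $ j)"
    using v by (simp add: rep_vec[OF i'(1) g] sum_distrib_left sum_distrib_right mult.assoc) (rule sum.swap)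
   also have "... = (SUM j<d. (SUM k<d'. rho' g $$ (i, k) * t k j) * v $ j)" using t g that by (intro sum.cong) (auto simp: intertw_def)
   also have "... = (SUM k<d'. rho' g $$ (i, k) * (SUM j<d. t k j * v $ j))"
    by (simp add: sum_distrib_left sum_distrib_right mult.assoc) (rule sum.swap)
   finally show ?thesis using v by simp
  qed
  then show "rho g *\<^sub>v v : ?W" using rep_vec_carrier[OF i'(1) g] v by simp
 qed auto
 then show ?thesis
 proof
  assume a: "?W = {0\<^sub>v d}"
  have "v k = 0" if v: "ALL i<d'. (SUM k<d. t i k * v k) = 0" "k < d" for v k
  proof -
   have "vec d v : ?W" using v by simp
   then have "vec d v = 0\<^sub>v d" using a by blast
   then have "vec d v $ k = 0\<^sub>v d $ k" by simp
   then show ?thesis using v(2) by simp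
  qed
  then show ?thesis by blast
 next
  assume a: "?W = carrier_vec d"
  have "t i j = 0" if "i < d'" "j < d" for i j
  proof -
   have "unit_vec d j : ?W" using a by simp
   then have "(SUM k<d. t i k * unit_vec d j $ k) = 0" using that by blast
   then show ?thesis using that by (simp add: unit_vec_def if_distrib[of "%x. _ * x"] cong: if_cong)
  qed
  then show ?thesis by blast
 qed
qed

text \<open>The image of an intertwiner is an invariant subspace of the irreducible target.\<close>

lemma image_cases:
 assumes i: "irreducible_rep G d' rho'" and r: "matrix_rep G d rho" and t: "intertw d rho d' rho' t"
 shows "(ALL i<d'. ALL j<d. t i j = 0) | (ALL v. EX u. ALL i<d'. (SUM k<d. t i k * u k) = v i)"
proof -
 note i' = irreducible_repD[OF i]
 let ?W = "{v : carrier_vec d'. EX u. ALL i<d'. v $ i = (SUM k<d. t i k * u k)}"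
 have "?W = {0\<^sub>v d'} | ?W = carrier_vec d'"
 proof (rule i'(3))
  have "ALL i<d'. 0\<^sub>v d' $ i = (SUM k<d. t i k * 0)" by simp
  then have "EX u. ALL i<d'. 0\<^sub>v d' $ i = (SUM k<d. t i k * u k)" by (rule exI[of _ "%_. 0"])
  then show "0\<^sub>v d' : ?W" by simp
  fix v assume "v : ?W"
  then obtain u where u: "v : carrier_vec d'" "ALL i<d'. v $ i = (SUM k<d. t i k * u k)" by auto
  show "c \<cdot>\<^sub>v v : ?W" for c using u by (auto simp: mult.left_commute[of _ c] sum_distrib_left intro!: exI[of _ "%k. c * u k"])
  show "v + w : ?W" if w: "w : ?W" for w
  proof -
   obtain u' where u': "w : carrier_vec d'" "ALL i<d'. w $ i = (SUM k<d. t i k * u' k)" using w by auto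
   show ?thesis using u u' by (auto simp: ring_distribs sum.distrib intro!: exI[of _ "%k. u k + u' k"])
  qed
  fix g assume g: "g : carrier G"
  have "(rho' g *\<^sub>v v) $ i = (SUM k<d. t i k * (SUM j<d. rho g $$ (k, j) * u j))" if "i < d'" for i
  proof -
   have "(rho' g *\<^sub>v v) $ i = (SUM j<d. (SUM k<d'. rho' g $$ (i, k) * t k j) * u j)"
    using u that by (simp add: rep_vec[OF i'(1) g] sum_distrib_left sum_distrib_right mult.assoc) (rule sum.swap)
   also have "... = (SUM j<d. (SUM k<d. t i k * rho g $$ (k, j)) * u j)" using t g that by (intro sum.cong) (auto simp: intertw_def)
   also have "... = (SUM k<d. t i k * (SUM j<d. rho g $$ (k, j) * u j))" by (simp add: sum_distrib_left sum_distrib_right mult.assoc) (rule sum.swap)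
   finally show ?thesis .
  qed
  then show "rho' g *\<^sub>v v : ?W" using rep_vec_carrier[OF i'(1) g u(1)] by auto
 qed auto
 then show ?thesis
 proof
  assume a: "?W = carrier_vec d'"
  have "EX u. ALL i<d'. (SUM k<d. t i k * u k) = v i" for v
  proof -
   have "vec d' v : ?W" using a by simp
   then obtain u where "ALL i<d'. vec d' v $ i = (SUM k<d. t i k * u k)" by blast
   then show ?thesis by (intro exI[of _ u]) simp
  qed
  then show ?thesis by blast
 next
  assume a: "?W = {0\<^sub>v d'}"
  have "t i j = 0" if ij: "i < d'" "j < d" for i j
  proof -
   have "vec d' (%i. t i j) : ?W" using ij by (auto simp: if_distrib[of "%x. _ * x"] cong: if_cong intro!: exI[of _ "%k. if k = j then 1 else 0"])
   then have "vec d' (%i. t i j) = 0\<^sub>v d'" using a by blast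
   then have "vec d' (%i. t i j) $ i = 0\<^sub>v d' $ i" by simp
   then show ?thesis using ij by simp
  qed
  then show ?thesis by blast
 qed
qed

end

section \<open>Schur's lemma and the orthogonality relations\<close>

context fin_group
begin

text \<open>A nonzero intertwiner is injective and surjective; a right inverse s, chosen column by
  column, is two-sided by injectivity, and conjugate matrices have equal traces. Inequivalence is
  expressed by different characters because the simple objects are indexed by characters.\<close>

lemma intertw_equal_char:
 assumes i: "irreducible_rep G d rho" and i': "irreducible_rep G d' rho'" and t: "intertw d rho d' rho' t"
 shows "(ALL i<d'. ALL j<d. t i j = 0) | rep_char G rho' = rep_char G rho"
proof (rule disjCI)
 note r = irreducible_repD(1)[OF i] irreducible_repD(1)[OF i']
 assume n: "rep_char G rho' ~= rep_char G rho"
 show "ALL i<d'. ALL j<d. t i j = 0"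
 proof (rule ccontr)
  assume nz: "~ ?thesis"
  have "ALL v. (ALL i<d'. (SUM k<d. t i k * v k) = 0) --> (ALL k<d. v k = 0)"
   by (rule disjE[OF kernel_cases[OF i r(2) t]], erule notE[OF nz], assumption)
  then have ker: "v k = 0" if "!!i. i < d' ==> (SUM k<d. t i k * v k) = 0" "k < d" for v k using that by blast
  have im: "ALL v. EX u. ALL i<d'. (SUM k<d. t i k * u k) = v i" by (rule disjE[OF image_cases[OF i' r(1) t]], erule notE[OF nz], assumption)
  have "ALL m. EX u. ALL i<d'. (SUM k<d. t i k * u k) = (if i = m then 1 else 0)" by (rule allI, rule spec[OF im])
  from choice[OF this] obtain s where s': "ALL m. ALL i<d'. (SUM k<d. t i k * s m k) = (if i = m then 1 else 0)" by (rule exE)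
  have s: "(SUM k<d. t i k * s m k) = (if i = m then 1 else 0)" if "i < d'" for i m using s'[rule_format, OF that] .
  have st: "(SUM m<d'. s m k * t m l) = (if k = l then 1 else 0)" if kl: "k < d" "l < d" for k l
  proof -
   have "(SUM m<d'. s m k * t m l) - (if k = l then 1 else 0) = 0"
   proof (rule ker[OF _ kl(1)])
    fix i assume "i < d'"
    have "(SUM k<d. t i k * (SUM m<d'. s m k * t m l)) = (SUM m<d'. (SUM k<d. t i k * s m k) * t m l)"
     by (simp add: sum_distrib_left sum_distrib_right mult.assoc) (rule sum.swap)
    also have "... = t i l" using \<open>i < d'\<close> by (simp add: s if_distrib[of "%x. x * _"] cong: if_cong)
    finally show "(SUM k<d. t i k * ((SUM m<d'. s m k * t m l) - (if k = l then 1 else 0))) = 0"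
     using kl by (simp add: right_diff_distrib sum_subtractf if_distrib[of "%x. _ * x"] cong: if_cong)
   qed
   then show ?thesis by simp
  qed
  have "rep_char G rho' g = rep_char G rho g" if g: "g : carrier G" for g
  proof -
   have "(SUM i<d'. rho' g $$ (i, i)) = (SUM i<d'. SUM k<d'. rho' g $$ (i, k) * (SUM l<d. t k l * s i l))"
    by (intro sum.cong) (auto simp: s if_distrib[of "%x. _ * x"] cong: if_cong)
   also have "... = (SUM i<d'. SUM l<d. (SUM k<d'. rho' g $$ (i, k) * t k l) * s i l)"
    by (simp add: sum_distrib_left sum_distrib_right mult.assoc) (intro sum.cong refl sum.swap)
   also have "... = (SUM i<d'. SUM l<d. (SUM k<d. t i k * rho g $$ (k, l)) * s i l)" using t g by (intro sum.cong refl) (auto simp: intertw_def)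
   also have "... = (SUM l<d. SUM i<d'. SUM k<d. rho g $$ (k, l) * (s i l * t i k))"
    by (simp add: sum_distrib_left sum_distrib_right mult_ac) (rule sum.swap)
   also have "... = (SUM l<d. SUM k<d. rho g $$ (k, l) * (SUM i<d'. s i l * t i k))" by (simp add: sum_distrib_left) (intro sum.cong refl sum.swap)
   also have "... = (SUM l<d. rho g $$ (l, l))" by (intro sum.cong refl) (simp add: st if_distrib[of "%x. _ * x"] cong: if_cong)
   finally show ?thesis using g by (simp add: rep_char_eq[OF r(1)] rep_char_eq[OF r(2)])
  qed
  then have "rep_char G rho' = rep_char G rho" by (intro ext) (auto simp: rep_char_def)
  then show False using n by blast
 qed
qed

text \<open>Subtracting an eigenvalue leaves an intertwiner with nonzero kernel, hence zero.\<close>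

lemma intertw_scalar:
 fixes rho :: "'g => 'k::alg_closed_field mat"
 assumes i: "irreducible_rep G d rho" and t: "intertw d rho d rho t"
 shows "EX c. ALL i<d. ALL j<d. t i j = (if i = j then c else 0)"
proof -
 note r = irreducible_repD[OF i]
 let ?T = "mat d d (%(i, j). t i j)"
 have T: "?T : carrier_mat d d" by simp
 have "degree (char_poly ?T) > 0" using degree_monic_char_poly[OF T] r(2) by simp
 then obtain c where "poly (char_poly ?T) c = 0" using alg_closed_imp_poly_has_root by blast
 then obtain v where v: "eigenvector ?T v c" using eigenvalue_root_char_poly[OF T] by (auto simp: eigenvalue_def)
 then have v: "v : carrier_vec d" "v ~= 0\<^sub>v d" "?T *\<^sub>v v = c \<cdot>\<^sub>v v" by (auto simp: eigenvector_def)
 let ?t = "%i j. t i j - (if i = j then c else 0)"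
 have vz: "(SUM k<d. ?t i k * v $ k) = 0" if "i < d" for i
 proof -
  have "(?T *\<^sub>v v) $ i = (SUM k<d. t i k * v $ k)" using v(1) that by (simp add: scalar_prod_def lessThan_atLeast0)
  moreover have "(?T *\<^sub>v v) $ i = c * v $ i" unfolding v(3) using v(1) that by simp
  ultimately show ?thesis using that by (simp add: left_diff_distrib sum_subtractf if_distrib[of "%x. x * _"] cong: if_cong)
 qed
 have vnz: "~ (ALL k<d. v $ k = 0)"
 proof
  assume "ALL k<d. v $ k = 0" then have "v = 0\<^sub>v d" using v(1) by (intro eq_vecI) auto
  then show False using v by simp
 qed
 have it: "intertw d rho d rho ?t" unfolding intertw_def
 proof (intro ballI allI impI)
  fix g i j assume g: "g : carrier G" "i < d" "j < d"
  have "(SUM k<d. rho g $$ (i, k) * ?t k j) = (SUM k<d. rho g $$ (i, k) * t k j) - c * rho g $$ (i, j)"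
   "(SUM k<d. ?t i k * rho g $$ (k, j)) = (SUM k<d. t i k * rho g $$ (k, j)) - c * rho g $$ (i, j)"
   using g by (simp_all add: left_diff_distrib right_diff_distrib sum_subtractf
    if_distrib[of "%x. x * _"] if_distrib[of "%x. _ * x"] cong: if_cong)
  then show "(SUM k<d. rho g $$ (i, k) * ?t k j) = (SUM k<d. ?t i k * rho g $$ (k, j))" using t g by (simp add: intertw_def)
 qed
 have "ALL i<d. ALL j<d. ?t i j = 0"
 proof (rule disjE[OF kernel_cases[OF i r(1) it]])
  assume "ALL v. (ALL i<d. (SUM k<d. ?t i k * v k) = 0) --> (ALL k<d. v k = 0)"
  from spec[OF this, of "%k. v $ k"] show ?thesis using vz vnz by simp
 qed
 then have "ALL i<d. ALL j<d. t i j = (if i = j then c else 0)" by simp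
 then show ?thesis by (rule exI)
qed

text \<open>This is the elementary matrix with entry 1 at (b, c), conjugated by the group elements
  and summed. The orthogonality relations are Schur's lemma for this sum.\<close>

lemma intertw_average:
 assumes r: "matrix_rep G d rho" "matrix_rep G d' rho'" and bc: "b < d'" "c < d"
 shows "intertw d rho d' rho' (%i j. SUM g:carrier G. rho' g $$ (i, b) * rho (inv g) $$ (c, j))" unfolding intertw_def
proof (intro ballI allI impI)
 fix h i j assume h: "h : carrier G" and ij: "i < d'" "j < d"
 have "(SUM k<d'. rho' h $$ (i, k) * (SUM g:carrier G. rho' g $$ (k, b) * rho (inv g) $$ (c, j)))
  = (SUM g:carrier G. (SUM k<d'. rho' h $$ (i, k) * rho' g $$ (k, b)) * rho (inv g) $$ (c, j))"
  by (simp add: sum_distrib_left sum_distrib_right mult.assoc) (rule sum.swap)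
 also have "... = (SUM g:carrier G. rho' (h \<otimes> g) $$ (i, b) * rho (inv (h \<otimes> g) \<otimes> h) $$ (c, j))"
  using h ij bc by (intro sum.cong) (auto simp: rep_mult[OF r(2)] inv_mult_group m_assoc)
 also have "... = (SUM g:carrier G. rho' g $$ (i, b) * rho (inv g \<otimes> h) $$ (c, j))"
  by (rule sum_left[OF h, of "%g. rho' g $$ (i, b) * rho (inv g \<otimes> h) $$ (c, j)"])
 also have "... = (SUM g:carrier G. rho' g $$ (i, b) * (SUM k<d. rho (inv g) $$ (c, k) * rho h $$ (k, j)))"
  using h ij bc by (intro sum.cong) (auto simp: rep_mult[OF r(1)])
 also have "... = (SUM k<d. (SUM g:carrier G. rho' g $$ (i, b) * rho (inv g) $$ (c, k)) * rho h $$ (k, j))"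
  by (simp add: sum_distrib_left sum_distrib_right mult.assoc) (rule sum.swap)
 finally show "(SUM k<d'. rho' h $$ (i, k) * (SUM g:carrier G. rho' g $$ (k, b) * rho (inv g) $$ (c, j)))
  = (SUM k<d. (SUM g:carrier G. rho' g $$ (i, b) * rho (inv g) $$ (c, k)) * rho h $$ (k, j))" .
qed

lemma schur_zero:
 assumes "irreducible_rep G d rho" "irreducible_rep G d' rho'" "rep_char G rho' ~= rep_char G rho"
  "i < d'" "b < d'" "c < d" "j < d"
 shows "(SUM g:carrier G. rho' g $$ (i, b) * rho (inv g) $$ (c, j)) = 0"
 by (rule disjE[OF intertw_equal_char[OF assms(1,2) intertw_average[OF irreducible_repD(1)[OF assms(1)] irreducible_repD(1)[OF assms(2)] assms(5,6)]]])
  (use assms(3,4,7) in auto)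

lemma schur_same:
 fixes rho :: "'g => 'k::alg_closed_field mat"
 assumes i: "irreducible_rep G d rho" and d: "i < d" "b < d" "c < d" "j < d"
 shows "of_nat d * (SUM g:carrier G. rho g $$ (i, b) * rho (inv g) $$ (c, j)) =
  (if i = j & b = c then of_nat (Coset.order G) else 0)"
proof -
 note r = irreducible_repD(1)[OF i]
 let ?t = "%i j. SUM g:carrier G. rho g $$ (i, b) * rho (inv g) $$ (c, j)"
 from intertw_scalar[OF i intertw_average[OF r r d(2,3)]]
 obtain l where l': "ALL i<d. ALL j<d. ?t i j = (if i = j then l else 0)" by (rule exE)
 have l: "?t i j = (if i = j then l else 0)" if "i < d" "j < d" for i j using l'[rule_format, OF that] .
 \<comment> \<open>The scalar is read off from the trace; the factor \<open>of_nat d\<close> stays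
   on the left to avoid a division.\<close>
 have "of_nat d * l = (SUM i<d. ?t i i)" by (simp add: l)
 also have "... = (SUM g:carrier G. SUM i<d. rho (inv g) $$ (c, i) * rho g $$ (i, b))" by (subst sum.swap) (simp add: mult.commute)
 also have "... = (SUM g:carrier G. rho (inv g \<otimes> g) $$ (c, b))" by (intro sum.cong refl rep_mult[OF r, symmetric]) (use d in auto)
 also have "... = (if b = c then of_nat (Coset.order G) else 0)" using d by (auto simp: rep_one[OF r] Coset.order_def)
 finally show ?thesis using l[OF d(1,4)] by auto
qed

text \<open>Summing a class function against the representation gives an intertwiner of rho with
  itself, hence a scalar determined by its trace. It serves to trade matrix coefficients for
  characters.\<close>

lemma class_function_scalar:
 fixes rho :: "'g => 'k::alg_closed_field mat"
 assumes i: "irreducible_rep G d rho" and c: "!!g h. g : carrier G ==> h : carrier G ==> psi (h \<otimes> g \<otimes> inv h) = psi g"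
  and d: "a < d" "b < d"
 shows "of_nat d * (SUM g:carrier G. psi g * rho g $$ (a, b)) = (if a = b then SUM g:carrier G. psi g * rep_char G rho g else 0)"
proof -
 note r = irreducible_repD(1)[OF i]
 let ?t = "%i j. SUM g:carrier G. psi g * rho g $$ (i, j)"
 have "intertw d rho d rho ?t" unfolding intertw_def
 proof (intro ballI allI impI)
  fix h i j assume h: "h : carrier G" and ij: "i < d" "j < d"
  have "(SUM k<d. ?t i k * rho h $$ (k, j)) = (SUM g:carrier G. psi g * (SUM k<d. rho g $$ (i, k) * rho h $$ (k, j)))"
   by (simp add: sum_distrib_left sum_distrib_right mult.assoc) (rule sum.swap)
  also have "... = (SUM g:carrier G. psi g * rho (g \<otimes> h) $$ (i, j))" using h ij by (intro sum.cong) (auto simp: rep_mult[OF r])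
  also have "... = (SUM g:carrier G. psi (h \<otimes> g \<otimes> inv h) * rho (h \<otimes> g \<otimes> inv h \<otimes> h) $$ (i, j))"
   by (rule sum_conj[OF h, symmetric])
  also have "... = (SUM g:carrier G. psi g * (SUM k<d. rho h $$ (i, k) * rho g $$ (k, j)))"
  proof (rule sum.cong[OF refl])
   fix g assume g: "g : carrier G"
   have "h \<otimes> g \<otimes> inv h \<otimes> h = h \<otimes> g" using g h by (simp add: m_assoc)
   then show "psi (h \<otimes> g \<otimes> inv h) * rho (h \<otimes> g \<otimes> inv h \<otimes> h) $$ (i, j) = psi g * (SUM k<d. rho h $$ (i, k) * rho g $$ (k, j))"
    using c[OF g h] rep_mult[OF r h g ij] by simp
  qed
  also have "... = (SUM k<d. rho h $$ (i, k) * ?t k j)" by (simp add: sum_distrib_left sum_distrib_right mult_ac) (rule sum.swap)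
  finally show "(SUM k<d. rho h $$ (i, k) * ?t k j) = (SUM k<d. ?t i k * rho h $$ (k, j))" ..
 qed
 from intertw_scalar[OF i this]
 obtain l where l': "ALL i<d. ALL j<d. ?t i j = (if i = j then l else 0)" by (rule exE)
 have l: "?t i j = (if i = j then l else 0)" if "i < d" "j < d" for i j using l'[rule_format, OF that] .
 have "of_nat d * l = (SUM i<d. ?t i i)" by (simp add: l)
 also have "... = (SUM g:carrier G. psi g * rep_char G rho g)" by (subst sum.swap) (simp add: rep_char_eq[OF r] sum_distrib_left)
 finally show ?thesis using l[OF d] by auto
qed

lemma char_orthogonal:
 fixes rho :: "'g => 'k::{alg_closed_field, field_char_0} mat"
 assumes i: "irreducible_rep G d rho" and i': "irreducible_rep G d' rho'"
 shows "(SUM g:carrier G. rep_char G rho' g * rep_char G rho (inv g)) =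
  (if rep_char G rho' = rep_char G rho then of_nat (Coset.order G) else 0)"
proof -
 note r = irreducible_repD(1)[OF i] and r' = irreducible_repD(1)[OF i']
 have e: "(SUM g:carrier G. rep_char G rho'' g * rep_char G rho (inv g)) =
   (SUM i<n. SUM j<d. SUM g:carrier G. rho'' g $$ (i, i) * rho (inv g) $$ (j, j))" if "matrix_rep G n rho''" for n rho''
 proof -
  have "(SUM g:carrier G. rep_char G rho'' g * rep_char G rho (inv g)) =
   (SUM g:carrier G. SUM i<n. SUM j<d. rho'' g $$ (i, i) * rho (inv g) $$ (j, j))"
   by (intro sum.cong refl) (simp add: rep_char_eq[OF r] rep_char_eq[OF that] sum_product)
  also have "... = (SUM i<n. SUM g:carrier G. SUM j<d. rho'' g $$ (i, i) * rho (inv g) $$ (j, j))" by (rule sum.swap)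
  also have "... = (SUM i<n. SUM j<d. SUM g:carrier G. rho'' g $$ (i, i) * rho (inv g) $$ (j, j))" by (intro sum.cong refl sum.swap)
  finally show ?thesis .
 qed
 show ?thesis
 proof (cases "rep_char G rho' = rep_char G rho")
  case True
  have d0: "(of_nat d :: 'k) ~= 0" using irreducible_repD(2)[OF i] by simp
  have "of_nat d * (SUM g:carrier G. rep_char G rho g * rep_char G rho (inv g)) =
   (SUM i<d. SUM j<d. of_nat d * (SUM g:carrier G. rho g $$ (i, i) * rho (inv g) $$ (j, j)))" unfolding e[OF r] by (simp add: sum_distrib_left)
  also have "... = (SUM i<d. SUM j<d. if i = j then of_nat (Coset.order G) else 0)" by (intro sum.cong refl) (use schur_same[OF i] in auto)
  also have "... = of_nat d * of_nat (Coset.order G)" by simp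
  finally show ?thesis using d0 True by simp
 next
  case False
  then show ?thesis unfolding e[OF r'] using schur_zero[OF i i' False] by simp
 qed
qed

end

subsection \<open>Completeness of the irreducible characters\<close>

global_interpretation fv: vector_space "fsc :: 'k::field => ('s => 'k) => 's => 'k"
 by unfold_locales (auto simp: fsc_def fun_eq_iff fun_apply algebra_simps)

lemma span_basis_vec: "finite S ==> (!!x. x ~: S ==> h x = 0) ==> h : fv.span (basis_vec ` S)"
 and basis_vec_expand: "finite S ==> (!!x. x ~: S ==> h x = 0) ==> h = (SUM s:S. fsc (h s) (basis_vec s))"
proof -
 assume S: "finite S" and h: "!!x. x ~: S ==> h x = 0"
 show e: "h = (SUM s:S. fsc (h s) (basis_vec s))"
  using S h by (auto simp: fun_eq_iff sum_fun_eval fsc_apply basis_vec_def if_distrib[of "%x. _ * x"] cong: if_cong)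
 show "h : fv.span (basis_vec ` S)" by (subst e, intro fv.span_sum fv.span_scale fv.span_base) auto
qed

lemma subspace_basis:
 fixes H :: "('s => 'k::field) set"
 assumes "fv.subspace H" "finite S" "H <= {h. ALL x. x ~: S --> h x = 0}"
 obtains B where "finite B" "fv.independent B" "fv.span B = H"
proof -
 obtain B where B: "B <= H" "fv.independent B" "H <= fv.span B" using fv.maximal_independent_subset[of H] by blast
 have "finite B" using fv.independent_span_bound[of "basis_vec ` S" B] B(1,2) span_basis_vec[OF assms(2)] assms(2,3) by blast
 moreover have "fv.span B = H" using B fv.span_minimal[OF B(1) assms(1)] by blast
 ultimately show ?thesis using that B(2) by blast
qed

lemma representation_lin:
 assumes B: "fv.independent B" and v: "!!a. a : I ==> v a : fv.span B"
 shows "fv.representation B (SUM a:I. fsc (c a) (v a)) b = (SUM a:I. c a * fv.representation B (v a) b)"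
 by (subst fv.representation_sum[OF B]) (use v in \<open>auto simp: fv.span_scale fv.representation_scale[OF B] intro!: sum.cong\<close>)

lemma linear_fsc_sum:
 fixes Q :: "('s => 'k::field) => 's => 'k"
 assumes "!!h k. Q (h + k) = Q h + Q k" "!!c h. Q (fsc c h) = fsc c (Q h)"
 shows "Q (SUM a:I. fsc (c a) (v a)) = (SUM a:I. fsc (c a) (Q (v a)))"
 using assms(2)[of 0 0] by (induction I rule: infinite_finite_induct) (simp_all add: assms)

text \<open>Besides the equality of trace and rank, a basis w of the image and coordinates phi are
  returned, since the basis vectors become projections onto simple summands. The trace collapses to
  the sum of the coordinates of each \<open>w i\<close> along itself.\<close>

lemma idempotent_rank_factorization:
 fixes Q :: "('s => 'k::field) => 's => 'k"
 assumes S: "finite S" and H: "H = {h. ALL x. x ~: S --> h x = 0}"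
  and lin: "!!h k. Q (h + k) = Q h + Q k" "!!c h. Q (fsc c h) = fsc c (Q h)"
  and Q: "!!h. h : H ==> Q h : H" "!!h. h : H ==> Q (Q h) = Q h"
 obtains n :: nat and w phi where "!!i. i < n ==> w i : H" "!!i. i < n ==> Q (w i) = w i"
  "!!h. h : H ==> Q h = (SUM i<n. fsc (phi i h) (w i))"
  "!!c c' i. (SUM i<n. fsc (c i) (w i)) = (SUM i<n. fsc (c' i) (w i)) ==> i < n ==> c i = c' i"
  "(SUM s:S. Q (basis_vec s) s) = of_nat n"
proof -
 have Hs: "fv.subspace H" unfolding H by (auto simp: fv.subspace_def fun_apply fsc_apply)
 have "fv.subspace (Q ` H)" unfolding fv.subspace_def
 proof (intro conjI ballI allI)
  show "0 : Q ` H" using lin(2)[of 0 0] fv.subspace_0[OF Hs] by (metis fsc_simps(2) image_eqI)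
  show "x + y : Q ` H" if "x : Q ` H" "y : Q ` H" for x y using that fv.subspace_add[OF Hs] lin(1)[symmetric] by (auto intro!: imageI)
  show "fsc c x : Q ` H" if "x : Q ` H" for c x using that fv.subspace_scale[OF Hs] lin(2)[symmetric] by (auto intro!: imageI)
 qed
 then obtain B where B: "finite B" "fv.independent B" "fv.span B = Q ` H" by (rule subspace_basis[OF _ S, of "Q ` H"]) (use Q(1) H in auto)
 obtain w where w: "bij_betw w {..<card B} B" using ex_bij_betw_nat_finite[OF B(1)] by (auto simp: lessThan_atLeast0)
 have wB: "w i : B" if "i < card B" for i using bij_betw_apply[OF w] that by simp
 have uniq: "fv.representation B (SUM i<card B. fsc (c i) (w i)) (w i) = c i" if i: "i < card B" for c i
 proof -
  have "fv.representation B (SUM i<card B. fsc (c i) (w i)) (w i) = (SUM j<card B. c j * fv.representation B (w j) (w i))"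
   by (rule representation_lin[OF B(2)]) (auto intro: fv.span_base wB)
  also have "... = (SUM j<card B. if j = i then c i else 0)"
   using B(2) wB i inj_onD[OF bij_betw_imp_inj_on[OF w]] by (intro sum.cong refl) (auto simp: fv.representation_basis)
  finally show ?thesis using i by simp
 qed
 let ?phi = "%i h. fv.representation B (Q h) (w i)"
 have "w i : Q ` H" if "i < card B" for i using fv.span_base[OF wB[OF that]] B(3) by simp
 then have wH: "w i : H" "Q (w i) = w i" if "i < card B" for i using Q that by (metis (no_types) imageE)+
 have Qw: "Q h = (SUM i<card B. fsc (?phi i h) (w i))" if "h : H" for h using fv.sum_representation_eq[OF B(2) _ B(1) order_refl, of "Q h"] that B(3)
  by (simp add: sum.reindex_bij_betw[OF w, of "%b. fsc (fv.representation B (Q h) b) b"])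
 have bH: "basis_vec s : H" if "s : S" for s using that by (auto simp: H basis_vec_def)
 have "(SUM s:S. Q (basis_vec s) s) = (SUM s:S. SUM i<card B. w i s * ?phi i (basis_vec s))"
  by (intro sum.cong refl, subst Qw) (auto simp: bH sum_fun_eval fsc_apply mult.commute)
 also have "... = (SUM i<card B. SUM s:S. w i s * ?phi i (basis_vec s))" by (rule sum.swap)
 also have "... = (SUM i<card B. ?phi i (w i))"
 proof (rule sum.cong[OF refl])
  fix i assume "i : {..<card B}"
  then have e: "w i = (SUM s:S. fsc (w i s) (basis_vec s))" using wH(1)[of i] by (intro basis_vec_expand[OF S]) (auto simp: H)
  have "Q (w i) = (SUM s:S. fsc (w i s) (Q (basis_vec s)))" using trans[OF arg_cong[OF e, of Q] linear_fsc_sum[of Q "w i" basis_vec S, OF lin]] .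
  then show "(SUM s:S. w i s * ?phi i (basis_vec s)) = ?phi i (w i)"
   using representation_lin[OF B(2), of S "%s. Q (basis_vec s)" "w i" "w i"] B(3) bH by simp
 qed
 also have "... = of_nat (card B)"
 proof -
  have "?phi i (w i) = 1" if "i < card B" for i using wH[OF that] fv.representation_basis[OF B(2) wB[OF that]] by simp
  then show ?thesis by simp
 qed
 finally have "(SUM s:S. Q (basis_vec s) s) = of_nat (card B)" .
 moreover have "c i = c' i" if "(SUM i<card B. fsc (c i) (w i)) = (SUM i<card B. fsc (c' i) (w i))" "i < card B" for c c' i
  using uniq[OF that(2), of c] uniq[OF that(2), of c'] that(1) by simp
 ultimately show ?thesis by (intro that[of "card B" w ?phi] wH Qw)
qed

context fin_group
begin

lemma irr_charE:
 assumes "chi : irr_chars G"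
 obtains d rho where "irreducible_rep G d rho" "chi = rep_char G rho" "chi \<one> = of_nat d"
 using assms rep_char_one irreducible_repD(1) by (fastforce simp: irr_chars_def)

lemma irr_char_orthogonal:
 fixes chi :: "'g => 'k::{alg_closed_field, field_char_0}"
 assumes "chi : irr_chars G" "psi : irr_chars G"
 shows "(SUM g:carrier G. psi g * chi (inv g)) = (if psi = chi then of_nat (Coset.order G) else 0)"
proof -
 obtain d rho where r: "irreducible_rep G d rho" "chi = rep_char G rho" "chi \<one> = of_nat d" using irr_charE[OF assms(1)] .
 obtain d' rho' where r': "irreducible_rep G d' rho'" "psi = rep_char G rho'" "psi \<one> = of_nat d'" using irr_charE[OF assms(2)] .
 show ?thesis unfolding r(2) r'(2) by (rule char_orthogonal[OF r(1) r'(1)])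
qed

text \<open>Orthogonality makes the irreducible characters linearly independent in the
  finite-dimensional space of functions on the group.\<close>

lemma finite_irr_chars: "finite (irr_chars G :: ('g => 'k::{alg_closed_field, field_char_0}) set)"
proof -
 let ?X = "irr_chars G :: ('g => 'k) set"
 have o: "(of_nat (Coset.order G) :: 'k) ~= 0" using order_pos by simp
 have "fv.independent ?X"
 proof
  assume "fv.dependent ?X"
  then obtain T u chi where T: "finite T" "T <= ?X" "(SUM v:T. fsc (u v) v) = 0" "chi : T" "u chi ~= 0" by (auto simp: fv.dependent_explicit)
  have "0 = (SUM g:carrier G. (SUM v:T. fsc (u v) v) g * chi (inv g))" by (simp add: T(3) fun_apply)
  also have "... = (SUM v:T. u v * (SUM g:carrier G. v g * chi (inv g)))"
   by (simp add: sum_fun_eval fsc_apply sum_distrib_left sum_distrib_right mult.assoc) (rule sum.swap)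
  also have "... = (SUM v:T. if v = chi then u chi * of_nat (Coset.order G) else 0)"
  proof (rule sum.cong[OF refl])
   fix v assume "v : T"
   then have "v : ?X" "chi : ?X" using T(2,4) by auto
   then show "u v * (SUM g:carrier G. v g * chi (inv g)) = (if v = chi then u chi * of_nat (Coset.order G) else 0)"
    using irr_char_orthogonal[of chi v] by auto
  qed
  also have "... = u chi * of_nat (Coset.order G)" using T(1,4) by simp
  finally show False using T(5) o by simp
 qed
 moreover have "?X <= fv.span (basis_vec ` carrier G)" by (auto intro!: span_basis_vec[OF fin] simp: irr_chars_def rep_char_def)
 ultimately show ?thesis using fv.independent_span_bound[of "basis_vec ` carrier G" ?X] fin by blast
qed

text \<open>In a basis adapted to a proper invariant subspace the matrices are block triangular, and
  the diagonal blocks are the representations on the subspace and on the quotient.\<close>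

lemma reducible_rep_char:
 assumes r: "matrix_rep G d (rho :: 'g => 'k::field mat)" and n: "~ irreducible_rep G d rho" "d > 0"
 obtains k l rho1 rho2 where "matrix_rep G k (rho1 :: 'g => 'k mat)" "matrix_rep G l (rho2 :: 'g => 'k mat)" "k < d" "l < d"
  "rep_char G rho = rep_char G rho1 + rep_char G rho2"
proof -
 obtain W :: "'k vec set" where W': "VectorSpace.subspace class_ring W (module_vec TYPE('k) d)"
  "ALL g:carrier G. ALL v:W. rho g *\<^sub>v v : W" "W ~= {0\<^sub>v d}" "W ~= carrier_vec d" using r n unfolding irreducible_rep_def by blast
 have W: "W <= carrier_vec d" "0\<^sub>v d : W" "!!u v. u : W ==> v : W ==> u + v : W" "!!c v. v : W ==> c \<cdot>\<^sub>v v : W"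
  using W'(1) by (auto simp: VectorSpace.subspace_def submodule_def module_vec_simps)
 let ?f = "%v i. if i < d then v $ i else 0 :: 'k" and ?S = "{..<d}"
 let ?H = "{h :: nat => 'k. ALL x. x ~: ?S --> h x = 0}"
 \<comment> \<open>Vectors are turned into functions supported below d, where spans and bases of
   \<open>fv\<close> are available; \<open>op g\<close> is the matrix \<open>rho g\<close> acting on
   them.\<close>
 define op where "op g h i = (if i < d then SUM j<d. rho g $$ (i, j) * h j else 0)" for g h i
 have opl: "op g (h + k) = op g h + op g k" "op g (fsc c h) = fsc c (op g h)" for g h k c
  by (auto simp: op_def fun_eq_iff fun_apply fsc_apply ring_distribs sum.distrib sum_distrib_left mult_ac)
 have opH: "op g h : ?H" for g h by (simp add: op_def)
 have opm: "op (g \<otimes> h) v = op g (op h v)" if "g : carrier G" "h : carrier G" for g h v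
  using that by (auto simp: op_def fun_eq_iff rep_mult[OF r] sum_distrib_left sum_distrib_right mult.assoc intro: sum.swap)
 have op1: "op \<one> v = v" if "v : ?H" for v using that by (auto simp: op_def fun_eq_iff rep_one[OF r] if_distrib[of "%x. x * _"] cong: if_cong)
 have fW: "?f ` W <= ?H" by auto
 have "fv.subspace (?f ` W)" unfolding fv.subspace_def
 proof (intro conjI ballI allI)
  show "0 : ?f ` W" by (rule image_eqI[OF _ W(2)]) (auto simp: fun_eq_iff zero_fun_apply)
  fix a b c assume "a : ?f ` W" "b : ?f ` W"
  then obtain u v where uv: "u : W" "v : W" "a = ?f u" "b = ?f v" by blast
  show "a + b : ?f ` W" by (rule image_eqI[OF _ W(3)[OF uv(1,2)]]) (use uv W(1) in \<open>auto simp: fun_eq_iff fun_apply\<close>)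
  show "fsc c a : ?f ` W" by (rule image_eqI[OF _ W(4)[OF uv(1)]]) (use uv W(1) in \<open>auto simp: fun_eq_iff fsc_apply\<close>)
 qed
 then obtain B where B: "finite B" "fv.independent B" "fv.span B = ?f ` W" by (rule subspace_basis[OF _ _ fW]) simp
 have BH: "B <= ?H" using fv.span_superset[of B] B(3) fW by blast
 obtain B' where B': "B <= B'" "B' <= ?H" "fv.independent B'" "?H <= fv.span B'" using fv.maximal_independent_subset_extend[OF BH B(2)] .
 have Hs: "?H <= fv.span (basis_vec ` ?S)" using span_basis_vec[of ?S] by blast
 note b = fv.independent_span_bound[OF finite_imageI[OF finite_lessThan] B'(3) subset_trans[OF B'(2) Hs]]
 have c: "finite B'" by (rule conjunct1[OF b])
 have "card B' <= card ?S" by (rule order_trans[OF conjunct2[OF b] card_image_le[OF finite_lessThan]])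
 then have cd: "card B' <= d" by simp
 have "B ~= {}"
 proof
  assume "B = {}"
  then have z: "?f ` W = {0}" using B(3)[symmetric] by (simp only: fv.span_empty)
  have "v = 0\<^sub>v d" if "v : W" for v
  proof (rule eq_vecI)
   fix i assume "i < dim_vec (0\<^sub>v d :: 'k vec)"
   moreover have "?f v = 0" using z that by blast
   ultimately show "v $ i = 0\<^sub>v d $ i" using fun_cong[of "?f v" 0 i] by (simp add: zero_fun_apply)
  qed (use that W(1) in auto)
  then show False using W(2) W'(3) by blast
 qed
 then have l2: "card (B' - B) < d" using card_Diff_subset[OF B(1) B'(1)] card_gt_0_iff[of B] B(1) card_mono[OF c B'(1)] cd by linarith
 have "B ~= B'"
 proof
  assume "B = B'"
  then have h: "?H <= ?f ` W" using B(3) B'(4) by simp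
  have "v : W" if v: "v : carrier_vec d" for v
  proof -
   have "?f v : ?f ` W" using h by auto
   then obtain u where u: "u : W" "?f v = ?f u" by blast
   have "v = u"
   proof (rule eq_vecI)
    fix i assume "i < dim_vec u"
    then show "v $ i = u $ i" using fun_cong[OF u(2), of i] u(1) W(1) by auto
   qed (use u W(1) v in auto)
   then show ?thesis using u(1) by simp
  qed
  then show False using W(1) W'(4) by blast
 qed
 then have l1: "card B < d" using psubset_card_mono[OF c psubsetI[OF B'(1)]] cd by simp
 define R where "R g a b = fv.representation B' (op g b) a" for g a b
 have oS: "op g b : fv.span B'" for g b by (rule subsetD[OF B'(4) opH])
 have ob: "op g b = (SUM c:B'. fsc (R g c b) c)" for g b unfolding R_def by (rule fv.sum_representation_eq[OF B'(3) oS c order_refl, symmetric])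
 have Rm: "R (g \<otimes> h) a b = (SUM c:B'. R g a c * R h c b)" if "g : carrier G" "h : carrier G" for g h a b
 proof -
  have "op (g \<otimes> h) b = (SUM c:B'. fsc (R h c b) (op g c))"
   unfolding opm[OF that] by (subst ob[of h b]) (rule linear_fsc_sum[of "op g", OF opl])
  then have "R (g \<otimes> h) a b = fv.representation B' (SUM c:B'. fsc (R h c b) (op g c)) a" by (simp only: R_def)
  also have "... = (SUM c:B'. R h c b * R g a c)" unfolding R_def[of g a] by (rule representation_lin[OF B'(3) oS])
  finally show ?thesis by (simp add: mult.commute)
 qed
 have R1: "R \<one> a b = (if a = b then 1 else 0)" if "b : B'" for a b using that B'(2,3) op1[of b] by (auto simp: R_def fv.representation_basis)
 \<comment> \<open>Invariance of W: the block leading from B to the remaining basis vectors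
   vanishes.\<close>
 have R0: "R g a b = 0" if g: "g : carrier G" and ab: "b : B" "a ~: B" for g a b
 proof -
  obtain v where v: "v : W" "b = ?f v" using fv.span_base[OF ab(1)] B(3) by auto
  have "op g b = ?f (rho g *\<^sub>v v)" using v W(1) by (auto simp: op_def fun_eq_iff rep_vec[OF r g])
  then have "op g b : fv.span B" using W'(2) g v(1) B(3) by blast
  then have "R g a b = fv.representation B (op g b) a" unfolding R_def by (simp add: fv.representation_extend[OF B'(3) _ B'(1)])
  then show ?thesis using fv.representation_ne_zero[of B "op g b" a] ab(2) by auto
 qed
 \<comment> \<open>A diagonal block that is multiplicative by itself is a representation;
   triangularity supplies this for B and for its complement in \<open>B'\<close>.\<close>
 have block: "EX \<sigma>. matrix_rep G (card D) \<sigma> & (ALL g:carrier G. rep_char G \<sigma> g = (SUM a:D. R g a a))"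
  if D: "D <= B'" and s: "!!g h a b. g : carrier G ==> h : carrier G ==> a : D ==> b : D ==> (SUM c:B'. R g a c * R h c b) = (SUM c:D. R g a c * R h c b)" for D
 proof -
  obtain f where f: "bij_betw f {..<card D} D" using ex_bij_betw_nat_finite[OF finite_subset[OF D c]] by (auto simp: lessThan_atLeast0)
  let ?\<sigma> = "%g. mat (card D) (card D) (%(i, j). R g (f i) (f j))"
  have fD: "f i : D" if "i < card D" for i using bij_betw_apply[OF f] that by simp
  have "matrix_rep G (card D) ?\<sigma>" unfolding matrix_rep_def
  proof (intro conjI ballI)
   show "?\<sigma> \<one> = 1\<^sub>m (card D)" using R1[OF subsetD[OF D fD]] inj_onD[OF bij_betw_imp_inj_on[OF f]] by (intro eq_matI) auto
   fix g h assume g: "g : carrier G" "h : carrier G"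
   show "?\<sigma> (g \<otimes> h) = ?\<sigma> g * ?\<sigma> h" using s[OF g fD fD] by (intro eq_matI)
     (auto simp: scalar_prod_def Rm[OF g] lessThan_atLeast0[symmetric] sum.reindex_bij_betw[OF f, symmetric])
  qed auto
  moreover have "rep_char G ?\<sigma> g = (SUM a:D. R g a a)" if "g : carrier G" for g
   using that calculation by (simp add: rep_char_eq sum.reindex_bij_betw[OF f, of "%a. R g a a"])
  ultimately show ?thesis by blast
 qed
 have "EX \<sigma>. matrix_rep G (card B) \<sigma> & (ALL g:carrier G. rep_char G \<sigma> g = (SUM a:B. R g a a))"
  by (rule block[OF B'(1)], rule sum.mono_neutral_right[OF c B'(1)]) (auto simp: R0)
 then obtain rho1 where 1: "matrix_rep G (card B) rho1" "ALL g:carrier G. rep_char G rho1 g = (SUM a:B. R g a a)" by blast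
 have "EX \<sigma>. matrix_rep G (card (B' - B)) \<sigma> & (ALL g:carrier G. rep_char G \<sigma> g = (SUM a:B' - B. R g a a))"
  by (rule block[OF Diff_subset], rule sum.mono_neutral_right[OF c Diff_subset]) (auto simp: R0)
 then obtain rho2 where 2: "matrix_rep G (card (B' - B)) rho2" "ALL g:carrier G. rep_char G rho2 g = (SUM a:B' - B. R g a a)" by blast
 have "rep_char G rho g = rep_char G rho1 g + rep_char G rho2 g" if g: "g : carrier G" for g
 proof -
  have e: "basis_vec i : ?H" if "i < d" for i using that by (auto simp: basis_vec_def)
  have "rep_char G rho g = (SUM i<d. op g (basis_vec i) i)"
   by (simp add: rep_char_eq[OF r g] op_def basis_vec_def if_distrib[of "%x. _ * x"] cong: if_cong)
  \<comment> \<open>The trace does not depend on the basis: standard basis vectors are expanded in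
    \<open>B'\<close>, and afterwards the images of \<open>B'\<close> in the standard basis.\<close>
  also have "... = (SUM i<d. SUM b:B'. fv.representation B' (basis_vec i) b * op g b i)"
  proof (rule sum.cong[OF refl])
   fix i assume "i : ?S"
   then have "basis_vec i : fv.span B'" using subsetD[OF B'(4) e] by simp
   from fv.sum_representation_eq[OF B'(3) this c order_refl, symmetric]
   have "op g (basis_vec i) = (SUM b:B'. fsc (fv.representation B' (basis_vec i) b) (op g b))"
    by (rule trans[OF arg_cong[where f = "op g"] linear_fsc_sum[of "op g", OF opl]])
   then show "op g (basis_vec i) i = (SUM b:B'. fv.representation B' (basis_vec i) b * op g b i)" by (simp add: sum_fun_eval fsc_apply)
  qed
  also have "... = (SUM b:B'. SUM i<d. op g b i * fv.representation B' (basis_vec i) b)" by (subst sum.swap) (simp add: mult.commute)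
  also have "... = (SUM b:B'. R g b b)"
  proof (rule sum.cong[OF refl])
   fix b
   have "op g b = (SUM i<d. fsc (op g b i) (basis_vec i))" by (rule basis_vec_expand) (auto simp: op_def)
   then have "R g b b = fv.representation B' (SUM i<d. fsc (op g b i) (basis_vec i)) b" by (simp add: R_def)
   also have "... = (SUM i<d. op g b i * fv.representation B' (basis_vec i) b)"
    by (rule representation_lin[OF B'(3)]) (use subsetD[OF B'(4) e] in blast)
   finally show "(SUM i<d. op g b i * fv.representation B' (basis_vec i) b) = R g b b" ..
  qed
  also have "... = (SUM b:B' - B. R g b b) + (SUM b:B. R g b b)" by (rule sum.subset_diff[OF B'(1) c])
  finally show ?thesis using 1(2) 2(2) g by simp
 qed
 then have "rep_char G rho = rep_char G rho1 + rep_char G rho2" by (auto simp: fun_eq_iff fun_apply rep_char_def)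
 then show ?thesis by (rule that[OF 1(1) 2(1) l1 l2])
qed

lemma rep_char_in_span: "matrix_rep G d (rho :: 'g => 'k::field mat) ==> rep_char G rho : fv.span (irr_chars G)"
proof (induction d arbitrary: rho rule: less_induct)
 case (less d)
 consider "d = 0" | "irreducible_rep G d rho" | "~ irreducible_rep G d rho" "d > 0" by blast
 then show ?case
 proof cases
  case 1
  then have "rep_char G rho = 0" using rep_char_eq[OF less.prems] by (auto simp: fun_eq_iff rep_char_def zero_fun_apply)
  then show ?thesis by (simp add: fv.span_zero)
 next
  case 2
  then show ?thesis by (intro fv.span_base) (auto simp: irr_chars_def)
 next
  case 3
  show ?thesis by (rule reducible_rep_char[OF less.prems 3]) (use less.IH fv.span_add in metis)
 qed
qed

text \<open>The regular representation has the order of the group as character value at the unit and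
  0 elsewhere. In its expansion into irreducible characters the coefficient of psi is psi at the
  unit, by orthogonality. The identity is used to split the unit of the group algebra into matrix
  units.\<close>

lemma char_completeness:
 assumes g: "g : carrier G"
 shows "(SUM chi:irr_chars G. chi \<one> * chi (inv g)) = (if g = \<one> then of_nat (Coset.order G) else 0 :: 'k::{alg_closed_field, field_char_0})"
proof -
 let ?n = "of_nat (Coset.order G) :: 'k" and ?X = "irr_chars G :: ('g => 'k) set" and ?m = "Coset.order G"
 obtain f where f: "bij_betw f {..<?m} (carrier G)" using ex_bij_betw_nat_finite[OF fin] by (auto simp: lessThan_atLeast0 Coset.order_def)
 let ?rho = "%g. mat ?m ?m (%(i, j). if f i = g \<otimes> f j then 1 else 0 :: 'k)"
 have fc: "f i : carrier G" if "i < ?m" for i using bij_betw_apply[OF f] that by simp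
 have r: "matrix_rep G ?m ?rho" unfolding matrix_rep_def
 proof (intro conjI ballI)
  show "?rho \<one> = 1\<^sub>m ?m" using fc inj_onD[OF bij_betw_imp_inj_on[OF f]] by (intro eq_matI) auto
  fix g h assume g: "g : carrier G" "h : carrier G"
  show "?rho (g \<otimes> h) = ?rho g * ?rho h"
  proof (rule eq_matI)
   fix i j assume ij: "i < dim_row (?rho g * ?rho h)" "j < dim_col (?rho g * ?rho h)"
   have "(SUM k<?m. (if f i = g \<otimes> f k then 1 else 0) * (if f k = h \<otimes> f j then 1 else 0)) =
     (SUM x:carrier G. (if f i = g \<otimes> x then 1 else 0) * (if x = h \<otimes> f j then 1 else 0 :: 'k))" by (rule sum.reindex_bij_betw[OF f])
   also have "... = (if f i = g \<otimes> (h \<otimes> f j) then 1 else 0)" using fin g fc ij by (simp add: if_distrib[of "%x. _ * x"] cong: if_cong)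
   finally show "?rho (g \<otimes> h) $$ (i, j) = (?rho g * ?rho h) $$ (i, j)"
    using ij g fc by (simp add: scalar_prod_def m_assoc lessThan_atLeast0[symmetric])
  qed auto
 qed auto
 have reg: "rep_char G ?rho g = (if g = \<one> then ?n else 0)" if g: "g : carrier G" for g
 proof -
  have "f i = g \<otimes> f i \<longleftrightarrow> g = \<one>" if "i < ?m" for i using g fc[OF that] r_cancel_one' by auto
  then show ?thesis by (simp add: rep_char_eq[OF r g])
 qed
 obtain c where c: "rep_char G ?rho = (SUM chi:?X. fsc (c chi) chi)" using rep_char_in_span[OF r] fv.span_finite[OF finite_irr_chars] by auto
 have "c psi = psi \<one>" if p: "psi : ?X" for psi
 proof -
  have "?n * psi \<one> = (SUM g:carrier G. rep_char G ?rho g * psi (inv g))" using fin by (simp add: reg if_distrib[of "%x. x * _"] cong: if_cong)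
  also have "... = (SUM chi:?X. c chi * (SUM g:carrier G. chi g * psi (inv g)))"
   unfolding c by (simp add: sum_fun_eval fsc_apply sum_distrib_left sum_distrib_right mult.assoc) (rule sum.swap)
  also have "... = (SUM chi:?X. if chi = psi then c psi * ?n else 0)" using irr_char_orthogonal[OF p] by (intro sum.cong refl) auto
  also have "... = c psi * ?n" unfolding sum.delta[OF finite_irr_chars] using p by simp
  finally show ?thesis using order_pos by simp
 qed
 then have "(SUM chi:?X. chi \<one> * chi (inv g)) = rep_char G ?rho (inv g)" unfolding c by (simp add: sum_fun_eval fsc_apply)
 then show ?thesis using reg[OF inv_closed[OF g]] g by simp
qed

end

section \<open>Matrix units in the endomorphism algebras\<close>

locale alg_category = mal_category C \<delta>
  for C :: "('o, 'm) category_data" (structure) and \<delta> :: "'m => 'k::{alg_closed_field, field_char_0}"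
begin

lemma fin_group_A: "obj x ==> fin_group (A x)" by (intro fin_group.intro group_A fin_group_axioms.intro finite_A)

definition ga :: "'o => ('m => 'k) => 'm set => 'k" where
 "ga x c = (SUM g:AA x. fsc (c g) (gr g))"

text \<open>Fourier inversion: by Schur orthogonality this element of the group algebra acts in rho
  as the elementary matrix at (a, b), which explains the inverse and the transposed indices.\<close>

definition mx :: "'o => nat => ('m => 'k mat) => nat => nat => 'm set => 'k" where
 "mx x d rho a b = ga x (%g. of_nat d / of_nat (Coset.order (A x)) * rho (iv x g) $$ (b, a))"

lemma ga_hom0: "ga x c : hom0 x x" unfolding ga_def by (intro hom0_sum hom0_fsc gr_A)

lemma ga_comp:
 assumes x: "obj x"
 shows "cx x (ga x c) (ga x c') = ga x (%k. SUM g:AA x. c g * c' (iv x g \<otimes>\<^bsub>A x\<^esub> k))"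
proof -
 interpret G: fin_group "A x" using fin_group_A[OF x] .
 let ?G = "AA x"
 have "cx x (ga x c) (ga x c') = (SUM g:?G. SUM h:?G. fsc (c g * c' h) (gr (g \<otimes>\<^bsub>A x\<^esub> h)))"
  unfolding ga_def cp_sum_left by (intro sum.cong refl) (simp add: cp_fsc_left cp_sum_right cp_fsc_right fsc_sum gr_mult mult.commute del: A_simps)
 also have "... = (SUM g:?G. SUM k:?G. fsc (c g * c' (iv x g \<otimes>\<^bsub>A x\<^esub> k)) (gr k))"
 proof (rule sum.cong[OF refl])
  fix g assume g: "g : ?G"
  have "(SUM h:?G. fsc (c g * c' h) (gr (g \<otimes>\<^bsub>A x\<^esub> h))) =
   (SUM h:?G. fsc (c g * c' (iv x g \<otimes>\<^bsub>A x\<^esub> (g \<otimes>\<^bsub>A x\<^esub> h))) (gr (g \<otimes>\<^bsub>A x\<^esub> h)))"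
   using g by (intro sum.cong refl) (simp add: G.m_assoc[symmetric] del: A_simps)
  also have "... = (SUM k:?G. fsc (c g * c' (iv x g \<otimes>\<^bsub>A x\<^esub> k)) (gr k))"
   by (rule G.sum_left[OF g, of "%k. fsc (c g * c' (iv x g \<otimes>\<^bsub>A x\<^esub> k)) (gr k)"])
  finally show "(SUM h:?G. fsc (c g * c' h) (gr (g \<otimes>\<^bsub>A x\<^esub> h))) =
   (SUM k:?G. fsc (c g * c' (iv x g \<otimes>\<^bsub>A x\<^esub> k)) (gr k))" .
 qed
 also have "... = ga x (%k. SUM g:?G. c g * c' (iv x g \<otimes>\<^bsub>A x\<^esub> k))"
  unfolding ga_def by (subst sum.swap) (simp add: fv.scale_sum_left)
 finally show ?thesis .
qed

lemma ga_cong: "(!!g. g : AA x ==> c g = c' g) ==> ga x c = ga x c'" by (simp add: ga_def)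

lemma ga_zero: "ga x (%g. 0) = 0" by (simp add: ga_def)

text \<open>The convolution is arranged so that the inner sum over g has the shape of the
  orthogonality relations.\<close>

lemma mx_expand:
 assumes x: "obj x" and r: "matrix_rep (A x) d' rho'" and m: "c < d'" "e < d'"
 shows "cx x (mx x d rho a b) (mx x d' rho' c e) = ga x (%k. of_nat d * of_nat d' / of_nat (Coset.order (A x)) ^ 2 *
  (SUM m<d'. rho' (iv x k) $$ (e, m) * (SUM g:AA x. rho' g $$ (m, c) * rho (iv x g) $$ (b, a))))" unfolding mx_def ga_comp[OF x]
proof (rule ga_cong)
 interpret G: fin_group "A x" using fin_group_A[OF x] .
 let ?G = "AA x" and ?n = "of_nat (Coset.order (A x)) :: 'k"
 fix k assume k: "k : ?G"
 have "(SUM g:?G. of_nat d / ?n * rho (iv x g) $$ (b, a) * (of_nat d' / ?n * rho' (iv x (iv x g \<otimes>\<^bsub>A x\<^esub> k)) $$ (e, c)))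
  = (SUM g:?G. SUM m<d'. of_nat d * of_nat d' / ?n ^ 2 * (rho' (iv x k) $$ (e, m) * (rho' g $$ (m, c) * rho (iv x g) $$ (b, a))))"
  using k m by (intro sum.cong refl) (simp add: G.inv_mult_group G.rep_mult[OF r] sum_distrib_left power2_eq_square mult_ac del: A_simps)
 also have "... = (SUM m<d'. of_nat d * of_nat d' / ?n ^ 2 * (rho' (iv x k) $$ (e, m) * (SUM g:?G. rho' g $$ (m, c) * rho (iv x g) $$ (b, a))))"
  by (subst sum.swap) (simp add: sum_distrib_left)
 finally show "(SUM g:?G. of_nat d / ?n * rho (iv x g) $$ (b, a) * (of_nat d' / ?n * rho' (iv x (iv x g \<otimes>\<^bsub>A x\<^esub> k)) $$ (e, c)))
  = of_nat d * of_nat d' / ?n ^ 2 * (SUM m<d'. rho' (iv x k) $$ (e, m) * (SUM g:?G. rho' g $$ (m, c) * rho (iv x g) $$ (b, a)))"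
  by (simp add: sum_distrib_left)
qed

lemma mx_zero:
 assumes x: "obj x" and r: "irreducible_rep (A x) d rho" "irreducible_rep (A x) d' rho'"
  "rep_char (A x) rho' ~= rep_char (A x) rho" and "a < d" "b < d" "c < d'" "e < d'"
 shows "cx x (mx x d rho a b) (mx x d' rho' c e) = 0" unfolding mx_expand[OF x irreducible_repD(1)[OF r(2)] assms(7,8)]
 using fin_group.schur_zero[OF fin_group_A[OF x] r] assms by (simp add: ga_zero)

lemma mx_mult:
 assumes x: "obj x" and r: "irreducible_rep (A x) d rho" and m: "a < d" "b < d" "c < d" "e < d"
 shows "cx x (mx x d rho a b) (mx x d rho c e) = (if b = c then mx x d rho a e else 0)"
proof -
 interpret G: fin_group "A x" using fin_group_A[OF x] .
 let ?n = "of_nat (Coset.order (A x)) :: 'k"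
 have n: "?n ~= 0" "(of_nat d :: 'k) ~= 0" using G.order_pos irreducible_repD(2)[OF r] by auto
 have s: "(SUM g:AA x. rho g $$ (i, c) * rho (iv x g) $$ (b, a)) = (if i = a & c = b then ?n / of_nat d else 0)" if "i < d" for i
  using G.schur_same[OF r that m(3,2,1)] n by (auto simp: field_simps split: if_splits)
 have q: "(SUM i<d. h i * (SUM g:AA x. rho g $$ (i, c) * rho (iv x g) $$ (b, a))) =
   (if b = c then h a * (?n / of_nat d) else 0)" for h
 proof -
  have "(SUM i<d. h i * (SUM g:AA x. rho g $$ (i, c) * rho (iv x g) $$ (b, a))) =
   (SUM i<d. if i = a then (if b = c then h a * (?n / of_nat d) else 0) else 0)" by (intro sum.cong refl) (simp add: s)
  then show ?thesis using m by simp
 qed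
 show ?thesis unfolding mx_expand[OF x irreducible_repD(1)[OF r] m(3,4)] q using n by (auto simp: ga_zero mx_def power2_eq_square intro!: ga_cong)
qed

lemma mx_hom0: "mx x d rho a b : hom0 x x" unfolding mx_def by (rule ga_hom0)

text \<open>Under left multiplication the matrix units of a fixed column transform by rho; this
  provides the equivariance demanded of a simple family.\<close>

lemma gr_mx:
 assumes x: "obj x" and r: "matrix_rep (A x) d rho" and m: "b < d" "c < d" and g: "g : AA x"
 shows "cx x (gr g) (mx x d rho b c) = (SUM a<d. fsc (rho g $$ (a, b)) (mx x d rho a c))"
proof -
 interpret G: fin_group "A x" using fin_group_A[OF x] .
 let ?G = "AA x" let ?q = "of_nat d / of_nat (Coset.order (A x)) :: 'k"
 have "cx x (gr g) (mx x d rho b c) = (SUM h:?G. fsc (?q * rho (iv x h) $$ (c, b)) (gr (g \<otimes>\<^bsub>A x\<^esub> h)))"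
  unfolding mx_def ga_def cp_sum_right cp_fsc_right using g by (intro sum.cong refl) (simp add: gr_mult del: A_simps)
 also have "... = (SUM h:?G. fsc (?q * rho (iv x (g \<otimes>\<^bsub>A x\<^esub> h) \<otimes>\<^bsub>A x\<^esub> g) $$ (c, b)) (gr (g \<otimes>\<^bsub>A x\<^esub> h)))"
  using g by (intro sum.cong refl) (simp add: G.inv_mult_group G.m_assoc del: A_simps)
 also have "... = (SUM k:?G. fsc (?q * rho (iv x k \<otimes>\<^bsub>A x\<^esub> g) $$ (c, b)) (gr k))"
  by (rule G.sum_left[OF g, of "%k. fsc (?q * rho (iv x k \<otimes>\<^bsub>A x\<^esub> g) $$ (c, b)) (gr k)"])
 also have "... = (SUM k:?G. SUM a<d. fsc (rho g $$ (a, b) * (?q * rho (iv x k) $$ (c, a))) (gr k))" using g m by (intro sum.cong refl)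
   (simp add: G.rep_mult[OF r] sum_distrib_left mult_ac fv.scale_sum_left[symmetric] del: A_simps)
 also have "... = (SUM a<d. fsc (rho g $$ (a, b)) (mx x d rho a c))" unfolding mx_def ga_def by (subst sum.swap) (simp add: fsc_sum)
 finally show ?thesis .
qed

lemma mx_complete:
 assumes x: "obj x" and r: "!!chi. chi : irr x ==> irreducible_rep (A x) (d chi) (rho chi) & rep_char (A x) (rho chi) = chi"
 shows "(SUM chi:irr x. SUM a<d chi. mx x (d chi) (rho chi) a a) = id0 x"
proof -
 interpret G: fin_group "A x" using fin_group_A[OF x] .
 let ?G = "AA x" let ?n = "of_nat (Coset.order (A x)) :: 'k"
 have n: "?n ~= 0" using G.order_pos by simp
 have c: "(SUM a<d chi. of_nat (d chi) / ?n * rho chi (iv x g) $$ (a, a)) = chi \<one>\<^bsub>A x\<^esub> * chi (iv x g) / ?n"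
  if "chi : irr x" "g : ?G" for chi g
 proof -
  note m = irreducible_repD(1)[OF conjunct1[OF r[OF that(1)]]]
  have "chi \<one>\<^bsub>A x\<^esub> = of_nat (d chi)" "chi (iv x g) = (SUM a<d chi. rho chi (iv x g) $$ (a, a))"
   using G.rep_char_one[OF m] G.rep_char_eq[OF m G.inv_closed[OF that(2)]] r[OF that(1)] by simp_all
  then show ?thesis by (simp add: sum_distrib_left sum_divide_distrib)
 qed
 have "(SUM chi:irr x. SUM a<d chi. mx x (d chi) (rho chi) a a) =
  (SUM chi:irr x. SUM g:?G. fsc (SUM a<d chi. of_nat (d chi) / ?n * rho chi (iv x g) $$ (a, a)) (gr g))"
  unfolding mx_def ga_def by (intro sum.cong refl) (subst sum.swap, simp add: fv.scale_sum_left)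
 also have "... = (SUM chi:irr x. SUM g:?G. fsc (chi \<one>\<^bsub>A x\<^esub> * chi (iv x g) / ?n) (gr g))" by (intro sum.cong refl) (simp only: c)
 also have "... = (SUM g:?G. fsc ((SUM chi:irr x. chi \<one>\<^bsub>A x\<^esub> * chi (iv x g)) / ?n) (gr g))"
  by (subst sum.swap) (simp add: fv.scale_sum_left sum_divide_distrib)
 also have "... = (SUM g:?G. if g = \<one>\<^bsub>A x\<^esub> then gr g else 0)" by (intro sum.cong refl, subst G.char_completeness) (use n in auto)
 also have "... = gr \<one>\<^bsub>A x\<^esub>" using G.fin G.one_closed by (simp del: A_simps)
 finally show ?thesis using gr_ide[OF x] by simp
qed

lemma ga_lowid: "lowid x e ==> obj x ==> cx x (id0 x - e) (ga x c) = cx x (ga x c) (id0 x - e)"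
 unfolding ga_def cp_sum_right cp_sum_left cp_fsc_right cp_fsc_left by (intro sum.cong refl) (simp add: lowid_facts(9))

end

declare minus_apply [simp del]

text \<open>Lower projectors and matrix representations are parameters rather than fixed choices:
  the locale is used once with arbitrary ones, to see that simple families exist, and once with
  those read off from the families picked by \<open>simple_object\<close>.\<close>

locale simple_data = alg_category C \<delta>
  for C :: "('o, 'm) category_data" (structure) and \<delta> :: "'m => 'k::{alg_closed_field, field_char_0}" +
 fixes lo :: "'o => 'm set => 'k" and dm :: "'o => ('m => 'k) => nat" and rho :: "'o => ('m => 'k) => 'm => 'k mat"
 assumes lo: "obj x ==> lowid x (lo x)"
  and rho: "obj x ==> chi : irr x ==> irreducible_rep (A x) (dm x chi) (rho x chi) & rep_char (A x) (rho x chi) = chi"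
begin

abbreviation up :: "'o => 'm set => 'k" where "up x == id0 x - lo x"

abbreviation E :: "'o => ('m => 'k) => nat => nat => 'm set => 'k" where
 "E x chi == mx x (dm x chi) (rho x chi)"

text \<open>The idempotent whose image is \<open>[x]^0_chi\<close>. Index 0 selects one of the
  \<open>dm x chi\<close> isomorphic copies and is legitimate because dimensions are
  positive.\<close>

definition ep :: "'o => ('m => 'k) => 'm set => 'k" where
 "ep x chi = cx x (E x chi 0 0) (up x)"

lemma lf2: "obj x ==> up x : hom0 x x"
 and lf4: "obj x ==> cx x (up x) (up x) = up x"
 and lf7: "obj x ==> f : thru (PS x) y x ==> obj y ==> cp y x x (up x) f = 0"
 and lf9: "obj x ==> g : AA x ==> cx x (up x) (gr g) = cx x (gr g) (up x)" using lowid_facts[OF lo] by blast+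

lemma comp3: "f : hom0 x x ==> g : hom0 x x ==> h : hom0 x x ==> obj x ==>
  cx x h (cx x g f) = cx x (cx x h g) f" by (rule cp_assoc)

lemma up_E: "obj x ==> cx x (up x) (E x chi a b) = cx x (E x chi a b) (up x)" unfolding mx_def by (rule ga_lowid[OF lo])

lemma ep_hom0: "obj x ==> ep x chi : hom0 x x" unfolding ep_def by (intro cp_hom0 mx_hom0 lf2)

lemma dm_pos: "obj x ==> chi : irr x ==> 0 < dm x chi" using rho irreducible_repD(2) by blast

lemma up_ep: "obj x ==> cx x (up x) (ep x chi) = ep x chi"
 unfolding ep_def using comp3[OF lf2 mx_hom0 lf2] comp3[OF lf2 lf2 mx_hom0] up_E lf4 by metis

lemma ep_idem:
 assumes x: "obj x" and c: "chi : irr x"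
 shows "cx x (ep x chi) (ep x chi) = ep x chi"
proof -
 have "cx x (ep x chi) (ep x chi) = cx x (E x chi 0 0) (cx x (up x) (ep x chi))"
  unfolding ep_def[of x chi] using comp3[OF cp_hom0[OF lf2 mx_hom0] lf2 mx_hom0] x by simp
 also have "... = cx x (cx x (E x chi 0 0) (E x chi 0 0)) (up x)" unfolding up_ep[OF x] unfolding ep_def using comp3[OF lf2 mx_hom0 mx_hom0] x by simp
 finally show ?thesis using mx_mult[OF x conjunct1[OF rho[OF x c]]] dm_pos[OF x c] by (simp add: ep_def)
qed

lemma ep_gr_ep:
 assumes x: "obj x" and c: "chi : irr x" "chi' : irr x" and g: "g : AA x"
 shows "cx x (ep x chi') (cx x (gr g) (ep x chi)) = (if chi' = chi then fsc (rho x chi g $$ (0, 0)) (ep x chi) else 0)"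
proof -
 note r = rho[OF x c(1)] and r' = rho[OF x c(2)] and d = dm_pos[OF x c(1)] dm_pos[OF x c(2)]
 note h = lf2[OF x] mx_hom0 gr_A[OF g] ep_hom0[OF x]
 have ep': "cx x (gr g) (ep x chi) = cx x (SUM a<dm x chi. fsc (rho x chi g $$ (a, 0)) (E x chi a 0)) (up x)"
  unfolding ep_def using comp3[OF h(1) h(2) h(3) x] gr_mx[OF x irreducible_repD(1)[OF conjunct1[OF r]] d(1) d(1) g] by simp
 have gh: "cx x (gr g) (ep x chi) : hom0 x x" by (rule cp_hom0[OF h(4,3) x x x])
 have "cx x (ep x chi') (cx x (gr g) (ep x chi)) = cx x (E x chi' 0 0) (cx x (up x) (cx x (gr g) (ep x chi)))"
  unfolding ep_def[of x chi'] using comp3[OF gh h(1,2) x] by simp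
 also have "cx x (up x) (cx x (gr g) (ep x chi)) = cx x (gr g) (ep x chi)"
  using comp3[OF h(4,3,1) x] comp3[OF h(4,1,3) x] lf9[OF x g] up_ep[OF x] by simp
 also have "cx x (E x chi' 0 0) (cx x (gr g) (ep x chi)) =
   cx x (cx x (E x chi' 0 0) (SUM a<dm x chi. fsc (rho x chi g $$ (a, 0)) (E x chi a 0))) (up x)"
  unfolding ep' by (rule comp3[OF h(1) _ h(2) x]) (intro hom0_sum hom0_fsc mx_hom0)
 also have "cx x (E x chi' 0 0) (SUM a<dm x chi. fsc (rho x chi g $$ (a, 0)) (E x chi a 0)) =
   (if chi' = chi then fsc (rho x chi g $$ (0, 0)) (E x chi 0 0) else 0)"
 proof (cases "chi' = chi")
  case True
  have "(SUM a<dm x chi. fsc (rho x chi g $$ (a, 0)) (cx x (E x chi 0 0) (E x chi a 0))) =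
    (SUM a<dm x chi. if a = 0 then fsc (rho x chi g $$ (0, 0)) (E x chi 0 0) else 0)"
   by (intro sum.cong refl) (use mx_mult[OF x conjunct1[OF r]] d in auto)
  then show ?thesis using True d by (simp add: cp_sum_right cp_fsc_right)
 next
  case False
  then have "cx x (E x chi' 0 0) (E x chi a 0) = 0" if "a < dm x chi" for a using mx_zero[OF x conjunct1[OF r'] conjunct1[OF r]] r r' d that by auto
  then show ?thesis using False by (simp add: cp_sum_right cp_fsc_right)
 qed
 finally show ?thesis by (simp add: cp_fsc_left ep_def)
qed

text \<open>Schur's lemma for the simple objects over one x: modulo the ideal, m is a combination of
  automorphisms, and the sandwich keeps only their (0, 0) coefficients.\<close>

lemma ep_sandwich:
 assumes x: "obj x" and c: "chi : irr x" "chi' : irr x" and m: "m : hom0 x x"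
 shows "EX s. cx x (ep x chi') (cx x m (ep x chi)) = (if chi' = chi then fsc s (ep x chi) else 0)"
proof -
 let ?c = "%g. m (graph C g)"
 note h = lf2[OF x] mx_hom0 ep_hom0[OF x]
 define t where "t = m - (SUM g:AA x. fsc (?c g) (gr g))"
 have t: "t : thru (PS x) x x" unfolding t_def by (rule hom0_mod_thru[OF m x])
 have te: "cx x t (ep x chi) : thru (PS x) x x" by (rule thru_right[OF t h(3) x x x])
 have "cx x (ep x chi') (cx x t (ep x chi)) = cx x (E x chi' 0 0) (cx x (up x) (cx x t (ep x chi)))"
  unfolding ep_def[of x chi'] using comp3[OF thru_hom0[OF te x x] h(1) h(2) x] by simp
 then have z: "cx x (ep x chi') (cx x t (ep x chi)) = 0" using lf7[OF x te x] by simp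
 have m': "m = (SUM g:AA x. fsc (?c g) (gr g)) + t" by (simp add: t_def)
 have "cx x (ep x chi') (cx x m (ep x chi)) =
   (SUM g:AA x. fsc (?c g) (cx x (ep x chi') (cx x (gr g) (ep x chi))))"
  by (subst m') (simp add: cp_add_left cp_add_right z cp_sum_left cp_sum_right cp_fsc_left cp_fsc_right)
 also have "... = (if chi' = chi then fsc (SUM g:AA x. ?c g * rho x chi g $$ (0, 0)) (ep x chi) else 0)"
  using ep_gr_ep[OF x c] by (simp add: fv.scale_sum_left)
 finally show ?thesis by blast
qed

lemma ep_orthogonal:
 assumes o: "obj x" "obj y" and n: "~ isom x y" and m: "m : hom0 x y"
 shows "cp x y y (ep y chi') (cp x x y m (ep x chi)) = 0"
proof -
 note hx = lf2[OF o(1)] mx_hom0 ep_hom0[OF o(1)] and hy = lf2[OF o(2)] mx_hom0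
 have mE: "cp x x y m (E x chi 0 0) : hom0 x y" by (rule cp_hom0[OF hx(2) m o(1,1,2)])
 have "cp x y y (ep y chi') (cp x x y m (ep x chi)) = cp x y y (E y chi' 0 0) (cp x y y (up y) (cp x x y m (ep x chi)))"
  unfolding ep_def[of y] using cp_assoc[OF cp_hom0[OF hx(3) m o(1,1,2)] hy(1,2) o(1,2,2,2)] by simp
 moreover have "cp x x y m (ep x chi) = cp x x y (cp x x y m (E x chi 0 0)) (up x)" unfolding ep_def by (rule cp_assoc[OF hx(1,2) m o(1,1,1,2)])
 moreover have "cp x y y (up y) (cp x x y (cp x x y m (E x chi 0 0)) (up x)) = 0" by (rule lowid_orthogonal[OF mE o n lo lo]) (use o in auto)
 ultimately show ?thesis by simp
qed

text \<open>Sums of morphisms through the objects \<open>[x]^0_chi\<close> with x in R. An identity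
  morphism in this ideal means that the object is built from these simple objects.\<close>

inductive_set thrE :: "'o set => 'o => 'o => ('m set => 'k) set" for R y y' where
 thrE_zero: "0 : thrE R y y'"
| thrE_step: "f : thrE R y y' ==> x : R ==> obj x ==> chi : irr x ==> k : hom0 y x ==> k' : hom0 x y' ==>
  cp y x y' k' (cp y x x (ep x chi) k) + f : thrE R y y'"

lemma thrE_add: "f : thrE R y y' ==> g : thrE R y y' ==> f + g : thrE R y y'" by (induction rule: thrE.induct) (auto simp: add.assoc intro: thrE_step)

lemma thrE_sum: "(!!a. a : I ==> f a : thrE R y y') ==> (SUM a:I. f a) : thrE R y y'"
 by (induction I rule: infinite_finite_induct) (auto intro: thrE_add thrE_zero)

lemma thrE_comp:
 assumes "f : thrE R y y" "h : hom0 z y" "h' : hom0 y z'" "obj y" "obj z" "obj z'"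
 shows "cp z y z' h' (cp z y y f h) : thrE R z z'" using assms(1)
proof (induction rule: thrE.induct)
 case (thrE_step f x chi k k')
 note ek = cp_hom0[OF thrE_step(5) ep_hom0[OF thrE_step(3)] assms(4) thrE_step(3,3)]
 have "cp z y y (cp y x y k' (cp y x x (ep x chi) k)) h = cp z x y k' (cp z y x (cp y x x (ep x chi) k) h)"
  using cp_assoc[OF assms(2) ek thrE_step(6)] assms thrE_step(3) by simp
 also have "cp z y x (cp y x x (ep x chi) k) h = cp z x x (ep x chi) (cp z y x k h)"
  using cp_assoc[OF assms(2) thrE_step(5) ep_hom0] assms thrE_step(3) by simp
 finally have "cp z y z' h' (cp z y y (cp y x y k' (cp y x x (ep x chi) k)) h) =
   cp z x z' (cp x y z' h' k') (cp z x x (ep x chi) (cp z y x k h))"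
  using cp_assoc[OF _ thrE_step(6) assms(3), of "cp z x x (ep x chi) (cp z y x k h)" z]
   cp_hom0 ep_hom0 assms thrE_step(3,5) by simp
 moreover have "cp z x z' (cp x y z' h' k') (cp z x x (ep x chi) (cp z y x k h)) + cp z y z' h' (cp z y y f h) : thrE R z z'"
  using thrE_step assms by (intro thrE.thrE_step cp_hom0)
 ultimately show ?case by (simp add: cp_add_left cp_add_right)
qed (simp add: thrE_zero)

text \<open>The diagonal matrix units add up to the identity by completeness of the characters, and
  each of them passes through the one with index 0.\<close>

lemma up_thrE:
 assumes x: "obj x" "x : R" shows "up x : thrE R x x"
proof -
 interpret G: fin_group "A x" using fin_group_A[OF x(1)] .
 note h = lf2[OF x(1)] mx_hom0 ep_hom0[OF x(1)]
 have "up x = cx x (SUM chi:irr x. SUM a<dm x chi. E x chi a a) (up x)"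
  using mx_complete[OF x(1), of "dm x" "rho x"] rho[OF x(1)] cp_id_left[OF h(1)] x by simp
 also have "... = (SUM chi:irr x. SUM a<dm x chi. cx x (E x chi a 0) (cx x (ep x chi) (E x chi 0 a)))" unfolding cp_sum_left
 proof (intro sum.cong refl)
  fix chi a assume c: "chi : irr x" and a: "a : {..<dm x chi}"
  note r = conjunct1[OF rho[OF x(1) c]] and d = dm_pos[OF x(1) c]
  have "cx x (E x chi a a) (up x) = cx x (cx x (E x chi a 0) (E x chi 0 a)) (up x)" using mx_mult[OF x(1) r] a d by simp
  also have "... = cx x (E x chi a 0) (cx x (up x) (E x chi 0 a))" using comp3[OF h(1) h(2) h(2) x(1)] up_E[OF x(1)] by simp
  also have "cx x (up x) (E x chi 0 a) = cx x (cx x (E x chi 0 0) (E x chi 0 a)) (up x)" using mx_mult[OF x(1) r] a d up_E[OF x(1)] by simp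
  also have "... = cx x (ep x chi) (E x chi 0 a)" unfolding ep_def comp3[OF h(2) h(1) h(2) x(1), symmetric] up_E[OF x(1)]
   by (rule comp3[OF h(1) h(2) h(2) x(1), symmetric])
  finally show "cx x (E x chi a a) (up x) = cx x (E x chi a 0) (cx x (ep x chi) (E x chi 0 a))" .
 qed
 also have "... : thrE R x x" using thrE_step[OF thrE_zero x(2,1) _ mx_hom0 mx_hom0] by (intro thrE_sum) simp
 finally show ?thesis .
qed

text \<open>Induction on size. With y replaced by its representative w in R, the upper part of w is
  covered by \<open>up_thrE\<close>, and the lower part factors through smaller subquotients of
  X.\<close>

lemma id0_thrE:
 assumes X: "obj X" and R: "subquotient_representatives C X R" and s: "subq y X"
 shows "id0 y : thrE R y y" using s
proof (induction "csz y" arbitrary: y rule: less_induct)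
 case less
 have y: "obj y" using subquotient_obj[OF less.prems] by simp
 obtain w where w: "w : R" "isom y w" using R less.prems by (auto simp: subquotient_representatives_def)
 have ws: "subq w X" using R w(1) by (simp add: subquotient_representatives_def)
 have wo: "obj w" using subquotient_obj[OF ws] by simp
 have th: "f : thrE R w w" if "f : thru (PS w) w w" for f using that
 proof (induction rule: thru.induct)
  case (thru_step f z h h')
  have zX: "subq z X" using thru_step(2) ws subquotient_trans by (auto simp: PS_def proper_subquotient_def)
  have "csz z < csz y" using PS_csz[OF thru_step(2)] isomorphic_csz[OF w(2)] by simp
  then have "cp w z w h' (cp w z z (id0 z) h) : thrE R w w" using less.hyps[OF _ zX] thru_step wo by (intro thrE_comp)
  then show ?case using thrE_add thru_step cp_id_left wo by simp
 qed (rule thrE_zero)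
 have "lo w : thru (PS w) w w" using lo[OF wo] by (simp add: lowid_def)
 then have "id0 w : thrE R w w" using thrE_add[OF up_thrE[OF wo w(1)] th[of "lo w"]] by simp
 moreover obtain g where g0: "iso g" "dom g = y" "cod g = w" using w(2) by (rule isomorphicE)
 moreover obtain j where j: "arr g" "arr j" "dom j = cod g" "cod j = dom g"
  "j**g = ide (dom g)" "g**j = ide (cod g)" using isoD[OF g0(1)] .
 moreover have g: "arr g" "arr j" "dom g = y" "cod g = w" "dom j = w" "cod j = y" "j**g = ide y" using g0 j by auto
 ultimately have "cp y w y (gr j) (cp y w w (id0 w) (gr g)) : thrE R y y" using y wo gr_hom0[OF g(1,3,4)] gr_hom0[OF g(2,5,6)] by (intro thrE_comp)
 moreover have "cp y w y (gr j) (cp y w w (id0 w) (gr g)) = id0 y"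
  using cp_id_left[OF gr_hom0[OF g(1,3,4)] y wo] gr_comp[OF g(1,2,3,4,5,6)] g(7) gr_ide[OF y] by simp
 ultimately show ?case by simp
qed

end

subsection \<open>Multiplicities\<close>

text \<open>The fixed points of a conjugate are translates of the original ones, and an element and
  its inverse fix the same points.\<close>

lemma (in group) perm_char_conj_inv:
 assumes act: "!!g s. g : carrier G ==> s : S ==> act g s : S" "!!s. s : S ==> act \<one> s = s"
  "!!g h s. g : carrier G ==> h : carrier G ==> s : S ==> act g (act h s) = act (g \<otimes> h) s"
  and g: "g : carrier G"
 shows "h : carrier G ==> perm_char act S (h \<otimes> g \<otimes> inv h) = perm_char act S g"
  and "perm_char act S (inv g) = perm_char act S g"
proof -
 have i: "act (inv k) (act k s) = s" "act k (act (inv k) s) = s" if "k : carrier G" "s : S" for k s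
  using act(2)[OF that(2)] act(3)[OF _ _ that(2)] that(1) by simp_all
 have "{s : S. act (inv g) s = s} = {s : S. act g s = s}" using i[OF g] by metis
 then show "perm_char act S (inv g) = perm_char act S g" by (simp add: perm_char_def)
 assume h: "h : carrier G"
 have c: "act (h \<otimes> g \<otimes> inv h) (act h s) = act h (act g s)" if "s : S" for s
 proof -
  have "h \<otimes> g \<otimes> inv h \<otimes> h = h \<otimes> g" using g h by (simp add: m_assoc)
  then show ?thesis using act(3)[OF _ _ that] g h by simp
 qed
 have "bij_betw (act h) {s : S. act g s = s} {s : S. act (h \<otimes> g \<otimes> inv h) s = s}"
 proof (rule bij_betw_byWitness[where f' = "act (inv h)"])
  show "act h ` {s : S. act g s = s} <= {s : S. act (h \<otimes> g \<otimes> inv h) s = s}" using act(1)[OF h] c by auto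
  have "act g (act (inv h) t) = act (inv h) t" if t: "t : S" "act (h \<otimes> g \<otimes> inv h) t = t" for t
  proof -
   have "act (inv h) (act (h \<otimes> g \<otimes> inv h) t) = act (inv h) t" using t by simp
   moreover have "inv h \<otimes> (h \<otimes> g \<otimes> inv h) = g \<otimes> inv h" using g h by (simp add: m_assoc[symmetric])
   ultimately show ?thesis using act(3)[OF _ _ t(1)] g h by simp
  qed
  then show "act (inv h) ` {s : S. act (h \<otimes> g \<otimes> inv h) s = s} <= {s : S. act g s = s}" using act(1)[OF inv_closed[OF h]] by auto
 qed (use i[OF h] in auto)
 then show "perm_char act S (h \<otimes> g \<otimes> inv h) = perm_char act S g" by (simp add: perm_char_def bij_betw_same_card)
qed

lemma linear_sum:
 assumes "!!f g. T (f + g) = T f + T g" "!!c f. T (fsc c f) = fsc c (T f)"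
 shows "T (SUM i:I. fsc (a i) (u i)) = (SUM i:I. fsc (a i) (T (u i)))"
 using assms(2)[of 0 0] by (induction I rule: infinite_finite_induct) (simp_all add: assms)

context simple_data
begin

lemma ternary_action_group:
 assumes o: "obj x" "obj y" "obj z" and r: "r : ternary_set C x y z"
  and h: "h1 : AA x" "h2 : AA y" "h3 : AA z"
 shows "ternary_action C x y z (h1, h2, h3) r : ternary_set C x y z"
  "ternary_action C x y z (ide x, ide y, ide z) r = r"
  "!!g1 g2 g3. g1 : AA x ==> g2 : AA y ==> g3 : AA z ==>
   ternary_action C x y z (g1, g2, g3) (ternary_action C x y z (h1, h2, h3) r) = ternary_action C x y z (g1**h1, g2**h2, g3**h3) r"
proof -
 have rS: "r : Sub (prd (prd x y) z)" using r by (simp add: ternary_set_def prd3_def)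
 obtain a b c where a: "arr a" "arr b" "arr c" "dom a = dom b" "dom c = dom b"
  "cod a = x" "cod b = y" "cod c = z" "mono (t3 a b c)" "sub (t3 a b c) = r"
  "r : ternary_set C x y z \<longleftrightarrow> Tc a b c" using ternary_obtain[OF rS o] .
 note act = ternary_action_sub_of[OF a(9,1-8)]
 have d: "arr h1" "arr h2" "arr h3" "dom h1 = x" "dom h2 = y" "dom h3 = z" "cod h1 = x" "cod h2 = y" "cod h3 = z" using h by (auto simp: A_iff)
 have ar: "arr (h1**a)" "arr (h2**b)" "arr (h3**c)" "dom (h1**a) = dom (h2**b)" "dom (h3**c) = dom (h2**b)"
  "cod (h1**a) = x" "cod (h2**b) = y" "cod (h3**c) = z" using a d by auto
 show "ternary_action C x y z (h1, h2, h3) r : ternary_set C x y z"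
  using act(2)[OF h] act(3)[OF h] a(10,11) r ternary_set_sub_of[OF act(1)[OF h] ar] by simp
 have I: "ide x : AA x" "ide y : AA y" "ide z : AA z"
  using group.is_monoid[OF group_A[OF o(1)], THEN monoid.one_closed] group.is_monoid[OF group_A[OF o(2)], THEN monoid.one_closed]
   group.is_monoid[OF group_A[OF o(3)], THEN monoid.one_closed] by simp_all
 have "ide x**a = a" "ide y**b = b" "ide z**c = c" using a by auto
 then show "ternary_action C x y z (ide x, ide y, ide z) r = r" using act(2)[OF I] a(10) by simp
 fix g1 g2 g3 assume g: "g1 : AA x" "g2 : AA y" "g3 : AA z"
 have gh: "g1**h1 : AA x" "g2**h2 : AA y" "g3**h3 : AA z" using monoid.m_closed[OF group.is_monoid[OF group_A]] o g h by (metis A_simps(1))+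
 have "(g1**h1)**a = g1**(h1**a)" "(g2**h2)**b = g2**(h2**b)" "(g3**h3)**c = g3**(h3**c)" using a d g by (auto simp: A_iff)
 then show "ternary_action C x y z (g1, g2, g3) (ternary_action C x y z (h1, h2, h3) r) = ternary_action C x y z (g1**h1, g2**h2, g3**h3) r"
  using act(2)[OF gh] act(2)[OF h] ternary_action_sub_of(2)[OF act(1)[OF h] ar g] a(10) by simp
qed

lemma ternary_char_conj_inv:
 assumes o: "obj x" "obj y" "obj z"
 defines "P == A x \<times>\<times> A y \<times>\<times> A z"
 assumes g: "g : carrier P"
 shows "h : carrier P ==> ternary_char C x y z (h \<otimes>\<^bsub>P\<^esub> g \<otimes>\<^bsub>P\<^esub> inv\<^bsub>P\<^esub> h) = (ternary_char C x y z g :: 'k)"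
  and "ternary_char C x y z (inv\<^bsub>P\<^esub> g) = (ternary_char C x y z g :: 'k)"
proof -
 interpret P: group P unfolding P_def by (intro DirProd_group group_A o)
 note a = ternary_action_group[OF o]
 have 1: "ternary_action C x y z g s : ternary_set C x y z" if "g : carrier P" "s : ternary_set C x y z" for g s
  using a(1)[OF that(2)] that(1) by (auto simp: P_def)
 have 2: "ternary_action C x y z \<one>\<^bsub>P\<^esub> s = s" if "s : ternary_set C x y z" for s
  using a(2)[OF that, of "ide x" "ide y" "ide z"] P.one_closed by (simp add: P_def)
 have 3: "ternary_action C x y z g (ternary_action C x y z h s) = ternary_action C x y z (g \<otimes>\<^bsub>P\<^esub> h) s"
  if "g : carrier P" "h : carrier P" "s : ternary_set C x y z" for g h s using a(3)[OF that(3)] that(1,2) by (auto simp: P_def)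
 show "h : carrier P ==> ternary_char C x y z (h \<otimes>\<^bsub>P\<^esub> g \<otimes>\<^bsub>P\<^esub> inv\<^bsub>P\<^esub> h) = (ternary_char C x y z g :: 'k)"
  "ternary_char C x y z (inv\<^bsub>P\<^esub> g) = (ternary_char C x y z g :: 'k)"
  unfolding ternary_char_def by (rule P.perm_char_conj_inv[OF 1 2 3 g]; assumption)+
qed

text \<open>The coefficients of the matrix unit \<open>E x chi 0 0\<close> in the group
  algebra.\<close>

definition kc :: "'o => ('m => 'k) => 'm => 'k" where
 "kc x chi g = of_nat (dm x chi) / of_nat (Coset.order (A x)) * rho x chi (iv x g) $$ (0, 0)"

text \<open>Against a class function the (0, 0) matrix coefficient may be replaced by its average
  over the diagonal, the character divided by the dimension; the dimension in \<open>kc\<close>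
  cancels this division.\<close>

lemma kc_class_function:
 assumes x: "obj x" and c: "chi : irr x"
  and f: "!!g h. g : AA x ==> h : AA x ==> psi (h \<otimes>\<^bsub>A x\<^esub> g \<otimes>\<^bsub>A x\<^esub> iv x h) = psi g"
 shows "(SUM g:AA x. kc x chi g * psi g) = (SUM g:AA x. chi (iv x g) * psi g) / of_nat (Coset.order (A x))"
proof -
 interpret G: fin_group "A x" using fin_group_A[OF x] .
 let ?G = "AA x" and ?n = "of_nat (Coset.order (A x)) :: 'k"
 note r = rho[OF x c] and d = dm_pos[OF x c]
 have f': "psi (iv x (h \<otimes>\<^bsub>A x\<^esub> g \<otimes>\<^bsub>A x\<^esub> iv x h)) = psi (iv x g)" if "g : ?G" "h : ?G" for g h
  using f[OF G.inv_closed[OF that(1)] that(2)] that by (simp add: G.inv_mult_group G.m_assoc del: A_simps)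
 have "(SUM g:?G. kc x chi g * psi g) = (SUM g:?G. kc x chi (iv x g) * psi (iv x g))" by (rule G.sum_inv[symmetric])
 also have "... = of_nat (dm x chi) * (SUM g:?G. psi (iv x g) * rho x chi g $$ (0, 0)) / ?n"
  by (simp add: kc_def sum_distrib_left sum_divide_distrib mult_ac)
 also have "of_nat (dm x chi) * (SUM g:?G. psi (iv x g) * rho x chi g $$ (0, 0)) = (SUM g:?G. psi (iv x g) * chi g)"
  using G.class_function_scalar[OF conjunct1[OF r] f' d d] conjunct2[OF r] by simp
 also have "(SUM g:?G. psi (iv x g) * chi g) = (SUM g:?G. chi (iv x g) * psi g)" by (subst G.sum_inv[symmetric]) (simp add: mult.commute)
 finally show ?thesis .
qed

lemma ep_kc: "obj x ==> ep x chi = (SUM g:AA x. fsc (kc x chi g) (cx x (up x) (gr g)))"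
 unfolding ep_def up_E[symmetric] by (simp add: mx_def ga_def kc_def cp_sum_right cp_fsc_right)

lemma Th_lin:
 "Th x y z (SUM i:I. fsc (a i) (u i)) q w m = (SUM i:I. fsc (a i) (Th x y z (u i) q w m))"
 "Th x y z p (SUM i:I. fsc (a i) (u i)) w m = (SUM i:I. fsc (a i) (Th x y z p (u i) w m))"
 "Th x y z p q (SUM i:I. fsc (a i) (u i)) m = (SUM i:I. fsc (a i) (Th x y z p q (u i) m))"
 by (rule linear_sum; simp add: Th_def ten0_add_left ten0_fsc_left ten0_add_right ten0_fsc_right
  cp_add_left cp_add_right cp_fsc_left cp_fsc_right)+

text \<open>The trace expands over triples of automorphisms with values of the permutation
  character. As that character is a class function in each variable, the matrix coefficients turn
  into characters one variable at a time, and its invariance under inversion puts the inverses where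
  the pairing has them.\<close>

lemma ep_trace:
 assumes o: "obj x1" "obj x2" "obj x"
  and c: "chi1 : irr x1" "chi2 : irr x2" "chi : irr x"
 shows "(SUM r:Sub (prd (prd x1 x2) x). Th x1 x2 x (ep x1 chi1) (ep x2 chi2) (ep x chi) (basis_vec r) r) =
  char_pairing (A x1 \<times>\<times> A x2 \<times>\<times> A x) (ternary_char C x1 x2 x) (tensor_char chi1 chi2 (dual_char (A x) chi))"
proof -
 let ?S = "Sub (prd (prd x1 x2) x)" and ?G1 = "carrier (A x1)" and ?G2 = "carrier (A x2)" and ?G = "AA x"
 let ?T = "ternary_char C x1 x2 x :: _ => 'k"
 let ?i1 = "%g. iv x1 g" and ?i2 = "%g. iv x2 g" and ?i = "%g. iv x g"
 let ?n1 = "of_nat (Coset.order (A x1)) :: 'k" and ?n2 = "of_nat (Coset.order (A x2)) :: 'k" and ?n = "of_nat (Coset.order (A x)) :: 'k"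
 interpret G1: fin_group "A x1" using fin_group_A[OF o(1)] .
 interpret G2: fin_group "A x2" using fin_group_A[OF o(2)] .
 interpret G: fin_group "A x" using fin_group_A[OF o(3)] .
 interpret H: group "A x2 \<times>\<times> A x" by (intro DirProd_group group_A o)
 interpret P: group "A x1 \<times>\<times> A x2 \<times>\<times> A x" by (intro DirProd_group group_A o)
 have inv_P: "inv\<^bsub>A x1 \<times>\<times> A x2 \<times>\<times> A x\<^esub> (g1, g2, g3) = (?i1 g1, ?i2 g2, ?i g3)"
  if "g1 : ?G1" "g2 : ?G2" "g3 : ?G" for g1 g2 g3
  using that inv_DirProd[OF G1.is_group H.is_group] inv_DirProd[OF G2.is_group G.is_group] by (simp add: G1.is_group H.is_group)
 have conj: "?T (h1 \<otimes>\<^bsub>A x1\<^esub> g1 \<otimes>\<^bsub>A x1\<^esub> ?i1 h1, h2 \<otimes>\<^bsub>A x2\<^esub> g2 \<otimes>\<^bsub>A x2\<^esub> ?i2 h2, h3 \<otimes>\<^bsub>A x\<^esub> g3 \<otimes>\<^bsub>A x\<^esub> ?i h3) = ?T (g1, g2, g3)"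
  if "g1 : ?G1" "g2 : ?G2" "g3 : ?G" "h1 : ?G1" "h2 : ?G2" "h3 : ?G" for g1 g2 g3 h1 h2 h3
  using ternary_char_conj_inv(1)[OF o, of "(g1, g2, g3)" "(h1, h2, h3)"] that inv_P by (simp del: A_simps)
 have Tinv: "?T (?i1 g1, ?i2 g2, ?i g3) = ?T (g1, g2, g3)" if "g1 : ?G1" "g2 : ?G2" "g3 : ?G" for g1 g2 g3
  using ternary_char_conj_inv(2)[OF o, of "(g1, g2, g3)"] that inv_P by simp
 have c3: "?T (g1, g2, h \<otimes>\<^bsub>A x\<^esub> g3 \<otimes>\<^bsub>A x\<^esub> ?i h) = ?T (g1, g2, g3)" if "g1 : ?G1" "g2 : ?G2" "g3 : ?G" "h : ?G" for g1 g2 g3 h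
  using conj[OF that(1-3) G1.one_closed G2.one_closed that(4)] that by (simp del: A_simps)
 have c2: "?T (?i1 g1, ?i2 (h \<otimes>\<^bsub>A x2\<^esub> g2 \<otimes>\<^bsub>A x2\<^esub> ?i2 h), g3) = ?T (?i1 g1, ?i2 g2, g3)" if "g1 : ?G1" "g2 : ?G2" "g3 : ?G" "h : ?G2" for g1 g2 g3 h
  using conj[of "?i1 g1" "?i2 g2" g3 "\<one>\<^bsub>A x1\<^esub>" h "\<one>\<^bsub>A x\<^esub>"] that
  by (simp add: G2.inv_mult_group G2.m_assoc del: A_simps)
 have c1: "?T (?i1 (h \<otimes>\<^bsub>A x1\<^esub> g1 \<otimes>\<^bsub>A x1\<^esub> ?i1 h), ?i2 g2, g3) = ?T (?i1 g1, ?i2 g2, g3)" if "g1 : ?G1" "g2 : ?G2" "g3 : ?G" "h : ?G1" for g1 g2 g3 h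
  using conj[of "?i1 g1" "?i2 g2" g3 h "\<one>\<^bsub>A x2\<^esub>" "\<one>\<^bsub>A x\<^esub>"] that
  by (simp add: G1.inv_mult_group G1.m_assoc del: A_simps)
 have "(SUM r:?S. Th x1 x2 x (ep x1 chi1) (ep x2 chi2) (ep x chi) (basis_vec r) r) =
  (SUM r:?S. SUM g1:?G1. SUM g2:?G2. SUM g:?G. kc x1 chi1 g1 * (kc x2 chi2 g2 * (kc x chi g *
   Th x1 x2 x (cp x1 x1 x1 (up x1) (gr g1)) (cp x2 x2 x2 (up x2) (gr g2)) (cx x (up x) (gr g)) (basis_vec r) r)))"
  unfolding ep_kc[OF o(1)] ep_kc[OF o(2)] ep_kc[OF o(3)] Th_lin(1) unfolding Th_lin(2) unfolding Th_lin(3) by (simp add: sum_fun_eval fsc_apply sum_distrib_left)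
 also have "... = (SUM g1:?G1. SUM g2:?G2. SUM g:?G. kc x1 chi1 g1 * (kc x2 chi2 g2 * (kc x chi g * (SUM r:?S.
   Th x1 x2 x (cp x1 x1 x1 (up x1) (gr g1)) (cp x2 x2 x2 (up x2) (gr g2)) (cx x (up x) (gr g)) (basis_vec r) r))))"
  by (subst sum.swap, rule sum.cong[OF refl], subst sum.swap, rule sum.cong[OF refl], subst sum.swap) (simp add: sum_distrib_left)
 also have "... = (SUM g1:?G1. SUM g2:?G2. SUM g:?G. kc x1 chi1 g1 * (kc x2 chi2 g2 * (kc x chi g * ?T (?i1 g1, ?i2 g2, g))))"
  by (intro sum.cong refl arg_cong2[where f = "(*)"] Th_trace o lo)
 also have "... = (SUM g1:?G1. kc x1 chi1 g1 * (SUM g2:?G2. kc x2 chi2 g2 * (SUM g:?G. kc x chi g * ?T (?i1 g1, ?i2 g2, g))))"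
  by (simp add: sum_distrib_left)
 also have "... = (SUM g1:?G1. kc x1 chi1 g1 * (SUM g2:?G2. kc x2 chi2 g2 * ((SUM g:?G. chi (?i g) * ?T (?i1 g1, ?i2 g2, g)) / ?n)))"
  by (intro sum.cong refl arg_cong2[where f = "(*)"] kc_class_function[OF o(3) c(3)] c3 G1.inv_closed G2.inv_closed)
 also have "... = (SUM g1:?G1. kc x1 chi1 g1 * ((SUM g2:?G2. chi2 (?i2 g2) * ((SUM g:?G. chi (?i g) * ?T (?i1 g1, ?i2 g2, g)) / ?n)) / ?n2))"
  by (intro sum.cong refl arg_cong2[where f = "(*)"] arg_cong2[where f = "(/)"] kc_class_function[OF o(2) c(2)]) (use c2 in auto)
 also have "... = (SUM g1:?G1. chi1 (?i1 g1) * ((SUM g2:?G2. chi2 (?i2 g2) * ((SUM g:?G. chi (?i g) * ?T (?i1 g1, ?i2 g2, g)) / ?n)) / ?n2)) / ?n1"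
  by (rule kc_class_function[OF o(1) c(1)]) (use c1 in auto)
 also have "... = (SUM g1:?G1. SUM g2:?G2. SUM g:?G. ?T (?i1 g1, ?i2 g2, g) * (chi1 (?i1 g1) * chi2 (?i2 g2) * chi (?i g))) / (?n1 * (?n2 * ?n))"
  by (simp add: sum_distrib_left sum_divide_distrib mult_ac)
 also have "(SUM g1:?G1. SUM g2:?G2. SUM g:?G. ?T (?i1 g1, ?i2 g2, g) * (chi1 (?i1 g1) * chi2 (?i2 g2) * chi (?i g))) =
  (SUM g1:?G1. SUM g2:?G2. SUM g:?G. ?T (g1, g2, g) * (chi1 (?i1 g1) * chi2 (?i2 g2) * chi g))"
 proof (rule sum.cong[OF refl], rule sum.cong[OF refl])
  fix g1 g2 assume g: "g1 : ?G1" "g2 : ?G2"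
  have "(SUM g:?G. ?T (?i1 g1, ?i2 g2, g) * (chi1 (?i1 g1) * chi2 (?i2 g2) * chi (?i g))) =
   (SUM g:?G. ?T (?i1 g1, ?i2 g2, ?i g) * (chi1 (?i1 g1) * chi2 (?i2 g2) * chi (?i (?i g))))" by (rule G.sum_inv[symmetric])
  also have "... = (SUM g:?G. ?T (g1, g2, g) * (chi1 (?i1 g1) * chi2 (?i2 g2) * chi g))" using Tinv g by (intro sum.cong refl) simp
  finally show "(SUM g:?G. ?T (?i1 g1, ?i2 g2, g) * (chi1 (?i1 g1) * chi2 (?i2 g2) * chi (?i g))) =
   (SUM g:?G. ?T (g1, g2, g) * (chi1 (?i1 g1) * chi2 (?i2 g2) * chi g))" .
 qed
 also have "... = (SUM g:carrier (A x1 \<times>\<times> A x2 \<times>\<times> A x). ?T g * tensor_char chi1 chi2 (dual_char (A x) chi) (inv\<^bsub>A x1 \<times>\<times> A x2 \<times>\<times> A x\<^esub> g))"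
  by (simp add: sum.cartesian_product') (intro sum.cong refl, simp add: inv_P tensor_char_def dual_char_def)
 finally show ?thesis by (simp add: char_pairing_def Coset.order_def card_cartesian_product)
qed

end

subsection \<open>Decomposition of a tensor product of simple summands\<close>

context simple_data
begin

text \<open>The rank n, a basis w of the space of morphisms into \<open>[x]^0_chi\<close> and
  coordinates phi, packed into one triple so that they can be chosen for all x and chi at
  once.\<close>

definition rfac :: "'o => ('m => 'k) => 'o => ('m => 'k) => 'o => ('m => 'k) =>
  nat \<times> (nat => 'm set => 'k) \<times> (nat => ('m set => 'k) => 'k) => bool" where
 "rfac x1 chi1 x2 chi2 x chi = (%(n, w, phi). let X = prd x1 x2; P = ten0 x1 x1 x2 x2 (ep x1 chi1) (ep x2 chi2) in
  (ALL i<n. w i : hom0 X x & cp X x x (ep x chi) (w i) = w i & cp X X x (w i) P = w i) &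
  (ALL h:hom0 X x. cp X x x (ep x chi) (cp X X x h P) = (SUM i<n. fsc (phi i h) (w i))) &
  (ALL c c'. (SUM i<n. fsc (c i) (w i)) = (SUM i<n. fsc (c' i) (w i)) --> (ALL i<n. c i = c' i)) &
  of_nat n = char_pairing (A x1 \<times>\<times> A x2 \<times>\<times> A x) (ternary_char C x1 x2 x) (tensor_char chi1 chi2 (dual_char (A x) chi)))"

lemma ep_tensor_idem:
 assumes o: "obj x1" "obj x2" and c: "chi1 : irr x1" "chi2 : irr x2"
 shows "cp (prd x1 x2) (prd x1 x2) (prd x1 x2) (ten0 x1 x1 x2 x2 (ep x1 chi1) (ep x2 chi2))
  (ten0 x1 x1 x2 x2 (ep x1 chi1) (ep x2 chi2)) = ten0 x1 x1 x2 x2 (ep x1 chi1) (ep x2 chi2)"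
 using ten0_cp[OF ep_hom0[OF o(1), of chi1] ep_hom0[OF o(1), of chi1] ep_hom0[OF o(2), of chi2] ep_hom0[OF o(2), of chi2] o(1,1,1,2,2,2)]
  ep_idem[OF o(1) c(1)] ep_idem[OF o(2) c(2)] by simp

lemma rfac_exists:
 assumes o: "obj x1" "obj x2" "obj x"
  and c: "chi1 : irr x1" "chi2 : irr x2" "chi : irr x"
 shows "EX t. rfac x1 chi1 x2 chi2 x chi t"
proof -
 let ?X = "prd x1 x2" and ?P = "ten0 x1 x1 x2 x2 (ep x1 chi1) (ep x2 chi2)" and ?e = "ep x chi"
 let ?Q = "Th x1 x2 x (ep x1 chi1) (ep x2 chi2) ?e"
 have X: "obj ?X" using o by simp
 note h = ep_hom0[OF o(1), of chi1] ep_hom0[OF o(2), of chi2] ep_hom0[OF o(3), of chi]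
 have P: "?P : hom0 ?X ?X" using h o by (intro ten0_hom0)
 note PP = ep_tensor_idem[OF o(1,2) c(1,2)]
 have lin: "?Q (h + k) = ?Q h + ?Q k" "?Q (fsc c h) = fsc c (?Q h)" for h k c
  by (simp_all add: Th_def cp_add_left cp_add_right cp_fsc_left cp_fsc_right)
 have Qh: "?Q m : hom0 ?X x" if "m : hom0 ?X x" for m by (rule Th_hom0[OF that h o])
 have Qi: "?Q (?Q m) = ?Q m" if "m : hom0 ?X x" for m using Th_comp[OF that h(1,1,2,2,3,3) o] ep_idem o c by simp
 obtain n :: nat and w phi where w: "!!i. i < n ==> w i : hom0 ?X x" "!!i. i < n ==> ?Q (w i) = w i"
  "!!m. m : hom0 ?X x ==> ?Q m = (SUM i<n. fsc (phi i m) (w i))"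
  "!!c c' i. (SUM i<n. fsc (c i) (w i)) = (SUM i<n. fsc (c' i) (w i)) ==> i < n ==> c i = c' i"
  "(SUM r:Sub (prd ?X x). ?Q (basis_vec r) r) = of_nat n"
 proof (rule idempotent_rank_factorization[of "Sub (prd ?X x)" "hom0 ?X x" ?Q])
  show "finite (Sub (prd ?X x))" using X o by simp
  show "hom0 ?X x = {h. ALL r. r ~: Sub (prd ?X x) --> h r = 0}" by (auto simp: hom0_iff)
 qed (use lin Qh Qi in blast)+
 have mP: "cp ?X ?X x m ?P : hom0 ?X x" if "m : hom0 ?X x" for m by (rule cp_hom0[OF P that X X o(3)])
 have "cp ?X x x ?e (w i) = w i & cp ?X ?X x (w i) ?P = w i" if i: "i < n" for i
 proof -
  have e: "w i = cp ?X x x ?e (cp ?X ?X x (w i) ?P)" using w(2)[OF i] by (simp add: Th_def)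
  have "cp ?X x x ?e (w i) = cp ?X x x (cx x ?e ?e) (cp ?X ?X x (w i) ?P)" by (subst e) (rule cp_assoc[OF mP[OF w(1)[OF i]] h(3,3) X o(3,3,3)])
  moreover have "cp ?X ?X x (w i) ?P = cp ?X x x ?e (cp ?X ?X x (cp ?X ?X x (w i) ?P) ?P)"
   by (subst e) (rule cp_assoc[OF P mP[OF w(1)[OF i]] h(3) X X o(3,3), symmetric])
  ultimately show ?thesis using ep_idem[OF o(3) c(3)] e cp_assoc[OF P P w(1)[OF i] X X X o(3)] PP by simp
 qed
 then show ?thesis using w ep_trace[OF o c] by (intro exI[of _ "(n, w, phi)"]) (simp add: rfac_def Th_def Let_def)
qed

text \<open>The projections w are the bases of the multiplicity spaces, and the injections v come
  from writing P, a morphism through simple objects, in terms of the w. Biorthogonality is then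
  forced: \<open>w b\<close> after \<open>v a\<close> is a scalar by Schur's lemma, zero unless a
  and b share x and chi; since \<open>w b\<close> is fixed by P, it is the combination of the
  \<open>w a\<close> with these scalars, and linear independence makes them 1 or 0.\<close>

lemma tensor_decomposition:
 assumes o: "obj x1" "obj x2" and c: "chi1 : irr x1" "chi2 : irr x2"
  and R: "subquotient_representatives C (prd x1 x2) R"
 defines "X == prd x1 x2" and "P == ten0 x1 x1 x2 x2 (ep x1 chi1) (ep x2 chi2)"
  and "ea == %a. ep (fst a) (fst (snd a))"
 shows "EX n w v. (ALL x:R. ALL chi:irr x. of_nat (n x chi) =
   char_pairing (A x1 \<times>\<times> A x2 \<times>\<times> A x) (ternary_char C x1 x2 x) (tensor_char chi1 chi2 (dual_char (A x) chi))) &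
  (let I = {(x, chi, k). x : R & chi : irr x & k < n x chi} in finite I &
   (ALL a:I. w a : hom0 X (fst a) & v a : hom0 (fst a) X & cp X (fst a) (fst a) (ea a) (w a) = w a & cp X X (fst a) (w a) P = w a) &
   (ALL a:I. ALL b:I. cp (fst a) X (fst b) (w b) (v a) = (if a = b then ea a else 0)) &
   (SUM a:I. cp X (fst a) X (v a) (w a)) = P)"
proof -
 have XO: "obj X" using o by (simp add: X_def)
 have RO: "obj x" if "x : R" for x using R that subquotient_obj(1) by (auto simp: subquotient_representatives_def)
 have Runiq: "x = y" if "x : R" "y : R" "isom x y" for x y
 proof -
  have "subq x (prd x1 x2)" using R that(1) unfolding subquotient_representatives_def by blast
  then have "EX! u. u : R & isom x u" using R unfolding subquotient_representatives_def by blast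
  then show ?thesis using that isomorphic_refl[OF RO[OF that(1)]] by blast
 qed
 note h = ep_hom0[OF o(1)] ep_hom0[OF o(2)]
 have P: "P : hom0 X X" unfolding P_def X_def using h o by (intro ten0_hom0)
 have PP: "cp X X X P P = P" unfolding P_def X_def by (rule ep_tensor_idem[OF o c])
 define T where "T x chi = (SOME t. rfac x1 chi1 x2 chi2 x chi t)" for x chi
 define n where "n x chi = fst (T x chi)" for x chi
 define w where "w a = fst (snd (T (fst a) (fst (snd a)))) (snd (snd a))" for a
 define phi where "phi x chi = snd (snd (T x chi))" for x chi
 have rf: "rfac x1 chi1 x2 chi2 x chi (n x chi, (%i. w (x, chi, i)), phi x chi)" if "x : R" "chi : irr x" for x chi
  using someI_ex[OF rfac_exists[OF o RO[OF that(1)] c that(2)]] by (simp add: n_def w_def phi_def T_def)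
 let ?I = "{(x, chi, k). x : R & chi : irr x & k < n x chi}"
 have IS: "?I = (SIGMA x:R. SIGMA chi:irr x. {..<n x chi})" by auto
 have finI: "finite ?I" unfolding IS
  using subquotient_representatives_finite[OF XO[unfolded X_def] R] fin_group.finite_irr_chars[OF fin_group_A[OF RO]]
  by (intro finite_SigmaI finite_lessThan)
 have wf: "w a : hom0 X (fst a)" "cp X (fst a) (fst a) (ea a) (w a) = w a" "cp X X (fst a) (w a) P = w a" if "a : ?I" for a
  using that rf by (auto simp: rfac_def Let_def X_def P_def ea_def)
 have Io: "obj (fst a)" "fst (snd a) : irr_chars (A (fst a))" if "a : ?I" for a using that RO by auto
 have eah: "ea a : hom0 (fst a) (fst a)" if "a : ?I" for a unfolding ea_def by (rule ep_hom0[OF Io(1)[OF that]])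
 \<comment> \<open>A morphism through simple objects, cut down by P, is expressed by the w:
   \<open>ep x chi\<close> after k after P lies in the span of the \<open>w (x, chi, i)\<close> and
   has the coordinates phi.\<close>
 have dec: "EX V. (ALL a:?I. V a : hom0 (fst a) X) &
   cp X X X P (cp X X X f P) = (SUM a:?I. cp X (fst a) X (cp (fst a) (fst a) X (V a) (ea a)) (w a))" if "f : thrE R X X" for f using that
 proof (induction rule: thrE.induct)
  case thrE_zero
  show ?case by (rule exI[of _ "%_. 0"]) (simp add: hom0_zero)
 next
  case (thrE_step f x chi k k')
  note s = thrE_step(2-6)
  obtain V where V: "ALL a:?I. V a : hom0 (fst a) X" "cp X X X P (cp X X X f P) =
    (SUM a:?I. cp X (fst a) X (cp (fst a) (fst a) X (V a) (ea a)) (w a))" using thrE_step.IH by blast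
  have Pk: "cp x X X P k' : hom0 x X" by (rule cp_hom0[OF s(5) P s(2) XO XO])
  define D where "D a = (if (fst a, fst (snd a)) = (x, chi) then fsc (phi x chi (snd (snd a)) k) (cp x X X P k') else 0)" for a
  have ek: "cp X x x (ep x chi) k : hom0 X x" by (rule cp_hom0[OF s(4) ep_hom0[OF s(2)] XO s(2,2)])
  have "cp X X X P (cp X X X (cp X x X k' (cp X x x (ep x chi) k)) P) =
    cp X x X (cp x X X P k') (cp X X x (cp X x x (ep x chi) k) P)"
   using cp_assoc[OF P ek s(5) XO XO s(2) XO] cp_assoc[OF cp_hom0[OF P ek XO XO s(2)] s(5) P XO s(2) XO XO] by simp
  also have "cp X X x (cp X x x (ep x chi) k) P = cp X x x (ep x chi) (cp X X x k P)"
   by (rule cp_assoc[OF P s(4) ep_hom0[OF s(2)] XO XO s(2,2), symmetric])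
  also have "... = (SUM i<n x chi. fsc (phi x chi i k) (w (x, chi, i)))" using rf[OF s(1,3)] s(4) by (simp add: rfac_def Let_def X_def P_def)
  also have "cp X x X (cp x X X P k') ... = (SUM i<n x chi. cp X x X (cp x x X (fsc (phi x chi i k) (cp x X X P k')) (ep x chi)) (w (x, chi, i)))"
   unfolding cp_sum_right cp_fsc_right cp_fsc_left
  proof (rule sum.cong[OF refl])
   fix i assume "i : {..<n x chi}"
   then have i: "(x, chi, i) : ?I" using s by simp
   show "fsc (phi x chi i k) (cp X x X (cp x X X P k') (w (x, chi, i))) =
     fsc (phi x chi i k) (cp X x X (cp x x X (cp x X X P k') (ep x chi)) (w (x, chi, i)))"
    using cp_assoc[OF wf(1)[OF i] eah[OF i] _ XO] wf(2)[OF i] Pk s(2) XO by (simp add: ea_def)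
  qed
  also have "... = (SUM a:Pair x ` Pair chi ` {..<n x chi}. cp X (fst a) X (cp (fst a) (fst a) X (D a) (ea a)) (w a))"
   by (subst sum.reindex, simp add: inj_on_def, subst sum.reindex) (simp_all add: D_def ea_def inj_on_def)
  also have "... = (SUM a:?I. cp X (fst a) X (cp (fst a) (fst a) X (D a) (ea a)) (w a))"
   by (rule sum.mono_neutral_left[OF finI]) (use s in \<open>auto simp: D_def\<close>)
  finally have "cp X X X P (cp X X X (cp X x X k' (cp X x x (ep x chi) k) + f) P) =
    (SUM a:?I. cp X (fst a) X (cp (fst a) (fst a) X (D a + V a) (ea a)) (w a))" by (simp add: cp_add_left cp_add_right V(2) sum.distrib)
  moreover have "ALL a:?I. D a + V a : hom0 (fst a) X" using V(1) Pk by (auto simp: D_def intro!: hom0_add hom0_fsc hom0_zero)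
  ultimately show ?case by (intro exI[of _ "%a. D a + V a"] conjI)
 qed
 have "id0 X : thrE R X X" using id0_thrE[OF XO R[folded X_def] subquotient_refl[OF XO]] .
 from dec[OF this] obtain V where V: "ALL a:?I. V a : hom0 (fst a) X"
  "P = (SUM a:?I. cp X (fst a) X (cp (fst a) (fst a) X (V a) (ea a)) (w a))" using cp_id_left[OF P XO XO] PP by auto
 define v where "v a = cp (fst a) (fst a) X (V a) (ea a)" for a
 have vh: "v a : hom0 (fst a) X" if "a : ?I" for a
  unfolding v_def by (rule cp_hom0[OF eah[OF that] _ Io(1)[OF that] Io(1)[OF that] XO]) (use V(1) that in blast)
 have wv: "cp (fst a) X (fst b) (w b) (v a) = cp (fst a) (fst b) (fst b) (ea b) (cp (fst a) (fst a) (fst b) (cp (fst a) X (fst b) (w b) (V a)) (ea a))"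
  if a: "a : ?I" and b: "b : ?I" for a b
 proof -
  note oa = Io(1)[OF a] and ob = Io(1)[OF b]
  have Va: "V a : hom0 (fst a) X" using V(1) a by blast
  have "cp (fst a) X (fst b) (w b) (v a) = cp (fst a) (fst b) (fst b) (ea b) (cp (fst a) X (fst b) (w b) (v a))"
   using cp_assoc[OF vh[OF a] wf(1)[OF b] eah[OF b] oa XO ob ob] wf(2)[OF b] by simp
  moreover have "cp (fst a) X (fst b) (w b) (v a) = cp (fst a) (fst a) (fst b) (cp (fst a) X (fst b) (w b) (V a)) (ea a)"
   unfolding v_def by (rule cp_assoc[OF eah[OF a] Va wf(1)[OF b] oa oa XO ob])
  ultimately show ?thesis by simp
 qed
 have wVh: "cp (fst a) X (fst b) (w b) (V a) : hom0 (fst a) (fst b)" if "a : ?I" "b : ?I" for a b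
  by (rule cp_hom0[OF _ wf(1)[OF that(2)] Io(1)[OF that(1)] XO Io(1)[OF that(2)]]) (use V(1) that in blast)
 have "ALL p:?I \<times> ?I. EX s. cp (fst (fst p)) X (fst (snd p)) (w (snd p)) (v (fst p)) =
   (if fst (fst p) = fst (snd p) & fst (snd (fst p)) = fst (snd (snd p)) then fsc s (ea (fst p)) else 0)"
 proof
  fix p assume "p : ?I \<times> ?I"
  then obtain a b where p: "p = (a, b)" "a : ?I" "b : ?I" by blast
  show "EX s. cp (fst (fst p)) X (fst (snd p)) (w (snd p)) (v (fst p)) =
   (if fst (fst p) = fst (snd p) & fst (snd (fst p)) = fst (snd (snd p)) then fsc s (ea (fst p)) else 0)"
  proof (cases "fst a = fst b")
   case True
   show ?thesis using ep_sandwich[OF Io(1)[OF p(2)] Io(2)[OF p(2)], of "fst (snd b)"] Io(2)[OF p(3)] wVh[OF p(2,3)] wv[OF p(2,3)] True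
    by (auto simp: p(1) ea_def)
  next
   case False
   have "~ isom (fst a) (fst b)"
   proof
    assume i: "isom (fst a) (fst b)"
    have "fst a : R" "fst b : R" using p(2,3) by auto
    from Runiq[OF this i] show False using False by blast
   qed
   from ep_orthogonal[OF Io(1)[OF p(2)] Io(1)[OF p(3)] this wVh[OF p(2,3)]]
   show ?thesis using wv[OF p(2,3)] False by (simp add: p(1) ea_def)
  qed
 qed
 from bchoice[OF this] obtain s where s: "ALL p:?I \<times> ?I. cp (fst (fst p)) X (fst (snd p)) (w (snd p)) (v (fst p)) =
   (if fst (fst p) = fst (snd p) & fst (snd (fst p)) = fst (snd (snd p)) then fsc (s p) (ea (fst p)) else 0)" by (rule exE)
 have orth: "cp (fst a) X (fst b) (w b) (v a) = (if a = b then ea a else 0)" if a: "a : ?I" and b: "b : ?I" for a b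
 proof -
  have sab: "cp (fst a) X (fst b) (w b) (v a) = (if fst a = fst b & fst (snd a) = fst (snd b) then fsc (s (a, b)) (ea a) else 0)"
   if "a : ?I" for a using bspec[OF s, of "(a, b)"] that b by simp
  obtain x chi l where bt: "b = (x, chi, l)" by (cases b)
  have xl: "x : R" "chi : irr x" "l < n x chi" using b bt by auto
  note ob = Io(1)[OF b]
  have "w b = cp X X (fst b) (w b) (SUM a:?I. cp X (fst a) X (v a) (w a))" using wf(3)[OF b] V(2) by (simp add: v_def)
  also have "... = (SUM a:?I. if (fst a, fst (snd a)) = (x, chi) then fsc (s (a, b)) (w a) else 0)" unfolding cp_sum_right
  proof (rule sum.cong[OF refl])
   fix a assume a: "a : ?I"
   have "cp X X (fst b) (w b) (cp X (fst a) X (v a) (w a)) = cp X (fst a) (fst b) (cp (fst a) X (fst b) (w b) (v a)) (w a)"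
    by (rule cp_assoc[OF wf(1)[OF a] vh[OF a] wf(1)[OF b] XO Io(1)[OF a] XO ob])
   then show "cp X X (fst b) (w b) (cp X (fst a) X (v a) (w a)) = (if (fst a, fst (snd a)) = (x, chi) then fsc (s (a, b)) (w a) else 0)"
    using sab[OF a] wf(2)[OF a] bt by (auto simp: cp_fsc_left)
  qed
  also have "... = (SUM a:Pair x ` Pair chi ` {..<n x chi}. fsc (s (a, b)) (w a))" by (rule sum.mono_neutral_cong_right[OF finI]) (use xl in auto)
  also have "... = (SUM i<n x chi. fsc (s ((x, chi, i), b)) (w (x, chi, i)))"
   by (subst sum.reindex, simp add: inj_on_def, subst sum.reindex) (simp_all add: inj_on_def)
  finally have "(SUM i<n x chi. fsc (if i = l then 1 else 0) (w (x, chi, i))) = (SUM i<n x chi. fsc (s ((x, chi, i), b)) (w (x, chi, i)))"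
   using xl bt by (simp add: if_distrib[of "%x. fsc x _"] cong: if_cong)
  moreover have U: "ALL c c'. (SUM i<n x chi. fsc (c i) (w (x, chi, i))) = (SUM i<n x chi. fsc (c' i) (w (x, chi, i))) --> (ALL i<n x chi. c i = c' i)"
   using rf[OF xl(1,2)] unfolding rfac_def Let_def split by (elim conjE)
  ultimately have sd: "ALL i<n x chi. (if i = l then 1 else 0) = s ((x, chi, i), b)"
   by (intro mp[OF spec[OF spec[OF U, of "%i. if i = l then 1 else 0"], of "%i. s ((x, chi, i), b)"]])
  show ?thesis
  proof (cases "fst a = fst b & fst (snd a) = fst (snd b)")
   case True
   then obtain i where i: "a = (x, chi, i)" using bt by (cases a) auto
   then have "s (a, b) = (if i = l then 1 else 0)" using sd a by simp
   then show ?thesis using sab[OF a] True i bt by auto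
  next
   case False
   then show ?thesis using sab[OF a] by auto
  qed
 qed
 have P_sum: "(SUM a:?I. cp X (fst a) X (v a) (w a)) = P" using V(2) by (simp add: v_def)
 show ?thesis
 proof (rule exI[of _ n], rule exI[of _ w], rule exI[of _ v], intro conjI ballI)
  fix x and chi :: "'m => 'k" assume "x : R" "chi : irr x"
  from rf[OF this] show "of_nat (n x chi) = char_pairing (A x1 \<times>\<times> A x2 \<times>\<times> A x) (ternary_char C x1 x2 x) (tensor_char chi1 chi2 (dual_char (A x) chi))"
   by (simp add: rfac_def Let_def)
 next
  show "let I = ?I in finite I &
   (ALL a:I. w a : hom0 X (fst a) & v a : hom0 (fst a) X & cp X (fst a) (fst a) (ea a) (w a) = w a & cp X X (fst a) (w a) P = w a) &
   (ALL a:I. ALL b:I. cp (fst a) X (fst b) (w b) (v a) = (if a = b then ea a else 0)) &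
   (SUM a:I. cp X (fst a) X (v a) (w a)) = P" unfolding Let_def by (intro conjI ballI finI P_sum orth wf vh)
 qed
qed

end

section \<open>The additive and idempotent completion\<close>

lemma mod_lt: "k < m * n ==> k mod n < n" for n :: nat by (cases n) auto

text \<open>Index arithmetic of Kronecker products: position \<open>a * n + b\<close> stands for the
  pair (a, b).\<close>

lemma sum_div_mod: "(SUM k<m * n. f (k div n) (k mod n)) = (SUM a<m. SUM b<n. f a b)" for n :: nat
proof -
 have b: "a * n + b < m * n" if "a < m" "b < n" for a b using mult_le_mono1[of "Suc a" m n] that by simp
 show ?thesis unfolding sum.cartesian_product by (rule sum.reindex_bij_witness[of _ "%(a, b). a * n + b" "%k. (k div n, k mod n)"])
   (auto simp: b less_mult_imp_div_less mod_lt)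
qed

lemma length_concat_map: "length (concat (map (%x. map (f x) ys) xs)) = length xs * length ys" by (induction xs) auto

lemma concat_map_nth: "i < length xs * length ys ==>
  concat (map (%x. map (f x) ys) xs) ! i = f (xs ! (i div length ys)) (ys ! (i mod length ys))"
proof (induction xs arbitrary: i)
 case (Cons x xs)
 then have n: "length ys > 0" by (cases ys) auto
 show ?case
 proof (cases "i < length ys")
  case False
  then have "i div length ys = Suc ((i - length ys) div length ys)" "i mod length ys = (i - length ys) mod length ys"
   using n by (auto simp: le_div_geq le_mod_geq)
  moreover have "i - length ys < length xs * length ys" using Cons.prems False by simp
  ultimately show ?thesis using Cons.IH[of "i - length ys"] False by (simp add: nth_append)
 qed (simp add: nth_append)
qed simp

context deg_category
begin

abbreviation AC where "AC == additive_completion (TCat0 C \<delta>)"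
abbreviation mH where "mH == lhom AC"
abbreviation mc where "mc == lcomp AC"
abbreviation tc where "tc X Y Z == mc (fst X) (fst Y) (fst Z)"

definition m11 :: "('m set => 'k) => nat => nat => 'm set => 'k" where
 "m11 f = (%i j. if i = 0 & j = 0 then f else 0)"

lemma mH_iff: "M : mH xs ys \<longleftrightarrow> (ALL i j. if i < length ys & j < length xs then M i j : hom0 (xs ! j) (ys ! i) else M i j = 0)"
 by (simp add: additive_completion_def)

lemma mc_eq: "mc xs ys zs N M = (%i j. if i < length zs & j < length xs
  then (SUM k<length ys. cp (xs ! j) (ys ! k) (zs ! i) (N i k) (M k j)) else 0)" by (simp add: additive_completion_def)

lemma hom0_sum_closed: "(!!a. a : I ==> f a : hom0 x y) ==> (SUM a:I. f a) : hom0 x y"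
 by (induction I rule: infinite_finite_induct) (auto intro: hom0_add hom0_zero)

lemma mc_hom:
 assumes "M : mH xs ys" "N : mH ys zs" "set xs <= Obj C" "set ys <= Obj C" "set zs <= Obj C"
 shows "mc xs ys zs N M : mH xs zs"
proof -
 have "M k j : hom0 (xs ! j) (ys ! k)" "N i k : hom0 (ys ! k) (zs ! i)" if "i < length zs" "k < length ys" "j < length xs" for i j k
  using assms(1,2) that unfolding mH_iff by metis+
 moreover have "obj (xs ! j)" "obj (ys ! k)" "obj (zs ! i)" if "i < length zs" "k < length ys" "j < length xs" for i j k using that assms(3-5) by auto
 ultimately show ?thesis unfolding mH_iff mc_eq by (auto intro!: hom0_sum_closed cp_hom0)
qed

lemma mc_assoc:
 assumes "M : mH xs ys" "N : mH ys zs" "K : mH zs us" and o: "set xs <= Obj C" "set ys <= Obj C" "set zs <= Obj C" "set us <= Obj C"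
 shows "mc xs zs us K (mc xs ys zs N M) = mc xs ys us (mc ys zs us K N) M"
proof (rule ext, rule ext)
 fix i j
 have h: "M l j : hom0 (xs ! j) (ys ! l)" "N k l : hom0 (ys ! l) (zs ! k)" "K i k : hom0 (zs ! k) (us ! i)"
  if "i < length us" "k < length zs" "l < length ys" "j < length xs" for k l using assms(1-3) that unfolding mH_iff by metis+
 have ob: "obj (xs ! j)" "obj (ys ! l)" "obj (zs ! k)" "obj (us ! i)" if "i < length us" "k < length zs" "l < length ys" "j < length xs" for k l
  using that o by auto
 show "mc xs zs us K (mc xs ys zs N M) i j = mc xs ys us (mc ys zs us K N) M i j"
 proof (cases "i < length us & j < length xs")
  case True
  have "(SUM k<length zs. SUM l<length ys. cp (xs ! j) (zs ! k) (us ! i) (K i k) (cp (xs ! j) (ys ! l) (zs ! k) (N k l) (M l j))) =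
   (SUM k<length zs. SUM l<length ys. cp (xs ! j) (ys ! l) (us ! i) (cp (ys ! l) (zs ! k) (us ! i) (K i k) (N k l)) (M l j))"
   by (intro sum.cong refl cp_assoc h ob) (use True in auto)
  also have "... = (SUM l<length ys. SUM k<length zs. cp (xs ! j) (ys ! l) (us ! i) (cp (ys ! l) (zs ! k) (us ! i) (K i k) (N k l)) (M l j))"
   by (rule sum.swap)
  finally show ?thesis using True by (simp add: mc_eq cp_sum_left cp_sum_right)
 qed (auto simp: mc_eq)
qed

lemma m11_mH: "m11 f : mH [x] [y] \<longleftrightarrow> f : hom0 x y" by (auto simp: mH_iff m11_def)

lemma m11_comp [simp]: "mc [x] [y] [z] (m11 g) (m11 f) = m11 (cp x y z g f)" by (auto simp: mc_eq m11_def fun_eq_iff)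

lemma m11_eta: "M : mH [x] [y] ==> m11 (M 0 0) = M" by (auto simp: mH_iff m11_def fun_eq_iff)

lemma m11_inject: "m11 f = m11 g \<longleftrightarrow> f = g"
proof
 assume "m11 f = m11 g"
 then have "m11 f 0 0 = m11 g 0 0" by simp
 then show "f = g" by (simp add: m11_def)
qed simp

lemma sum_fun_eval2: "sum h I i j = (SUM a:I. h a i j)" for h :: "'a => nat => nat => 'm set => 'k"
 by (induction I rule: infinite_finite_induct) (auto simp: plus_fun_apply zero_fun_apply)

lemma m11_sum: "m11 (SUM a:I. f a) = (SUM a:I. m11 (f a))" by (intro ext) (simp add: m11_def sum_fun_eval2)

lemma mc_sum:
 "mc xs ys zs (SUM a:I. L a) M = (SUM a:I. mc xs ys zs (L a) M)"
 "mc xs ys zs N (SUM a:I. L a) = (SUM a:I. mc xs ys zs N (L a))"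
proof -
 have "mc xs ys zs (SUM a:I. L a) M i j = (SUM a:I. mc xs ys zs (L a) M) i j &
   mc xs ys zs N (SUM a:I. L a) i j = (SUM a:I. mc xs ys zs N (L a)) i j" for i j
 proof (cases "i < length zs & j < length xs")
  case True
  then show ?thesis unfolding mc_eq sum_fun_eval2 cp_sum_left cp_sum_right if_P[OF True] by (intro conjI sum.swap)
 qed (auto simp: mc_eq sum_fun_eval2)
 then show "mc xs ys zs (SUM a:I. L a) M = (SUM a:I. mc xs ys zs (L a) M)"
  "mc xs ys zs N (SUM a:I. L a) = (SUM a:I. mc xs ys zs N (L a))" by (auto simp: fun_eq_iff)
qed

lemma mc_zero: "mc xs ys zs 0 M = 0" "mc xs ys zs N 0 = 0" using mc_sum[where I = "{}"] by simp_all

lemma lid_AC: "lid AC [x] = m11 (id0 x)" if "obj x" using that by (auto simp: additive_completion_def m11_def fun_eq_iff lid0)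

lemma TC_hom: "h : lhom TC X Y \<longleftrightarrow> h : mH (fst X) (fst Y) &
  tc X Y Y (snd Y) (tc X X Y h (snd X)) = h" by (cases X; cases Y) (simp add: TCat_def idempotent_completion_def)

lemma TC_comp: "lcomp TC X Y Z = tc X Y Z" by (simp add: TCat_def idempotent_completion_def)

lemma TC_id: "lid TC = snd" by (simp add: TCat_def idempotent_completion_def)

lemma TC_obj: "X : lobj TC \<longleftrightarrow> set (fst X) <= Obj C & snd X : mH (fst X) (fst X) &
  tc X X X (snd X) (snd X) = snd X" by (cases X) (auto simp: TCat_def idempotent_completion_def additive_completion_def TCat0_def lists_eq_set)

text \<open>Membership in a hom set of the idempotent completion only states invariance under both
  idempotents at once; their idempotency separates the two sides.\<close>

lemma TC_unit:
 assumes h: "h : lhom TC X Y" and o: "X : lobj TC" "Y : lobj TC"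
 shows "tc X X Y h (snd X) = h" "tc X Y Y (snd Y) h = h"
proof -
 note X = o(1)[unfolded TC_obj] and Y = o(2)[unfolded TC_obj] and H = h[unfolded TC_hom]
 have hX: "tc X X Y h (snd X) : mH (fst X) (fst Y)" using X Y H by (intro mc_hom) auto
 have "tc X Y Y (snd Y) h = tc X Y Y (tc Y Y Y (snd Y) (snd Y)) (tc X X Y h (snd X))"
  using mc_assoc[OF hX, of "snd Y" "fst Y" "snd Y" "fst Y"] X Y H by simp
 then show l: "tc X Y Y (snd Y) h = h" using Y H by simp
 have "tc X X Y (tc X Y Y (snd Y) h) (snd X) = h" using mc_assoc[of "snd X" "fst X" "fst X" h "fst Y" "snd Y" "fst Y"] X Y H by simp
 then show "tc X X Y h (snd X) = h" unfolding l .
qed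

lemma TC_homI:
 assumes "h : mH (fst X) (fst Y)" "tc X X Y h (snd X) = h" "tc X Y Y (snd Y) h = h"
 shows "h : lhom TC X Y" using assms by (simp add: TC_hom)

lemma TC_comp_hom:
 assumes f: "f : lhom TC X Y" "g : lhom TC Y Z" and o: "X : lobj TC" "Y : lobj TC" "Z : lobj TC"
 shows "tc X Y Z g f : lhom TC X Z"
proof (rule TC_homI)
 note X = o(1)[unfolded TC_obj] and Y = o(2)[unfolded TC_obj] and Z = o(3)[unfolded TC_obj]
 note F = f(1)[unfolded TC_hom] and G = f(2)[unfolded TC_hom]
 show "tc X Y Z g f : mH (fst X) (fst Z)" using X Y Z F G by (intro mc_hom) auto
 show "tc X X Z (tc X Y Z g f) (snd X) = tc X Y Z g f"
  using mc_assoc[of "snd X" "fst X" "fst X" f "fst Y" g "fst Z"] X Y Z F G TC_unit[OF f(1) o(1,2)] by simp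
 show "tc X Z Z (snd Z) (tc X Y Z g f) = tc X Y Z g f"
  using mc_assoc[of f "fst X" "fst Y" g "fst Z" "snd Z" "fst Z"] X Y Z F G TC_unit[OF f(2) o(2,3)] by simp
qed

lemma T_obj_eq: "obj x ==> Tob x = ([x], m11 (id0 x))" by (simp add: T_obj_def T_sum_def lid_AC)

lemma TC_obj1: "obj x ==> ([x], m11 e) : lobj TC \<longleftrightarrow> e : hom0 x x & cx x e e = e" by (simp add: TC_obj m11_mH m11_inject)

lemma TC_hom1: "obj x ==> obj y ==> m11 h : lhom TC ([x], m11 e) ([y], m11 f) \<longleftrightarrow>
  h : hom0 x y & cp x y y f (cp x x y h e) = h" by (simp add: TC_hom m11_mH m11_inject)

lemma T_graph_eq: "arr g ==> T_graph C g = m11 (gr g)" by (simp add: T_graph_def m11_def gr_basis fun_eq_iff)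

abbreviation tl :: "'o list => 'o list => 'o list" where
 "tl xs ys == concat (map (%x. map (prd x) ys) xs)"

text \<open>\<open>T_tensor\<close> forms the Kronecker product of two idempotents only; this is the
  same product for rectangular matrices, needed to tensor the inclusion and projection maps of two
  retracts.\<close>

definition kr where
 "kr xs xs' ys ys' M N = (%i j. if i < length xs' * length ys' & j < length xs * length ys
  then ten0 (xs ! (j div length ys)) (xs' ! (i div length ys')) (ys ! (j mod length ys)) (ys' ! (i mod length ys'))
   (M (i div length ys') (j div length ys)) (N (i mod length ys') (j mod length ys)) else 0)"

lemma T_tensor_eq: "T_tensor C X Y = (tl (fst X) (fst Y), kr (fst X) (fst X) (fst Y) (fst Y) (snd X) (snd Y))"
 by (simp add: T_tensor_def kr_def Let_def)

lemma set_tl: "set xs <= Obj C ==> set ys <= Obj C ==> set (tl xs ys) <= Obj C" by (auto intro!: prd_obj)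

lemma kr_hom:
 assumes "M : mH xs xs'" "N : mH ys ys'" and o: "set xs <= Obj C" "set xs' <= Obj C" "set ys <= Obj C" "set ys' <= Obj C"
 shows "kr xs xs' ys ys' M N : mH (tl xs ys) (tl xs' ys')" unfolding mH_iff
proof (intro allI)
 fix i j
 let ?a = "i div length ys'" and ?b = "i mod length ys'" and ?c = "j div length ys" and ?d = "j mod length ys"
 show "if i < length (tl xs' ys') & j < length (tl xs ys) then kr xs xs' ys ys' M N i j : hom0 (tl xs ys ! j) (tl xs' ys' ! i)
   else kr xs xs' ys ys' M N i j = 0"
 proof (cases "i < length xs' * length ys' & j < length xs * length ys")
  case True
  then have b: "?a < length xs'" "?b < length ys'" "?c < length xs" "?d < length ys" by (auto simp: less_mult_imp_div_less mod_lt)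
  then have "M ?a ?c : hom0 (xs ! ?c) (xs' ! ?a)" "N ?b ?d : hom0 (ys ! ?d) (ys' ! ?b)" using assms(1,2) unfolding mH_iff by metis+
  moreover have "obj (xs ! ?c)" "obj (xs' ! ?a)" "obj (ys ! ?d)" "obj (ys' ! ?b)" using b o by auto
  ultimately have "ten0 (xs ! ?c) (xs' ! ?a) (ys ! ?d) (ys' ! ?b) (M ?a ?c) (N ?b ?d) : hom0 (prd (xs ! ?c) (ys ! ?d)) (prd (xs' ! ?a) (ys' ! ?b))"
   by (rule ten0_hom0)
  then show ?thesis using True by (simp add: kr_def length_concat_map concat_map_nth)
 qed (auto simp: kr_def length_concat_map concat_map_nth)
qed

lemma ten0_sum: "ten0 x x' y y' (SUM a:I. f a) g = (SUM a:I. ten0 x x' y y' (f a) g)"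
 "ten0 x x' y y' f' (SUM b:J. h b) = (SUM b:J. ten0 x x' y y' f' (h b))" by (induction I rule: infinite_finite_induct; simp add: ten0_add_left)
  (induction J rule: infinite_finite_induct; simp add: ten0_add_right)

lemma kr_comp:
 assumes M: "M : mH xs xs'" "M' : mH xs' xs''" and N: "N : mH ys ys'" "N' : mH ys' ys''"
  and o: "set xs <= Obj C" "set xs' <= Obj C" "set xs'' <= Obj C" "set ys <= Obj C" "set ys' <= Obj C" "set ys'' <= Obj C"
 shows "mc (tl xs ys) (tl xs' ys') (tl xs'' ys'') (kr xs' xs'' ys' ys'' M' N') (kr xs xs' ys ys' M N) =
  kr xs xs'' ys ys'' (mc xs xs' xs'' M' M) (mc ys ys' ys'' N' N)"
proof (rule ext, rule ext)
 fix i j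
 let ?a = "i div length ys''" and ?b = "i mod length ys''" and ?c = "j div length ys" and ?d = "j mod length ys"
 show "mc (tl xs ys) (tl xs' ys') (tl xs'' ys'') (kr xs' xs'' ys' ys'' M' N') (kr xs xs' ys ys' M N) i j =
  kr xs xs'' ys ys'' (mc xs xs' xs'' M' M) (mc ys ys' ys'' N' N) i j"
 proof (cases "i < length xs'' * length ys'' & j < length xs * length ys")
  case True
  then have b: "?a < length xs''" "?b < length ys''" "?c < length xs" "?d < length ys" by (auto simp: less_mult_imp_div_less mod_lt)
  let ?t = "%k l. cp (prd (xs ! ?c) (ys ! ?d)) (prd (xs' ! k) (ys' ! l)) (prd (xs'' ! ?a) (ys'' ! ?b))
   (ten0 (xs' ! k) (xs'' ! ?a) (ys' ! l) (ys'' ! ?b) (M' ?a k) (N' ?b l)) (ten0 (xs ! ?c) (xs' ! k) (ys ! ?d) (ys' ! l) (M k ?c) (N l ?d))"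
  have "mc (tl xs ys) (tl xs' ys') (tl xs'' ys'') (kr xs' xs'' ys' ys'' M' N') (kr xs xs' ys ys' M N) i j =
   (SUM k<length xs' * length ys'. ?t (k div length ys') (k mod length ys'))" using True by (simp add: mc_eq kr_def length_concat_map concat_map_nth)
  also have "... = (SUM k<length xs'. SUM l<length ys'. ?t k l)" by (rule sum_div_mod)
  also have "... = (SUM k<length xs'. SUM l<length ys'. ten0 (xs ! ?c) (xs'' ! ?a) (ys ! ?d) (ys'' ! ?b)
   (cp (xs ! ?c) (xs' ! k) (xs'' ! ?a) (M' ?a k) (M k ?c)) (cp (ys ! ?d) (ys' ! l) (ys'' ! ?b) (N' ?b l) (N l ?d)))"
  proof (intro sum.cong refl)
   fix k l assume kl: "k : {..<length xs'}" "l : {..<length ys'}"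
   have h: "M k ?c : hom0 (xs ! ?c) (xs' ! k)" "M' ?a k : hom0 (xs' ! k) (xs'' ! ?a)" "N l ?d : hom0 (ys ! ?d) (ys' ! l)" "N' ?b l : hom0 (ys' ! l) (ys'' ! ?b)"
    using M N b kl unfolding mH_iff by (metis lessThan_iff)+
   show "?t k l = ten0 (xs ! ?c) (xs'' ! ?a) (ys ! ?d) (ys'' ! ?b) (cp (xs ! ?c) (xs' ! k) (xs'' ! ?a) (M' ?a k) (M k ?c))
     (cp (ys ! ?d) (ys' ! l) (ys'' ! ?b) (N' ?b l) (N l ?d))" by (rule ten0_cp[OF h, symmetric]) (use b kl o in auto)
  qed
  also have "... = kr xs xs'' ys ys'' (mc xs xs' xs'' M' M) (mc ys ys' ys'' N' N) i j"
   using True b by (simp add: kr_def mc_eq ten0_sum(1)) (simp add: ten0_sum(2))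
  finally show ?thesis .
 qed (auto simp: mc_eq kr_def length_concat_map concat_map_nth)
qed

lemma kr_m11: "kr [x] [x'] [y] [y'] (m11 f) (m11 g) = m11 (ten0 x x' y y' f g)" by (auto simp: kr_def m11_def fun_eq_iff)

end

section \<open>Scalars, lists of objects and their identities in the completion\<close>

context deg_category
begin

definition msc :: "'k => (nat => nat => 'm set => 'k) => nat => nat => 'm set => 'k" where
 "msc c M = (%i j. fsc c (M i j))"

lemma TC_scale: "lscale TC c M = msc c M" by (simp add: TCat_def idempotent_completion_def additive_completion_def TCat0_def msc_def fsc_def)

lemma msc_comp: "mc xs ys zs (msc c N) M = msc c (mc xs ys zs N M)" "mc xs ys zs N (msc c M) = msc c (mc xs ys zs N M)"
 by (auto simp: mc_eq msc_def fun_eq_iff cp_fsc_left cp_fsc_right fsc_sum)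

lemma msc_m11: "m11 (fsc c f) = msc c (m11 f)" by (auto simp: m11_def msc_def fun_eq_iff)

lemma msc_msc [simp]: "msc c (msc c' M) = msc (c * c') M" "msc 0 M = 0" "msc 1 M = M" by (auto simp: msc_def fun_eq_iff zero_fun_apply)

lemma msc_sum: "msc c (SUM a:I. f a) = (SUM a:I. msc c (f a))" "(SUM a:I. msc (s a) M) = msc (SUM a:I. s a) M"
 by (auto simp: msc_def fun_eq_iff sum_fun_eval2 sum_fun_eval fsc_apply sum_distrib_left sum_distrib_right)

text \<open>The recursive description of the ideal is turned into one list of objects; their direct
  sum is the object of which \<open>[x]^1\<close> is shown to be a retract.\<close>

lemma thru_list:
 assumes "f : thru Q x y"
 shows "EX zs hs hs'. set zs <= Q \<inter> Obj C & (ALL k<length zs. hs k : hom0 x (zs ! k) & hs' k : hom0 (zs ! k) y) &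
  f = (SUM k<length zs. cp x (zs ! k) y (hs' k) (hs k))" using assms
proof (induction rule: thru.induct)
 case thru_zero
 show ?case by (intro exI[of _ "[]"]) simp
next
 case (thru_step f z h h')
 then obtain zs hs hs' where z: "set zs <= Q \<inter> Obj C" "ALL k<length zs. hs k : hom0 x (zs ! k) & hs' k : hom0 (zs ! k) y"
  "f = (SUM k<length zs. cp x (zs ! k) y (hs' k) (hs k))" by blast
 show ?case by (intro exI[of _ "z # zs"] exI[of _ "case_nat h hs"] exI[of _ "case_nat h' hs'"])
   (use z thru_step(2-5) in \<open>auto simp: sum.lessThan_Suc_shift less_Suc_eq_0_disj simp del: sum.lessThan_Suc\<close>)
qed

lemma lid_AC_eq: "set zs <= Obj C ==> lid AC zs i j = (if i = j & i < length zs then id0 (zs ! i) else 0)"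
proof -
 assume "set zs <= Obj C"
 then have "obj (zs ! i)" if "i < length zs" for i using that by auto
 then show ?thesis by (auto simp: additive_completion_def lid0)
qed

lemma lid_AC_unit:
 assumes z: "set zs <= Obj C"
 shows "lid AC zs : mH zs zs"
  "M : mH xs zs ==> set xs <= Obj C ==> mc xs zs zs (lid AC zs) M = M"
  "N : mH zs ys ==> set ys <= Obj C ==> mc zs zs ys N (lid AC zs) = N"
proof -
 have zo: "obj (zs ! i)" if "i < length zs" for i using that z by auto
 show "lid AC zs : mH zs zs" using zo by (auto simp: mH_iff lid_AC_eq[OF z] intro!: id0_hom0 hom0_zero)
 show "mc xs zs zs (lid AC zs) M = M" if M: "M : mH xs zs" and x: "set xs <= Obj C"
 proof (rule ext, rule ext)
  fix i j show "mc xs zs zs (lid AC zs) M i j = M i j"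
  proof (cases "i < length zs & j < length xs")
   case True
   then have "M i j : hom0 (xs ! j) (zs ! i)" "obj (xs ! j)" using M x unfolding mH_iff by auto
   then have "cp (xs ! j) (zs ! k) (zs ! i) (lid AC zs i k) (M k j) = (if k = i then M i j else 0)" for k
    using True cp_id_left zo by (simp add: lid_AC_eq[OF z])
   then show ?thesis using True by (simp add: mc_eq)
  next
   case False
   then show ?thesis using M unfolding mH_iff mc_eq by auto
  qed
 qed
 show "mc zs zs ys N (lid AC zs) = N" if N: "N : mH zs ys" and y: "set ys <= Obj C"
 proof (rule ext, rule ext)
  fix i j show "mc zs zs ys N (lid AC zs) i j = N i j"
  proof (cases "i < length ys & j < length zs")
   case True
   then have "N i j : hom0 (zs ! j) (ys ! i)" "obj (ys ! i)" using N y unfolding mH_iff by auto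
   then have "cp (zs ! j) (zs ! k) (ys ! i) (N i k) (lid AC zs k j) = (if k = j then N i j else 0)" if "k < length zs" for k
    using True cp_id_right zo that by (simp add: lid_AC_eq[OF z])
   then show ?thesis using True by (simp add: mc_eq)
  next
   case False
   then show ?thesis using N unfolding mH_iff mc_eq by auto
  qed
 qed
qed

lemma T_sum_obj: "set zs <= Obj C ==> T_sum C \<delta> zs : lobj TC" using lid_AC_unit[of zs] by (simp add: TC_obj T_sum_def)

end

lemma (in alg_category) simple_data_exists: "EX lo dm rho. simple_data C \<delta> lo dm rho"
proof -
 define lo where "lo x = (SOME e. lowid x e)" for x
 define dr where "dr x chi = (SOME t. irreducible_rep (A x) (fst t) (snd t) & rep_char (A x) (snd t) = chi)" for x and chi :: "'m => 'k"
 have "lowid x (lo x)" if "obj x" for x unfolding lo_def using lowid_exists[OF that] by (rule someI_ex)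
 moreover have "irreducible_rep (A x) (fst (dr x chi)) (snd (dr x chi)) & rep_char (A x) (snd (dr x chi)) = chi" if "chi : irr x" for x chi
  unfolding dr_def by (rule someI_ex) (use that in \<open>auto simp: irr_chars_def\<close>)
 ultimately have "simple_data C \<delta> lo (%x chi. fst (dr x chi)) (%x chi. snd (dr x chi))" by unfold_locales auto
 then show ?thesis by blast
qed

section \<open>An explicit family of simple objects\<close>

context simple_data
begin

lemma ga_up:
 assumes x: "obj x"
 shows "cx x (cx x (ga x c) (up x)) (cx x (ga x c') (up x)) = cx x (cx x (ga x c) (ga x c')) (up x)"
proof -
 note h = ga_hom0[of x] lf2[OF x]
 have "cx x (cx x (ga x c) (up x)) (cx x (ga x c') (up x)) =
   cx x (ga x c) (cx x (up x) (cx x (ga x c') (up x)))" by (rule comp3[OF cp_hom0[OF h(2,1) x x x] h(2) h(1) x, symmetric])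
 also have "cx x (up x) (cx x (ga x c') (up x)) = cx x (ga x c') (up x)"
  using comp3[OF h(2) h(1) h(2) x] comp3[OF h(2) h(2) h(1) x] ga_lowid[OF lo[OF x] x] lf4[OF x] by simp
 finally show ?thesis using comp3[OF h(2) h(1) h(1) x] by simp
qed

text \<open>Makes the specification behind \<open>simple_object\<close> satisfiable, so that the
  choice made there has the specified properties. Every object is \<open>[x]\<close> with an
  idempotent; the injections are the matrix units of column 0 and the projections those of row 0,
  cut down by \<open>up x\<close>.\<close>

lemma simple_family_ep:
 assumes x: "obj x"
 shows "is_simple_family C \<delta> x (%chi. ([x], m11 (ep x chi)))"
proof -
 interpret G: fin_group "A x" using fin_group_A[OF x] .
 let ?X = "Tob x" and ?e = "lo x" and ?p = "up x"
 let ?Z = "([x], m11 ?p)" and ?Y = "([x], m11 ?e)" and ?F = "%chi. ([x], m11 (ep x chi))"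
 let ?i = "%chi a. m11 (cx x (E x chi a 0) ?p)" and ?q = "%chi a. m11 (cx x (E x chi 0 a) ?p)"
 note l = lo[OF x]
 have eh: "?e : hom0 x x" and ee: "cx x ?e ?e = ?e" using lowid_facts(1,3)[OF l x] by auto
 note ph = lf2[OF x] and pp = lf4[OF x] and ih = id0_hom0[OF x]
 have pe: "cx x ?p ?e = 0" "cx x ?e ?p = 0" using cp_id_left[OF eh x x] cp_id_right[OF eh x x] ee by (simp_all add: cp_minus_left cp_minus_right)
 have Xe: "?X = ([x], m11 (id0 x))" by (rule T_obj_eq[OF x])
 have idl: "cx x (id0 x) f = f" "cx x f (id0 x) = f" if "f : hom0 x x" for f using that cp_id_left cp_id_right x by auto
 have thr: "?e : thru (PS x) x x" and lu: "!!z f. z : PS x ==> f : hom0 z x ==> cp z x x ?e f = f" using l by (auto simp: lowid_def)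
 have low: "is_lower_part C \<delta> x ?Y (m11 ?e)" unfolding is_lower_part_def
 proof (intro conjI allI impI ballI)
  show "EX p. is_summand TC ?Y ?X (m11 ?e) p" by (rule exI[of _ "m11 ?e"]) (simp add: is_summand_def Xe TC_obj1 TC_hom1 TC_comp TC_id x eh ee ih idl)
  obtain zs hs hs' where z: "set zs <= PS x \<inter> Obj C" "ALL k<length zs. hs k : hom0 x (zs ! k) & hs' k : hom0 (zs ! k) x"
   "?e = (SUM k<length zs. cp x (zs ! k) x (hs' k) (hs k))" using thru_list[OF thr] by blast
  define i' :: "nat => nat => 'm set => 'k" where "i' = (%i j. if i < length zs & j = 0 then hs i else 0)"
  define p' :: "nat => nat => 'm set => 'k" where "p' = (%i j. if i = 0 & j < length zs then hs' j else 0)"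
  have ip: "i' : mH [x] zs" "p' : mH zs [x]" using z(2) by (auto simp: mH_iff i'_def p'_def)
  have zo: "set zs <= Obj C" "set [x] <= Obj C" using z(1) x by auto
  have pi: "mc [x] zs [x] p' i' = m11 ?e" using z(3) by (auto simp: mc_eq i'_def p'_def m11_def fun_eq_iff)
  have me: "m11 ?e : mH [x] [x]" using eh by (simp add: m11_mH)
  \<comment> \<open>Cutting with the idempotent on the side of \<open>[x]\<close> turns the raw
    matrices into morphisms of the idempotent completion.\<close>
  let ?i' = "mc [x] [x] zs i' (m11 ?e)" and ?p' = "mc zs [x] [x] (m11 ?e) p'"
  have h: "?i' : mH [x] zs" "?p' : mH zs [x]" using mc_hom me ip zo by auto
  have "is_summand TC ?Y (T_sum C \<delta> zs) ?i' ?p'" unfolding is_summand_def TC_comp TC_id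
  proof (intro conjI)
   show "T_sum C \<delta> zs : lobj TC" by (rule T_sum_obj[OF zo(1)])
   show "?Y : lobj TC" using TC_obj1[OF x] eh ee by simp
   have "mc [x] [x] zs ?i' (m11 ?e) = ?i'" "mc zs [x] [x] (m11 ?e) ?p' = ?p'"
    using mc_assoc[OF me me ip(1) zo(2,2,2,1)] mc_assoc[OF ip(2) me me zo(1,2,2,2)] ee by simp_all
   then show "?i' : lhom TC ?Y (T_sum C \<delta> zs)" "?p' : lhom TC (T_sum C \<delta> zs) ?Y"
    using h lid_AC_unit(2)[OF zo(1) h(1) zo(2)] lid_AC_unit(3)[OF zo(1) h(2) zo(2)] by (auto simp: TC_hom T_sum_def)
   have "mc [x] zs [x] ?p' ?i' = mc [x] [x] [x] (m11 ?e) (mc [x] zs [x] p' ?i')" by (rule mc_assoc[OF h(1) ip(2) me zo(2,1,2,2), symmetric])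
   also have "mc [x] zs [x] p' ?i' = mc [x] [x] [x] (mc [x] zs [x] p' i') (m11 ?e)" by (rule mc_assoc[OF me ip zo(2,2,1,2)])
   finally show "tc ?Y (T_sum C \<delta> zs) ?Y ?p' ?i' = snd ?Y" by (simp add: T_sum_def pi ee)
  qed
  then show "EX zs i' p'. (ALL z:set zs. proper_subquotient C z x) & is_summand TC ?Y (T_sum C \<delta> zs) i' p'"
   using z(1) by (intro exI[of _ zs] exI[of _ ?i'] exI[of _ ?p']) (auto simp: PS_def)
  fix w f assume wp: "proper_subquotient C w x" and f: "f : lhom TC (Tob w) ?X"
  have w: "w : PS x" using wp by (simp add: PS_def)
  note wo = PS_obj[OF w]
  have f': "f : mH [w] [x]" using f by (simp add: TC_hom T_obj_eq wo x)
  have fh: "f 0 0 : hom0 w x" using m11_mH[of "f 0 0" w x] m11_eta[OF f'] f' by simp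
  have ff: "m11 (f 0 0) = f" by (rule m11_eta[OF f'])
  have "mc [w] [x] [x] (m11 ?e) (m11 (f 0 0)) = m11 (f 0 0)" using lu[OF w fh] by simp
  moreover have "m11 (f 0 0) : lhom TC (Tob w) ?Y" using fh lu[OF w fh] cp_id_right[OF fh wo x] by (simp add: T_obj_eq wo TC_hom1 x)
  ultimately show "EX g:lhom TC (Tob w) ?Y. lcomp TC (Tob w) ?Y ?X (m11 ?e) g = f"
   unfolding ff by (intro bexI[of _ f]) (simp_all add: TC_comp T_obj_eq wo x)
 qed
 have upper: "is_upper_part C \<delta> x ?Z (m11 ?p) (m11 ?p)" unfolding is_upper_part_def
 proof (intro exI conjI)
  show "is_lower_part C \<delta> x ?Y (m11 ?e)" by (rule low)
  have "m11 ?p + m11 ?e = m11 (id0 x)" by (auto simp: m11_def fun_eq_iff plus_fun_apply minus_apply zero_fun_apply)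
  moreover have "m11 0 = 0" by (auto simp: m11_def fun_eq_iff zero_fun_apply)
  ultimately show "is_direct_sum TC ?X {0, 1::nat} (%a. if a = 0 then ?Z else ?Y) (%a. if a = 0 then m11 ?p else m11 ?e)
    (%a. if a = 0 then m11 ?p else m11 ?e)" by (auto simp: is_direct_sum_def Xe TC_obj1 TC_hom1 TC_comp TC_id x eh ee ph pp ih idl pe)
 qed
 have Eh: "cx x (E x chi a b) ?p : hom0 x x" for chi a b by (rule cp_hom0[OF ph mx_hom0 x x x])
 have EE: "cx x (cx x (E x chi a b) ?p) (cx x (E x chi' c b') ?p) =
   (if chi = chi' & b = c then cx x (E x chi a b') ?p else 0)"
  if c: "chi : irr x" "chi' : irr x" "a < dm x chi" "b < dm x chi" "c < dm x chi'" "b' < dm x chi'" for chi chi' a b c b'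
 proof -
  note r = rho[OF x c(1)] and r' = rho[OF x c(2)]
  have "cx x (E x chi a b) (E x chi' c b') = (if chi = chi' & b = c then E x chi a b' else 0)"
  proof (cases "chi = chi'")
   case True then show ?thesis using mx_mult[OF x conjunct1[OF r]] c by simp
  next
   case False then show ?thesis using mx_zero[OF x conjunct1[OF r] conjunct1[OF r']] r r' c by simp
  qed
  then show ?thesis unfolding mx_def ga_up[OF x] by simp
 qed
 have pE: "cx x ?p (cx x (E x chi a b) ?p) = cx x (E x chi a b) ?p"
  "cx x (cx x (E x chi a b) ?p) ?p = cx x (E x chi a b) ?p" for chi a b
  using comp3[OF ph ph mx_hom0 x] comp3[OF ph mx_hom0 ph x] comp3[OF mx_hom0 ph ph x] up_E[OF x] pp by simp_all
 have "is_direct_sum TC ?Z (SIGMA chi:irr x. {..<dm x chi}) (%(chi, a). ?F chi) (%(chi, a). ?i chi a) (%(chi, a). ?q chi a)"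
  unfolding is_direct_sum_def
 proof (intro conjI ballI)
  show "finite (SIGMA chi:irr x. {..<dm x chi})" using G.finite_irr_chars by auto
  show "?Z : lobj TC" using TC_obj1[OF x] ph pp by simp
  fix c assume c: "c : (SIGMA chi:irr x. {..<dm x chi})"
  then obtain chi a where ca: "c = (chi, a)" "chi : irr x" "a < dm x chi" by auto
  note d = dm_pos[OF x ca(2)]
  have eE: "cx x (ep x chi) (cx x (E x chi 0 a) ?p) = cx x (E x chi 0 a) ?p"
   "cx x (cx x (E x chi a 0) ?p) (ep x chi) = cx x (E x chi a 0) ?p" unfolding ep_def using EE ca d by simp_all
  show "(case c of (chi, a) => ?F chi) : lobj TC" using TC_obj1[OF x] ep_hom0[OF x] ep_idem[OF x ca(2)] ca(1) by simp
  show "(case c of (chi, a) => ?i chi a) : lhom TC (case c of (chi, a) => ?F chi) ?Z" using TC_hom1[OF x x] Eh eE pE ca(1) by simp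
  show "(case c of (chi, a) => ?q chi a) : lhom TC ?Z (case c of (chi, a) => ?F chi)" using TC_hom1[OF x x] Eh eE pE ca(1) by simp
  fix c' assume c': "c' : (SIGMA chi:irr x. {..<dm x chi})"
  then obtain chi' a' where ca': "c' = (chi', a')" "chi' : irr x" "a' < dm x chi'" by auto
  have "m11 0 = 0" by (auto simp: m11_def fun_eq_iff zero_fun_apply)
  then show "lcomp TC (case c of (chi, a) => ?F chi) ?Z (case c' of (chi, a) => ?F chi) (case c' of (chi, a) => ?q chi a) (case c of (chi, a) => ?i chi a) =
    (if c = c' then lid TC (case c of (chi, a) => ?F chi) else 0)"
   using EE[OF ca'(2) ca(2) _ ca'(3) ca(3), of 0 0] dm_pos[OF x ca'(2)] d ca(1) ca'(1) by (auto simp: TC_comp TC_id ep_def)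
 next
  have "(SUM c:(SIGMA chi:irr x. {..<dm x chi}). lcomp TC ?Z (case c of (chi, a) => ?F chi) ?Z (case c of (chi, a) => ?i chi a) (case c of (chi, a) => ?q chi a)) =
    (SUM (chi, a):(SIGMA chi:irr x. {..<dm x chi}). m11 (cx x (E x chi a a) ?p))" using EE dm_pos[OF x] by (intro sum.cong refl) (auto simp: TC_comp)
  also have "... = (SUM chi:irr x. SUM a<dm x chi. m11 (cx x (E x chi a a) ?p))" by (rule sum.Sigma[symmetric]) (use G.finite_irr_chars in auto)
  also have "... = m11 (cx x (SUM chi:irr x. SUM a<dm x chi. E x chi a a) ?p)" by (simp add: cp_sum_left m11_sum)
  also have "... = m11 ?p" using mx_complete[OF x, of "dm x" "rho x"] rho[OF x] idl(1)[OF ph] by simp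
  finally show "(SUM c:(SIGMA chi:irr x. {..<dm x chi}). lcomp TC ?Z (case c of (chi, a) => ?F chi) ?Z (case c of (chi, a) => ?i chi a) (case c of (chi, a) => ?q chi a)) = lid TC ?Z"
   by (simp add: TC_id)
 qed
 moreover have "lcomp TC (?F chi) ?Z ?Z (upper_action C \<delta> x ?Z (m11 ?p) (m11 ?p) g) (?i chi b) = (SUM a<dm x chi. lscale TC (rho x chi g $$ (a, b)) (?i chi a))"
  if g: "g : AA x" and c: "chi : irr x" "b < dm x chi" for g chi b
 proof -
  note gh = gr_A[OF g]
  have ga: "arr g" using g by (auto simp: A_iff)
  have "cx x ?p (cx x (gr g) ?p) = cx x (gr g) ?p" using comp3[OF ph gh ph x] comp3[OF ph ph gh x] lf9[OF x g] pp by simp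
  then have "lcomp TC (?F chi) ?Z ?Z (upper_action C \<delta> x ?Z (m11 ?p) (m11 ?p) g) (?i chi b) =
    m11 (cx x (cx x (gr g) ?p) (cx x (E x chi b 0) ?p))" by (simp add: upper_action_def TC_comp Xe T_graph_eq[OF ga])
  also have "cx x (cx x (gr g) ?p) (cx x (E x chi b 0) ?p) = cx x (gr g) (cx x (E x chi b 0) ?p)" using comp3[OF Eh[of chi b 0] ph gh x] pE by simp
  also have "... = cx x (SUM a<dm x chi. fsc (rho x chi g $$ (a, b)) (E x chi a 0)) ?p"
   using comp3[OF ph mx_hom0 gh x] gr_mx[OF x irreducible_repD(1)[OF conjunct1[OF rho[OF x c(1)]]] c(2) dm_pos[OF x c(1)] g] by simp
  finally show ?thesis by (simp add: TC_scale cp_sum_left cp_fsc_left m11_sum msc_m11)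
 qed
 ultimately show ?thesis unfolding is_simple_family_def
  by (intro exI[of _ ?Z] exI[of _ "m11 ?p"] exI[of _ "dm x"] exI[of _ "rho x"] exI[of _ ?i] exI[of _ ?q] conjI upper) (use rho[OF x] in auto)
qed

end

section \<open>The idempotents belonging to an arbitrary simple family\<close>

context alg_category
begin

text \<open>Whatever object realises \<open>[x]^1\<close>, its projector lies in the ideal because
  the object is a retract of a sum of proper subquotients, and fixes morphisms from proper
  subquotients because they factor through it. Multiplying it with the two-sided unit e then gives
  both elements at once.\<close>

lemma lower_part_idempotent:
 assumes low: "is_lower_part C \<delta> x Y i" and x: "obj x"
  and Y: "Y : lobj TC" "i : lhom TC Y (Tob x)" "p : lhom TC (Tob x) Y"
  and pi: "mc (fst Y) [x] (fst Y) p i = snd Y" and e: "lowid x e"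
 shows "mc [x] (fst Y) [x] i p = m11 e"
proof -
 let ?ys = "fst Y" and ?e = "mc [x] (fst Y) [x] i p 0 0"
 have Xe: "Tob x = ([x], m11 (id0 x))" by (rule T_obj_eq[OF x])
 have Xo: "Tob x : lobj TC" using x by (simp add: Xe TC_obj1 id0_hom0 cp_id_left)
 have Yo: "set ?ys <= Obj C" "snd Y : mH ?ys ?ys" using Y(1) by (auto simp: TC_obj)
 have xo: "set [x] <= Obj C" using x by simp
 have i: "i : mH ?ys [x]" "p : mH [x] ?ys" using Y(2,3) by (auto simp: TC_hom Xe)
 have ip: "m11 ?e = mc [x] ?ys [x] i p" by (rule m11_eta[OF mc_hom[OF i(2,1) xo Yo(1) xo]])
 have eh: "?e : hom0 x x" using mc_hom[OF i(2,1) xo Yo(1) xo] m11_mH ip by metis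
 have fix1: "cp z x x ?e f = f" if z: "z : PS x" and f: "f : hom0 z x" for z f
 proof -
  note zo = PS_obj[OF z]
  have Ze: "Tob z = ([z], m11 (id0 z))" by (rule T_obj_eq[OF zo])
  have Zo: "Tob z : lobj TC" using zo by (simp add: Ze TC_obj1 id0_hom0 cp_id_left)
  have "m11 f : lhom TC (Tob z) (Tob x)" using f cp_id_left[OF f zo x] cp_id_right[OF f zo x] by (simp add: Ze Xe TC_hom1 zo x)
  moreover have "proper_subquotient C z x" using z by (simp add: PS_def)
  ultimately have "EX g:lhom TC (Tob z) Y. lcomp TC (Tob z) Y (Tob x) i g = m11 f"
   using conjunct2[OF conjunct2[OF low[unfolded is_lower_part_def]]] by blast
  then obtain g where g: "g : lhom TC (Tob z) Y" "mc [z] ?ys [x] i g = m11 f" by (auto simp: TC_comp Ze Xe)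
  have gm: "g : mH [z] ?ys" using g(1) by (simp add: TC_hom Ze)
  have zo': "set [z] <= Obj C" using zo by simp
  have "m11 (cp z x x ?e f) = mc [z] [x] [x] (m11 ?e) (m11 f)" by (rule m11_comp[symmetric])
  also have "... = mc [z] [x] [x] (mc [x] ?ys [x] i p) (mc [z] ?ys [x] i g)" by (rule arg_cong2[OF ip g(2)[symmetric]])
  also have "... = mc [z] ?ys [x] i (mc [z] [x] ?ys p (mc [z] ?ys [x] i g))"
   by (rule mc_assoc[OF mc_hom[OF gm i(1) zo' Yo(1) xo] i(2,1) zo' xo Yo(1) xo, symmetric])
  also have "mc [z] [x] ?ys p (mc [z] ?ys [x] i g) = g" using mc_assoc[OF gm i zo' Yo(1) xo Yo(1)] pi TC_unit(2)[OF g(1) Zo Y(1)] by (simp add: Ze)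
  finally have "m11 (cp z x x ?e f) = mc [z] ?ys [x] i g" .
  then show ?thesis unfolding g(2) m11_inject .
 qed
 obtain zs i' p' where z: "ALL z:set zs. proper_subquotient C z x" "is_summand TC Y (T_sum C \<delta> zs) i' p'"
  using conjunct1[OF conjunct2[OF low[unfolded is_lower_part_def]]] by blast
 have zP: "set zs <= PS x" using z(1) by (auto simp: PS_def)
 then have zo: "set zs <= Obj C" using PS_obj by blast
 have s: "i' : mH ?ys zs" "p' : mH zs ?ys" "mc ?ys zs ?ys p' i' = snd Y" using z(2) by (auto simp: is_summand_def TC_hom TC_comp TC_id T_sum_def)
 have pu: "mc [x] ?ys ?ys (snd Y) p = p" using TC_unit(2)[OF Y(3) Xo Y(1)] by (simp add: Xe)
 have "mc [x] ?ys [x] i p = mc [x] ?ys [x] i (mc [x] zs ?ys p' (mc [x] ?ys zs i' p))" using pu mc_assoc[OF i(2) s(1,2) xo Yo(1) zo Yo(1)] s(3) by simp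
 also have "... = mc [x] zs [x] (mc zs ?ys [x] i p') (mc [x] ?ys zs i' p)"
  by (rule mc_assoc[OF mc_hom[OF i(2) s(1) xo Yo(1) zo] s(2) i(1) xo zo Yo(1) xo])
 finally have fac: "mc [x] ?ys [x] i p = mc [x] zs [x] (mc zs ?ys [x] i p') (mc [x] ?ys zs i' p)" .
 have h: "mc zs ?ys [x] i p' : mH zs [x]" "mc [x] ?ys zs i' p : mH [x] zs"
  by (rule mc_hom[OF s(2) i(1) zo Yo(1) xo], rule mc_hom[OF i(2) s(1) xo Yo(1) zo])
 have "?e = (SUM k<length zs. cp x (zs ! k) x (mc zs ?ys [x] i p' 0 k) (mc [x] ?ys zs i' p k 0))" unfolding fac by (subst mc_eq) simp
 moreover have "cp x (zs ! k) x (mc zs ?ys [x] i p' 0 k) (mc [x] ?ys zs i' p k 0) : thru (PS x) x x" if k: "k < length zs" for k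
 proof (rule thru_comp)
  show "zs ! k : PS x" "obj (zs ! k)" using zP zo k by auto
  show "mc [x] ?ys zs i' p k 0 : hom0 x (zs ! k)" using spec[OF spec[OF h(2)[unfolded mH_iff], of k], of 0] k by simp
  show "mc zs ?ys [x] i p' 0 k : hom0 (zs ! k) x" using spec[OF spec[OF h(1)[unfolded mH_iff], of 0], of k] k by simp
 qed
 ultimately have th: "?e : thru (PS x) x x" using thru_sum[of "{..<length zs}"] by simp
 have "cx x ?e e = e"
 proof (rule thru_unit_left[OF _ _ eh x x])
  show "e : thru (PS x) x x" using e by (simp add: lowid_def)
  show "cp z x x ?e f = f" if "z : PS x" "obj z" "f : hom0 z x" for z f by (rule fix1[OF that(1,3)])
 qed
 moreover have "cx x ?e e = ?e" by (rule thru_unit_right[OF th _ lowid_facts(1)[OF e x] x x]) (use e in \<open>simp add: lowid_def\<close>)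
 ultimately show ?thesis using ip by simp
qed

text \<open>For an arbitrary family the copy with index 0 is a retract of \<open>[x]\<close>, and
  its idempotent can be named: the group acts on the copies through rho, so by Schur orthogonality
  the matrix unit at (0, 0) projects onto that copy.\<close>

lemma family_data:
 assumes F: "is_simple_family C \<delta> x F" and x: "obj x"
 shows "EX e d rho \<iota> \<pi>. lowid x e & (ALL chi:irr x. (irreducible_rep (A x) (d chi) (rho chi) & rep_char (A x) (rho chi) = chi) &
  F chi : lobj TC & \<iota> chi : lhom TC (F chi) (Tob x) & \<pi> chi : lhom TC (Tob x) (F chi) &
  mc (fst (F chi)) [x] (fst (F chi)) (\<pi> chi) (\<iota> chi) = snd (F chi) &
  mc [x] (fst (F chi)) [x] (\<iota> chi) (\<pi> chi) = m11 (cx x (mx x (d chi) (rho chi) 0 0) (id0 x - e)))"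
proof -
 interpret G: fin_group "A x" using fin_group_A[OF x] .
 let ?f = "%chi. fst (F chi)"
 let ?X = "Tob x" and ?I = "irr x :: ('m => 'k) set"
 have Xe: "?X = ([x], m11 (id0 x))" by (rule T_obj_eq[OF x])
 have Xo: "?X : lobj TC" using x by (simp add: Xe TC_obj1 id0_hom0 cp_id_left)
 have xo: "set [x] <= Obj C" using x by simp
 obtain Z j q d rho i p where f: "is_upper_part C \<delta> x Z j q"
  "ALL chi:?I. irreducible_rep (A x) (d chi) (rho chi) & rep_char (A x) (rho chi) = chi"
  "is_direct_sum TC Z (SIGMA chi:?I. {..<d chi}) (%(chi, a). F chi) (%(chi, a). i chi a) (%(chi, a). p chi a)"
  "ALL g:AA x. ALL chi:?I. ALL b<d chi. lcomp TC (F chi) Z Z (upper_action C \<delta> x Z j q g) (i chi b) =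
   (SUM a<d chi. lscale TC (rho chi g $$ (a, b)) (i chi a))" using F unfolding is_simple_family_def by blast
 obtain Y i1 p1 where Y: "is_lower_part C \<delta> x Y i1"
  "is_direct_sum TC ?X {0, 1::nat} (%a. if a = 0 then Z else Y) (%a. if a = 0 then j else i1) (%a. if a = 0 then q else p1)"
  using f(1) unfolding is_upper_part_def by blast
 let ?zs = "fst Z"
 have D: "Z : lobj TC" "j : lhom TC Z ?X" "q : lhom TC ?X Z" "Y : lobj TC" "i1 : lhom TC Y ?X" "p1 : lhom TC ?X Y"
  "mc ?zs [x] ?zs q j = snd Z" "mc (fst Y) [x] (fst Y) p1 i1 = snd Y"
  "mc [x] ?zs [x] j q + mc [x] (fst Y) [x] i1 p1 = m11 (id0 x)" using Y(2) by (auto simp: is_direct_sum_def TC_comp TC_id Xe)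
 obtain e where e: "lowid x e" using lowid_exists[OF x] by blast
 note E = lowid_facts[OF e x]
 have jm: "j : mH ?zs [x]" "q : mH [x] ?zs" and Zo: "set ?zs <= Obj C" using D(1-3) by (auto simp: TC_hom TC_obj Xe)
 have "mc [x] (fst Y) [x] i1 p1 = m11 e" by (rule lower_part_idempotent[OF Y(1) x D(4-6,8) e])
 then have "mc [x] ?zs [x] j q = m11 (id0 x) - m11 e" using D(9) by (simp add: eq_diff_eq)
 also have "... = m11 (id0 x - e)" by (auto simp: m11_def fun_eq_iff minus_apply zero_fun_apply)
 finally have jq: "mc [x] ?zs [x] j q = m11 (id0 x - e)" .
 have F1: "F chi : lobj TC" "i chi a : lhom TC (F chi) Z" "p chi a : lhom TC Z (F chi)" if "chi : ?I" "a < d chi" for chi a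
  using f(3) that unfolding is_direct_sum_def by auto
 have F2: "mc (?f chi) ?zs (?f chi') (p chi' a') (i chi a) = (if chi = chi' & a = a' then snd (F chi) else 0)"
  if "chi : ?I" "a < d chi" "chi' : ?I" "a' < d chi'" for chi a chi' a'
 proof -
  have "(chi, a) : (SIGMA chi:?I. {..<d chi})" "(chi', a') : (SIGMA chi:?I. {..<d chi})" using that by auto
  from bspec[OF bspec[OF conjunct1[OF conjunct2[OF conjunct2[OF conjunct2[OF f(3)[unfolded is_direct_sum_def]]]]] this(1)] this(2)]
  show ?thesis by (simp add: TC_comp TC_id)
 qed
 have F3: "(SUM (chi, a):(SIGMA chi:?I. {..<d chi}). mc ?zs (?f chi) ?zs (i chi a) (p chi a)) = snd Z"
 proof -
  have "(SUM c:(SIGMA chi:?I. {..<d chi}). lcomp TC Z (case c of (chi, a) => F chi) Z (case c of (chi, a) => i chi a) (case c of (chi, a) => p chi a)) = lid TC Z"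
   using f(3) unfolding is_direct_sum_def by blast
  moreover have "(SUM (chi, a):(SIGMA chi:?I. {..<d chi}). mc ?zs (?f chi) ?zs (i chi a) (p chi a)) =
   (SUM c:(SIGMA chi:?I. {..<d chi}). lcomp TC Z (case c of (chi, a) => F chi) Z (case c of (chi, a) => i chi a) (case c of (chi, a) => p chi a))"
   by (intro sum.cong refl) (auto simp: TC_comp)
  ultimately show ?thesis by (simp add: TC_id)
 qed
 define \<iota> where "\<iota> chi a = mc (?f chi) ?zs [x] j (i chi a)" for chi a
 define \<pi> where "\<pi> chi a = mc [x] ?zs (?f chi) (p chi a) q" for chi a
 have ih: "\<iota> chi a : lhom TC (F chi) ?X" "\<pi> chi a : lhom TC ?X (F chi)" if "chi : ?I" "a < d chi" for chi a
  using TC_comp_hom[OF F1(2)[OF that] D(2) F1(1)[OF that] D(1) Xo] TC_comp_hom[OF D(3) F1(3)[OF that] Xo D(1) F1(1)[OF that]]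
  by (simp_all add: \<iota>_def \<pi>_def Xe)
 have im: "\<iota> chi a : mH (?f chi) [x]" "\<pi> chi a : mH [x] (?f chi)" "i chi a : mH (?f chi) ?zs" "p chi a : mH ?zs (?f chi)"
  "set (?f chi) <= Obj C" if "chi : ?I" "a < d chi" for chi a using ih[OF that] F1[OF that] by (auto simp: TC_hom TC_obj Xe)
 have qj: "mc [x] [x] ?zs q (mc [x] ?zs [x] j q) = q" using mc_assoc[OF jm(2,1,2) xo Zo xo Zo] TC_unit(2)[OF D(3) Xo D(1)] D(7) by (simp add: Xe)
 have jqj: "mc ?zs [x] [x] (mc [x] ?zs [x] j q) j = j" using mc_assoc[OF jm jm(1) Zo xo Zo xo] TC_unit(1)[OF D(2) D(1) Xo] D(7) by (simp add: Xe)
 have ji: "mc (?f chi) [x] ?zs q (\<iota> chi a) = i chi a" if "chi : ?I" "a < d chi" for chi a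
  unfolding \<iota>_def using mc_assoc[OF im(3)[OF that] jm im(5)[OF that] Zo xo Zo] D(7) TC_unit(2)[OF F1(2)[OF that] F1(1)[OF that] D(1)] by simp
 have pii: "mc (?f chi) [x] (?f chi) (\<pi> chi a) (\<iota> chi a) = snd (F chi)" if "chi : ?I" "a < d chi" for chi a
  unfolding \<pi>_def using mc_assoc[OF im(1)[OF that] jm(2) im(4)[OF that] im(5)[OF that] xo Zo im(5)[OF that]] ji[OF that] F2[OF that that] by simp
 have ipi: "m11 (id0 x - e) = (SUM (chi, a):(SIGMA chi:?I. {..<d chi}). mc [x] (?f chi) [x] (\<iota> chi a) (\<pi> chi a))"
 proof -
  have zz: "snd Z : mH ?zs ?zs" using D(1) by (simp add: TC_obj)
  have "m11 (id0 x - e) = mc [x] ?zs [x] j (mc [x] ?zs ?zs (snd Z) q)" using jq TC_unit(2)[OF D(3) Xo D(1)] by (simp add: Xe)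
  also have "... = (SUM (chi, a):(SIGMA chi:?I. {..<d chi}). mc [x] ?zs [x] j (mc [x] ?zs ?zs (mc ?zs (?f chi) ?zs (i chi a) (p chi a)) q))"
   unfolding F3[symmetric] mc_sum by (intro sum.cong refl) auto
  also have "... = (SUM (chi, a):(SIGMA chi:?I. {..<d chi}). mc [x] (?f chi) [x] (\<iota> chi a) (\<pi> chi a))"
  proof (intro sum.cong refl, clarsimp)
   fix chi a assume c: "chi : ?I" "a < d chi"
   note m = im[OF c]
   have "mc [x] ?zs ?zs (mc ?zs (?f chi) ?zs (i chi a) (p chi a)) q = mc [x] (?f chi) ?zs (i chi a) (\<pi> chi a)"
    unfolding \<pi>_def by (rule mc_assoc[OF jm(2) m(4,3) xo Zo m(5) Zo, symmetric])
   then show "mc [x] ?zs [x] j (mc [x] ?zs ?zs (mc ?zs (?f chi) ?zs (i chi a) (p chi a)) q) = mc [x] (?f chi) [x] (\<iota> chi a) (\<pi> chi a)"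
    unfolding \<iota>_def using mc_assoc[OF m(2,3) jm(1) xo m(5) Zo xo] by simp
  qed
  finally show ?thesis .
 qed
 \<comment> \<open>The specified equivariance concerns \<open>[x]^0\<close>; it carries over to
   \<open>[x]\<close> because automorphisms commute with the projector onto the upper part.\<close>
 have act: "mc (?f chi) [x] [x] (m11 (gr g)) (\<iota> chi b) = (SUM a<d chi. msc (rho chi g $$ (a, b)) (\<iota> chi a))"
  if g: "g : AA x" and c: "chi : ?I" "b < d chi" for g chi b
 proof -
  let ?fs = "fst (F chi)"
  note m = im[OF c]
  have ga: "arr g" using g by (auto simp: A_iff)
  have gm: "m11 (gr g) : mH [x] [x]" using gr_A[OF g] by (simp add: m11_mH)
  have gj: "mc ?zs [x] [x] (m11 (gr g)) j : mH ?zs [x]" by (rule mc_hom[OF jm(1) gm Zo xo xo])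
  have gi: "mc ?fs [x] [x] (m11 (gr g)) (\<iota> chi b) = mc ?fs ?zs [x] (mc ?zs [x] [x] (m11 (gr g)) j) (i chi b)"
   unfolding \<iota>_def by (rule mc_assoc[OF m(3) jm(1) gm m(5) Zo xo xo])
  have "mc ?zs [x] [x] (m11 (id0 x - e)) (mc ?zs [x] [x] (m11 (gr g)) j) =
    mc ?zs [x] [x] (mc [x] [x] [x] (m11 (id0 x - e)) (m11 (gr g))) j" by (rule mc_assoc[OF jm(1) gm _ Zo xo xo xo]) (simp add: m11_mH E(2))
  also have "mc [x] [x] [x] (m11 (id0 x - e)) (m11 (gr g)) = mc [x] [x] [x] (m11 (gr g)) (m11 (id0 x - e))" using E(9)[OF g] by simp
  also have "mc ?zs [x] [x] ... j = mc ?zs [x] [x] (m11 (gr g)) (mc ?zs [x] [x] (m11 (id0 x - e)) j)"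
   by (rule mc_assoc[OF jm(1) _ gm Zo xo xo xo, symmetric]) (simp add: m11_mH E(2))
  finally have pg: "mc ?zs [x] [x] (mc [x] ?zs [x] j q) (mc ?zs [x] [x] (m11 (gr g)) j) = mc ?zs [x] [x] (m11 (gr g)) j" unfolding jq[symmetric] jqj .
  have "mc ?fs ?zs ?zs (mc ?zs [x] ?zs q (mc ?zs [x] [x] (m11 (gr g)) j)) (i chi b) = (SUM a<d chi. msc (rho chi g $$ (a, b)) (i chi a))"
   using mp[OF spec[OF bspec[OF bspec[OF f(4) g] c(1)], of b] c(2)] by (simp add: upper_action_def TC_comp TC_scale T_graph_eq[OF ga] Xe)
  then have "mc ?fs ?zs [x] j (mc ?fs ?zs ?zs (mc ?zs [x] ?zs q (mc ?zs [x] [x] (m11 (gr g)) j)) (i chi b)) =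
    (SUM a<d chi. msc (rho chi g $$ (a, b)) (\<iota> chi a))" by (simp add: mc_sum msc_comp \<iota>_def)
  moreover have "mc ?fs ?zs [x] j (mc ?fs ?zs ?zs (mc ?zs [x] ?zs q (mc ?zs [x] [x] (m11 (gr g)) j)) (i chi b)) =
    mc ?fs ?zs [x] (mc ?zs ?zs [x] j (mc ?zs [x] ?zs q (mc ?zs [x] [x] (m11 (gr g)) j))) (i chi b)"
   by (rule mc_assoc[OF m(3) mc_hom[OF gj jm(2) Zo xo Zo] jm(1) m(5) Zo Zo xo])
  moreover have "mc ?zs ?zs [x] j (mc ?zs [x] ?zs q (mc ?zs [x] [x] (m11 (gr g)) j)) =
    mc ?zs [x] [x] (mc [x] ?zs [x] j q) (mc ?zs [x] [x] (m11 (gr g)) j)" by (rule mc_assoc[OF gj jm(2,1) Zo xo Zo xo])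
  ultimately show ?thesis using gi pg by simp
 qed
 have unit: "mc (?f chi) [x] [x] (m11 (mx x (d psi) (rho psi) 0 0)) (\<iota> chi b) = (if chi = psi & b = 0 then \<iota> psi 0 else 0)"
  if c: "psi : ?I" "chi : ?I" "b < d chi" for chi psi b
 proof -
  let ?n = "of_nat (Coset.order (A x)) :: 'k"
  note r = conjunct1[OF bspec[OF f(2) c(1)]] and r' = conjunct1[OF bspec[OF f(2) c(2)]]
  have d0: "0 < d psi" by (rule irreducible_repD(2)[OF r])
  have n: "?n ~= 0" using G.order_pos by simp
  have "mc (?f chi) [x] [x] (m11 (mx x (d psi) (rho psi) 0 0)) (\<iota> chi b) =
    (SUM g:AA x. SUM a<d chi. msc (of_nat (d psi) / ?n * rho psi (iv x g) $$ (0, 0) * rho chi g $$ (a, b)) (\<iota> chi a))"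
   unfolding mx_def ga_def m11_sum mc_sum msc_m11 msc_comp by (intro sum.cong refl) (simp add: act c msc_sum)
  also have "... = (SUM a<d chi. msc (of_nat (d psi) / ?n * (SUM g:AA x. rho chi g $$ (a, b) * rho psi (iv x g) $$ (0, 0))) (\<iota> chi a))"
   by (subst sum.swap) (simp add: msc_sum sum_distrib_left mult_ac)
  also have "... = (SUM a<d chi. if a = 0 then (if chi = psi & b = 0 then \<iota> psi 0 else 0) else 0)"
  proof (rule sum.cong[OF refl])
   fix a assume a: "a : {..<d chi}"
   show "msc (of_nat (d psi) / ?n * (SUM g:AA x. rho chi g $$ (a, b) * rho psi (iv x g) $$ (0, 0))) (\<iota> chi a) =
     (if a = 0 then (if chi = psi & b = 0 then \<iota> psi 0 else 0) else 0)"
   proof (cases "chi = psi")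
    case True
    then have "of_nat (d psi) / ?n * (SUM g:AA x. rho chi g $$ (a, b) * rho psi (iv x g) $$ (0, 0)) = (if a = 0 & b = 0 then 1 else 0)"
     using G.schur_same[OF r, of a b 0 0] a c d0 n by (simp add: field_simps split: if_splits)
    then show ?thesis using True by simp
   next
    case False
    then have "(SUM g:AA x. rho chi g $$ (a, b) * rho psi (iv x g) $$ (0, 0)) = 0"
     using G.schur_zero[OF r r' _ _ c(3) d0 d0, of a] bspec[OF f(2) c(1)] bspec[OF f(2) c(2)] a by simp
    then show ?thesis using False by simp
   qed
  qed
  also have "... = (if chi = psi & b = 0 then \<iota> psi 0 else 0)" using c by simp
  finally show ?thesis .
 qed
 have idem: "mc [x] (?f psi) [x] (\<iota> psi 0) (\<pi> psi 0) = m11 (cx x (mx x (d psi) (rho psi) 0 0) (id0 x - e))" if c: "psi : ?I" for psi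
 proof -
  have d0: "0 < d psi" by (rule irreducible_repD(2)[OF conjunct1[OF bspec[OF f(2) c]]])
  have "m11 (cx x (mx x (d psi) (rho psi) 0 0) (id0 x - e)) =
    (SUM (chi, a):(SIGMA chi:?I. {..<d chi}). mc [x] [x] [x] (m11 (mx x (d psi) (rho psi) 0 0)) (mc [x] (?f chi) [x] (\<iota> chi a) (\<pi> chi a)))"
   unfolding m11_comp[symmetric] ipi mc_sum by (intro sum.cong refl) auto
  also have "... = (SUM s:(SIGMA chi:?I. {..<d chi}). if s = (psi, 0) then mc [x] (?f psi) [x] (\<iota> psi 0) (\<pi> psi 0) else 0)"
  proof (rule sum.cong[OF refl])
   fix s assume "s : (SIGMA chi:?I. {..<d chi})"
   then obtain chi a where s: "s = (chi, a)" and ca: "chi : ?I" "a : {..<d chi}" by (rule SigmaE)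
   then have ca': "a < d chi" by simp
   note m = im[OF ca(1) ca']
   have "mc [x] [x] [x] (m11 (mx x (d psi) (rho psi) 0 0)) (mc [x] (?f chi) [x] (\<iota> chi a) (\<pi> chi a)) =
     mc [x] (?f chi) [x] (mc (?f chi) [x] [x] (m11 (mx x (d psi) (rho psi) 0 0)) (\<iota> chi a)) (\<pi> chi a)"
    by (rule mc_assoc[OF m(2,1) _ xo m(5) xo xo]) (simp add: m11_mH mx_hom0)
   then show "(case s of (chi, a) => mc [x] [x] [x] (m11 (mx x (d psi) (rho psi) 0 0)) (mc [x] (?f chi) [x] (\<iota> chi a) (\<pi> chi a))) =
     (if s = (psi, 0) then mc [x] (?f psi) [x] (\<iota> psi 0) (\<pi> psi 0) else 0)" using unit[OF c ca(1) ca'] by (auto simp: s mc_zero)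
  qed
  also have "... = mc [x] (?f psi) [x] (\<iota> psi 0) (\<pi> psi 0)" by (subst sum.delta) (use c d0 G.finite_irr_chars in auto)
  finally show ?thesis ..
 qed
 have d0: "0 < d chi" if "chi : ?I" for chi by (rule irreducible_repD(2)[OF conjunct1[OF bspec[OF f(2) that]]])
 show ?thesis
 proof (rule exI[of _ e], rule exI[of _ d], rule exI[of _ rho], rule exI[of _ "%chi. \<iota> chi 0"], rule exI[of _ "%chi. \<pi> chi 0"],
   rule conjI[OF e], rule ballI)
  fix chi assume c: "chi : ?I"
  note d = d0[OF c]
  show "(irreducible_rep (A x) (d chi) (rho chi) & rep_char (A x) (rho chi) = chi) &
   F chi : lobj TC & \<iota> chi 0 : lhom TC (F chi) ?X & \<pi> chi 0 : lhom TC ?X (F chi) &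
   mc (?f chi) [x] (?f chi) (\<pi> chi 0) (\<iota> chi 0) = snd (F chi) &
   mc [x] (?f chi) [x] (\<iota> chi 0) (\<pi> chi 0) = m11 (cx x (mx x (d chi) (rho chi) 0 0) (id0 x - e))"
   by (intro conjI conjunct1[OF bspec[OF f(2) c]] conjunct2[OF bspec[OF f(2) c]] F1(1)[OF c d] ih[OF c d] pii[OF c d] idem[OF c])
 qed
qed

end

section \<open>From decompositions of idempotents to direct sums of objects that split them\<close>

context deg_category
begin

lemma TC_assoc:
 assumes h: "f : lhom TC X Y" "g : lhom TC Y Z" "h : lhom TC Z W"
  and o: "X : lobj TC" "Y : lobj TC" "Z : lobj TC" "W : lobj TC"
 shows "tc X Z W h (tc X Y Z g f) = tc X Y W (tc Y Z W h g) f"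
 by (rule mc_assoc) (use h o in \<open>auto simp: TC_hom TC_obj\<close>)

text \<open>D splits an idempotent of X, each \<open>F a\<close> splits an idempotent of
  \<open>Y a\<close>, and w, v decompose the first idempotent into the others. The decomposition is
  transported to the splitting objects, since the objects chosen by \<open>simple_object\<close>
  need not be of the form \<open>[x]\<close> with an idempotent.\<close>

lemma direct_sum_retract:
 assumes D: "D : lobj TC" and X: "X : lobj TC" and I: "finite I"
  and i: "\<iota> : lhom TC D X" and p: "\<pi> : lhom TC X D" and pi: "tc D X D \<pi> \<iota> = snd D"
  and F: "!!a. a : I ==> F a : lobj TC" and Y: "!!a. a : I ==> Y a : lobj TC"
  and ia: "!!a. a : I ==> j a : lhom TC (F a) (Y a)" and pa: "!!a. a : I ==> q a : lhom TC (Y a) (F a)"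
  and pia: "!!a. a : I ==> tc (F a) (Y a) (F a) (q a) (j a) = snd (F a)"
  and w: "!!a. a : I ==> w a : lhom TC X (Y a)" and v: "!!a. a : I ==> v a : lhom TC (Y a) X"
  and wP: "!!a. a : I ==> tc X X (Y a) (w a) (tc X D X \<iota> \<pi>) = w a"
  and ew: "!!a. a : I ==> tc X (Y a) (Y a) (tc (Y a) (F a) (Y a) (j a) (q a)) (w a) = w a"
  and wv: "!!a b. a : I ==> b : I ==> tc (Y a) X (Y b) (w b) (v a) =
   (if a = b then tc (Y a) (F a) (Y a) (j a) (q a) else 0)"
  and vw: "(SUM a:I. tc X (Y a) X (v a) (w a)) = tc X D X \<iota> \<pi>"
 shows "is_direct_sum TC D I F
  (%a. tc (F a) X D \<pi> (tc (F a) (Y a) X (v a) (j a)))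
  (%a. tc D (Y a) (F a) (q a) (tc D X (Y a) (w a) \<iota>))" unfolding is_direct_sum_def
proof (intro conjI ballI)
 have vj: "tc (F a) (Y a) X (v a) (j a) : lhom TC (F a) X"
  and wi: "tc D X (Y a) (w a) \<iota> : lhom TC D (Y a)" if "a : I" for a using that D X i F Y ia w v by (intro TC_comp_hom; simp)+
 have io: "tc X D X \<iota> \<pi> : lhom TC X X" by (rule TC_comp_hom[OF p i X D X])
 have jq: "tc (Y a) (F a) (Y a) (j a) (q a) : lhom TC (Y a) (Y a)" if "a : I" for a
  by (rule TC_comp_hom[OF pa[OF that] ia[OF that] Y[OF that] F[OF that] Y[OF that]])
 show "finite I" "D : lobj TC" by fact+
 fix a assume a: "a : I"
 note Fa = F[OF a] and Ya = Y[OF a]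
 show "F a : lobj TC" by (rule Fa)
 show gh: "tc (F a) X D \<pi> (tc (F a) (Y a) X (v a) (j a)) : lhom TC (F a) D" by (rule TC_comp_hom[OF vj[OF a] p Fa X D])
 show "tc D (Y a) (F a) (q a) (tc D X (Y a) (w a) \<iota>) : lhom TC D (F a)" by (rule TC_comp_hom[OF wi[OF a] pa[OF a] D Ya Fa])
 fix b assume b: "b : I"
 note Fb = F[OF b] and Yb = Y[OF b]
 let ?t = "tc (F a) (Y a) X (v a) (j a)"
 have "tc (F a) D (Y b) (tc D X (Y b) (w b) \<iota>) (tc (F a) X D \<pi> ?t) =
   tc (F a) X (Y b) (w b) (tc (F a) D X \<iota> (tc (F a) X D \<pi> ?t))" by (rule TC_assoc[OF gh i w[OF b] Fa D X Yb, symmetric])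
 also have "tc (F a) D X \<iota> (tc (F a) X D \<pi> ?t) =
   tc (F a) X X (tc X D X \<iota> \<pi>) ?t" by (rule TC_assoc[OF vj[OF a] p i Fa X D X])
 also have "tc (F a) X (Y b) (w b) ... = tc (F a) X (Y b) (w b) ?t" using TC_assoc[OF vj[OF a] io w[OF b] Fa X X Yb] wP[OF b] by simp
 also have "... = tc (F a) (Y a) (Y b) (tc (Y a) X (Y b) (w b) (v a)) (j a)" by (rule TC_assoc[OF ia[OF a] v[OF a] w[OF b] Fa Ya X Yb])
 also have "... = (if a = b then j a else 0)"
  unfolding wv[OF a b] using TC_assoc[OF ia[OF a] pa[OF a] ia[OF a] Fa Ya Fa Ya, unfolded pia[OF a] TC_unit(1)[OF ia[OF a] Fa Ya], symmetric]
  by (auto simp: mc_zero)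
 finally have k: "tc (F a) D (Y b) (tc D X (Y b) (w b) \<iota>) (tc (F a) X D \<pi> ?t) =
  (if a = b then j a else 0)" .
 show "lcomp TC (F a) D (F b) (tc D (Y b) (F b) (q b) (tc D X (Y b) (w b) \<iota>))
   (tc (F a) X D \<pi> ?t) = (if a = b then lid TC (F a) else 0)"
  using TC_assoc[OF gh wi[OF b] pa[OF b] Fa D Yb Fb] k pia[OF a] by (auto simp: TC_comp TC_id mc_zero)
next
 have vj: "tc (F a) (Y a) X (v a) (j a) : lhom TC (F a) X"
  and wi: "tc D X (Y a) (w a) \<iota> : lhom TC D (Y a)" if "a : I" for a using that D X i F Y ia w v by (intro TC_comp_hom; simp)+
 have "tc D (F a) D (tc (F a) X D \<pi> (tc (F a) (Y a) X (v a) (j a)))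
   (tc D (Y a) (F a) (q a) (tc D X (Y a) (w a) \<iota>)) =
   tc D X D \<pi> (tc D X X (tc X (Y a) X (v a) (w a)) \<iota>)" if a: "a : I" for a
 proof -
  note Fa = F[OF a] and Ya = Y[OF a]
  let ?s = "tc D X (Y a) (w a) \<iota>"
  have qs: "tc D (Y a) (F a) (q a) ?s : lhom TC D (F a)" by (rule TC_comp_hom[OF wi[OF a] pa[OF a] D Ya Fa])
  have jqs: "tc D (F a) (Y a) (j a) (tc D (Y a) (F a) (q a) ?s) = ?s" using TC_assoc[OF wi[OF a] pa[OF a] ia[OF a] D Ya Fa Ya]
    TC_assoc[OF i w[OF a] TC_comp_hom[OF pa[OF a] ia[OF a] Ya Fa Ya] D X Ya Ya] ew[OF a] by simp
  have "tc D (F a) X (tc (F a) (Y a) X (v a) (j a)) (tc D (Y a) (F a) (q a) ?s) =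
    tc D (Y a) X (v a) ?s" using TC_assoc[OF qs ia[OF a] v[OF a] D Fa Ya X] jqs by simp
  then show ?thesis using TC_assoc[OF qs vj[OF a] p D Fa X D] TC_assoc[OF i w[OF a] v[OF a] D X Ya X] by simp
 qed
 then have "(SUM a:I. lcomp TC D (F a) D (tc (F a) X D \<pi> (tc (F a) (Y a) X (v a) (j a)))
   (tc D (Y a) (F a) (q a) (tc D X (Y a) (w a) \<iota>))) =
   tc D X D \<pi> (tc D X X (tc X D X \<iota> \<pi>) \<iota>)" by (simp add: TC_comp mc_sum[symmetric] vw)
 also have "... = snd D" using TC_assoc[OF i p i D X D X] pi TC_unit(1)[OF i D X] by simp
 finally show "(SUM a:I. lcomp TC D (F a) D (tc (F a) X D \<pi> (tc (F a) (Y a) X (v a) (j a)))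
   (tc D (Y a) (F a) (q a) (tc D X (Y a) (w a) \<iota>))) = lid TC D" by (simp add: TC_id)
qed

text \<open>Kronecker products of the inclusions and of the projections exhibit the tensor product
  of two retracts as a retract; the composites are evaluated by the interchange law
  \<open>kr_comp\<close>.\<close>

lemma T_tensor_retract:
 assumes x: "obj x1" "obj x2" and Z: "Z1 : lobj TC" "Z2 : lobj TC"
  and i: "i1 : lhom TC Z1 (Tob x1)" "i2 : lhom TC Z2 (Tob x2)"
  and p: "p1 : lhom TC (Tob x1) Z1" "p2 : lhom TC (Tob x2) Z2"
  and pi: "mc (fst Z1) [x1] (fst Z1) p1 i1 = snd Z1" "mc (fst Z2) [x2] (fst Z2) p2 i2 = snd Z2"
  and ip: "mc [x1] (fst Z1) [x1] i1 p1 = m11 e1" "mc [x2] (fst Z2) [x2] i2 p2 = m11 e2"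
 defines "D == T_tensor C Z1 Z2" and "X == Tob (prd x1 x2)"
  and "\<iota> == kr (fst Z1) [x1] (fst Z2) [x2] i1 i2" and "\<pi> == kr [x1] (fst Z1) [x2] (fst Z2) p1 p2"
 shows "D : lobj TC" "\<iota> : lhom TC D X" "\<pi> : lhom TC X D"
  "tc D X D \<pi> \<iota> = snd D" "tc X D X \<iota> \<pi> = m11 (ten0 x1 x1 x2 x2 e1 e2)"
proof -
 have o: "set (fst Z1) <= Obj C" "set (fst Z2) <= Obj C" "snd Z1 : mH (fst Z1) (fst Z1)" "snd Z2 : mH (fst Z2) (fst Z2)"
  using Z by (auto simp: TC_obj)
 have P: "obj (prd x1 x2)" by (rule prd_obj[OF x])
 have Xe: "X = ([prd x1 x2], m11 (id0 (prd x1 x2)))" unfolding X_def by (rule T_obj_eq[OF P])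
 have X1: "Tob x1 = ([x1], m11 (id0 x1))" "Tob x2 = ([x2], m11 (id0 x2))" using x by (simp_all add: T_obj_eq)
 have Xo: "X : lobj TC" "Tob x1 : lobj TC" "Tob x2 : lobj TC" using P x by (simp_all add: Xe X1 TC_obj1 id0_hom0 cp_id_left)
 have De: "D = (tl (fst Z1) (fst Z2), kr (fst Z1) (fst Z1) (fst Z2) (fst Z2) (snd Z1) (snd Z2))" unfolding D_def by (rule T_tensor_eq)
 have tX: "tl [x1] [x2] = [prd x1 x2]" by simp
 have xo: "set [x1] <= Obj C" "set [x2] <= Obj C" using x by simp_all
 have m: "i1 : mH (fst Z1) [x1]" "i2 : mH (fst Z2) [x2]" "p1 : mH [x1] (fst Z1)" "p2 : mH [x2] (fst Z2)" using i p by (simp_all add: TC_hom X1)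
 have u: "mc (fst Z1) (fst Z1) [x1] i1 (snd Z1) = i1" "mc (fst Z2) (fst Z2) [x2] i2 (snd Z2) = i2"
  "mc [x1] (fst Z1) (fst Z1) (snd Z1) p1 = p1" "mc [x2] (fst Z2) (fst Z2) (snd Z2) p2 = p2"
  using TC_unit(1)[OF i(1) Z(1) Xo(2)] TC_unit(1)[OF i(2) Z(2) Xo(3)] TC_unit(2)[OF p(1) Xo(2) Z(1)] TC_unit(2)[OF p(2) Xo(3) Z(2)]
  by (simp_all add: X1)
 have kh: "\<iota> : mH (tl (fst Z1) (fst Z2)) [prd x1 x2]" "\<pi> : mH [prd x1 x2] (tl (fst Z1) (fst Z2))"
  using kr_hom[OF m(1,2) o(1) xo(1) o(2) xo(2)] kr_hom[OF m(3,4) xo(1) o(1) xo(2) o(2)] unfolding \<iota>_def \<pi>_def tX .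
 show D: "D : lobj TC" unfolding De TC_obj fst_conv snd_conv
  using set_tl[OF o(1,2)] kr_hom[OF o(3,4) o(1,1,2,2)] kr_comp[OF o(3,3,4,4) o(1,1,1,2,2,2)] Z by (auto simp: TC_obj)
 have idl: "mc ys [prd x1 x2] [prd x1 x2] (m11 (id0 (prd x1 x2))) M = M" if "M : mH ys [prd x1 x2]" "set ys <= Obj C" for M ys
  using lid_AC_unit(2)[OF _ that] P lid_AC[OF P] by simp
 have idr: "mc [prd x1 x2] [prd x1 x2] ys M (m11 (id0 (prd x1 x2))) = M" if "M : mH [prd x1 x2] ys" "set ys <= Obj C" for M ys
  using lid_AC_unit(3)[OF _ that] P lid_AC[OF P] by simp
 show "\<iota> : lhom TC D X" by (rule TC_homI) (use kh idl[OF kh(1) set_tl[OF o(1,2)]] kr_comp[OF o(3) m(1) o(4) m(2) o(1,1) xo(1) o(2,2) xo(2)] u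
   in \<open>simp_all add: De Xe \<iota>_def\<close>)
 show "\<pi> : lhom TC X D" by (rule TC_homI) (use kh idr[OF kh(2) set_tl[OF o(1,2)]] kr_comp[OF m(3) o(3) m(4) o(4) xo(1) o(1,1) xo(2) o(2,2)] u
   in \<open>simp_all add: De Xe \<pi>_def\<close>)
 show "tc D X D \<pi> \<iota> = snd D" using kr_comp[OF m(1,3,2,4) o(1) xo(1) o(1,2) xo(2) o(2)] pi by (simp add: De Xe \<iota>_def \<pi>_def)
 show "tc X D X \<iota> \<pi> = m11 (ten0 x1 x1 x2 x2 e1 e2)"
  using kr_comp[OF m(3,1,4,2) xo(1) o(1) xo(1,2) o(2) xo(2)] ip by (simp add: De Xe \<iota>_def \<pi>_def kr_m11)
qed

end

lemma (in alg_category) simple_object_family: "obj x ==> is_simple_family C \<delta> x (simple_object C \<delta> x)"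
proof -
 assume x: "obj x"
 obtain lo dm rho where "simple_data C \<delta> lo dm rho" using simple_data_exists by blast
 then interpret simple_data C \<delta> lo dm rho .
 show ?thesis unfolding simple_object_def by (rule someI[of "is_simple_family C \<delta> x", OF simple_family_ep[OF x]])
qed

lemma (in alg_category) tensor_simple_objects:
 assumes x: "obj x1" "obj x2" and c: "chi1 : irr x1" "chi2 : irr x2"
  and R: "subquotient_representatives C (prd x1 x2) R"
 shows "EX m. (ALL x:R. ALL chi:irr x. of_nat (m x chi) =
   char_pairing (A x1 \<times>\<times> A x2 \<times>\<times> A x) (ternary_char C x1 x2 x) (tensor_char chi1 chi2 (dual_char (A x) chi))) &
  iso_to_direct_sum TC (T_tensor C (simple_object C \<delta> x1 chi1) (simple_object C \<delta> x2 chi2))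
   {(x, chi, k). x : R & chi : irr x & k < m x chi} (%(x, chi, k). simple_object C \<delta> x chi)"
proof -
 let ?F = "simple_object C \<delta>"
 define Q where "Q x = (%(e, d, rho, \<iota>, \<pi>). lowid x e & (ALL chi:irr x. (irreducible_rep (A x) (d chi) (rho chi) & rep_char (A x) (rho chi) = chi) &
  ?F x chi : lobj TC & \<iota> chi : lhom TC (?F x chi) (Tob x) & \<pi> chi : lhom TC (Tob x) (?F x chi) &
  mc (fst (?F x chi)) [x] (fst (?F x chi)) (\<pi> chi) (\<iota> chi) = snd (?F x chi) &
  mc [x] (fst (?F x chi)) [x] (\<iota> chi) (\<pi> chi) = m11 (cx x (mx x (d chi) (rho chi) 0 0) (id0 x - e))))" for x
 have "EX t. Q x t" if "obj x" for x
  using family_data[OF simple_object_family[OF that] that] unfolding Q_def by (simp only: split_paired_Ex case_prod_conv)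
 then have "ALL x:Obj C. EX t. Q x t" by blast
 from bchoice[OF this] obtain t where t: "ALL x:Obj C. Q x (t x)" ..
 define e d rho \<iota> \<pi> where defs: "e x = fst (t x)" "d x = fst (snd (t x))" "rho x = fst (snd (snd (t x)))"
  "\<iota> x = fst (snd (snd (snd (t x))))" "\<pi> x = snd (snd (snd (snd (t x))))" for x
 have q: "Q x (e x, d x, rho x, \<iota> x, \<pi> x)" if "obj x" for x using bspec[OF t that] unfolding defs prod.collapse .
 note q' = q[unfolded Q_def case_prod_conv]
 \<comment> \<open>The parameters are those read off from the chosen families, so that the
   idempotents \<open>S.ep\<close> are exactly the ones split by
   \<open>simple_object\<close>.\<close>
 interpret S: simple_data C \<delta> e d rho
 proof
  show "lowid x (e x)" if "obj x" for x by (rule conjunct1[OF q'[OF that]])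
  show "irreducible_rep (A x) (d x chi) (rho x chi) & rep_char (A x) (rho x chi) = chi" if "obj x" "chi : irr x" for x chi
   by (rule conjunct1[OF bspec[OF conjunct2[OF q'[OF that(1)]] that(2)]])
 qed
 have f: "?F x chi : lobj TC" "\<iota> x chi : lhom TC (?F x chi) (Tob x)" "\<pi> x chi : lhom TC (Tob x) (?F x chi)"
  "mc (fst (?F x chi)) [x] (fst (?F x chi)) (\<pi> x chi) (\<iota> x chi) = snd (?F x chi)"
  "mc [x] (fst (?F x chi)) [x] (\<iota> x chi) (\<pi> x chi) = m11 (S.ep x chi)" if "obj x" "chi : irr x" for x chi
  using conjunct2[OF bspec[OF conjunct2[OF q'[OF that(1)]] that(2)]] unfolding S.ep_def by blast+
 have RO: "obj x" if "x : R" for x using R that subquotient_obj(1) by (auto simp: subquotient_representatives_def)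
 let ?X = "prd x1 x2"
 have P: "obj ?X" by (rule prd_obj[OF x])
 note tr = T_tensor_retract[OF x f(1)[OF x(1) c(1)] f(1)[OF x(2) c(2)] f(2)[OF x(1) c(1)] f(2)[OF x(2) c(2)]
   f(3)[OF x(1) c(1)] f(3)[OF x(2) c(2)] f(4)[OF x(1) c(1)] f(4)[OF x(2) c(2)] f(5)[OF x(1) c(1)] f(5)[OF x(2) c(2)]]
 obtain m w v where m: "ALL x:R. ALL chi:irr x. of_nat (m x chi) =
   char_pairing (A x1 \<times>\<times> A x2 \<times>\<times> A x) (ternary_char C x1 x2 x) (tensor_char chi1 chi2 (dual_char (A x) chi))"
  and L: "let I = {(x, chi, k). x : R & chi : irr x & k < m x chi} in finite I &
   (ALL a:I. w a : hom0 ?X (fst a) & v a : hom0 (fst a) ?X & cp ?X (fst a) (fst a) (S.ep (fst a) (fst (snd a))) (w a) = w a &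
    cp ?X ?X (fst a) (w a) (ten0 x1 x1 x2 x2 (S.ep x1 chi1) (S.ep x2 chi2)) = w a) &
   (ALL a:I. ALL b:I. cp (fst a) ?X (fst b) (w b) (v a) = (if a = b then S.ep (fst a) (fst (snd a)) else 0)) &
   (SUM a:I. cp ?X (fst a) ?X (v a) (w a)) = ten0 x1 x1 x2 x2 (S.ep x1 chi1) (S.ep x2 chi2)"
  using S.tensor_decomposition[OF x c R] by (elim exE conjE)
 let ?I = "{(x, chi, k). x : R & chi : irr x & k < m x chi}"
 note L' = L[unfolded Let_def]
 have IO: "obj (fst a)" "fst (snd a) : irr_chars (A (fst a))" if "a : ?I" for a using that RO by auto
 have h: "w a : hom0 ?X (fst a)" "v a : hom0 (fst a) ?X" "cp ?X (fst a) (fst a) (S.ep (fst a) (fst (snd a))) (w a) = w a"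
   "cp ?X ?X (fst a) (w a) (ten0 x1 x1 x2 x2 (S.ep x1 chi1) (S.ep x2 chi2)) = w a" if "a : ?I" for a
  using bspec[OF conjunct1[OF conjunct2[OF L']] that] by blast+
 have Te: "Tob z = ([z], m11 (id0 z))" "Tob z : lobj TC" if "obj z" for z using that by (simp_all add: T_obj_eq TC_obj1 id0_hom0 cp_id_left)
 let ?D = "T_tensor C (?F x1 chi1) (?F x2 chi2)"
 have z: "m11 0 = 0" by (auto simp: m11_def fun_eq_iff zero_fun_apply)
 have ds: "EX i p. is_direct_sum TC ?D ?I (%a. ?F (fst a) (fst (snd a))) i p"
 proof (rule exI, rule exI, rule direct_sum_retract[OF tr(1) Te(2)[OF P] conjunct1[OF L'] tr(2,3,4),
    where Y = "%a. Tob (fst a)" and j = "%a. \<iota> (fst a) (fst (snd a))" and q = "%a. \<pi> (fst a) (fst (snd a))"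
     and w = "%a. m11 (w a)" and v = "%a. m11 (v a)"])
  fix a assume a: "a : ?I"
  note o = IO(1)[OF a] and fa = f[OF IO[OF a]] and ha = h[OF a]
  show "?F (fst a) (fst (snd a)) : lobj TC" "\<iota> (fst a) (fst (snd a)) : lhom TC (?F (fst a) (fst (snd a))) (Tob (fst a))"
   "\<pi> (fst a) (fst (snd a)) : lhom TC (Tob (fst a)) (?F (fst a) (fst (snd a)))" by (rule fa)+
  show "Tob (fst a) : lobj TC" by (rule Te(2)[OF o])
  show "tc (?F (fst a) (fst (snd a))) (Tob (fst a)) (?F (fst a) (fst (snd a)))
    (\<pi> (fst a) (fst (snd a))) (\<iota> (fst a) (fst (snd a))) = snd (?F (fst a) (fst (snd a)))" using fa(4) by (simp add: Te(1)[OF o])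
  show "m11 (w a) : lhom TC (Tob ?X) (Tob (fst a))" "m11 (v a) : lhom TC (Tob (fst a)) (Tob ?X)"
   using ha(1,2) o P by (simp_all add: Te(1) TC_hom1 cp_id_left cp_id_right)
  show "tc (Tob ?X) (Tob ?X) (Tob (fst a)) (m11 (w a))
    (tc (Tob ?X) ?D (Tob ?X) (kr (fst (?F x1 chi1)) [x1] (fst (?F x2 chi2)) [x2] (\<iota> x1 chi1) (\<iota> x2 chi2))
     (kr [x1] (fst (?F x1 chi1)) [x2] (fst (?F x2 chi2)) (\<pi> x1 chi1) (\<pi> x2 chi2))) = m11 (w a)"
   unfolding tr(5) using ha(4) by (simp add: Te(1) o P)
  show "tc (Tob ?X) (Tob (fst a)) (Tob (fst a))
    (tc (Tob (fst a)) (?F (fst a) (fst (snd a))) (Tob (fst a)) (\<iota> (fst a) (fst (snd a))) (\<pi> (fst a) (fst (snd a))))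
    (m11 (w a)) = m11 (w a)" using ha(3) fa(5) by (simp add: Te(1) o P)
  fix b assume b: "b : ?I"
  show "tc (Tob (fst a)) (Tob ?X) (Tob (fst b)) (m11 (w b)) (m11 (v a)) =
    (if a = b then tc (Tob (fst a)) (?F (fst a) (fst (snd a))) (Tob (fst a))
     (\<iota> (fst a) (fst (snd a))) (\<pi> (fst a) (fst (snd a))) else 0)"
   using bspec[OF bspec[OF conjunct1[OF conjunct2[OF conjunct2[OF L']]] a] b] fa(5) by (auto simp: Te(1) o P IO(1)[OF b] z)
 next
  have "(SUM a:?I. tc (Tob ?X) (Tob (fst a)) (Tob ?X) (m11 (v a)) (m11 (w a))) =
    (SUM a:?I. m11 (cp ?X (fst a) ?X (v a) (w a)))" by (rule sum.cong[OF refl]) (simp add: Te(1) IO(1) P)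
  also have "... = m11 (ten0 x1 x1 x2 x2 (S.ep x1 chi1) (S.ep x2 chi2))"
   unfolding m11_sum[symmetric] using conjunct2[OF conjunct2[OF conjunct2[OF L']]] by simp
  finally show "(SUM a:?I. tc (Tob ?X) (Tob (fst a)) (Tob ?X) (m11 (v a)) (m11 (w a))) =
    tc (Tob ?X) ?D (Tob ?X) (kr (fst (?F x1 chi1)) [x1] (fst (?F x2 chi2)) [x2] (\<iota> x1 chi1) (\<iota> x2 chi2))
     (kr [x1] (fst (?F x1 chi1)) [x2] (fst (?F x2 chi2)) (\<pi> x1 chi1) (\<pi> x2 chi2))" unfolding tr(5) .
 qed
 have eq: "(%a. ?F (fst a) (fst (snd a))) = (%(x, chi, k). ?F x chi)" by auto
 \<comment> \<open>The tensor product itself carries the direct sum structure, so the isomorphism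
   asked for is its identity, which in the idempotent completion is its idempotent.\<close>
 have li: "liso TC ?D ?D" unfolding liso_def using tr(1) by (intro bexI[of _ "snd ?D"]) (auto simp: TC_comp TC_id TC_obj intro!: TC_homI)
 have "iso_to_direct_sum TC ?D ?I (%(x, chi, k). ?F x chi)"
  unfolding iso_to_direct_sum_def using ds[unfolded eq] by (elim exE) (intro exI conjI, assumption, rule li)
 with m show ?thesis by (intro exI[of _ m] conjI)
qed

theorem theorem1p1:
  fixes C :: "('o, 'm) category_data"
    and \<delta> :: "'m \<Rightarrow> 'k::{alg_closed_field, field_char_0}"
    and x1 x2 :: 'o
    and \<chi>1 \<chi>2 :: "'m \<Rightarrow> 'k"
    and R :: "'o set"
  assumes "category C" and "finitely_complete C" and "regular C" and "subobject_finite C"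
    and "exact C" and "malcev C" and "terminal_has_no_proper_subobject C"
    and "degree_function C \<delta>" and "nondegenerate C \<delta>"
    and "x1 \<in> Obj C" and "x2 \<in> Obj C"
    and "\<chi>1 \<in> irr_chars (aut_group C x1)" and "\<chi>2 \<in> irr_chars (aut_group C x2)"
    and "subquotient_representatives C (prd C x1 x2) R"
  shows "\<exists>m :: 'o \<Rightarrow> ('m \<Rightarrow> 'k) \<Rightarrow> nat.
    (\<forall>x \<in> R. \<forall>\<chi> \<in> irr_chars (aut_group C x).
       of_nat (m x \<chi>) =
         char_pairing (aut_group C x1 \<times>\<times> aut_group C x2 \<times>\<times> aut_group C x)
           (ternary_char C x1 x2 x) (tensor_char \<chi>1 \<chi>2 (dual_char (aut_group C x) \<chi>))) \<and>
    iso_to_direct_sum (TCat C \<delta>)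
      (T_tensor C (simple_object C \<delta> x1 \<chi>1) (simple_object C \<delta> x2 \<chi>2))
      {(x, \<chi>, k). x \<in> R \<and> \<chi> \<in> irr_chars (aut_group C x) \<and> k < m x \<chi>}
      (\<lambda>(x, \<chi>, k). simple_object C \<delta> x \<chi>)"
proof -
  interpret alg_category C \<delta> by unfold_locales fact+
  show ?thesis by (rule tensor_simple_objects) fact+
qed

end
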